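(* Let $d\ge 3$. There exists $\epsilon^*\in\mathbb R$, $0<\epsilon^*\le\epsilon_0$, such that for every $\epsilon\in\mathbb R$ with $|\epsilon|\le\epsilon^*$ the equation $$\Big(\partial_t^2-\partial_r^2-\frac{d-1}{r}\partial_r\Big)u(t,r)+\frac{d-1}{r^2}\,w_\epsilon(u(t,r))\,w_\epsilon'(u(t,r))=0$$ admits a self-similar solution $u^T_\epsilon\in C^\infty([0,T)\times[0,\infty))\cap L^\infty([0,T]\times[0,\infty))$ of the form $$u^T_\epsilon(t,r)=f_\epsilon\Big(\frac{r}{T-t}\Big),\qquad T>0,$$ such that its gradient blows up in $r=0$, i.e. $\lim_{t\to T^-}|\partial_r u^T_\epsilon(t,0)|=+\infty$. The profile $f_\epsilon$ can be written as $f_\epsilon=f_0+\phi_\epsilon$ with $f_0(\rho)=2\arctan\big(\rho/\sqrt{d-2}\big)$ and a perturbation $\phi_\epsilon\in L^\infty([0,\infty))\cap C^\infty([0,\infty))$. The function $\phi_\epsilon$ depends Lipschitz continuously on the parameter $\epsilon$ in the sense that $$\big\|(\cdot)^{-1}(\phi_\epsilon-\phi_\kappa)\big\|_{W^{2,\infty}([0,\infty))}\lesssim|\epsilon-\kappa|$$ for all $|\epsilon|,|\kappa|\le\epsilon^*$, and $\phi_0=0$. Furthermore, $f_\epsilon$ satisfies $f_\epsilon(0)=0$ and the limit $\lim_{\rho\to\infty}f_\epsilon(\rho)$ exists. Finally, for every $k\in\mathbb N_0$ there are constants $C_{1,k},C_{2,k}>0$ depending on $\epsilon$ such that $$|f_\epsilon^{(k)}(\rho)|\le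 C_{1,k}\langle\rho\rangle^{-k}\quad\text{and}\quad \big|\big(f_\epsilon+(\cdot)f_\epsilon'\big)^{(k)}(\rho)\big|\le C_{2,k}\langle\rho\rangle^{-1-k}$$ for all $\rho\in[0,\infty)$.
   Context: Let $\alpha\in C^\infty(\mathbb R)$ be a fixed non-trivial, real-valued, $2\pi$-periodic, even, nonnegative function with $\alpha(0)=\alpha(\pi)=0$, and put $\epsilon_0=(\max_{u\in[0,\pi]}\alpha(u))^{-1}>0$. For $|\epsilon|\le\epsilon_0$ the warping function is $w_\epsilon(u)=\sin(u)(1+\epsilon\,\alpha(u))$, $u\in\mathbb R$. The displayed wave equation is the equation for the radial profile $u$ of a co-rotational wave map $U(t,x)=u(t,|x|)\frac{x}{|x|}$ from $(1+d)$-dimensional Minkowski space into the warped product manifold $(0,\pi)\times_{w_\epsilon}\mathbb S^{d-1}$ with metric $du^2+w_\epsilon(u)^2d\Omega^2$, where $d\Omega^2$ is the standard round metric on $\mathbb S^{d-1}$ (written in normal coordinates, with boundary condition $u(t,0)=0$). $A\lesssim B$ means $A\le CB$ with an absolute constant $C>0$; $\langle\rho\rangle=(1+\rho^2)^{1/2}$; $(\cdot)$ denotes the function $\rho\mapsto\rho$.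
   Formalization: The bound on (f_ε+(·)f_ε')^(k) is stated only for k≥1: for k=0 it is false, since at ε=0 one has f_ε=f_0 and f_0+ρf_0' tends to π as ρ→∞, so it is not O(⟨ρ⟩^{-1}). *)

theory Defs
  imports "HOL-Probability.Essential_Supremum"
begin

section \<open>Differentiability up to the boundary\<close>

text \<open>
  \<open>S\<close> may be a half-line or a product of intervals, so derivatives are taken within \<open>S\<close>:
  at boundary points this is smoothness up to the boundary. The partial derivatives \<open>D b\<close>
  are uniquely determined on all sets \<open>S\<close> used here (convex with nonempty interior).
\<close>

primrec Ck_on :: "nat \<Rightarrow> 'a::euclidean_space set \<Rightarrow> ('a \<Rightarrow> real) \<Rightarrow> bool" where
  "Ck_on 0 S f \<longleftrightarrow> continuous_on S f"
| "Ck_on (Suc k) S f \<longleftrightarrow>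
     (\<exists>D. (\<forall>x\<in>S. (f has_derivative (\<lambda>h. \<Sum>b\<in>Basis. (h \<bullet> b) * D b x)) (at x within S)) \<and>
          (\<forall>b\<in>Basis. Ck_on k S (D b)))"

definition smooth_on :: "'a::euclidean_space set \<Rightarrow> ('a \<Rightarrow> real) \<Rightarrow> bool" where
  "smooth_on S f \<longleftrightarrow> (\<forall>k. Ck_on k S f)"

definition deriv_within :: "real set \<Rightarrow> (real \<Rightarrow> real) \<Rightarrow> real \<Rightarrow> real" where
  "deriv_within S f x = vector_derivative f (at x within S)"

definition nderiv_within :: "real set \<Rightarrow> nat \<Rightarrow> (real \<Rightarrow> real) \<Rightarrow> real \<Rightarrow> real" where
  "nderiv_within S k f = (deriv_within S ^^ k) f"


section \<open>Lebesgue and Sobolev norms\<close>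

text \<open>
  Both norms take the value \<open>\<infinity>\<close> exactly when the function does not belong to the space. In
  the first one, measurability of \<open>f\<close> is required separately because it does not follow
  from that of the absolute value.
\<close>

definition Linf_norm :: "'a::euclidean_space set \<Rightarrow> ('a \<Rightarrow> real) \<Rightarrow> ennreal" where
  "Linf_norm S f =
     (if f \<in> borel_measurable (lebesgue_on S)
      then esssup (lebesgue_on S) (\<lambda>x. ennreal \<bar>f x\<bar>) else \<infinity>)"

definition Linf_on :: "'a::euclidean_space set \<Rightarrow> ('a \<Rightarrow> real) \<Rightarrow> bool" where
  "Linf_on S f \<longleftrightarrow> Linf_norm S f < \<infinity>"

definition test_function :: "real set \<Rightarrow> (real \<Rightarrow> real) \<Rightarrow> bool" where
  "test_function S \<psi> \<longleftrightarrow>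
     smooth_on UNIV \<psi> \<and> compact (closure {x. \<psi> x \<noteq> 0}) \<and> closure {x. \<psi> x \<noteq> 0} \<subseteq> S"

definition locally_integrable_on :: "real set \<Rightarrow> (real \<Rightarrow> real) \<Rightarrow> bool" where
  "locally_integrable_on S f \<longleftrightarrow> (\<forall>K. compact K \<and> K \<subseteq> S \<longrightarrow> f absolutely_integrable_on K)"

definition weak_deriv :: "real set \<Rightarrow> nat \<Rightarrow> (real \<Rightarrow> real) \<Rightarrow> (real \<Rightarrow> real) \<Rightarrow> bool" where
  "weak_deriv S k f g \<longleftrightarrow>
     locally_integrable_on S f \<and> locally_integrable_on S g \<and>
     (\<forall>\<psi>. test_function S \<psi> \<longrightarrow>
        (LINT x|lebesgue_on S. f x * (deriv ^^ k) \<psi> x) =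
        (-1) ^ k * (LINT x|lebesgue_on S. g x * \<psi> x))"

text \<open>
  \<open>S\<close> is open. Weak derivatives are unique almost everywhere, so the infimum ranges over at
  most one value.
\<close>

definition Wk_inf_norm :: "nat \<Rightarrow> real set \<Rightarrow> (real \<Rightarrow> real) \<Rightarrow> ennreal" where
  "Wk_inf_norm k S f =
     (INF D \<in> {D. \<forall>i\<le>k. weak_deriv S i f (D i)}. \<Sum>i\<le>k. Linf_norm S (D i))"


section \<open>The warped target and the co-rotational wave maps equation\<close>

definition admissible :: "(real \<Rightarrow> real) \<Rightarrow> bool" where
  "admissible \<alpha> \<longleftrightarrow>
     smooth_on UNIV \<alpha> \<and> (\<exists>u. \<alpha> u \<noteq> 0) \<and> (\<forall>u. \<alpha> (u + 2 * pi) = \<alpha> u) \<and>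
     (\<forall>u. \<alpha> (- u) = \<alpha> u) \<and> (\<forall>u. \<alpha> u \<ge> 0) \<and> \<alpha> 0 = 0 \<and> \<alpha> pi = 0"

definition eps0 :: "(real \<Rightarrow> real) \<Rightarrow> real" where
  "eps0 \<alpha> = inverse (SUP u\<in>{0..pi}. \<alpha> u)"

definition warp :: "(real \<Rightarrow> real) \<Rightarrow> real \<Rightarrow> real \<Rightarrow> real" where
  "warp \<alpha> \<epsilon> u = sin u * (1 + \<epsilon> * \<alpha> u)"

text \<open>
  Partial derivatives of a function of \<open>(t, r) \<in> [0,T) \<times> [0,\<infinity>)\<close>, one-sided at \<open>t = 0\<close> and \<open>r = 0\<close>.
\<close>

definition dt :: "real \<Rightarrow> (real \<Rightarrow> real \<Rightarrow> real) \<Rightarrow> real \<Rightarrow> real \<Rightarrow> real" where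
  "dt T u t r = deriv_within {0..<T} (\<lambda>s. u s r) t"

definition dr :: "(real \<Rightarrow> real \<Rightarrow> real) \<Rightarrow> real \<Rightarrow> real \<Rightarrow> real" where
  "dr u t r = deriv_within {0..} (u t) r"

text \<open>
  The coefficients are singular at \<open>r = 0\<close>: the equation is imposed for \<open>r > 0\<close>, together with
  the boundary condition at \<open>r = 0\<close>.
\<close>

definition wave_map_solution ::
  "nat \<Rightarrow> (real \<Rightarrow> real) \<Rightarrow> real \<Rightarrow> (real \<Rightarrow> real \<Rightarrow> real) \<Rightarrow> bool" where
  "wave_map_solution d w T u \<longleftrightarrow>
     (\<forall>t\<in>{0..<T}. \<forall>r>0.
        dt T (dt T u) t r - dr (dr u) t r - (real d - 1) / r * dr u t r
          + (real d - 1) / r\<^sup>2 * (w (u t r) * deriv w (u t r)) = 0) \<and>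
     (\<forall>t\<in>{0..<T}. u t 0 = 0)"

definition self_similar :: "real \<Rightarrow> (real \<Rightarrow> real) \<Rightarrow> real \<Rightarrow> real \<Rightarrow> real" where
  "self_similar T f t r = f (r / (T - t))"

definition f0 :: "nat \<Rightarrow> real \<Rightarrow> real" where
  "f0 d \<rho> = 2 * arctan (\<rho> / sqrt (real d - 2))"

definition japanese :: "real \<Rightarrow> real" where
  "japanese \<rho> = sqrt (1 + \<rho>\<^sup>2)"

text \<open>
  The symbol bound on \<open>f + (\<cdot>) f'\<close>, of order \<open>-1 - k\<close> for the \<open>k\<close>-th derivative, can
  only be asked for \<open>k \<ge> 1\<close>: for \<open>k = 0\<close> it fails already for the explicit profile
  \<open>f0\<close>, since \<open>f0 \<rho> + \<rho> f0' \<rho>\<close> tends to \<open>\<pi>\<close>. Given that \<open>f\<close> tends to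
  a limit \<open>L\<close>, the bound for \<open>k = 1\<close> implies that \<open>f + (\<cdot>) f' - L\<close> is of order \<open>-1\<close>.
\<close>

lemma f0_zeroth_order_bound_fails:
  assumes "d \<ge> 3"
  shows "\<nexists>C. \<forall>\<rho>\<ge>0.
    \<bar>nderiv_within {0..} 0 (\<lambda>\<rho>. f0 d \<rho> + \<rho> * deriv_within {0..} (f0 d) \<rho>) \<rho>\<bar>
      \<le> C * japanese \<rho> powi (-1)"
proof
  assume "\<exists>C. \<forall>\<rho>\<ge>0.
    \<bar>nderiv_within {0..} 0 (\<lambda>\<rho>. f0 d \<rho> + \<rho> * deriv_within {0..} (f0 d) \<rho>) \<rho>\<bar>
      \<le> C * japanese \<rho> powi (-1)"
  then obtain C where C: "\<And>\<rho>. \<rho> \<ge> 0 \<Longrightarrow>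
      \<bar>f0 d \<rho> + \<rho> * deriv_within {0..} (f0 d) \<rho>\<bar> \<le> C / japanese \<rho>"
    by (auto simp: nderiv_within_def power_int_minus divide_inverse)
  define a where "a = sqrt (real d - 2)"
  have a: "a > 0" using assms by (simp add: a_def)
  define \<rho> where "\<rho> = max a \<bar>C\<bar>"
  have \<rho>: "\<rho> \<ge> a" "\<rho> \<ge> \<bar>C\<bar>" "\<rho> > 0" using a by (auto simp: \<rho>_def)
  define D where "D = 2 * (inverse (1 + (\<rho> / a)\<^sup>2) * (1 / a))"
  have D0: "D \<ge> 0" using a by (simp add: D_def)
  have "(f0 d has_real_derivative D) (at \<rho>)"
    unfolding f0_def[abs_def] a_def[symmetric] D_def
    by (rule DERIV_cmult, rule DERIV_chain2[where g = "\<lambda>x. x / a"],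
        rule DERIV_arctan, rule DERIV_cdivide, rule DERIV_ident)
  hence "(f0 d has_vector_derivative D) (at \<rho>)"
    by (simp add: has_real_derivative_iff_has_vector_derivative)
  moreover have "at \<rho> within {0..} = at \<rho>"
    by (rule at_within_interior) (use \<rho> in simp)
  ultimately have D: "deriv_within {0..} (f0 d) \<rho> = D"
    unfolding deriv_within_def by (simp add: vector_derivative_at)
  have "arctan 1 \<le> arctan (\<rho> / a)"
    unfolding arctan_le_iff using \<rho> a by simp
  hence "pi / 2 \<le> f0 d \<rho>"
    by (simp add: f0_def a_def[symmetric] arctan_one)
  moreover have "\<rho> * D \<ge> 0" using D0 \<rho> by simp
  moreover have "3 < pi" by (rule pi_gt3)
  ultimately have 1: "1 < f0 d \<rho> + \<rho> * D" by simp
  have "\<rho> < japanese \<rho>"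
    unfolding japanese_def using \<rho> by (intro real_less_rsqrt) simp
  hence "C / japanese \<rho> \<le> 1"
    using \<rho> by (simp add: divide_le_eq)
  with 1 C[of \<rho>] D \<rho> show False by simp
qed

end

theory Submission
  imports Defs "HOL-Complex_Analysis.Great_Picard" "HOL-Computational_Algebra.Polynomial"
begin

text \<open>With \<open>x = r\<^sup>2\<close> and \<open>f(r) = r u(x)\<close> the profile equation becomes \<open>T u = G(x, u)\<close>, where
  \<open>T = x (1 - x) D\<^sup>2 + ((d + 2)/2 - 5x/2) D - 1/2\<close> is a hypergeometric operator that degenerates at the
  centre \<open>x = 0\<close> and at the light cone \<open>x = 1\<close>. Once \<open>m > (d - 3)/2\<close>, the \<open>m\<close> times differentiated
  equation has first order coefficients of the right sign at both points, and maximum principles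
  on \<open>[0, 4]\<close> control \<open>m + 1\<close> derivatives of \<open>u\<close> by \<open>m\<close> derivatives of \<open>T u\<close>. As \<open>T\<close> is bijective on
  polynomials, density makes it invertible with a gain of one derivative. Hence the linearization
  \<open>T - V\<close> at \<open>f\<^sub>0\<close> satisfies the Fredholm alternative. Its kernel is trivial: the Taylor coefficients
  at \<open>0\<close> of \<open>(d - 2 + x) u\<close> all have the same sign except the first, which contradicts the equation
  differentiated \<open>d\<close> times at \<open>x = 1\<close>. A contraction argument then yields profiles on \<open>[0, 4]\<close> depending
  Lipschitz continuously on \<open>\<epsilon>\<close>. Beyond the light cone \<open>f\<close> solves an ODE that is regular in
  \<open>s = 1/r\<close> down to \<open>s = 0\<close>, and smoothness at \<open>s = 0\<close> gives the limit and the symbol bounds.\<close>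

section \<open>Differentiability classes on the real line\<close>

text \<open>The threshold on \<open>m\<close> comes from the exponents \<open>0\<close> and
  \<open>(d - 1) / 2\<close> of the operator at the light cone. One-sided powers of
  \<open>x - 1\<close> with the second exponent spoil uniqueness at low regularity; they leave
  \<open>C^(m + 1)\<close> once \<open>m > (d - 3) / 2\<close>, which is also when the first order
  coefficient of the differentiated equation turns negative at \<open>x = 1\<close>. The same number
  decides a sign in the contradiction at the light cone. The factor \<open>d - 2 + x\<close> cures a
  double pole of the potential: at \<open>x = 2 - d\<close> the linearized equation has exponents
  \<open>-1\<close> and \<open>2\<close>, which the factor turns into \<open>0\<close> and
  \<open>3\<close>, leaving polynomial coefficients and a three-term recurrence. The product
  \<open>w w'\<close> is quadratic in \<epsilon>, and its perturbing coefficients are odd and vanish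
  to third order at \<open>0\<close>. Divided by the cube of \<open>r\<close> they become smooth in
  \<open>x\<close>, by Whitney's theorem on even functions, and \<open>T\<close> does not depend on
  \<epsilon>. The interval \<open>[0, 4]\<close> means \<open>0 \<le> r \<le> 2\<close>: it reaches
  past the cone so that the outer problem can start at the regular point \<open>r = 4/3\<close> and
  overlap with the inner one.\<close>

text \<open>Derivatives on \<open>S\<close> as a meta-level statement, so that it can be instantiated like a rule.\<close>

abbreviation (input) deriv_on :: "real set \<Rightarrow> (real \<Rightarrow> real) \<Rightarrow> (real \<Rightarrow> real) \<Rightarrow> prop" where
  "deriv_on S f f' \<equiv> (\<And>x. x \<in> S \<Longrightarrow> (f has_real_derivative f' x) (at x within S))"

text \<open>Over the reals \<open>Basis\<close> is \<open>{1}\<close>, so the family of partial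
  derivatives reduces to the single function \<open>D 1\<close>. All work on the line goes through
  this form.\<close>

lemma Ck_on_Suc_real:
  fixes f :: "real \<Rightarrow> real"
  shows "Ck_on (Suc k) S f \<longleftrightarrow>
    (\<exists>f'. (\<forall>x\<in>S. (f has_real_derivative f' x) (at x within S)) \<and> Ck_on k S f')"
proof
  assume "Ck_on (Suc k) S f"
  then obtain D :: "real \<Rightarrow> real \<Rightarrow> real" where
    "\<forall>x\<in>S. (f has_derivative (\<lambda>h. h * D 1 x)) (at x within S)" "Ck_on k S (D 1)"
    by auto
  then show "\<exists>f'. (\<forall>x\<in>S. (f has_real_derivative f' x) (at x within S)) \<and> Ck_on k S f'"
    by (intro exI[of _ "D 1"]) (auto simp: has_field_derivative_def mult.commute[of _ "D 1 _"])
next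
  assume "\<exists>f'. (\<forall>x\<in>S. (f has_real_derivative f' x) (at x within S)) \<and> Ck_on k S f'"
  then obtain f' where f': "\<forall>x\<in>S. (f has_real_derivative f' x) (at x within S)" "Ck_on k S f'"
    by blast
  have "\<forall>x\<in>S. (f has_derivative (\<lambda>h. \<Sum>b\<in>Basis. (h \<bullet> b) * f' x)) (at x within S)"
    using f' by (auto simp: has_field_derivative_def mult.commute[of _ "f' _"])
  with f'(2) show "Ck_on (Suc k) S f"
    unfolding Ck_on.simps by (intro exI[of _ "\<lambda>b x. f' x"]) simp
qed

lemma Ck_onE:
  fixes f :: "real \<Rightarrow> real"
  assumes "Ck_on (Suc k) S f"
  obtains f' where "PROP deriv_on S f f'" "Ck_on k S f'"
  using assms unfolding Ck_on_Suc_real by blast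

lemma Ck_on_SucI:
  fixes f :: "real \<Rightarrow> real"
  assumes "PROP deriv_on S f f'" "Ck_on k S f'"
  shows "Ck_on (Suc k) S f"
  using assms unfolding Ck_on_Suc_real by blast

lemma Ck_on_imp_continuous:
  fixes f :: "real \<Rightarrow> real"
  shows "Ck_on k S f \<Longrightarrow> continuous_on S f"
proof (cases k)
  case (Suc j)
  assume "Ck_on k S f"
  then obtain f' where "PROP deriv_on S f f'"
    unfolding Suc by (rule Ck_onE) blast
  then show ?thesis by (rule DERIV_continuous_on)
qed simp

lemma Ck_on_pred:
  fixes f :: "real \<Rightarrow> real"
  shows "Ck_on (Suc k) S f \<Longrightarrow> Ck_on k S f"
proof (induction k arbitrary: f)
  case 0
  then have "continuous_on S f" by (rule Ck_on_imp_continuous)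
  then show ?case by simp
next
  case (Suc k)
  obtain f' where "PROP deriv_on S f f'" "Ck_on (Suc k) S f'"
    using Suc.prems by (rule Ck_onE) blast
  then show ?case using Suc.IH Ck_on_SucI by blast
qed

lemma Ck_on_le:
  fixes f :: "real \<Rightarrow> real"
  assumes "Ck_on k S f" "j \<le> k" shows "Ck_on j S f"
  using assms(2,1) by (induction rule: inc_induct) (simp_all add: Ck_on_pred del: Ck_on.simps(2))

lemma Ck_on_cong:
  fixes f :: "real \<Rightarrow> real"
  assumes "\<And>x. x \<in> S \<Longrightarrow> f x = g x" "Ck_on k S f" shows "Ck_on k S g"
proof (cases k)
  case 0
  then show ?thesis using assms continuous_on_cong by fastforce
next
  case (Suc j)
  obtain f' where f': "PROP deriv_on S f f'" "Ck_on j S f'"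
    using assms(2) unfolding Suc by (rule Ck_onE) blast
  have "(g has_real_derivative f' x) (at x within S)" if "x \<in> S" for x
    using has_field_derivative_transform_within[OF f'(1)[OF that] zero_less_one that] assms(1) by blast
  with Suc f'(2) show ?thesis using Ck_on_SucI by blast
qed

lemma Ck_on_subset:
  fixes f :: "real \<Rightarrow> real"
  assumes "Ck_on k S f" "T \<subseteq> S" shows "Ck_on k T f"
  using assms(1)
proof (induction k arbitrary: f)
  case 0
  then show ?case using assms(2) continuous_on_subset by auto
next
  case (Suc k)
  obtain f' where "PROP deriv_on S f f'" "Ck_on k S f'"
    using Suc.prems by (rule Ck_onE) blast
  with Suc.IH assms(2) show ?case
    by (intro Ck_on_SucI[where f'=f']) (auto intro: has_field_derivative_subset)
qed

lemma Ck_on_const: "Ck_on k S (\<lambda>x::real. c)"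
proof (induction k arbitrary: c)
  case (Suc k)
  show ?case by (rule Ck_on_SucI[where f'="\<lambda>x. 0"]) (auto intro: Suc)
qed auto

lemma Ck_on_ident: "Ck_on k S (\<lambda>x::real. x)"
proof (cases k)
  case (Suc j)
  show ?thesis unfolding Suc
    by (rule Ck_on_SucI[where f'="\<lambda>x. 1"]) (auto intro: Ck_on_const)
qed auto

lemma Ck_on_add:
  fixes f g :: "real \<Rightarrow> real"
  assumes "Ck_on k S f" "Ck_on k S g" shows "Ck_on k S (\<lambda>x. f x + g x)"
  using assms
proof (induction k arbitrary: f g)
  case 0
  then show ?case by (auto intro: continuous_intros)
next
  case (Suc k)
  obtain f' where f': "PROP deriv_on S f f'" "Ck_on k S f'"
    using Suc.prems(1) by (rule Ck_onE) blast
  obtain g' where g': "PROP deriv_on S g g'" "Ck_on k S g'"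
    using Suc.prems(2) by (rule Ck_onE) blast
  note * = f' g'
  show ?case
    using * by (intro Ck_on_SucI[where f'="\<lambda>x. f' x + g' x"]) (auto intro: Suc.IH DERIV_add)
qed

lemma Ck_on_mult:
  fixes f g :: "real \<Rightarrow> real"
  assumes "Ck_on k S f" "Ck_on k S g" shows "Ck_on k S (\<lambda>x. f x * g x)"
  using assms
proof (induction k arbitrary: f g)
  case 0
  then show ?case by (auto intro: continuous_intros)
next
  case (Suc k)
  obtain f' where f': "PROP deriv_on S f f'" "Ck_on k S f'"
    using Suc.prems(1) by (rule Ck_onE) blast
  obtain g' where g': "PROP deriv_on S g g'" "Ck_on k S g'"
    using Suc.prems(2) by (rule Ck_onE) blast
  note * = f' g'
  have "Ck_on k S (\<lambda>x. f' x * g x + g' x * f x)"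
    by (intro Ck_on_add Suc.IH *(2,4) Suc.prems[THEN Ck_on_pred])
  then show ?case
    using * by (intro Ck_on_SucI[where f'="\<lambda>x. f' x * g x + g' x * f x"] DERIV_mult)
qed

lemma Ck_on_cmult:
  fixes f :: "real \<Rightarrow> real"
  shows "Ck_on k S f \<Longrightarrow> Ck_on k S (\<lambda>x. c * f x)"
  by (intro Ck_on_mult Ck_on_const)

lemma Ck_on_minus:
  fixes f :: "real \<Rightarrow> real"
  shows "Ck_on k S f \<Longrightarrow> Ck_on k S (\<lambda>x. - f x)"
  using Ck_on_cmult[of k S f "-1"] by simp

lemma Ck_on_diff:
  fixes f g :: "real \<Rightarrow> real"
  shows "Ck_on k S f \<Longrightarrow> Ck_on k S g \<Longrightarrow> Ck_on k S (\<lambda>x. f x - g x)"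
  using Ck_on_add[of k S f "\<lambda>x. - g x"] Ck_on_minus[of k S g] by simp

lemma Ck_on_power:
  fixes f :: "real \<Rightarrow> real"
  shows "Ck_on k S f \<Longrightarrow> Ck_on k S (\<lambda>x. f x ^ n)"
  by (induction n) (auto intro: Ck_on_const Ck_on_mult)

lemma DERIV_compose_within:
  fixes f g :: "real \<Rightarrow> real"
  assumes "(f has_real_derivative a) (at (g x) within T)" "(g has_real_derivative b) (at x within S)"
    "g ` S \<subseteq> T"
  shows "((\<lambda>x. f (g x)) has_real_derivative a * b) (at x within S)"
  using DERIV_image_chain[OF has_field_derivative_subset[OF assms(1,3)] assms(2)]
  by (simp add: o_def)

lemma Ck_on_compose:
  fixes f g :: "real \<Rightarrow> real"
  assumes "Ck_on k T f" "Ck_on k S g" "g ` S \<subseteq> T" shows "Ck_on k S (\<lambda>x. f (g x))"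
  using assms(1,2)
proof (induction k arbitrary: f)
  case 0
  then show ?case using assms(3) by (auto intro: continuous_on_compose2)
next
  case (Suc k)
  obtain f' where f': "PROP deriv_on T f f'" "Ck_on k T f'"
    using Suc.prems(1) by (rule Ck_onE) blast
  obtain g' where g': "PROP deriv_on S g g'" "Ck_on k S g'"
    using Suc.prems(2) by (rule Ck_onE) blast
  note * = f' g'
  have "Ck_on k S (\<lambda>x. f' (g x) * g' x)"
    by (rule Ck_on_mult[OF Suc.IH[OF f'(2) Ck_on_pred[OF Suc.prems(2)]] g'(2)])
  then show ?case
    using assms(3)
    by (intro Ck_on_SucI[where f'="\<lambda>x. f' (g x) * g' x"] DERIV_compose_within[OF f'(1) g'(1)]) auto
qed

lemma Ck_on_inverse:
  fixes f :: "real \<Rightarrow> real"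
  assumes "Ck_on k S f" "\<And>x. x \<in> S \<Longrightarrow> f x \<noteq> 0" shows "Ck_on k S (\<lambda>x. inverse (f x))"
  using assms
proof (induction k arbitrary: f)
  case 0
  then show ?case by (auto intro: continuous_intros)
next
  case (Suc k)
  obtain f' where *: "PROP deriv_on S f f'" "Ck_on k S f'"
    using Suc.prems(1) by (rule Ck_onE) blast
  have "Ck_on k S (\<lambda>x. - (f' x * (inverse (f x) * inverse (f x))))"
    by (intro Ck_on_minus Ck_on_mult Suc.IH *(2) Suc.prems(1)[THEN Ck_on_pred] Suc.prems(2))
  moreover have "((\<lambda>x. inverse (f x)) has_real_derivative - (f' x * (inverse (f x) * inverse (f x))))
      (at x within S)" if "x \<in> S" for x
    using DERIV_inverse'[OF *(1)[OF that] Suc.prems(2)[OF that]] by (simp add: algebra_simps)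
  ultimately show ?case by (rule Ck_on_SucI[rotated])
qed

lemma Ck_on_divide:
  fixes f g :: "real \<Rightarrow> real"
  assumes "Ck_on k S f" "Ck_on k S g" "\<And>x. x \<in> S \<Longrightarrow> g x \<noteq> 0"
  shows "Ck_on k S (\<lambda>x. f x / g x)"
  using Ck_on_mult[OF assms(1) Ck_on_inverse[OF assms(2,3)]] by (simp add: divide_inverse)

lemma Ck_on_sin_cos: "Ck_on k S (sin :: real \<Rightarrow> real) \<and> Ck_on k S (cos :: real \<Rightarrow> real)"
proof (induction k)
  case 0
  then show ?case by (auto intro: continuous_intros)
next
  case (Suc k)
  have "Ck_on (Suc k) S sin"
    by (rule Ck_on_SucI[where f'=cos]) (use Suc in \<open>auto intro!: derivative_eq_intros\<close>)
  moreover have "Ck_on (Suc k) S cos"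
    by (rule Ck_on_SucI[where f'="\<lambda>x. - sin x"])
       (use Suc in \<open>auto intro!: derivative_eq_intros Ck_on_minus\<close>)
  ultimately show ?case by blast
qed

lemma Ck_on_arctan: "Ck_on k S (arctan :: real \<Rightarrow> real)"
proof (cases k)
  case 0
  then show ?thesis by (auto intro: continuous_intros)
next
  case (Suc j)
  show ?thesis unfolding Suc
  proof (rule Ck_on_SucI[where f'="\<lambda>x. inverse (1 + x ^ 2)"])
    show "Ck_on j S (\<lambda>x. inverse (1 + x ^ 2))"
      by (intro Ck_on_inverse Ck_on_add Ck_on_const Ck_on_power Ck_on_ident)
         (auto simp: add_nonneg_eq_0_iff)
  qed (auto intro: DERIV_arctan DERIV_subset)
qed

lemma smooth_onD: "smooth_on S f \<Longrightarrow> Ck_on k S f" by (simp add: smooth_on_def)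

text \<open>Different orders \<open>k\<close> may come with different witnesses for the derivative.
  At points that are not isolated the witnesses coincide, so one and the same derivative lies in
  every class.\<close>

lemma smooth_on_derivE:
  fixes f :: "real \<Rightarrow> real"
  assumes "smooth_on S f" and nb: "\<And>x. x \<in> S \<Longrightarrow> at x within S \<noteq> bot"
  obtains f' where "PROP deriv_on S f f'" "smooth_on S f'"
proof -
  have "Ck_on (Suc 0) S f" using assms(1) by (rule smooth_onD)
  then obtain f' where f': "PROP deriv_on S f f'"
    by (rule Ck_onE) blast
  have "Ck_on k S f'" for k
  proof -
    have "Ck_on (Suc k) S f" using assms(1) by (rule smooth_onD)
    then obtain g where g: "PROP deriv_on S f g" "Ck_on k S g"
      by (rule Ck_onE) blast
    have "g x = f' x" if "x \<in> S" for x
      using g(1)[OF that] f'[OF that] nb[OF that] has_field_derivative_unique by blast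
    with g(2) show ?thesis using Ck_on_cong by blast
  qed
  with f' show ?thesis using that by (auto simp: smooth_on_def)
qed

lemma at_within_Icc_ne_bot:
  fixes a b :: real
  assumes "a < b" "x \<in> {a..b}" shows "at x within {a..b} \<noteq> bot"
  using assms by (simp add: trivial_limit_within islimpt_Icc)

lemma at_within_atLeast_ne_bot:
  fixes a :: real
  assumes "x \<in> {a..}" shows "at x within {a..} \<noteq> bot"
proof -
  have "x islimpt {x..x+1}" by (simp add: islimpt_Icc)
  moreover have "{x..x+1} \<subseteq> {a..}" using assms by auto
  ultimately show ?thesis unfolding trivial_limit_within using islimpt_subset by blast
qed

section \<open>Quantitative differentiability\<close>

text \<open>\<open>K\<close> is an upper bound for the \<open>C\<^sup>n\<close>-norm of \<open>g\<close> on \<open>S\<close>.\<close>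

primrec Cb :: "real set \<Rightarrow> nat \<Rightarrow> real \<Rightarrow> (real \<Rightarrow> real) \<Rightarrow> bool" where
  "Cb S 0 K g \<longleftrightarrow> continuous_on S g \<and> (\<forall>x\<in>S. \<bar>g x\<bar> \<le> K)"
| "Cb S (Suc n) K g \<longleftrightarrow> (\<forall>x\<in>S. \<bar>g x\<bar> \<le> K) \<and>
     (\<exists>g'. (\<forall>x\<in>S. (g has_real_derivative g' x) (at x within S)) \<and> Cb S n K g')"

lemma Cb_SucE:
  assumes "Cb S (Suc n) K g"
  obtains g' where "PROP deriv_on S g g'" "Cb S n K g'"
  using assms by auto

lemma Cb_SucI:
  assumes "\<And>x. x \<in> S \<Longrightarrow> \<bar>g x\<bar> \<le> K"
    "PROP deriv_on S g g'" "Cb S n K g'"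
  shows "Cb S (Suc n) K g"
  using assms by auto

lemma Cb_bound: "Cb S n K g \<Longrightarrow> x \<in> S \<Longrightarrow> \<bar>g x\<bar> \<le> K"
  by (cases n) auto

lemma Cb_mono: "Cb S n K g \<Longrightarrow> K \<le> L \<Longrightarrow> Cb S n L g"
proof (induction n arbitrary: g)
  case (Suc n)
  then show ?case by simp (meson order.trans)
qed force

lemma Cb_nonneg: "Cb S n K g \<Longrightarrow> S \<noteq> {} \<Longrightarrow> 0 \<le> K"
  using Cb_bound by (metis abs_ge_zero all_not_in_conv order_trans)

lemma Cb_imp_Ck: "Cb S n K g \<Longrightarrow> Ck_on n S g"
proof (induction n arbitrary: g)
  case (Suc n)
  obtain g' where "PROP deriv_on S g g'" "Cb S n K g'"
    using Suc.prems by (rule Cb_SucE) blast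
  then show ?case using Suc.IH by (intro Ck_on_SucI)
qed auto

lemma Cb_pred: "Cb S (Suc n) K g \<Longrightarrow> Cb S n K g"
proof (induction n arbitrary: g)
  case 0
  then obtain g' where "PROP deriv_on S g g'"
    by (rule Cb_SucE) blast
  then have "continuous_on S g" by (rule DERIV_continuous_on)
  with 0 show ?case by simp
next
  case (Suc n)
  obtain g' where "PROP deriv_on S g g'" "Cb S (Suc n) K g'"
    using Suc.prems by (rule Cb_SucE) blast
  then show ?case using Suc.IH Cb_bound[OF Suc.prems] Cb_SucI by blast
qed

lemma Cb_le: assumes "Cb S n K g" "j \<le> n" shows "Cb S j K g"
  using assms(2,1) by (induction rule: inc_induct) (simp_all add: Cb_pred del: Cb.simps(2))

lemma Cb_cong:
  assumes "\<And>x. x \<in> S \<Longrightarrow> f x = g x" "Cb S n K f" shows "Cb S n K g"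
proof (cases n)
  case 0
  then show ?thesis using assms continuous_on_cong by fastforce
next
  case (Suc j)
  obtain f' where f': "PROP deriv_on S f f'" "Cb S j K f'"
    using assms(2) unfolding Suc by (rule Cb_SucE) blast
  have "(g has_real_derivative f' x) (at x within S)" if "x \<in> S" for x
    using has_field_derivative_transform_within[OF f'(1)[OF that] zero_less_one that] assms(1) by blast
  moreover have "\<bar>g x\<bar> \<le> K" if "x \<in> S" for x using Cb_bound[OF assms(2) that] assms(1)[OF that] by simp
  ultimately show ?thesis using Suc f'(2) Cb_SucI by blast
qed

lemma Ck_on_imp_Cb:
  assumes "Ck_on n S g" "compact S" shows "\<exists>K\<ge>0. Cb S n K g"
  using assms(1)
proof (induction n arbitrary: g)
  case 0
  then have "bounded (g ` S)" using assms(2) compact_continuous_image compact_imp_bounded by auto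
  then obtain K where "\<forall>x\<in>S. \<bar>g x\<bar> \<le> K" unfolding bounded_iff by auto
  then show ?case using 0 by (intro exI[of _ "max 0 K"]) force
next
  case (Suc n)
  obtain g' where g': "PROP deriv_on S g g'" "Ck_on n S g'"
    using Suc.prems by (rule Ck_onE) blast
  obtain K where K: "K \<ge> 0" "Cb S n K g'" using Suc.IH g'(2) by blast
  have "bounded (g ` S)"
    using Ck_on_imp_continuous[OF Suc.prems] assms(2) compact_continuous_image compact_imp_bounded by auto
  then obtain L where L: "\<forall>x\<in>S. \<bar>g x\<bar> \<le> L" unfolding bounded_iff by auto
  have "Cb S (Suc n) (max K L) g"
    using K L by (intro Cb_SucI[where g'=g'] g') (auto intro: Cb_mono)
  then show ?case using K by (meson max.coboundedI1)
qed

lemma Cb_add: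
  assumes "Cb S n K f" "Cb S n L g" shows "Cb S n (K + L) (\<lambda>x. f x + g x)"
  using assms
proof (induction n arbitrary: f g)
  case 0
  then show ?case by (auto intro!: continuous_intros abs_triangle_ineq[THEN order_trans] add_mono)
next
  case (Suc n)
  obtain f' where f': "PROP deriv_on S f f'" "Cb S n K f'"
    using Suc.prems(1) by (rule Cb_SucE) blast
  obtain g' where g': "PROP deriv_on S g g'" "Cb S n L g'"
    using Suc.prems(2) by (rule Cb_SucE) blast
  show ?case
  proof (rule Cb_SucI[where g'="\<lambda>x. f' x + g' x"])
    show "\<bar>f x + g x\<bar> \<le> K + L" if "x \<in> S" for x
      using Cb_bound[OF Suc.prems(1) that] Cb_bound[OF Suc.prems(2) that] by linarith
  qed (auto intro: DERIV_add f' g' Suc.IH)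
qed

lemma Cb_cmult:
  assumes "Cb S n K f" shows "Cb S n (\<bar>c\<bar> * K) (\<lambda>x. c * f x)"
  using assms
proof (induction n arbitrary: f)
  case 0
  then show ?case by (auto intro!: continuous_intros mult_left_mono simp: abs_mult)
next
  case (Suc n)
  obtain f' where f': "PROP deriv_on S f f'" "Cb S n K f'"
    using Suc.prems(1) by (rule Cb_SucE) blast
  show ?case
  proof (rule Cb_SucI[where g'="\<lambda>x. c * f' x"])
    show "\<bar>c * f x\<bar> \<le> \<bar>c\<bar> * K" if "x \<in> S" for x
      using Cb_bound[OF Suc.prems(1) that] by (simp add: abs_mult mult_left_mono)
  qed (auto intro: DERIV_cmult f' Suc.IH)
qed

lemma Cb_minus: "Cb S n K f \<Longrightarrow> Cb S n K (\<lambda>x. - f x)"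
  using Cb_cmult[of S n K f "-1"] by simp

lemma Cb_diff:
  assumes "Cb S n K f" "Cb S n L g" shows "Cb S n (K + L) (\<lambda>x. f x - g x)"
  using Cb_add[OF assms(1) Cb_minus[OF assms(2)]] by simp

lemma Cb_diff_commute: "Cb S n K (\<lambda>x. f x - g x) \<Longrightarrow> Cb S n K (\<lambda>x. g x - f x)"
  using Cb_minus[of S n K "\<lambda>x. f x - g x"] by simp

text \<open>The product rule turns each differentiation into a sum of two products of the same kind,
  so the bound at most doubles with each order; this is the factor \<open>2 ^ n\<close>.\<close>

lemma Cb_mult:
  assumes "Cb S n K f" "Cb S n L g" shows "Cb S n (2 ^ n * (K * L)) (\<lambda>x. f x * g x)"
  using assms
proof (induction n arbitrary: f g K L)
  case 0
  then show ?case
    by (auto intro!: continuous_intros simp: abs_mult)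
       (metis abs_ge_zero mult_mono order_trans)
next
  case (Suc n)
  obtain f' where f': "PROP deriv_on S f f'" "Cb S n K f'"
    using Suc.prems(1) by (rule Cb_SucE) blast
  obtain g' where g': "PROP deriv_on S g g'" "Cb S n L g'"
    using Suc.prems(2) by (rule Cb_SucE) blast
  show ?case
  proof (rule Cb_SucI[where g'="\<lambda>x. f' x * g x + g' x * f x"])
    show "\<bar>f x * g x\<bar> \<le> 2 ^ Suc n * (K * L)" if "x \<in> S" for x
    proof -
      have fx: "\<bar>f x\<bar> \<le> K" "\<bar>g x\<bar> \<le> L"
        using Cb_bound[OF Suc.prems(1) that] Cb_bound[OF Suc.prems(2) that] by auto
      then have "0 \<le> K" "0 \<le> L" by linarith+
      then have 0: "0 \<le> K * L" by simp
      have "\<bar>f x * g x\<bar> \<le> K * L" using fx \<open>0 \<le> K\<close> by (simp add: abs_mult mult_mono)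
      also have "\<dots> \<le> 2 ^ Suc n * (K * L)"
        using 0 mult_right_mono[of 1 "2 ^ Suc n" "K * L"] by (simp del: power_Suc)
      finally show ?thesis .
    qed
    have "Cb S n (2 ^ n * (K * L) + 2 ^ n * (L * K)) (\<lambda>x. f' x * g x + g' x * f x)"
      by (rule Cb_add[OF Suc.IH[OF f'(2) Cb_pred[OF Suc.prems(2)]] Suc.IH[OF g'(2) Cb_pred[OF Suc.prems(1)]]])
    then show "Cb S n (2 ^ Suc n * (K * L)) (\<lambda>x. f' x * g x + g' x * f x)"
      by (simp add: algebra_simps)
  qed (auto intro: DERIV_mult f' g')
qed

section \<open>Composition with a fixed function: boundedness, Lipschitz dependence and first order
  expansion\<close>

lemma Cb_compose:
  assumes F: "Cb J n L F"
  shows "\<exists>M\<ge>0. \<forall>q. Cb S n K q \<and> q ` S \<subseteq> J \<longrightarrow> Cb S n M (\<lambda>x. F (q x))"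
  using F
proof (induction n arbitrary: F)
  case 0
  then have "continuous_on J F" "\<forall>x\<in>J. \<bar>F x\<bar> \<le> L" by auto
  then show ?case
    by (intro exI[of _ "max 0 L"]) (auto intro!: continuous_on_compose2[of J F] max.coboundedI2)
next
  case (Suc n)
  obtain F' where F': "PROP deriv_on J F F'" "Cb J n L F'"
    using Suc.prems(1) by (rule Cb_SucE) blast
  obtain M where M: "M \<ge> 0" "\<And>q. Cb S n K q \<Longrightarrow> q ` S \<subseteq> J \<Longrightarrow> Cb S n M (\<lambda>x. F' (q x))"
    using Suc.IH[OF F'(2)] by blast
  \<comment> \<open>\<open>M\<close> bounds \<open>F' (q x)\<close> with its derivatives and
    \<open>K\<close> bounds those of \<open>q'\<close>, so \<open>N\<close> is independent of
    \<open>q\<close>. Fixed point arguments need exactly this uniformity.\<close>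
  define N where "N = max \<bar>L\<bar> (2 ^ n * (M * K))"
  have "Cb S (Suc n) N (\<lambda>x. F (q x))" if q: "Cb S (Suc n) K q" "q ` S \<subseteq> J" for q
  proof -
    obtain q' where q': "PROP deriv_on S q q'" "Cb S n K q'"
      using q(1) by (rule Cb_SucE) blast
    show ?thesis
    proof (rule Cb_SucI[where g'="\<lambda>x. F' (q x) * q' x"])
      show "\<bar>F (q x)\<bar> \<le> N" if "x \<in> S" for x
        using Cb_bound[OF Suc.prems, of "q x"] that q(2) by (auto simp: N_def)
      show "Cb S n N (\<lambda>x. F' (q x) * q' x)"
        using Cb_mult[OF M(2)[OF Cb_pred[OF q(1)] q(2)] q'(2)] by (rule Cb_mono) (simp add: N_def)
      show "((\<lambda>x. F (q x)) has_real_derivative F' (q x) * q' x) (at x within S)" if "x \<in> S" for x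
        using that q(2) by (intro DERIV_compose_within[OF F'(1) q'(1)]) auto
    qed
  qed
  then show ?case by (intro exI[of _ N]) (auto simp: N_def)
qed

text \<open>Derivatives in \<open>Ck_on\<close> and \<open>Cb\<close> are existentially quantified.
  On a set without isolated points they are unique, so a given derivative can be identified with the
  one promised by membership in the class.\<close>

definition no_isolated :: "real set \<Rightarrow> bool" where
  "no_isolated S \<longleftrightarrow> (\<forall>x\<in>S. at x within S \<noteq> bot)"

lemma no_isolated_Icc: "a < b \<Longrightarrow> no_isolated {a..b}"
  by (simp add: no_isolated_def trivial_limit_within islimpt_Icc)

lemma no_isolated_unique:
  "no_isolated S \<Longrightarrow> x \<in> S \<Longrightarrow> (f has_real_derivative a) (at x within S) \<Longrightarrow>
    (f has_real_derivative b) (at x within S) \<Longrightarrow> a = b"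
  unfolding no_isolated_def using has_field_derivative_unique by blast

lemma Cb_deriv:
  assumes "no_isolated S" "Cb S (Suc n) K g"
    "PROP deriv_on S g g'"
  shows "Cb S n K g'"
proof -
  obtain h where h: "PROP deriv_on S g h" "Cb S n K h"
    using assms(2) by (rule Cb_SucE) blast
  show ?thesis
    using h(2) by (rule Cb_cong[rotated]) (use assms h(1) no_isolated_unique in blast)
qed

lemma Cb_lipschitz:
  assumes F: "Cb J (Suc n) L F" and J: "convex J" and uv: "u \<in> J" "v \<in> J"
  shows "\<bar>F u - F v\<bar> \<le> \<bar>L\<bar> * \<bar>u - v\<bar>"
proof -
  obtain F' where F': "PROP deriv_on J F F'" "Cb J n L F'"
    using F by (rule Cb_SucE) blast
  have "\<bar>F' z\<bar> \<le> \<bar>L\<bar>" if "z \<in> J" for z using Cb_bound[OF F'(2) that] by linarith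
  then show ?thesis
    using field_differentiable_bound[OF J F'(1), of "\<bar>L\<bar>" u v] uv by (auto simp: abs_minus_commute)
qed

lemma Cb_empty: "Cb {} n K g"
  by (induction n arbitrary: g) auto

text \<open>Differentiation gives \<open>(F' q1 - F' q2) q1' + F' q2 (q1' - q2')\<close>: the first
  summand is handled by induction, the second by \<open>Cb_compose\<close>. Lipschitz dependence
  costs one derivative of \<open>F\<close>.\<close>

lemma Cb_compose_diff:
  assumes S: "no_isolated S" and F: "Cb J (Suc n) L F" and J: "convex J"
  shows "\<exists>M\<ge>0. \<forall>q1 q2 r. Cb S n K q1 \<and> Cb S n K q2 \<and> q1 ` S \<subseteq> J \<and> q2 ` S \<subseteq> J \<and>
     Cb S n r (\<lambda>x. q1 x - q2 x) \<longrightarrow> Cb S n (M * r) (\<lambda>x. F (q1 x) - F (q2 x))"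
  using F
proof (induction n arbitrary: F)
  case 0
  have contF: "continuous_on J F" using Cb_imp_Ck[OF 0] Ck_on_imp_continuous by blast
  have "Cb S 0 (\<bar>L\<bar> * r) (\<lambda>x. F (q1 x) - F (q2 x))"
    if q: "Cb S 0 K q1" "Cb S 0 K q2" "q1 ` S \<subseteq> J" "q2 ` S \<subseteq> J" "Cb S 0 r (\<lambda>x. q1 x - q2 x)"
    for q1 q2 r
  proof -
    have "continuous_on S (\<lambda>x. F (q1 x) - F (q2 x))"
      using q by (intro continuous_intros continuous_on_compose2[OF contF]) auto
    moreover have "\<bar>F (q1 x) - F (q2 x)\<bar> \<le> \<bar>L\<bar> * r" if "x \<in> S" for x
    proof -
      have "\<bar>F (q1 x) - F (q2 x)\<bar> \<le> \<bar>L\<bar> * \<bar>q1 x - q2 x\<bar>"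
        using q that by (intro Cb_lipschitz[OF 0 J]) auto
      also have "\<dots> \<le> \<bar>L\<bar> * r" using q(5) that by (intro mult_left_mono) auto
      finally show ?thesis .
    qed
    ultimately show ?thesis by simp
  qed
  then show ?case by (intro exI[of _ "\<bar>L\<bar>"]) auto
next
  case (Suc n)
  obtain F' where F': "PROP deriv_on J F F'" "Cb J (Suc n) L F'"
    using Suc.prems(1) by (rule Cb_SucE) blast
  obtain M where M: "M \<ge> 0" "\<And>q1 q2 r. Cb S n K q1 \<Longrightarrow> Cb S n K q2 \<Longrightarrow> q1 ` S \<subseteq> J \<Longrightarrow> q2 ` S \<subseteq> J \<Longrightarrow>
     Cb S n r (\<lambda>x. q1 x - q2 x) \<Longrightarrow> Cb S n (M * r) (\<lambda>x. F' (q1 x) - F' (q2 x))"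
    using Suc.IH[OF F'(2)] by blast
  obtain M0 where M0: "M0 \<ge> 0" "\<And>q. Cb S n K q \<Longrightarrow> q ` S \<subseteq> J \<Longrightarrow> Cb S n M0 (\<lambda>x. F' (q x))"
    using Cb_compose[OF Cb_pred[OF F'(2)], of S K] by blast
  define N where "N = \<bar>L\<bar> + 2 ^ n * (M * \<bar>K\<bar>) + 2 ^ n * M0"
  have N: "N \<ge> 0" using M(1) M0(1) by (simp add: N_def)
  have "Cb S (Suc n) (N * r) (\<lambda>x. F (q1 x) - F (q2 x))"
    if q: "Cb S (Suc n) K q1" "Cb S (Suc n) K q2" "q1 ` S \<subseteq> J" "q2 ` S \<subseteq> J"
      "Cb S (Suc n) r (\<lambda>x. q1 x - q2 x)"
    for q1 q2 r
  proof -
    obtain q1' where q1': "PROP deriv_on S q1 q1'" "Cb S n K q1'"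
      using q(1) by (rule Cb_SucE) blast
    obtain q2' where q2': "PROP deriv_on S q2 q2'" "Cb S n K q2'"
      using q(2) by (rule Cb_SucE) blast
    have d: "Cb S n r (\<lambda>x. q1' x - q2' x)"
      by (rule Cb_deriv[OF S q(5)]) (intro DERIV_diff q1' q2')
    show ?thesis
    proof (cases "S = {}")
      case False
      then have r: "r \<ge> 0" using q(5) Cb_nonneg by blast
      show ?thesis
      proof (rule Cb_SucI[where g'="\<lambda>x. (F' (q1 x) - F' (q2 x)) * q1' x + F' (q2 x) * (q1' x - q2' x)"])
        fix x assume x: "x \<in> S"
        have "\<bar>F (q1 x) - F (q2 x)\<bar> \<le> \<bar>L\<bar> * \<bar>q1 x - q2 x\<bar>"
          using q x by (intro Cb_lipschitz[OF Suc.prems J]) auto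
        also have "\<dots> \<le> \<bar>L\<bar> * r" using Cb_bound[OF q(5) x] by (intro mult_left_mono) auto
        also have "\<dots> \<le> N * r" using r M(1) M0(1) by (intro mult_right_mono) (auto simp: N_def)
        finally show "\<bar>F (q1 x) - F (q2 x)\<bar> \<le> N * r" .
        have "((\<lambda>x. F (q1 x) - F (q2 x)) has_real_derivative F' (q1 x) * q1' x - F' (q2 x) * q2' x)
            (at x within S)"
          using x q by (intro DERIV_diff DERIV_compose_within[OF F'(1)] q1' q2') auto
        then show "((\<lambda>x. F (q1 x) - F (q2 x)) has_real_derivative
            (F' (q1 x) - F' (q2 x)) * q1' x + F' (q2 x) * (q1' x - q2' x)) (at x within S)"
          by (simp add: algebra_simps)
      next
        have "Cb S n (2 ^ n * (M * r * \<bar>K\<bar>) + 2 ^ n * (M0 * r))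
          (\<lambda>x. (F' (q1 x) - F' (q2 x)) * q1' x + F' (q2 x) * (q1' x - q2' x))"
          by (intro Cb_add Cb_mult M(2) M0(2) d Cb_pred[OF q(1)] Cb_pred[OF q(2)] Cb_pred[OF q(5)]
              Cb_mono[OF q1'(2)] q(3,4) abs_ge_self)
        then show "Cb S n (N * r)
          (\<lambda>x. (F' (q1 x) - F' (q2 x)) * q1' x + F' (q2 x) * (q1' x - q2' x))"
          by (rule Cb_mono) (use r in \<open>simp add: N_def algebra_simps\<close>)
      qed
    next
      case True
      then show ?thesis using Cb_empty by simp
    qed
  qed
  then show ?case using N by (intro exI[of _ N]) blast
qed

text \<open>The function \<open>F z - F' v * z\<close> has derivative \<open>F' z - F' v\<close>, at
  most \<open>L * \<bar>u - v\<bar>\<close> on the segment, so the mean value inequality suffices.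
  It costs the factor \<open>1/2\<close> of Taylor's formula but needs no second derivative.\<close>

lemma Taylor_first_order_bound:
  assumes F': "PROP deriv_on J F F'"
    and lip: "\<And>u v. u \<in> J \<Longrightarrow> v \<in> J \<Longrightarrow> \<bar>F' u - F' v\<bar> \<le> L * \<bar>u - v\<bar>"
    and J: "convex J" and L: "L \<ge> 0" and uv: "u \<in> J" "v \<in> J"
  shows "\<bar>F u - F v - F' v * (u - v)\<bar> \<le> L * \<bar>u - v\<bar> ^ 2"
proof -
  let ?I = "closed_segment v u"
  have sub: "?I \<subseteq> J" using J uv by (simp add: closed_segment_subset)
  have "\<bar>(F u - F' v * u) - (F v - F' v * v)\<bar> \<le> (L * \<bar>u - v\<bar>) * norm (u - v)"
    unfolding real_norm_def[symmetric, of "(F u - F' v * u) - (F v - F' v * v)"]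
  proof (rule field_differentiable_bound[of ?I _ "\<lambda>z. F' z - F' v"])
    fix z assume z: "z \<in> ?I"
    show "((\<lambda>z. F z - F' v * z) has_real_derivative F' z - F' v) (at z within ?I)"
      using z sub by (auto intro!: derivative_eq_intros has_field_derivative_subset[OF F'])
    have "\<bar>F' z - F' v\<bar> \<le> L * \<bar>z - v\<bar>" using z sub uv by (intro lip) auto
    also have "\<dots> \<le> L * \<bar>u - v\<bar>"
      using z L segment_bound(1)[of z v u] by (intro mult_left_mono) (auto simp: abs_minus_commute)
    finally show "norm (F' z - F' v) \<le> L * \<bar>u - v\<bar>" by simp
  qed (auto simp: uv)
  then show ?thesis by (simp add: algebra_simps power2_eq_square)
qed

text \<open>The derivative of the remainder of \<open>F\<close> is the remainder of
  \<open>F'\<close> times \<open>q2'\<close> plus \<open>(F' q1 - F' q2) (q1' - q2')\<close>. Both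
  terms are quadratic in the distance, the second one by \<open>Cb_compose_diff\<close>.\<close>

lemma Cb_compose_Taylor:
  assumes S: "no_isolated S" and J: "convex J"
    and F: "Cb J (Suc (Suc n)) L F"
    and F': "PROP deriv_on J F F'" "Cb J (Suc n) L F'"
  shows "\<exists>M\<ge>0. \<forall>q1 q2 r. Cb S n K q1 \<and> Cb S n K q2 \<and> q1 ` S \<subseteq> J \<and> q2 ` S \<subseteq> J \<and>
     Cb S n r (\<lambda>x. q1 x - q2 x) \<longrightarrow>
       Cb S n (M * r^2) (\<lambda>x. F (q1 x) - F (q2 x) - F' (q2 x) * (q1 x - q2 x))"
  using F F'
proof (induction n arbitrary: F F')
  case 0
  have cont: "continuous_on J F" "continuous_on J F'"
    using Cb_imp_Ck[OF 0(1)] Cb_imp_Ck[OF 0(3)] Ck_on_imp_continuous by blast+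
  have lip: "\<bar>F' u - F' v\<bar> \<le> \<bar>L\<bar> * \<bar>u - v\<bar>" if "u \<in> J" "v \<in> J" for u v
    using Cb_lipschitz[OF 0(3) J that] .
  have "Cb S 0 (\<bar>L\<bar> * r^2) (\<lambda>x. F (q1 x) - F (q2 x) - F' (q2 x) * (q1 x - q2 x))"
    if q: "Cb S 0 K q1" "Cb S 0 K q2" "q1 ` S \<subseteq> J" "q2 ` S \<subseteq> J" "Cb S 0 r (\<lambda>x. q1 x - q2 x)"
    for q1 q2 r
  proof -
    have "continuous_on S (\<lambda>x. F (q1 x) - F (q2 x) - F' (q2 x) * (q1 x - q2 x))"
      using q by (intro continuous_intros continuous_on_compose2[OF cont(1)] continuous_on_compose2[OF cont(2)]) auto
    moreover have "\<bar>F (q1 x) - F (q2 x) - F' (q2 x) * (q1 x - q2 x)\<bar> \<le> \<bar>L\<bar> * r^2" if "x \<in> S" for x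
    proof -
      have "\<bar>F (q1 x) - F (q2 x) - F' (q2 x) * (q1 x - q2 x)\<bar> \<le> \<bar>L\<bar> * \<bar>q1 x - q2 x\<bar> ^ 2"
        using q that by (intro Taylor_first_order_bound[OF 0(2) lip J]) auto
      also have "\<dots> \<le> \<bar>L\<bar> * r ^ 2" using q(5) that by (intro mult_left_mono power_mono) auto
      finally show ?thesis .
    qed
    ultimately show ?thesis by simp
  qed
  then show ?case by (intro exI[of _ "\<bar>L\<bar>"]) auto
next
  case (Suc n)
  obtain F'' where F'': "PROP deriv_on J F' F''" "Cb J (Suc n) L F''"
    using Suc.prems(3) by (rule Cb_SucE) blast
  obtain M where M: "M \<ge> 0" "\<And>q1 q2 r. Cb S n K q1 \<Longrightarrow> Cb S n K q2 \<Longrightarrow> q1 ` S \<subseteq> J \<Longrightarrow> q2 ` S \<subseteq> J \<Longrightarrow>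
     Cb S n r (\<lambda>x. q1 x - q2 x) \<Longrightarrow>
       Cb S n (M * r^2) (\<lambda>x. F' (q1 x) - F' (q2 x) - F'' (q2 x) * (q1 x - q2 x))"
    using Suc.IH[OF Suc.prems(3) F''] by blast
  obtain M0 where M0: "M0 \<ge> 0" "\<And>q1 q2 r. Cb S n K q1 \<Longrightarrow> Cb S n K q2 \<Longrightarrow> q1 ` S \<subseteq> J \<Longrightarrow> q2 ` S \<subseteq> J \<Longrightarrow>
     Cb S n r (\<lambda>x. q1 x - q2 x) \<Longrightarrow> Cb S n (M0 * r) (\<lambda>x. F' (q1 x) - F' (q2 x))"
    using Cb_compose_diff[OF S Cb_pred[OF Suc.prems(3)] J, where K=K] by (elim exE conjE) blast
  define N where "N = \<bar>L\<bar> + 2 ^ n * (M * \<bar>K\<bar>) + 2 ^ n * M0"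
  have N: "N \<ge> 0" using M(1) M0(1) by (simp add: N_def)
  have "Cb S (Suc n) (N * r^2) (\<lambda>x. F (q1 x) - F (q2 x) - F' (q2 x) * (q1 x - q2 x))"
    if q: "Cb S (Suc n) K q1" "Cb S (Suc n) K q2" "q1 ` S \<subseteq> J" "q2 ` S \<subseteq> J"
      "Cb S (Suc n) r (\<lambda>x. q1 x - q2 x)"
    for q1 q2 r
  proof -
    obtain q1' where q1': "PROP deriv_on S q1 q1'" "Cb S n K q1'"
      using q(1) by (rule Cb_SucE) blast
    obtain q2' where q2': "PROP deriv_on S q2 q2'" "Cb S n K q2'"
      using q(2) by (rule Cb_SucE) blast
    have d: "Cb S n r (\<lambda>x. q1' x - q2' x)"
      by (rule Cb_deriv[OF S q(5)]) (intro DERIV_diff q1' q2')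
    note qn = Cb_pred[OF q(1)] Cb_pred[OF q(2)] q(3,4) Cb_pred[OF q(5)]
    let ?D = "\<lambda>x. (F' (q1 x) - F' (q2 x) - F'' (q2 x) * (q1 x - q2 x)) * q2' x
              + (F' (q1 x) - F' (q2 x)) * (q1' x - q2' x)"
    show ?thesis
    proof (rule Cb_SucI[where g'="?D"])
      fix x assume x: "x \<in> S"
      have "\<bar>F (q1 x) - F (q2 x) - F' (q2 x) * (q1 x - q2 x)\<bar> \<le> \<bar>L\<bar> * \<bar>q1 x - q2 x\<bar> ^ 2"
        using q x by (intro Taylor_first_order_bound[OF Suc.prems(2) Cb_lipschitz[OF Suc.prems(3) J] J]) auto
      also have "\<dots> \<le> \<bar>L\<bar> * r ^ 2" using Cb_bound[OF q(5) x] by (intro mult_left_mono power_mono) auto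
      also have "\<dots> \<le> N * r ^ 2" using M(1) M0(1) by (intro mult_right_mono) (auto simp: N_def)
      finally show "\<bar>F (q1 x) - F (q2 x) - F' (q2 x) * (q1 x - q2 x)\<bar> \<le> N * r ^ 2" .
      have "((\<lambda>x. F (q1 x) - F (q2 x) - F' (q2 x) * (q1 x - q2 x)) has_real_derivative
          F' (q1 x) * q1' x - F' (q2 x) * q2' x
          - ((F'' (q2 x) * q2' x) * (q1 x - q2 x) + (q1' x - q2' x) * F' (q2 x))) (at x within S)"
        using x q by (intro DERIV_diff DERIV_mult DERIV_compose_within[OF Suc.prems(2)]
            DERIV_compose_within[OF F''(1)] q1' q2') auto
      then show "((\<lambda>x. F (q1 x) - F (q2 x) - F' (q2 x) * (q1 x - q2 x)) has_real_derivative ?D x)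
         (at x within S)"
        by (simp add: algebra_simps)
    next
      have "Cb S n (2 ^ n * (M * r^2 * K) + 2 ^ n * ((M0 * r) * r)) ?D"
        by (rule Cb_add[OF Cb_mult[OF M(2)[OF qn] q2'(2)] Cb_mult[OF M0(2)[OF qn] d]])
      moreover have "2 ^ n * (M * r^2 * K) + 2 ^ n * ((M0 * r) * r) \<le> N * r^2"
      proof -
        have "2 ^ n * (M * r^2 * K) \<le> 2 ^ n * (M * r^2 * \<bar>K\<bar>)"
          using M(1) by (intro mult_left_mono) auto
        moreover have "N * r^2 = \<bar>L\<bar> * r^2 + 2 ^ n * (M * r^2 * \<bar>K\<bar>) + 2 ^ n * ((M0 * r) * r)"
          by (simp add: N_def algebra_simps power2_eq_square)
        moreover have "0 \<le> \<bar>L\<bar> * r^2" by simp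
        ultimately show ?thesis by linarith
      qed
      ultimately show "Cb S n (N * r^2) ?D" by (rule Cb_mono)
    qed
  qed
  then show ?case using N by (intro exI[of _ N]) blast
qed

section \<open>Closedness, completeness, compact embedding and density of polynomials\<close>

lemma Cb_closed:
  assumes S: "no_isolated S" and "\<And>et. et > 0 \<Longrightarrow> Cb S n (K + et) g"
  shows "Cb S n K g"
  using assms(2)
proof (induction n arbitrary: g)
  case 0
  have "\<bar>g x\<bar> \<le> K" if "x \<in> S" for x
    by (rule field_le_epsilon) (use 0 that in auto)
  with 0[of 1] show ?case by simp
next
  case (Suc n)
  have 1: "Cb S (Suc n) (K + 1) g" using Suc.prems by simp
  obtain g' where g': "PROP deriv_on S g g'"
    using 1 by (rule Cb_SucE) blast
  show ?case
  proof (rule Cb_SucI[where g'=g'])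
    show "Cb S n K g'" by (rule Suc.IH, rule Cb_deriv[OF S]) (use Suc.prems g' in blast)+
    show "\<bar>g x\<bar> \<le> K" if "x \<in> S" for x
      by (rule field_le_epsilon) (use Suc.prems Cb_bound that in blast)
  qed (use g' in blast)
qed

lemma Cb_zero: "K \<ge> 0 \<Longrightarrow> Cb S n K (\<lambda>x. 0)"
proof (induction n)
  case (Suc n)
  then show ?case by (intro Cb_SucI[where g'="\<lambda>x. 0"]) auto
qed auto

lemma Cb_const: "\<bar>c\<bar> \<le> K \<Longrightarrow> Cb S n K (\<lambda>x. c)"
proof (cases n)
  case (Suc m)
  assume "\<bar>c\<bar> \<le> K" then show ?thesis unfolding Suc
    by (intro Cb_SucI[where g'="\<lambda>x. 0"] Cb_zero) auto
qed auto

definition Cb_Cauchy :: "real set \<Rightarrow> nat \<Rightarrow> (nat \<Rightarrow> real \<Rightarrow> real) \<Rightarrow> bool" where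
  "Cb_Cauchy S n u \<longleftrightarrow> (\<forall>et>0. \<exists>N. \<forall>i\<ge>N. \<forall>j\<ge>N. Cb S n et (\<lambda>x. u i x - u j x))"

definition Cb_lim :: "real set \<Rightarrow> nat \<Rightarrow> (nat \<Rightarrow> real \<Rightarrow> real) \<Rightarrow> (real \<Rightarrow> real) \<Rightarrow> bool" where
  "Cb_lim S n u v \<longleftrightarrow> (\<forall>et>0. \<exists>N. \<forall>i\<ge>N. Cb S n et (\<lambda>x. u i x - v x))"

lemma Cb_lim_Ck:
  assumes "Cb_lim S n u v" "\<And>i. Ck_on n S (u i)" shows "Ck_on n S v"
proof -
  obtain N where "Cb S n 1 (\<lambda>x. u N x - v x)"
    using assms(1) unfolding Cb_lim_def by (meson le_refl zero_less_one)
  then have "Ck_on n S (\<lambda>x. u N x - (u N x - v x))"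
    by (intro Ck_on_diff assms(2) Cb_imp_Ck)
  then show ?thesis by simp
qed

lemma Cb_lim_pointwise:
  assumes "Cb_lim S n u v" "x \<in> S" shows "(\<lambda>i. u i x) \<longlonglongrightarrow> v x"
proof (rule LIMSEQ_I)
  fix r :: real assume "r > 0"
  then obtain N where "\<forall>i\<ge>N. Cb S n (r/2) (\<lambda>x. u i x - v x)"
    using assms(1) unfolding Cb_lim_def by (meson half_gt_zero)
  then have "\<forall>i\<ge>N. norm (u i x - v x) \<le> r / 2"
    using Cb_bound[of S n "r/2" "\<lambda>x. u _ x - v x", OF _ assms(2)] by simp
  then show "\<exists>N. \<forall>i\<ge>N. norm (u i x - v x) < r" using \<open>r > 0\<close> by (intro exI[of _ N]) force
qed

lemma Cb_lim_deriv:
  assumes S: "no_isolated S" and "Cb_lim S (Suc n) u v"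
    and u': "\<And>i x. x \<in> S \<Longrightarrow> (u i has_real_derivative u' i x) (at x within S)"
    and v': "PROP deriv_on S v v'"
  shows "Cb_lim S n u' v'"
  unfolding Cb_lim_def
proof (intro allI impI)
  fix et :: real assume "et > 0"
  then obtain N where "\<forall>i\<ge>N. Cb S (Suc n) et (\<lambda>x. u i x - v x)"
    using assms(2) unfolding Cb_lim_def by blast
  then show "\<exists>N. \<forall>i\<ge>N. Cb S n et (\<lambda>x. u' i x - v' x)"
    using Cb_deriv[OF S _ DERIV_diff[OF u' v']] by blast
qed

text \<open>By induction the derivatives converge uniformly. Convergence at the single point
  \<open>a\<close> fixes the constant of integration, and termwise differentiation identifies the
  derivative of the limit.\<close>

lemma Cb_complete:
  assumes ab: "a < b" and "Cb_Cauchy {a..b} n u" "\<And>i. Ck_on n {a..b} (u i)"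
  shows "\<exists>v. Cb_lim {a..b} n u v"
  using assms(2,3)
proof (induction n arbitrary: u)
  case 0
  let ?S = "{a..b}"
  have "uniformly_Cauchy_on ?S u"
    unfolding uniformly_Cauchy_on_def
  proof (intro allI impI)
    fix e :: real assume "e > 0"
    then obtain N where N: "\<forall>i\<ge>N. \<forall>j\<ge>N. Cb ?S 0 (e/2) (\<lambda>x. u i x - u j x)"
      using 0 unfolding Cb_Cauchy_def by (meson half_gt_zero)
    show "\<exists>M. \<forall>x\<in>?S. \<forall>m\<ge>M. \<forall>n\<ge>M. dist (u m x) (u n x) < e"
    proof (intro exI[of _ N] ballI allI impI)
      fix x m n assume "x \<in> ?S" "m \<ge> N" "n \<ge> N"
      then have "\<bar>u m x - u n x\<bar> \<le> e/2" using N Cb_bound by blast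
      then show "dist (u m x) (u n x) < e" using \<open>e > 0\<close> by (simp add: dist_real_def)
    qed
  qed
  then obtain v where v: "uniform_limit ?S u v sequentially"
    using Cauchy_uniformly_convergent uniformly_convergent_on_def by blast
  have cont: "continuous_on ?S v"
    by (rule uniform_limit_theorem[OF _ v]) (use 0 in auto)
  have "Cb_lim ?S 0 u v"
    unfolding Cb_lim_def
  proof (intro allI impI)
    fix et :: real assume "et > 0"
    then obtain N where "\<forall>n\<ge>N. \<forall>x\<in>?S. dist (u n x) (v x) < et"
      using v unfolding uniform_limit_sequentially_iff by blast
    then show "\<exists>N. \<forall>i\<ge>N. Cb ?S 0 et (\<lambda>x. u i x - v x)"
      using 0 cont by (intro exI[of _ N]) (force simp: dist_real_def intro!: continuous_intros)
  qed
  then show ?case by blast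
next
  case (Suc n)
  let ?S = "{a..b}"
  have S: "no_isolated ?S" using ab by (rule no_isolated_Icc)
  have "\<exists>u'. (\<forall>x\<in>?S. (u i has_real_derivative u' x) (at x within ?S)) \<and> Ck_on n ?S u'" for i
    using Suc.prems(2)[of i] unfolding Ck_on_Suc_real .
  then obtain u' where u': "\<And>i x. x \<in> ?S \<Longrightarrow> (u i has_real_derivative u' i x) (at x within ?S)"
     "\<And>i. Ck_on n ?S (u' i)" by metis
  have "Cb_Cauchy ?S n u'"
    unfolding Cb_Cauchy_def
  proof (intro allI impI)
    fix et :: real assume "et > 0"
    then obtain N where "\<forall>i\<ge>N. \<forall>j\<ge>N. Cb ?S (Suc n) et (\<lambda>x. u i x - u j x)"
      using Suc.prems(1) unfolding Cb_Cauchy_def by blast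
    then show "\<exists>N. \<forall>i\<ge>N. \<forall>j\<ge>N. Cb ?S n et (\<lambda>x. u' i x - u' j x)"
      using Cb_deriv[OF S _ DERIV_diff[OF u'(1) u'(1)]] by blast
  qed
  then obtain v' where v': "Cb_lim ?S n u' v'" using Suc.IH u'(2) by blast
  have "Cauchy (\<lambda>i. u i a)"
  proof (rule CauchyI)
    fix e :: real assume "e > 0"
    then obtain N where N: "\<forall>i\<ge>N. \<forall>j\<ge>N. Cb ?S (Suc n) (e/2) (\<lambda>x. u i x - u j x)"
      using Suc.prems(1) unfolding Cb_Cauchy_def by (meson half_gt_zero)
    show "\<exists>M. \<forall>m\<ge>M. \<forall>n\<ge>M. norm (u m a - u n a) < e"
    proof (intro exI[of _ N] allI impI)
      fix m n assume "m \<ge> N" "n \<ge> N"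
      then have "\<bar>u m a - u n a\<bar> \<le> e/2" using N Cb_bound[of ?S _ _ _ a] ab by force
      then show "norm (u m a - u n a) < e" using \<open>e > 0\<close> by simp
    qed
  qed
  then obtain l where l: "(\<lambda>i. u i a) \<longlonglongrightarrow> l" using Cauchy_convergent_iff convergent_def by blast
  have "\<exists>v. \<forall>x\<in>?S. (\<lambda>n. u n x) \<longlonglongrightarrow> v x \<and> (v has_derivative (\<lambda>h. v' x * h)) (at x within ?S)"
  proof (rule has_derivative_sequence[where f'="\<lambda>i x h. u' i x * h" and ?x0.0=a])
    show "(u n has_derivative (*) (u' n x)) (at x within ?S)" if "x \<in> ?S" for n x
      using u'(1)[OF that] by (simp add: has_field_derivative_def)
    fix e :: real assume "e > 0"
    then obtain N where N: "\<forall>i\<ge>N. Cb ?S n e (\<lambda>x. u' i x - v' x)" using v' unfolding Cb_lim_def by blast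
    show "\<forall>\<^sub>F n in sequentially. \<forall>x\<in>?S. \<forall>h. norm (u' n x * h - v' x * h) \<le> e * norm h"
      unfolding eventually_sequentially
    proof (intro exI[of _ N] allI impI ballI)
      fix m x h assume "N \<le> m" "x \<in> ?S"
      then have "\<bar>u' m x - v' x\<bar> \<le> e" using N Cb_bound by blast
      then show "norm (u' m x * h - v' x * h) \<le> e * norm h"
        by (simp add: left_diff_distrib[symmetric] abs_mult mult_right_mono)
    qed
  qed (use ab l in auto)
  then obtain v where v: "\<And>x. x \<in> ?S \<Longrightarrow> (\<lambda>n. u n x) \<longlonglongrightarrow> v x"
    "PROP deriv_on ?S v v'"
    unfolding has_field_derivative_def by blast
  have "Cb_lim ?S (Suc n) u v"
    unfolding Cb_lim_def
  proof (intro allI impI)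
    fix et :: real assume et: "et > 0"
    obtain N where N: "\<forall>i\<ge>N. Cb ?S n et (\<lambda>x. u' i x - v' x)" using v' et unfolding Cb_lim_def by blast
    obtain N' where N': "\<forall>i\<ge>N'. \<forall>j\<ge>N'. Cb ?S (Suc n) et (\<lambda>x. u i x - u j x)"
      using Suc.prems(1) et unfolding Cb_Cauchy_def by blast
    have "Cb ?S (Suc n) et (\<lambda>x. u i x - v x)" if i: "i \<ge> max N N'" for i
    proof (rule Cb_SucI[where g'="\<lambda>x. u' i x - v' x"])
      fix x assume x: "x \<in> ?S"
      have lim: "(\<lambda>j. \<bar>u i x - u j x\<bar>) \<longlonglongrightarrow> \<bar>u i x - v x\<bar>"
        by (intro tendsto_intros v x)
      show "\<bar>u i x - v x\<bar> \<le> et"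
      proof (rule LIMSEQ_le_const2[OF lim], intro exI[of _ N'] allI impI)
        fix j assume "j \<ge> N'"
        then have "Cb ?S (Suc n) et (\<lambda>x. u i x - u j x)" using N' i by simp
        then show "\<bar>u i x - u j x\<bar> \<le> et" using Cb_bound[OF _ x] by blast
      qed
      show "((\<lambda>x. u i x - v x) has_real_derivative u' i x - v' x) (at x within ?S)"
        by (rule DERIV_diff[OF u'(1)[OF x] v(2)[OF x]])
    qed (use N i in auto)
    then show "\<exists>N. \<forall>i\<ge>N. Cb ?S (Suc n) et (\<lambda>x. u i x - v x)" by blast
  qed
  then show ?case by blast
qed

text \<open>The mean value inequality from \<open>a\<close> recovers \<open>g\<close> from
  \<open>g'\<close> and one value. It lifts compactness and polynomial approximation from order
  \<open>n\<close> to order \<open>n + 1\<close>.\<close>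

lemma Cb_Suc_from_deriv:
  assumes ab: "a < b" and g': "PROP deriv_on {a..b} g g'"
    and "Cb {a..b} n et g'" "\<bar>g a\<bar> \<le> et" "(1 + (b - a)) * et \<le> K"
  shows "Cb {a..b} (Suc n) K g"
proof (rule Cb_SucI[OF _ g'])
  have et: "et \<ge> 0" using assms(4) by linarith
  then have "0 \<le> (b - a) * et" using ab by simp
  then have "et \<le> K" using assms(5) by (simp add: algebra_simps)
  then show "Cb {a..b} n K g'" using assms(3) Cb_mono by blast
  fix x assume x: "x \<in> {a..b}"
  have "norm (g x - g a) \<le> et * norm (x - a)"
    by (rule field_differentiable_bound[OF _ g']) (use x ab Cb_bound[OF assms(3)] in auto)
  also have "\<dots> \<le> et * (b - a)" using x et by (intro mult_left_mono) auto
  finally show "\<bar>g x\<bar> \<le> K" using assms(4,5) by (simp add: algebra_simps)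
qed

lemma Cb_Cauchy_subseq:
  assumes "Cb_Cauchy S n u" "strict_mono (r :: nat \<Rightarrow> nat)"
  shows "Cb_Cauchy S n (\<lambda>i. u (r i))"
  unfolding Cb_Cauchy_def
proof (intro allI impI)
  fix et :: real assume "et > 0"
  then obtain N where "\<forall>i\<ge>N. \<forall>j\<ge>N. Cb S n et (\<lambda>x. u i x - u j x)"
    using assms(1) unfolding Cb_Cauchy_def by blast
  then show "\<exists>N. \<forall>i\<ge>N. \<forall>j\<ge>N. Cb S n et (\<lambda>x. u (r i) x - u (r j) x)"
    using seq_suble[OF assms(2)] by (meson order_trans)
qed

text \<open>Arzela-Ascoli settles order \<open>0\<close>. For higher orders a subsequence is chosen
  for the derivatives by induction, and a further one for the bounded values at
  \<open>a\<close>.\<close>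

lemma Cb_compact:
  assumes ab: "a < b" and "\<And>i. Cb {a..b} (Suc n) K (u i)"
  shows "\<exists>r::nat\<Rightarrow>nat. strict_mono r \<and> Cb_Cauchy {a..b} n (\<lambda>i. u (r i))"
  using assms(2)
proof (induction n arbitrary: u)
  case 0
  let ?S = "{a..b}"
  have lip: "\<bar>u i x - u i y\<bar> \<le> \<bar>K\<bar> * \<bar>x - y\<bar>" if "x \<in> ?S" "y \<in> ?S" for i x y
    by (rule Cb_lipschitz[OF 0]) (use that in auto)
  obtain g k where gk: "continuous_on ?S g" "strict_mono (k :: nat \<Rightarrow> nat)"
      "\<And>e. 0 < e \<Longrightarrow> \<exists>N. \<forall>n x. n \<ge> N \<and> x \<in> ?S \<longrightarrow> norm (u (k n) x - g x) < e"
  proof (rule Arzela_Ascoli[of ?S u K])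
    show "norm (u n x) \<le> K" if "x \<in> ?S" for n x using Cb_bound[OF 0 that] by simp
    fix x e :: real assume "x \<in> ?S" "0 < e"
    show "\<exists>d>0. \<forall>n y. y \<in> ?S \<and> norm (x - y) < d \<longrightarrow> norm (u n x - u n y) < e"
    proof (intro exI[of _ "e / (\<bar>K\<bar> + 1)"] conjI allI impI)
      fix n y assume y: "y \<in> ?S \<and> norm (x - y) < e / (\<bar>K\<bar> + 1)"
      have "\<bar>u n x - u n y\<bar> \<le> \<bar>K\<bar> * \<bar>x - y\<bar>" using lip y \<open>x \<in> ?S\<close> by blast
      also have "\<dots> \<le> (\<bar>K\<bar> + 1) * \<bar>x - y\<bar>" by (intro mult_right_mono) auto
      also have "\<dots> < e" using y by (simp add: field_simps pos_less_divide_eq[of "\<bar>K\<bar> + 1"])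
      finally show "norm (u n x - u n y) < e" by simp
    qed (use \<open>0 < e\<close> in auto)
  qed auto
  have "Cb_Cauchy ?S 0 (\<lambda>i. u (k i))"
    unfolding Cb_Cauchy_def
  proof (intro allI impI)
    fix et :: real assume "et > 0"
    then obtain N where N: "\<forall>n x. n \<ge> N \<and> x \<in> ?S \<longrightarrow> norm (u (k n) x - g x) < et / 2"
      using gk(3) by (meson half_gt_zero)
    have "Cb ?S 0 et (\<lambda>x. u (k i) x - u (k j) x)" if "i \<ge> N" "j \<ge> N" for i j
    proof -
      have "\<bar>u (k i) x - u (k j) x\<bar> \<le> et" if "x \<in> ?S" for x
      proof -
        have "\<bar>u (k i) x - g x\<bar> < et / 2" "\<bar>u (k j) x - g x\<bar> < et / 2"
          using N that \<open>i \<ge> N\<close> \<open>j \<ge> N\<close> by auto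
        then show ?thesis by linarith
      qed
      then show ?thesis using Cb_imp_Ck[OF Cb_pred[OF 0]] by (auto intro!: continuous_intros)
    qed
    then show "\<exists>N. \<forall>i\<ge>N. \<forall>j\<ge>N. Cb ?S 0 et (\<lambda>x. u (k i) x - u (k j) x)" by blast
  qed
  with gk(2) show ?case by blast
next
  case (Suc n)
  let ?S = "{a..b}"
  have "\<exists>u'. (\<forall>x\<in>?S. (u i has_real_derivative u' x) (at x within ?S)) \<and> Cb ?S (Suc n) K u'" for i
    using Suc.prems[of i] unfolding Cb.simps(2)[of _ "Suc n"] by blast
  then obtain u' where u': "\<And>i x. x \<in> ?S \<Longrightarrow> (u i has_real_derivative u' i x) (at x within ?S)"
     "\<And>i. Cb ?S (Suc n) K (u' i)" by metis
  obtain r where r: "strict_mono (r :: nat \<Rightarrow> nat)" "Cb_Cauchy ?S n (\<lambda>i. u' (r i))"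
    using Suc.IH[of u'] u'(2) by blast
  have "\<forall>i. u (r i) a \<in> {-K..K}"
    using Cb_bound[OF Suc.prems, of a] ab by (auto simp: abs_le_iff) (metis minus_le_iff)+
  then obtain l s where s: "strict_mono (s :: nat \<Rightarrow> nat)" "((\<lambda>i. u (r i) a) \<circ> s) \<longlonglongrightarrow> l"
    using compact_Icc[of "-K" K, unfolded compact_def, THEN spec, of "\<lambda>i. u (r i) a"] by blast
  have s2: "(\<lambda>i. u (r (s i)) a) \<longlonglongrightarrow> l" using s(2) by (simp add: o_def)
  have C1: "Cauchy (\<lambda>i. u (r (s i)) a)" using s2 LIMSEQ_imp_Cauchy by blast
  have C2: "Cb_Cauchy ?S n (\<lambda>i. u' (r (s i)))" using Cb_Cauchy_subseq[OF r(2) s(1)] .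
  have "Cb_Cauchy ?S (Suc n) (\<lambda>i. u (r (s i)))"
    unfolding Cb_Cauchy_def
  proof (intro allI impI)
    fix et :: real assume "et > 0"
    define e where "e = et / (1 + (b - a))"
    have e: "e > 0" "(1 + (b - a)) * e \<le> et" using ab \<open>et > 0\<close> by (auto simp: e_def)
    obtain N where N: "\<forall>i\<ge>N. \<forall>j\<ge>N. Cb ?S n e (\<lambda>x. u' (r (s i)) x - u' (r (s j)) x)"
      using C2 e(1) unfolding Cb_Cauchy_def by blast
    obtain N' where N': "\<forall>i\<ge>N'. \<forall>j\<ge>N'. norm (u (r (s i)) a - u (r (s j)) a) < e"
      using C1 e(1) unfolding Cauchy_iff by blast
    have "Cb ?S (Suc n) et (\<lambda>x. u (r (s i)) x - u (r (s j)) x)" if "i \<ge> max N N'" "j \<ge> max N N'" for i j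
      by (rule Cb_Suc_from_deriv[OF ab DERIV_diff[OF u'(1) u'(1)], where et=e])
         (use N N' that e in \<open>auto intro: less_imp_le\<close>)
    then show "\<exists>N. \<forall>i\<ge>N. \<forall>j\<ge>N. Cb ?S (Suc n) et (\<lambda>x. u (r (s i)) x - u (r (s j)) x)" by blast
  qed
  then show ?case using strict_mono_o[OF r(1) s(1)] by (intro exI[of _ "r \<circ> s"]) (auto simp: o_def)
qed

lemma pderiv_surj: "\<exists>q. pderiv q = (p :: real poly)"
proof -
  define q where "q = (\<Sum>i\<le>degree p. monom (coeff p i / real (Suc i)) (Suc i))"
  have "pderiv q = (\<Sum>i\<le>degree p. monom (coeff p i) i)"
    using higher_pderiv_sum[of 1 "\<lambda>i. monom (coeff p i / real (Suc i)) (Suc i)" "{..degree p}"] by (simp add: q_def pderiv_monom del: of_nat_Suc)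
  then show ?thesis using poly_as_sum_of_monoms by metis
qed

text \<open>Approximate the derivative and integrate: a primitive of the approximating polynomial,
  shifted to agree with \<open>g\<close> at \<open>a\<close>, is close to \<open>g\<close> by the
  mean value inequality.\<close>

lemma Weierstrass_Ck:
  assumes ab: "a < b" and "Ck_on n {a..b} g" "et > 0"
  shows "\<exists>p :: real poly. Cb {a..b} n et (\<lambda>x. g x - poly p x)"
  using assms(2,3)
proof (induction n arbitrary: g et)
  case 0
  then obtain h where h: "real_polynomial_function h" "\<And>x. x \<in> {a..b} \<Longrightarrow> \<bar>g x - h x\<bar> < et"
    using Stone_Weierstrass_real_polynomial_function[of "{a..b}" g et] by auto
  obtain c N where "h = (\<lambda>x. \<Sum>i\<le>N. c i * x ^ i)"
    using h(1) unfolding real_polynomial_function_iff_sum by blast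
  then have "h = poly (\<Sum>i\<le>N. monom (c i) i)" by (auto simp: poly_sum poly_monom)
  then show ?case using h(2) 0(1)
    by (intro exI[of _ "\<Sum>i\<le>N. monom (c i) i"]) (auto intro!: continuous_intros intro: less_imp_le)
next
  case (Suc n)
  obtain g' where g': "PROP deriv_on {a..b} g g'"
     "Ck_on n {a..b} g'"
    using Suc.prems(1) by (rule Ck_onE) blast
  define e where "e = et / (1 + (b - a))"
  have e: "e > 0" "(1 + (b - a)) * e \<le> et" using ab \<open>et > 0\<close> by (auto simp: e_def)
  obtain p where p: "Cb {a..b} n e (\<lambda>x. g' x - poly p x)" using Suc.IH[OF g'(2) e(1)] by blast
  obtain q0 where q0: "pderiv q0 = p" using pderiv_surj by blast
  define q where "q = q0 + [:g a - poly q0 a:]"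
  have q: "pderiv q = p" "poly q a = g a" by (auto simp: q_def q0 pderiv_add)
  have "Cb {a..b} (Suc n) et (\<lambda>x. g x - poly q x)"
    by (rule Cb_Suc_from_deriv[OF ab DERIV_diff[OF g'(1)] p])
       (use q e in \<open>auto intro!: DERIV_subset[OF poly_DERIV] simp flip: q(1)\<close>)
  then show ?case by blast
qed

section \<open>Superposition operators\<close>

text \<open>\<open>r\<close> bounds both functions and \<open>rr\<close> their distance. Keeping the
  two apart gives remainders of size \<open>r * rr\<close>, hence contraction constants proportional
  to \<open>r\<close>.\<close>

definition small_pair :: "real set \<Rightarrow> nat \<Rightarrow> real \<Rightarrow> real \<Rightarrow> (real \<Rightarrow> real) \<Rightarrow> (real \<Rightarrow> real) \<Rightarrow> bool" where
  "small_pair S n r rr f1 f2 \<longleftrightarrow> 0 \<le> r \<and> 0 \<le> rr \<and> Cb S n r f1 \<and> Cb S n r f2 \<and> Cb S n rr (\<lambda>x. f1 x - f2 x)"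

text \<open>\<open>f \<mapsto> g x (f x)\<close> is strictly differentiable at \<open>0\<close> as a map on \<open>C\<^sup>n\<close>, its derivative being
  the multiplication by \<open>L\<close>.\<close>

definition strict_diff :: "real set \<Rightarrow> nat \<Rightarrow> (real \<Rightarrow> real \<Rightarrow> real) \<Rightarrow> (real \<Rightarrow> real) \<Rightarrow> bool" where
  "strict_diff S n g L \<longleftrightarrow> (\<exists>K\<ge>0. Cb S n K L) \<and> (\<exists>K\<ge>0. Cb S n K (\<lambda>x. g x 0)) \<and>
     (\<exists>K\<ge>0. \<exists>r0>0. \<forall>r rr f1 f2. r \<le> r0 \<longrightarrow> small_pair S n r rr f1 f2 \<longrightarrow>
        Cb S n (K * (r * rr)) (\<lambda>x. g x (f1 x) - g x (f2 x) - L x * (f1 x - f2 x)))"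

lemma strict_diffI:
  assumes "\<exists>K\<ge>0. Cb S n K L" "\<exists>K\<ge>0. Cb S n K (\<lambda>x. g x 0)" "K \<ge> 0" "r0 > 0"
    "\<And>r rr f1 f2. r \<le> r0 \<Longrightarrow> small_pair S n r rr f1 f2 \<Longrightarrow>
       Cb S n (K * (r * rr)) (\<lambda>x. g x (f1 x) - g x (f2 x) - L x * (f1 x - f2 x))"
  shows "strict_diff S n g L"
  using assms unfolding strict_diff_def by blast

lemma strict_diffE:
  assumes "strict_diff S n g L"
  obtains K r0 where "K \<ge> 0" "r0 > 0"
    "\<And>r rr f1 f2. r \<le> r0 \<Longrightarrow> small_pair S n r rr f1 f2 \<Longrightarrow>
       Cb S n (K * (r * rr)) (\<lambda>x. g x (f1 x) - g x (f2 x) - L x * (f1 x - f2 x))"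
proof -
  have "\<exists>K\<ge>0. \<exists>r0>0. \<forall>r rr f1 f2. r \<le> r0 \<longrightarrow> small_pair S n r rr f1 f2 \<longrightarrow>
        Cb S n (K * (r * rr)) (\<lambda>x. g x (f1 x) - g x (f2 x) - L x * (f1 x - f2 x))"
    using assms unfolding strict_diff_def by blast
  then show ?thesis using that by metis
qed

text \<open>For \<open>r \<le> 1\<close> the remainder \<open>r * rr\<close> is at most
  \<open>rr\<close>, so the nonlinear map inherits a Lipschitz bound from its differential.
  Comparison with the zero function gives the other two estimates.\<close>

lemma strict_diff_lipE:
  assumes "strict_diff S n g L"
  obtains K r0 where "K \<ge> 0" "r0 > 0"
    "\<And>r rr f1 f2. r \<le> r0 \<Longrightarrow> small_pair S n r rr f1 f2 \<Longrightarrow> Cb S n (K * rr) (\<lambda>x. g x (f1 x) - g x (f2 x))"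
    "\<And>r f. 0 \<le> r \<Longrightarrow> r \<le> r0 \<Longrightarrow> Cb S n r f \<Longrightarrow> Cb S n (K * r) (\<lambda>x. g x (f x) - g x 0)"
    "\<And>r f. 0 \<le> r \<Longrightarrow> r \<le> r0 \<Longrightarrow> Cb S n r f \<Longrightarrow> Cb S n K (\<lambda>x. g x (f x))"
proof -
  obtain K r0 where K: "K \<ge> 0" "r0 > 0"
    "\<And>r rr f1 f2. r \<le> r0 \<Longrightarrow> small_pair S n r rr f1 f2 \<Longrightarrow>
       Cb S n (K * (r * rr)) (\<lambda>x. g x (f1 x) - g x (f2 x) - L x * (f1 x - f2 x))"
    by (fact strict_diffE[OF assms])
  obtain K1 where K1: "K1 \<ge> 0" "Cb S n K1 L" using assms unfolding strict_diff_def by blast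
  obtain K2 where K2: "K2 \<ge> 0" "Cb S n K2 (\<lambda>x. g x 0)" using assms unfolding strict_diff_def by blast
  define M where "M = K + 2 ^ n * K1 + K2"
  have lip: "Cb S n ((K + 2 ^ n * K1) * rr) (\<lambda>x. g x (f1 x) - g x (f2 x))"
    if "r \<le> min r0 1" and p: "small_pair S n r rr f1 f2" for r rr f1 f2
  proof -
    have 1: "Cb S n (K * (r * rr)) (\<lambda>x. g x (f1 x) - g x (f2 x) - L x * (f1 x - f2 x))"
      using K(3) that by simp
    have 2: "Cb S n (2 ^ n * (K1 * rr)) (\<lambda>x. L x * (f1 x - f2 x))"
      using p by (intro Cb_mult K1) (simp add: small_pair_def)
    have 3: "Cb S n (K * (r * rr) + 2 ^ n * (K1 * rr)) (\<lambda>x. g x (f1 x) - g x (f2 x))"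
      using Cb_add[OF 1 2] by simp
    have "K * (r * rr) \<le> K * (1 * rr)"
      using K(1) that by (intro mult_left_mono mult_right_mono) (auto simp: small_pair_def)
    then show ?thesis by (intro Cb_mono[OF 3]) (simp add: algebra_simps)
  qed
  have bd: "Cb S n ((K + 2 ^ n * K1) * r) (\<lambda>x. g x (f x) - g x 0)"
    if "0 \<le> r" "r \<le> min r0 1" "Cb S n r f" for r f
    using lip[OF that(2), of r f "\<lambda>x. 0"] that by (simp add: small_pair_def Cb_zero)
  show ?thesis
  proof (rule that[of M "min r0 1"])
    show "M \<ge> 0" "min r0 1 > 0" using K K1 K2 by (auto simp: M_def)
    fix r :: real and f assume r: "0 \<le> r" "r \<le> min r0 1" "Cb S n r f"
    have 1: "(K + 2 ^ n * K1) * r \<le> (K + 2 ^ n * K1) * 1" using r K K1 by (intro mult_left_mono) auto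
    show "Cb S n (M * r) (\<lambda>x. g x (f x) - g x 0)"
      using bd[OF r] by (rule Cb_mono) (use r K2 in \<open>auto simp: M_def algebra_simps\<close>)
    show "Cb S n M (\<lambda>x. g x (f x))"
      using Cb_mono[OF Cb_add[OF bd[OF r] K2(2)], of M] 1 by (simp add: M_def)
  next
    fix r rr f1 f2 assume *: "r \<le> min r0 1" "small_pair S n r rr f1 f2"
    show "Cb S n (M * rr) (\<lambda>x. g x (f1 x) - g x (f2 x))"
      using lip[OF *] by (rule Cb_mono) (use * K2 in \<open>auto simp: M_def algebra_simps small_pair_def\<close>)
  qed
qed

lemma strict_diff_const:
  assumes "Cb S n K a" "K \<ge> 0" shows "strict_diff S n (\<lambda>x v. a x) (\<lambda>x. 0)"
  unfolding strict_diff_def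
proof (intro conjI)
  show "\<exists>K\<ge>0. Cb S n K (\<lambda>x. 0)" by (intro exI[of _ 0]) (simp add: Cb_zero)
  show "\<exists>K\<ge>0. Cb S n K a" using assms by blast
  show "\<exists>K\<ge>0. \<exists>r0>0. \<forall>r rr f1 f2. r \<le> r0 \<longrightarrow> small_pair S n r rr f1 f2 \<longrightarrow> Cb S n (K * (r * rr)) (\<lambda>x. a x - a x - 0 * (f1 x - f2 x))"
    by (intro exI[of _ "0::real"]) (simp add: Cb_zero gt_ex)
qed

lemma strict_diff_shift:
  assumes "Cb S n K a" "K \<ge> 0" shows "strict_diff S n (\<lambda>x v. a x + v) (\<lambda>x. 1)"
  unfolding strict_diff_def
proof (intro conjI)
  show "\<exists>K\<ge>0. Cb S n K (\<lambda>x. 1)" by (intro exI[of _ 1]) (simp add: Cb_const)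
  show "\<exists>K\<ge>0. Cb S n K (\<lambda>x. a x + 0)" using assms by auto
  show "\<exists>K\<ge>0. \<exists>r0>0. \<forall>r rr f1 f2. r \<le> r0 \<longrightarrow> small_pair S n r rr f1 f2 \<longrightarrow> Cb S n (K * (r * rr)) (\<lambda>x. a x + f1 x - (a x + f2 x) - 1 * (f1 x - f2 x))"
    by (intro exI[of _ "0::real"]) (simp add: Cb_zero gt_ex)
qed

text \<open>The increment of the product is
  \<open>(g1 f1 - g1 f2) g2 f1 + g1 f2 (g2 f1 - g2 f2)\<close>. Each increment is replaced by its
  linearization and each remaining factor by its value at \<open>0\<close>; the four errors are all
  of order \<open>r * \<rho>\<close>.\<close>

lemma strict_diff_mult:
  assumes "strict_diff S n g1 La1" "strict_diff S n g2 La2"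
  shows "strict_diff S n (\<lambda>x v. g1 x v * g2 x v) (\<lambda>x. La1 x * g2 x 0 + g1 x 0 * La2 x)"
proof -
  obtain A a where A: "A \<ge> 0" "a > 0"
    "\<And>r \<rho> f1 f2. r \<le> a \<Longrightarrow> small_pair S n r \<rho> f1 f2 \<Longrightarrow>
       Cb S n (A * (r * \<rho>)) (\<lambda>x. g1 x (f1 x) - g1 x (f2 x) - La1 x * (f1 x - f2 x))"
    by (fact strict_diffE[OF assms(1)])
  obtain B b where B: "B \<ge> 0" "b > 0"
    "\<And>r \<rho> f1 f2. r \<le> b \<Longrightarrow> small_pair S n r \<rho> f1 f2 \<Longrightarrow>
       Cb S n (B * (r * \<rho>)) (\<lambda>x. g2 x (f1 x) - g2 x (f2 x) - La2 x * (f1 x - f2 x))"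
    by (fact strict_diffE[OF assms(2)])
  obtain C c where C: "C \<ge> 0" "c > 0"
    "\<And>r \<rho> f1 f2. r \<le> c \<Longrightarrow> small_pair S n r \<rho> f1 f2 \<Longrightarrow> Cb S n (C * \<rho>) (\<lambda>x. g1 x (f1 x) - g1 x (f2 x))"
    "\<And>r f. 0 \<le> r \<Longrightarrow> r \<le> c \<Longrightarrow> Cb S n r f \<Longrightarrow> Cb S n (C * r) (\<lambda>x. g1 x (f x) - g1 x 0)"
    "\<And>r f. 0 \<le> r \<Longrightarrow> r \<le> c \<Longrightarrow> Cb S n r f \<Longrightarrow> Cb S n C (\<lambda>x. g1 x (f x))"
    by (fact strict_diff_lipE[OF assms(1)])
  obtain D d where D: "D \<ge> 0" "d > 0"
    "\<And>r \<rho> f1 f2. r \<le> d \<Longrightarrow> small_pair S n r \<rho> f1 f2 \<Longrightarrow> Cb S n (D * \<rho>) (\<lambda>x. g2 x (f1 x) - g2 x (f2 x))"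
    "\<And>r f. 0 \<le> r \<Longrightarrow> r \<le> d \<Longrightarrow> Cb S n r f \<Longrightarrow> Cb S n (D * r) (\<lambda>x. g2 x (f x) - g2 x 0)"
    "\<And>r f. 0 \<le> r \<Longrightarrow> r \<le> d \<Longrightarrow> Cb S n r f \<Longrightarrow> Cb S n D (\<lambda>x. g2 x (f x))"
    by (fact strict_diff_lipE[OF assms(2)])
  obtain L1 where L1: "L1 \<ge> 0" "Cb S n L1 La1" using assms(1) unfolding strict_diff_def by blast
  obtain L2 where L2: "L2 \<ge> 0" "Cb S n L2 La2" using assms(2) unfolding strict_diff_def by blast
  obtain M1 where M1: "M1 \<ge> 0" "Cb S n M1 (\<lambda>x. g1 x 0)" using assms(1) unfolding strict_diff_def by blast
  obtain M2 where M2: "M2 \<ge> 0" "Cb S n M2 (\<lambda>x. g2 x 0)" using assms(2) unfolding strict_diff_def by blast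
  define r0 where "r0 = min (min a b) (min c d)"
  define K where "K = 2^n * (A * D) + 2^n * (2^n * L1 * D) + 2^n * (C * B) + 2^n * (C * (2^n * L2))"
  show ?thesis
  proof (rule strict_diffI[where K=K and ?r0.0=r0])
    show "\<exists>K\<ge>0. Cb S n K (\<lambda>x. La1 x * g2 x 0 + g1 x 0 * La2 x)"
      using Cb_add[OF Cb_mult[OF L1(2) M2(2)] Cb_mult[OF M1(2) L2(2)]] L1(1) L2(1) M1(1) M2(1)
      by (intro exI[of _ "2 ^ n * (L1 * M2) + 2 ^ n * (M1 * L2)"]) simp
    show "\<exists>K\<ge>0. Cb S n K (\<lambda>x. g1 x 0 * g2 x 0)"
      using Cb_mult[OF M1(2) M2(2)] M1(1) M2(1)
      by (intro exI[of _ "2 ^ n * (M1 * M2)"]) simp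
      show "0 \<le> K" "0 < r0" using A B C D L1 L2 by (auto simp: K_def r0_def)
      fix r \<rho> f1 f2 assume r: "r \<le> r0" and p: "small_pair S n r \<rho> f1 f2"
      have rr: "r \<le> a" "r \<le> b" "r \<le> c" "r \<le> d" using r by (auto simp: r0_def)
      have q: "0 \<le> r" "0 \<le> \<rho>" "Cb S n r f1" "Cb S n r f2" "Cb S n \<rho> (\<lambda>x. f1 x - f2 x)"
        using p by (auto simp: small_pair_def)
      have 1: "Cb S n (2^n * (A * (r * \<rho>) * D))
         (\<lambda>x. (g1 x (f1 x) - g1 x (f2 x) - La1 x * (f1 x - f2 x)) * g2 x (f1 x))"
        by (rule Cb_mult[OF A(3)[OF rr(1) p] D(5)[OF q(1) rr(4) q(3)]])
      have 2: "Cb S n (2^n * ((2^n * (L1 * \<rho>)) * (D * r)))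
         (\<lambda>x. (La1 x * (f1 x - f2 x)) * (g2 x (f1 x) - g2 x 0))"
        by (rule Cb_mult[OF Cb_mult[OF L1(2) q(5)] D(4)[OF q(1) rr(4) q(3)]])
      have 3: "Cb S n (2^n * (C * (B * (r * \<rho>))))
         (\<lambda>x. g1 x (f2 x) * (g2 x (f1 x) - g2 x (f2 x) - La2 x * (f1 x - f2 x)))"
        by (rule Cb_mult[OF C(5)[OF q(1) rr(3) q(4)] B(3)[OF rr(2) p]])
      have 4: "Cb S n (2^n * ((C * r) * (2^n * (L2 * \<rho>))))
         (\<lambda>x. (g1 x (f2 x) - g1 x 0) * (La2 x * (f1 x - f2 x)))"
        by (rule Cb_mult[OF C(4)[OF q(1) rr(3) q(4)] Cb_mult[OF L2(2) q(5)]])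
      have "Cb S n (K * (r * \<rho>)) (\<lambda>x.
           (g1 x (f1 x) - g1 x (f2 x) - La1 x * (f1 x - f2 x)) * g2 x (f1 x)
         + (La1 x * (f1 x - f2 x)) * (g2 x (f1 x) - g2 x 0)
         + g1 x (f2 x) * (g2 x (f1 x) - g2 x (f2 x) - La2 x * (f1 x - f2 x))
         + (g1 x (f2 x) - g1 x 0) * (La2 x * (f1 x - f2 x)))"
        using Cb_add[OF Cb_add[OF Cb_add[OF 1 2] 3] 4]
        by (rule Cb_mono) (simp add: K_def algebra_simps)
      then show "Cb S n (K * (r * \<rho>)) (\<lambda>x. g1 x (f1 x) * g2 x (f1 x) - g1 x (f2 x) * g2 x (f2 x)
           - (La1 x * g2 x 0 + g1 x 0 * La2 x) * (f1 x - f2 x))"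
        by (rule Cb_cong[rotated]) (simp add: algebra_simps)
  qed
qed

text \<open>The error splits into the Taylor remainder of \<open>F\<close> at
  \<open>gm x (f2 x)\<close>, the change of \<open>F'\<close> between there and
  \<open>gm x 0\<close>, and the linearization error of \<open>gm\<close>. Nonnegativity of
  \<open>gm\<close> keeps the arguments in the half-line where \<open>F\<close> is smooth.\<close>

lemma strict_diff_compose:
  assumes S: "no_isolated S" and g: "strict_diff S n gm La"
    and F: "smooth_on {0..} F" and F'1: "\<And>x. x \<ge> 0 \<Longrightarrow> (F has_real_derivative F' x) (at x within {0..})"
    and nonneg: "\<And>x v. x \<in> S \<Longrightarrow> 0 \<le> gm x v"
  shows "strict_diff S n (\<lambda>x v. F (gm x v)) (\<lambda>x. F' (gm x 0) * La x)"
proof -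
  obtain A a where A: "A \<ge> 0" "a > 0"
    "\<And>r \<rho> f1 f2. r \<le> a \<Longrightarrow> small_pair S n r \<rho> f1 f2 \<Longrightarrow>
       Cb S n (A * (r * \<rho>)) (\<lambda>x. gm x (f1 x) - gm x (f2 x) - La x * (f1 x - f2 x))"
    by (fact strict_diffE[OF g])
  obtain C c where C: "C \<ge> 0" "c > 0"
    "\<And>r \<rho> f1 f2. r \<le> c \<Longrightarrow> small_pair S n r \<rho> f1 f2 \<Longrightarrow> Cb S n (C * \<rho>) (\<lambda>x. gm x (f1 x) - gm x (f2 x))"
    "\<And>r f. 0 \<le> r \<Longrightarrow> r \<le> c \<Longrightarrow> Cb S n r f \<Longrightarrow> Cb S n (C * r) (\<lambda>x. gm x (f x) - gm x 0)"
    "\<And>r f. 0 \<le> r \<Longrightarrow> r \<le> c \<Longrightarrow> Cb S n r f \<Longrightarrow> Cb S n C (\<lambda>x. gm x (f x))"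
    by (fact strict_diff_lipE[OF g])
  obtain L where L: "L \<ge> 0" "Cb S n L La" using g unfolding strict_diff_def by blast
  \<comment> \<open>The extra \<open>1\<close> keeps \<open>J\<close> a nondegenerate interval when
    \<open>C = 0\<close>, so that it has no isolated points.\<close>
  define J where "J = {0..C + 1}"
  have ab: "0 < C + 1" using C(1) by simp
  have J: "convex J" "J \<subseteq> {0..}" by (auto simp: J_def)
  have "Ck_on (Suc (Suc n)) J F" using Ck_on_subset[OF smooth_onD[OF F] J(2)] .
  then obtain P where P: "Cb J (Suc (Suc n)) P F"
    using Ck_on_imp_Cb[of _ J F] compact_Icc[of 0 "C + 1"] unfolding J_def by blast
  have F'2: "(F has_real_derivative F' x) (at x within J)" if "x \<in> J" for x
    using has_field_derivative_subset[OF F'1 J(2)] that J(2) by auto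
  have F'3: "Cb J (Suc n) P F'"
    by (rule Cb_deriv[OF no_isolated_Icc[OF ab, folded J_def] P F'2])
  obtain M where M: "M \<ge> 0" "\<And>q1 q2 \<rho>. Cb S n C q1 \<Longrightarrow> Cb S n C q2 \<Longrightarrow> q1 ` S \<subseteq> J \<Longrightarrow> q2 ` S \<subseteq> J \<Longrightarrow>
     Cb S n \<rho> (\<lambda>x. q1 x - q2 x) \<Longrightarrow> Cb S n (M * \<rho>^2) (\<lambda>x. F (q1 x) - F (q2 x) - F' (q2 x) * (q1 x - q2 x))"
    using Cb_compose_Taylor[OF S J(1) P F'2 F'3, where K=C, simplified] by (elim exE conjE) blast
  obtain N where N: "N \<ge> 0" "\<And>q1 q2 \<rho>. Cb S n C q1 \<Longrightarrow> Cb S n C q2 \<Longrightarrow> q1 ` S \<subseteq> J \<Longrightarrow> q2 ` S \<subseteq> J \<Longrightarrow>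
     Cb S n \<rho> (\<lambda>x. q1 x - q2 x) \<Longrightarrow> Cb S n (N * \<rho>) (\<lambda>x. F' (q1 x) - F' (q2 x))"
    using Cb_compose_diff[OF S F'3 J(1), where K=C] by (elim exE conjE) blast
  obtain Q where Q: "Q \<ge> 0" "\<And>q. Cb S n C q \<Longrightarrow> q ` S \<subseteq> J \<Longrightarrow> Cb S n Q (\<lambda>x. F' (q x))"
    using Cb_compose[OF Cb_pred[OF F'3], of S C] by (elim exE conjE) blast
  obtain Q' where Q': "Q' \<ge> 0" "\<And>q. Cb S n C q \<Longrightarrow> q ` S \<subseteq> J \<Longrightarrow> Cb S n Q' (\<lambda>x. F (q x))"
    using Cb_compose[OF Cb_pred[OF Cb_pred[OF P]], of S C] by (elim exE conjE) blast
  have inJ: "(\<lambda>x. gm x (f x)) ` S \<subseteq> J" if "Cb S n C (\<lambda>x. gm x (f x))" for f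
    using Cb_bound[OF that] nonneg by (force simp: J_def)
  have C0: "Cb S n C (\<lambda>x. gm x 0)" using C(5)[of 0 "\<lambda>x. 0"] C(2) by (simp add: Cb_zero)
  have J0: "(\<lambda>x. gm x 0) ` S \<subseteq> J" using inJ[of "\<lambda>x. 0"] C0 by simp
  define r0 where "r0 = min a c"
  define K where "K = M * C\<^sup>2 * 2 + 2^n * (N * C * C) + 2^n * (Q * A)"
  show ?thesis
  proof (rule strict_diffI[where K=K and ?r0.0=r0])
    show "\<exists>K\<ge>0. Cb S n K (\<lambda>x. F' (gm x 0) * La x)"
      using Cb_mult[OF Q(2)[OF C0 J0] L(2)] Q(1) L(1) by (intro exI[of _ "2 ^ n * (Q * L)"]) simp
    show "\<exists>K\<ge>0. Cb S n K (\<lambda>x. F (gm x 0))" using Q'(1) Q'(2)[OF C0 J0] by blast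
      show "0 \<le> K" "0 < r0" using A C M N Q by (auto simp: K_def r0_def)
      fix r \<rho> f1 f2 assume r: "r \<le> r0" and p: "small_pair S n r \<rho> f1 f2"
      have rr: "r \<le> a" "r \<le> c" using r by (auto simp: r0_def)
      have q: "0 \<le> r" "0 \<le> \<rho>" "Cb S n r f1" "Cb S n r f2" "Cb S n \<rho> (\<lambda>x. f1 x - f2 x)"
        using p by (auto simp: small_pair_def)
      \<comment> \<open>The Taylor remainder is quadratic in the distance, whereas
        \<open>r * \<rho>\<close> is wanted. Two functions bounded by \<open>r\<close> are at most
        \<open>2 * r\<close> apart, so the distance may be taken as \<rho>' with the square of
        \<rho>' at most \<open>2 * r * \<rho>\<close>.\<close>
      define \<rho>' where "\<rho>' = min \<rho> (2 * r)"
      have \<rho>': "0 \<le> \<rho>'" "\<rho>' \<le> \<rho>" "\<rho>' \<le> 2 * r" using q by (auto simp: \<rho>'_def)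
      have "Cb S n (2 * r) (\<lambda>x. f1 x - f2 x)" using Cb_diff[OF q(3,4)] by simp
      then have p': "small_pair S n r \<rho>' f1 f2"
        using q by (auto simp: small_pair_def \<rho>'_def min_def)
      note b1 = C(5)[OF q(1) rr(2) q(3)] and b2 = C(5)[OF q(1) rr(2) q(4)]
      note j1 = inJ[OF b1] and j2 = inJ[OF b2]
      have 1: "Cb S n (M * (C * \<rho>')^2) (\<lambda>x. F (gm x (f1 x)) - F (gm x (f2 x))
          - F' (gm x (f2 x)) * (gm x (f1 x) - gm x (f2 x)))"
        by (rule M(2)[OF b1 b2 j1 j2 C(3)[OF rr(2) p']])
      have 2: "Cb S n (2^n * ((N * (C * r)) * (C * \<rho>)))
          (\<lambda>x. (F' (gm x (f2 x)) - F' (gm x 0)) * (gm x (f1 x) - gm x (f2 x)))"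
        by (rule Cb_mult[OF N(2)[OF b2 C0 j2 J0 C(4)[OF q(1) rr(2) q(4)]] C(3)[OF rr(2) p]])
      have 3: "Cb S n (2^n * (Q * (A * (r * \<rho>))))
          (\<lambda>x. F' (gm x 0) * (gm x (f1 x) - gm x (f2 x) - La x * (f1 x - f2 x)))"
        by (rule Cb_mult[OF Q(2)[OF C0 J0] A(3)[OF rr(1) p]])
      have "\<rho>'^2 \<le> 2 * r * \<rho>"
        using mult_mono[OF \<rho>'(3) \<rho>'(2)] \<rho>' q by (simp add: power2_eq_square)
      then have "M * C\<^sup>2 * \<rho>'^2 \<le> M * C\<^sup>2 * (2 * r * \<rho>)" using M(1) by (intro mult_left_mono) auto
      then have *: "M * (C * \<rho>')^2 + 2^n * ((N * (C * r)) * (C * \<rho>)) + 2^n * (Q * (A * (r * \<rho>))) \<le> K * (r * \<rho>)"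
        by (simp add: K_def algebra_simps power_mult_distrib)
      show "Cb S n (K * (r * \<rho>)) (\<lambda>x. F (gm x (f1 x)) - F (gm x (f2 x))
           - (F' (gm x 0) * La x) * (f1 x - f2 x))"
        by (rule Cb_cong[OF _ Cb_mono[OF Cb_add[OF Cb_add[OF 1 2] 3] *]]) (simp add: algebra_simps)
  qed
qed

lemma strict_diff_cong:
  assumes "strict_diff S n g L" "\<And>x v. x \<in> S \<Longrightarrow> g x v = g' x v" "\<And>x. x \<in> S \<Longrightarrow> L x = L' x"
  shows "strict_diff S n g' L'"
proof -
  obtain K r0 where K: "K \<ge> 0" "r0 > 0"
    "\<And>r rr f1 f2. r \<le> r0 \<Longrightarrow> small_pair S n r rr f1 f2 \<Longrightarrow>
       Cb S n (K * (r * rr)) (\<lambda>x. g x (f1 x) - g x (f2 x) - L x * (f1 x - f2 x))"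
    by (fact strict_diffE[OF assms(1)])
  have "Cb S n (K * (r * rr)) (\<lambda>x. g' x (f1 x) - g' x (f2 x) - L' x * (f1 x - f2 x))"
    if "r \<le> r0" "small_pair S n r rr f1 f2" for r rr f1 f2
    by (rule Cb_cong[OF _ K(3)[OF that]]) (simp add: assms(2,3))
  moreover have "\<exists>K\<ge>0. Cb S n K L'" "\<exists>K\<ge>0. Cb S n K (\<lambda>x. g' x 0)"
    using assms(1) Cb_cong[of S L L'] Cb_cong[of S "\<lambda>x. g x 0" "\<lambda>x. g' x 0"] assms(2,3)
    unfolding strict_diff_def by blast+
  ultimately show ?thesis using K(1,2) unfolding strict_diff_def by blast
qed

section \<open>Maximum principles\<close>

lemma deriv_at_max:
  fixes y :: "real \<Rightarrow> real"
  assumes "(y has_real_derivative l) (at x0 within {al..be})" "x0 \<in> {al..be}"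
    and max: "\<And>x. x \<in> {al..be} \<Longrightarrow> y x \<le> y x0"
  shows "x0 < be \<Longrightarrow> l \<le> 0" "al < x0 \<Longrightarrow> 0 \<le> l"
proof -
  show "l \<le> 0" if "x0 < be"
  proof (rule ccontr)
    assume "\<not> l \<le> 0"
    then obtain d where d: "d > 0" "\<And>h. h > 0 \<Longrightarrow> x0 + h \<in> {al..be} \<Longrightarrow> h < d \<Longrightarrow> y x0 < y (x0 + h)"
      using has_real_derivative_pos_inc_right[OF assms(1)] by (metis not_le)
    define h where "h = min (d/2) (be - x0)"
    have "h > 0" "x0 + h \<in> {al..be}" "h < d" using d(1) that assms(2) by (auto simp: h_def)
    then show False using d(2)[of h] max[of "x0 + h"] by simp
  qed
  show "0 \<le> l" if "al < x0"
  proof (rule ccontr)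
    assume "\<not> 0 \<le> l"
    then obtain d where d: "d > 0" "\<And>h. h > 0 \<Longrightarrow> x0 - h \<in> {al..be} \<Longrightarrow> h < d \<Longrightarrow> y x0 < y (x0 - h)"
      using has_real_derivative_neg_dec_left[OF assms(1)] by (metis not_le)
    define h where "h = min (d/2) (x0 - al)"
    have "h > 0" "x0 - h \<in> {al..be}" "h < d" using d(1) that assms(2) by (auto simp: h_def)
    then show False using d(2)[of h] max[of "x0 - h"] by simp
  qed
qed

text \<open>No boundary values are required: at a maximum on the left end \<open>y' \<le> 0\<close>
  and \<open>a \<le> 0\<close>, on the right end \<open>y' \<ge> 0\<close> and
  \<open>a \<ge> 0\<close>, inside \<open>y' = 0\<close>. Hence \<open>a * y' \<ge> 0\<close> at the
  maximum and \<open>m * y \<le> h\<close> there.\<close>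

lemma first_order_max_upper:
  fixes y :: "real \<Rightarrow> real"
  assumes ab: "al \<le> be" and y': "PROP deriv_on {al..be} y y'"
    and a: "a al \<le> 0" "a be \<ge> 0"
    and eq: "\<And>x. x \<in> {al..be} \<Longrightarrow> a x * y' x + m x * y x = h x"
    and m: "\<And>x. x \<in> {al..be} \<Longrightarrow> m x \<ge> m0" "m0 > 0"
    and h: "\<And>x. x \<in> {al..be} \<Longrightarrow> \<bar>h x\<bar> \<le> g"
    and x: "x \<in> {al..be}"
  shows "y x \<le> g / m0"
proof -
  have "continuous_on {al..be} y" by (rule DERIV_continuous_on[OF y'])
  then obtain x0 where x0: "x0 \<in> {al..be}" "\<And>x. x \<in> {al..be} \<Longrightarrow> y x \<le> y x0"
    using continuous_attains_sup[of "{al..be}" y] ab by auto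
  note s = deriv_at_max[OF y'[OF x0(1)] x0]
  have "a x0 * y' x0 \<ge> 0 \<or> al = be"
  proof (cases "x0 = al"; cases "x0 = be")
    assume "x0 = al" "x0 \<noteq> be"
    then show ?thesis using s(1) x0(1) a(1) by (simp add: mult_nonpos_nonpos)
  next
    assume "x0 \<noteq> al" "x0 = be"
    then show ?thesis using s(2) x0(1) a(2) by simp
  next
    assume "x0 \<noteq> al" "x0 \<noteq> be"
    then have "y' x0 = 0" using s x0(1) by (intro antisym) auto
    then show ?thesis by simp
  qed auto
  then have ay: "a x0 * y' x0 \<ge> 0"
  proof
    \<comment> \<open>On a one-point interval the two sign conditions together force
      \<open>a\<close> to vanish.\<close>
    assume "al = be"
    then have "a x0 = 0" using a x0(1) by auto
    then show ?thesis by simp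
  qed
  show ?thesis
  proof (cases "y x0 \<le> 0")
    case True
    have "0 \<le> g" using h[OF x] by linarith
    then show ?thesis using x0(2)[OF x] True m(2) by (meson divide_nonneg_pos order_trans)
  next
    case False
    have "m0 * y x0 \<le> m x0 * y x0" using m(1)[OF x0(1)] False by (intro mult_right_mono) auto
    also have "\<dots> \<le> h x0" using eq[OF x0(1)] ay by linarith
    also have "\<dots> \<le> g" using h[OF x0(1)] by linarith
    finally have "y x0 \<le> g / m0" using m(2) by (simp add: field_simps)
    then show ?thesis using x0(2)[OF x] by linarith
  qed
qed

lemma first_order_max:
  fixes y :: "real \<Rightarrow> real"
  assumes ab: "al \<le> be" and y': "PROP deriv_on {al..be} y y'"
    and a: "a al \<le> 0" "a be \<ge> 0"
    and eq: "\<And>x. x \<in> {al..be} \<Longrightarrow> a x * y' x + m x * y x = h x"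
    and m: "\<And>x. x \<in> {al..be} \<Longrightarrow> m x \<ge> m0" "m0 > 0"
    and h: "\<And>x. x \<in> {al..be} \<Longrightarrow> \<bar>h x\<bar> \<le> g"
    and x: "x \<in> {al..be}"
  shows "\<bar>y x\<bar> \<le> g / m0"
proof -
  have "- y x \<le> g / m0"
  proof (rule first_order_max_upper[OF ab _ a _ m _ x])
    show "((\<lambda>x. - y x) has_real_derivative - y' x) (at x within {al..be})" if "x \<in> {al..be}" for x
      using y'[OF that] by (rule DERIV_minus)
    show "a x * - y' x + m x * - y x = - h x" if "x \<in> {al..be}" for x using eq[OF that] by simp
  qed (use h in auto)
  moreover have "y x \<le> g / m0" by (rule first_order_max_upper[OF ab y' a eq m h x])
  ultimately show ?thesis by linarith
qed

text \<open>The sign conditions replace boundary values. At \<open>0\<close> the coefficient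
  \<open>A\<close> is positive and \<open>u1 \<le> 0\<close>; at \<open>1\<close> the coefficient
  \<open>A - B\<close> is negative and \<open>u1 \<ge> 0\<close>; inside \<open>u1 = 0\<close> and
  \<open>u2 \<le> 0\<close>. At the maximum both derivative terms are therefore nonpositive.\<close>

lemma second_order_max_upper:
  fixes u :: "real \<Rightarrow> real"
  assumes u1: "PROP deriv_on {0..1} u u1"
    and u2: "PROP deriv_on {0..1} u1 u2"
    and eq: "\<And>x. x \<in> {0..1} \<Longrightarrow> x * (1 - x) * u2 x + (A - B * x) * u1 x - k * u x = g x"
    and AB: "A > 0" "A < B" "k > 0"
    and g: "\<And>x. x \<in> {0..1} \<Longrightarrow> \<bar>g x\<bar> \<le> c"
    and x: "x \<in> {0..1}"
  shows "u x \<le> c / k"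
proof -
  have "continuous_on {0..1} u" by (rule DERIV_continuous_on[OF u1])
  then obtain x0 where x0: "x0 \<in> {0..1}" "\<And>x. x \<in> {0..1} \<Longrightarrow> u x \<le> u x0"
    using continuous_attains_sup[of "{0..1}" u] by auto
  note s = deriv_at_max[OF u1[OF x0(1)] x0]
  have 1: "(A - B * x0) * u1 x0 \<le> 0"
  proof -
    consider "x0 = 0" | "x0 = 1" | "0 < x0" "x0 < 1" using x0(1) by force
    then show ?thesis
    proof cases
      case 1 then show ?thesis using s AB by (simp add: mult_nonneg_nonpos)
    next
      case 2 then show ?thesis using s AB by (simp add: mult_nonpos_nonneg)
    next
      case 3 then have "u1 x0 = 0" using s by (intro antisym) auto
      then show ?thesis by simp
    qed
  qed
  have 2: "x0 * (1 - x0) * u2 x0 \<le> 0"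
  proof (cases "x0 = 0 \<or> x0 = 1")
    case False
    then have i: "0 < x0" "x0 < 1" using x0(1) by auto
    then have z: "u1 x0 = 0" using s by (intro antisym) auto
    \<comment> \<open>\<open>u2\<close> need not be continuous, so the second derivative test is
      done by hand: if \<open>u2 x0 > 0\<close>, then \<open>u1\<close> is positive just to the
      right of its zero \<open>x0\<close>, and \<open>u\<close> exceeds its maximum.\<close>
    have "u2 x0 \<le> 0"
    proof (rule ccontr)
      assume "\<not> u2 x0 \<le> 0"
      then obtain d where d: "d > 0" "\<And>h. h > 0 \<Longrightarrow> x0 + h \<in> {0..1} \<Longrightarrow> h < d \<Longrightarrow> u1 x0 < u1 (x0 + h)"
        using has_real_derivative_pos_inc_right[OF u2[OF x0(1)]] not_le by blast
      define h where "h = min (d/2) (1 - x0)"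
      have h: "h > 0" "x0 + h \<in> {0..1}" "h < d" using d(1) i by (auto simp: h_def)
      have "u x0 < u (x0 + h)"
      proof (rule DERIV_pos_imp_increasing_open[where f=u])
        fix t assume t: "x0 < t" "t < x0 + h"
        have t1: "t \<in> {0..1}" using t h i by auto
        have "at t within {0..1} = at t" by (rule at_within_Icc_at) (use t h i in auto)
        then have "(u has_real_derivative u1 t) (at t)" using u1[OF t1] by simp
        moreover have "u1 t > 0" using d(2)[of "t - x0"] t t1 h z by auto
        ultimately show "\<exists>y. (u has_real_derivative y) (at t) \<and> 0 < y" by blast
      next
        show "continuous_on {x0..x0 + h} u"
          by (rule continuous_on_subset[OF \<open>continuous_on {0..1} u\<close>]) (use h i in auto)
      qed (use h in auto)
      then show False using x0(2)[OF h(2)] by simp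
    qed
    then show ?thesis using i by (simp add: mult_nonneg_nonpos)
  qed auto
  have "k * u x0 \<le> c" using eq[OF x0(1)] 1 2 g[OF x0(1)] by linarith
  then have "u x0 \<le> c / k" using AB(3) by (simp add: field_simps)
  then show ?thesis using x0(2)[OF x] by linarith
qed

lemma second_order_max:
  fixes u :: "real \<Rightarrow> real"
  assumes u1: "PROP deriv_on {0..1} u u1"
    and u2: "PROP deriv_on {0..1} u1 u2"
    and eq: "\<And>x. x \<in> {0..1} \<Longrightarrow> x * (1 - x) * u2 x + (A - B * x) * u1 x - k * u x = g x"
    and AB: "A > 0" "A < B" "k > 0"
    and g: "\<And>x. x \<in> {0..1} \<Longrightarrow> \<bar>g x\<bar> \<le> c"
    and x: "x \<in> {0..1}"
  shows "\<bar>u x\<bar> \<le> c / k"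
proof -
  have "- u x \<le> c / k"
  proof (rule second_order_max_upper[OF _ _ _ AB _ x])
    show "((\<lambda>x. - u x) has_real_derivative - u1 x) (at x within {0..1})" if "x \<in> {0..1}" for x
      using u1[OF that] by (rule DERIV_minus)
    show "((\<lambda>x. - u1 x) has_real_derivative - u2 x) (at x within {0..1})" if "x \<in> {0..1}" for x
      using u2[OF that] by (rule DERIV_minus)
    show "x * (1 - x) * - u2 x + (A - B * x) * - u1 x - k * - u x = - g x" if "x \<in> {0..1}" for x
      using eq[OF that] by simp
  qed (use g in auto)
  moreover have "u x \<le> c / k" by (rule second_order_max_upper[OF u1 u2 eq AB g x])
  ultimately show ?thesis by linarith
qed

section \<open>The hypergeometric operator\<close>

text \<open>These are the coefficients of the equation differentiated \<open>k\<close> times. Each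
  differentiation adds \<open>1\<close> to the constant term, \<open>2\<close> to the slope, and the
  old slope \<open>coefB k\<close> to the zeroth order coefficient. The decisive quantity is
  \<open>coefB k - coefA d k = k - (d - 3) / 2\<close>.\<close>

definition coefA :: "nat \<Rightarrow> nat \<Rightarrow> real" where "coefA d k = (real d + 2) / 2 + real k"
definition coefB :: "nat \<Rightarrow> real" where "coefB k = 5 / 2 + 2 * real k"
definition coefK :: "nat \<Rightarrow> real" where "coefK k = (real k + 1) * (real k + 1 / 2)"

lemma coefK_pos: "coefK k > 0"
  by (simp add: coefK_def)

text \<open>For \<open>f(r) = r u(x)\<close> with \<open>x = r\<^sup>2\<close> the linear part of the profile equation is
  \<open>x(1-x)u'' + ((d+2)/2 - 5x/2)u' - u/2\<close>. In \<open>hyp_system\<close>, \<open>P j\<close> and \<open>G j\<close> are the \<open>j\<close>-th derivatives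
  of \<open>u\<close> and of the right hand side.\<close>

abbreviation (input) hyp_op :: "nat \<Rightarrow> real \<Rightarrow> real \<Rightarrow> real \<Rightarrow> real \<Rightarrow> real" where
  "hyp_op d x u2 u1 u \<equiv> x * (1 - x) * u2 + (coefA d 0 - coefB 0 * x) * u1 - coefK 0 * u"

definition hyp_system :: "nat \<Rightarrow> nat \<Rightarrow> (nat \<Rightarrow> real \<Rightarrow> real) \<Rightarrow> (nat \<Rightarrow> real \<Rightarrow> real) \<Rightarrow> real \<Rightarrow> bool" where
  "hyp_system d m P G g \<longleftrightarrow>
     (\<forall>j\<le>Suc m. \<forall>x\<in>{0..4}. (P j has_real_derivative P (Suc j) x) (at x within {0..4})) \<and>
     (\<forall>j<m. \<forall>x\<in>{0..4}. (G j has_real_derivative G (Suc j) x) (at x within {0..4})) \<and>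
     (\<forall>j\<le>m. \<forall>x\<in>{0..4}. \<bar>G j x\<bar> \<le> g) \<and>
     (\<forall>x\<in>{0..4}. hyp_op d x (P 2 x) (P 1 x) (P 0 x) = G 0 x)"

lemma hyp_system_deriv:
  assumes "hyp_system d m P G g" "k \<le> m" "x \<in> {0..4}"
  shows "x * (1 - x) * P (k + 2) x + (coefA d k - coefB k * x) * P (k + 1) x - coefK k * P k x = G k x"
  using assms(2,3)
proof (induction k arbitrary: x)
  case 0
  then show ?case using assms(1) by (simp add: hyp_system_def numeral_2_eq_2)
next
  case (Suc k)
  let ?S = "{0..4::real}"
  have P: "(P j has_real_derivative P (Suc j) x) (at x within ?S)" if "j \<le> Suc m" for j
    using assms(1) that Suc.prems(2) by (simp add: hyp_system_def)
  have G: "(G k has_real_derivative G (Suc k) x) (at x within ?S)"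
    using assms(1) Suc.prems by (simp add: hyp_system_def)
  let ?L = "\<lambda>x. x * (1 - x) * P (k + 2) x + (coefA d k - coefB k * x) * P (k + 1) x - coefK k * P k x"
  let ?D = "x * (1 - x) * P (k + 3) x + (coefA d (Suc k) - coefB (Suc k) * x) * P (k + 2) x
      - coefK (Suc k) * P (k + 1) x"
  have "(?L has_real_derivative
      (x * (1 - x) * P (Suc (k + 2)) x + (1 - x - x) * P (k + 2) x)
      + ((coefA d k - coefB k * x) * P (Suc (k + 1)) x + (- coefB k) * P (k + 1) x)
      - coefK k * P (Suc k) x) (at x within ?S)"
    using Suc.prems(1) by (auto intro!: derivative_eq_intros P)
  also have "(x * (1 - x) * P (Suc (k + 2)) x + (1 - x - x) * P (k + 2) x)
      + ((coefA d k - coefB k * x) * P (Suc (k + 1)) x + (- coefB k) * P (k + 1) x)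
      - coefK k * P (Suc k) x = ?D"
    by (simp add: coefA_def coefB_def coefK_def numeral_2_eq_2 numeral_3_eq_3 algebra_simps)
  finally have "(?L has_real_derivative ?D) (at x within ?S)" .
  moreover have "(?L has_real_derivative G (Suc k) x) (at x within ?S)"
    by (rule has_field_derivative_transform_within[OF G zero_less_one Suc.prems(2)])
       (use Suc.IH Suc.prems(1) in simp)
  ultimately have "?D = G (Suc k) x"
    using no_isolated_unique[OF no_isolated_Icc Suc.prems(2)] by auto
  then show ?case by (simp add: numeral_2_eq_2 numeral_3_eq_3)
qed

text \<open>The second order principle bounds \<open>P m\<close>. Then \<open>P (Suc m)\<close>
  solves a first order equation whose zeroth order coefficient \<open>A - B x\<close> is positive at
  \<open>0\<close> and negative at \<open>1\<close>. Near \<open>0\<close> the first order principle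
  applies directly, away from \<open>0\<close> to \<open>x ^ p * P (Suc m) x\<close> with the
  equation multiplied by \<open>-1\<close>.\<close>

lemma hyp_top_bound_left:
  assumes m: "real m > (real d - 3) / 2"
  shows "\<exists>M\<ge>0. \<forall>P G g. hyp_system d m P G g \<longrightarrow>
    (\<forall>x\<in>{0..1}. \<bar>P m x\<bar> \<le> g / coefK m \<and> \<bar>P (Suc m) x\<bar> \<le> M * g)"
proof -
  define A where "A = coefA d m"
  define B where "B = coefB m"
  define k where "k = coefK m"
  have A: "A > 0" "A < B" "k > 0" using m coefK_pos by (auto simp: A_def B_def k_def coefA_def coefB_def field_simps)
  \<comment> \<open>Half of the zero \<open>A / B\<close> of the coefficient, so that
    \<open>A - B x \<ge> A / 2\<close> up to \<open>x1\<close>.\<close>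
  define x1 where "x1 = A / (2 * B)"
  have x1: "0 < x1" "x1 < 1" "B * x1 = A / 2" using A by (auto simp: x1_def field_simps)
  \<comment> \<open>The weight \<open>x ^ p\<close> changes the zeroth order coefficient into
    \<open>(p - A) (1 - x) + (B - A) x\<close>, which is positive on all of \<open>[0, 1]\<close> as
    soon as \<open>p > A\<close>.\<close>
  define p where "p = nat \<lceil>A\<rceil> + 1"
  have p: "real p > A" "p \<ge> 1" by (auto simp: p_def) linarith
  define m0 where "m0 = min (real p - A) (B - A)"
  have m0: "m0 > 0" using A p by (simp add: m0_def)
  define M where "M = 2 / (A / 2) + 2 / m0 / x1 ^ p"
  show ?thesis
  proof (intro exI[of _ M] conjI allI impI ballI)
    show "0 \<le> M" using A m0 x1 by (simp add: M_def)
    fix P G g x assume W: "hyp_system d m P G g" and x: "x \<in> {0..1::real}"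
    have P: "(P j has_real_derivative P (Suc j) t) (at t within T)"
      if "j \<le> Suc m" "t \<in> T" "T \<subseteq> {0..4}" for j t T
      by (rule has_field_derivative_subset[OF _ that(3)]) (use W that in \<open>auto simp: hyp_system_def\<close>)
    have G: "\<bar>G m t\<bar> \<le> g" if "t \<in> {0..4}" for t using W that by (simp add: hyp_system_def)
    have g: "g \<ge> 0" using G[of 0] by simp
    have eq: "t * (1 - t) * P (Suc (Suc m)) t + (A - B * t) * P (Suc m) t - k * P m t = G m t"
      if "t \<in> {0..4}" for t
      using hyp_system_deriv[OF W le_refl that] by (simp add: A_def B_def k_def)
    have Pm: "\<bar>P m t\<bar> \<le> g / k" if "t \<in> {0..1}" for t
      by (rule second_order_max[OF P P eq A G that]) auto
    then show "\<bar>P m x\<bar> \<le> g / coefK m" using x k_def by blast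
    have h: "\<bar>G m t + k * P m t\<bar> \<le> 2 * g" if "t \<in> {0..1}" for t
    proof -
      have "k * \<bar>P m t\<bar> \<le> g" using Pm[OF that] A(3) by (simp add: field_simps)
      then show ?thesis using G[of t] that abs_triangle_ineq[of "G m t" "k * P m t"] A(3)
        by (simp add: abs_mult)
    qed
    show "\<bar>P (Suc m) x\<bar> \<le> M * g"
    proof (cases "x \<le> x1")
      case True
      have "\<bar>P (Suc m) x\<bar> \<le> 2 * g / (A / 2)"
      proof (rule first_order_max[where al=0 and be=x1 and a="\<lambda>t. t * (1 - t)" and m="\<lambda>t. A - B * t"
            and h="\<lambda>t. G m t + k * P m t" and y="P (Suc m)" and y'="P (Suc (Suc m))"])
        show "(P (Suc m) has_real_derivative P (Suc (Suc m)) t) (at t within {0..x1})" if "t \<in> {0..x1}" for t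
          using that x1 by (intro P) auto
        show "t * (1 - t) * P (Suc (Suc m)) t + (A - B * t) * P (Suc m) t = G m t + k * P m t"
          if "t \<in> {0..x1}" for t using eq[of t] that x1 by simp
        show "A / 2 \<le> A - B * t" if "t \<in> {0..x1}" for t
          using mult_left_mono[of t x1 B] that x1 A by simp
      qed (use x1 x True A h in auto)
      also have "\<dots> = 2 / (A / 2) * g" by simp
      also have "\<dots> \<le> M * g" using g m0 x1 by (intro mult_right_mono) (auto simp: M_def)
      finally show ?thesis .
    next
      case False
      have "\<bar>x ^ p * P (Suc m) x\<bar> \<le> 2 * g / m0"
      proof (rule first_order_max[where al=0 and be=1 and a="\<lambda>t. - (t * (1 - t))"
            and m="\<lambda>t. (real p - A) * (1 - t) + (B - A) * t"
            and h="\<lambda>t. - (t ^ p * (G m t + k * P m t))"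
            and y="\<lambda>t. t ^ p * P (Suc m) t" and y'="\<lambda>t. real p * t ^ (p - 1) * P (Suc m) t + t ^ p * P (Suc (Suc m)) t"])
        show "((\<lambda>t. t ^ p * P (Suc m) t) has_real_derivative
            real p * t ^ (p - 1) * P (Suc m) t + t ^ p * P (Suc (Suc m)) t) (at t within {0..1})"
          if "t \<in> {0..1}" for t
          using that by (auto intro!: derivative_eq_intros P)
        have pp: "t ^ p = t * t ^ (p - 1)" for t :: real using p(2) by (cases p) auto
        show "- (t * (1 - t)) * (real p * t ^ (p - 1) * P (Suc m) t + t ^ p * P (Suc (Suc m)) t)
            + ((real p - A) * (1 - t) + (B - A) * t) * (t ^ p * P (Suc m) t) = - (t ^ p * (G m t + k * P m t))"
          if "t \<in> {0..1}" for t
        proof -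
          have "G m t + k * P m t = t * (1 - t) * P (Suc (Suc m)) t + (A - B * t) * P (Suc m) t"
            using eq[of t] that by simp
          then show ?thesis by (simp only: pp) (simp add: algebra_simps)
        qed
        show "m0 \<le> (real p - A) * (1 - t) + (B - A) * t" if "t \<in> {0..1}" for t
        proof -
          have "m0 * (1 - t) \<le> (real p - A) * (1 - t)" "m0 * t \<le> (B - A) * t"
            using that by (auto simp: m0_def intro!: mult_right_mono)
          then show ?thesis by (simp add: algebra_simps)
        qed
        show "\<bar>- (t ^ p * (G m t + k * P m t))\<bar> \<le> 2 * g" if "t \<in> {0..1}" for t
        proof -
          have "\<bar>t ^ p\<bar> \<le> 1" using that by (simp add: power_le_one)
          then show ?thesis using h[OF that] mult_mono[of "\<bar>t ^ p\<bar>" 1 "\<bar>G m t + k * P m t\<bar>" "2 * g"]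
            by (simp add: abs_mult)
        qed
      qed (use m0 x in auto)
      then have "x1 ^ p * \<bar>P (Suc m) x\<bar> \<le> 2 * g / m0"
        using False x1 mult_right_mono[of "x1 ^ p" "x ^ p" "\<bar>P (Suc m) x\<bar>"] power_mono[of x1 x p]
        by (simp add: abs_mult power_abs)
      then have "\<bar>P (Suc m) x\<bar> \<le> 2 * g / m0 / x1 ^ p"
        using x1(1) by (subst pos_le_divide_eq) (simp_all add: mult.commute)
      also have "\<dots> = 2 / m0 / x1 ^ p * g" by simp
      also have "\<dots> \<le> M * g" using g A by (intro mult_right_mono) (auto simp: M_def)
      finally show ?thesis .
    qed
  qed
qed

text \<open>Beyond the light cone the leading coefficient is negative and the second order principle
  fails for \<open>P m\<close>. Instead \<open>P m\<close> is recovered by integrating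
  \<open>P (Suc m)\<close> from \<open>1\<close>; measured with an exponential weight this
  contributes only half of the weighted maximum \<open>N\<close>, which is absorbed.\<close>

lemma hyp_top_bound_right:
  assumes m: "real m > (real d - 3) / 2"
  shows "\<exists>M\<ge>0. \<forall>P G g. hyp_system d m P G g \<longrightarrow>
    (\<forall>x\<in>{1..4}. \<bar>P (Suc m) x\<bar> \<le> M * g)"
proof -
  define A where "A = coefA d m"
  define B where "B = coefB m"
  define k where "k = coefK m"
  have A: "A > 0" "A < B" "k > 0" using m coefK_pos by (auto simp: A_def B_def k_def coefA_def coefB_def field_simps)
  \<comment> \<open>Integration against the weight gains \<open>1 / l\<close>; this choice makes
    \<open>k / l\<close> half of the lower bound \<open>B - A\<close> in the first order
    principle.\<close>
  define l where "l = 2 * k / (B - A)"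
  have l: "l > 0" "k / l = (B - A) / 2" using A by (auto simp: l_def)
  define M where "M = exp (3 * l) * (4 / (B - A))"
  obtain M1 where M1: "\<And>P G g. hyp_system d m P G g \<Longrightarrow>
    (\<forall>x\<in>{0..1}. \<bar>P m x\<bar> \<le> g / coefK m \<and> \<bar>P (Suc m) x\<bar> \<le> M1 * g)" using hyp_top_bound_left[OF m] by blast
  show ?thesis
  proof (intro exI[of _ M] conjI allI impI ballI)
    show "0 \<le> M" using A by (simp add: M_def)
    fix P G g x assume W: "hyp_system d m P G g" and x: "x \<in> {1..4::real}"
    have P: "(P j has_real_derivative P (Suc j) t) (at t within {1..4})"
      if "j \<le> Suc m" "t \<in> {1..4}" for j t
      by (rule has_field_derivative_subset[of _ _ _ "{0..4}"]) (use W that in \<open>auto simp: hyp_system_def\<close>)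
    have G: "\<bar>G m t\<bar> \<le> g" if "t \<in> {1..4}" for t using W that by (simp add: hyp_system_def)
    have g: "g \<ge> 0" using G[of 1] by simp
    have eq: "t * (1 - t) * P (Suc (Suc m)) t + (A - B * t) * P (Suc m) t - k * P m t = G m t"
      if "t \<in> {1..4}" for t
      using hyp_system_deriv[OF W le_refl, of t] that by (simp add: A_def B_def k_def)
    have Pm1: "\<bar>P m 1\<bar> \<le> g / k" using M1[OF W] k_def by simp
    define Y where "Y = (\<lambda>t. exp (- l * (t - 1)) * P (Suc m) t)"
    have Y': "(Y has_real_derivative exp (- l * (t - 1)) * (P (Suc (Suc m)) t - l * P (Suc m) t)) (at t within {1..4})"
      if "t \<in> {1..4}" for t
      unfolding Y_def using that by (auto intro!: derivative_eq_intros P simp: algebra_simps)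
    have "continuous_on {1..4} (\<lambda>t. \<bar>Y t\<bar>)"
      by (intro continuous_intros DERIV_continuous_on[OF Y'])
    then obtain z where z: "z \<in> {1..4}" "\<And>t. t \<in> {1..4} \<Longrightarrow> \<bar>Y t\<bar> \<le> \<bar>Y z\<bar>"
      using continuous_attains_sup[of "{1..4}" "\<lambda>t. \<bar>Y t\<bar>"] by auto
    define N where "N = \<bar>Y z\<bar>"
    have N: "N \<ge> 0" by (simp add: N_def)
    have yN: "\<bar>P (Suc m) t\<bar> \<le> N * exp (l * (t - 1))" if "t \<in> {1..4}" for t
    proof -
      have "\<bar>P (Suc m) t\<bar> = \<bar>Y t\<bar> * exp (l * (t - 1))"
        by (simp add: Y_def abs_mult exp_minus)
      also have "\<dots> \<le> N * exp (l * (t - 1))" unfolding N_def by (intro mult_right_mono z that) auto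
      finally show ?thesis .
    qed
    have Pm: "\<bar>P m t\<bar> \<le> g / k + N / l * exp (l * (t - 1))" if t: "t \<in> {1..4}" for t
    proof -
      have "sg * P m t \<le> sg * P m 1 + N / l * exp (l * (t - 1))" if sg: "\<bar>sg\<bar> = 1" for sg
      proof -
        let ?f = "\<lambda>t. N / l * exp (l * (t - 1)) - sg * P m t"
        have f': "(?f has_real_derivative N * exp (l * (s - 1)) - sg * P (Suc m) s) (at s within {1..4})"
          if "s \<in> {1..4}" for s
          using that l(1) by (auto intro!: derivative_eq_intros P)
        have "?f 1 \<le> ?f t"
        proof (rule DERIV_nonneg_imp_increasing_open[where f="?f" and a=1 and b=t])
          fix s assume s: "1 < s" "s < t"
          then have "s \<in> {1..4}" using t by auto
          have "at s within {1..4} = at s" by (rule at_within_Icc_at) (use t s in auto)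
          then have "(?f has_real_derivative N * exp (l * (s - 1)) - sg * P (Suc m) s) (at s)"
            using f'[OF \<open>s \<in> {1..4}\<close>] by simp
          moreover have "sg * P (Suc m) s \<le> \<bar>P (Suc m) s\<bar>"
            using sg by (metis abs_ge_self abs_mult mult_1)
          ultimately show "\<exists>y. (?f has_real_derivative y) (at s) \<and> 0 \<le> y"
            using yN[OF \<open>s \<in> {1..4}\<close>] by (intro exI conjI) auto
        next
          show "continuous_on {1..t} ?f"
            by (rule continuous_on_subset[OF DERIV_continuous_on[OF f']]) (use t in auto)
        qed (use t in auto)
        moreover have "N / l \<ge> 0" using N l by simp
        ultimately show ?thesis by simp
      qed
      from this[of 1] this[of "-1"] Pm1 show ?thesis by (simp add: abs_le_iff)
    qed
    have "\<bar>Y t\<bar> \<le> (2 * g + (B - A) / 2 * N) / (B - A)" if "t \<in> {1..4}" for t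
    proof (rule first_order_max[where al=1 and be=4 and a="\<lambda>t. t * (t - 1)"
          and m="\<lambda>t. B * t - A + l * t * (t - 1)" and h="\<lambda>t. - (exp (- l * (t - 1)) * (G m t + k * P m t))"
          and y'="\<lambda>t. exp (- l * (t - 1)) * (P (Suc (Suc m)) t - l * P (Suc m) t)", OF _ Y'])
      fix t :: real assume t: "t \<in> {1..4}"
      have e: "G m t + k * P m t = t * (1 - t) * P (Suc (Suc m)) t + (A - B * t) * P (Suc m) t"
        using eq[of t] t by simp
      show "t * (t - 1) * (exp (- l * (t - 1)) * (P (Suc (Suc m)) t - l * P (Suc m) t))
         + (B * t - A + l * t * (t - 1)) * Y t = - (exp (- l * (t - 1)) * (G m t + k * P m t))"
        unfolding e Y_def by (simp add: algebra_simps)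
      have "B * 1 \<le> B * t" using t A by (intro mult_left_mono) auto
      moreover have "0 \<le> l * t * (t - 1)" using t l by simp
      ultimately show "B - A \<le> B * t - A + l * t * (t - 1)" by simp
      have E: "exp (- l * (t - 1)) \<le> 1" "exp (- l * (t - 1)) * exp (l * (t - 1)) = 1"
        using t l by (auto simp: mult_exp_exp)
      have "k * \<bar>P m t\<bar> \<le> k * (g / k + N / l * exp (l * (t - 1)))"
        using A Pm[OF t] by (intro mult_left_mono) auto
      also have "\<dots> = g + k / l * N * exp (l * (t - 1))" using A by (simp add: algebra_simps)
      finally have "\<bar>G m t + k * P m t\<bar> \<le> 2 * g + k / l * N * exp (l * (t - 1))"
        using G[OF t] abs_triangle_ineq[of "G m t" "k * P m t"] A(3) by (simp add: abs_mult)
      then have "exp (- l * (t - 1)) * \<bar>G m t + k * P m t\<bar>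
         \<le> exp (- l * (t - 1)) * (2 * g + k / l * N * exp (l * (t - 1)))"
        by (intro mult_left_mono) auto
      also have "\<dots> = exp (- l * (t - 1)) * (2 * g) + k / l * N * (exp (- l * (t - 1)) * exp (l * (t - 1)))"
        by (simp add: algebra_simps)
      also have "\<dots> \<le> 2 * g + (B - A) / 2 * N"
        unfolding E(2) l(2) using mult_right_mono[OF E(1), of "2 * g"] g by simp
      finally show "\<bar>- (exp (- l * (t - 1)) * (G m t + k * P m t))\<bar> \<le> 2 * g + (B - A) / 2 * N"
        by (simp add: abs_mult)
    qed (use A that in auto)
    from this[OF z(1)] have "N \<le> 2 * g / (B - A) + N / 2"
      using A by (simp add: N_def[symmetric] field_simps)
    then have N4: "N \<le> 4 / (B - A) * g" by simp
    have "\<bar>P (Suc m) x\<bar> \<le> N * exp (l * (x - 1))" using yN[OF x] .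
    also have "\<dots> \<le> (4 / (B - A) * g) * exp (3 * l)"
      using x l N N4 by (intro mult_mono) auto
    finally show "\<bar>P (Suc m) x\<bar> \<le> M * g" by (simp add: M_def algebra_simps)
  qed
qed

text \<open>The two top orders come from the maximum principles. The lower ones are read off from
  the differentiated equations in descending order, since the coefficient
  \<open>coefK j \<ge> 1/2\<close> of \<open>P j\<close> can be divided out.\<close>

lemma hyp_apriori:
  assumes m: "real m > (real d - 3) / 2" and d: "d \<ge> 3"
  shows "\<exists>M\<ge>0. \<forall>P G g. hyp_system d m P G g \<longrightarrow> (\<forall>j\<le>Suc m. \<forall>x\<in>{0..4}. \<bar>P j x\<bar> \<le> M * g)"
proof -
  obtain M1 where M1: "M1 \<ge> 0" "\<And>P G g. hyp_system d m P G g \<Longrightarrow>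
    (\<forall>x\<in>{0..1}. \<bar>P m x\<bar> \<le> g / coefK m \<and> \<bar>P (Suc m) x\<bar> \<le> M1 * g)" using hyp_top_bound_left[OF m] by blast
  obtain M2 where M2: "M2 \<ge> 0" "\<And>P G g. hyp_system d m P G g \<Longrightarrow>
    (\<forall>x\<in>{1..4}. \<bar>P (Suc m) x\<bar> \<le> M2 * g)" using hyp_top_bound_right[OF m] by blast
  define M0 where "M0 = M1 + M2 + (2 + 3 * M2)"
  have k: "coefK j \<ge> 1/2" for j
    unfolding coefK_def using mult_mono[of 1 "real j + 1" "1/2" "real j + 1/2"] by simp
  have top: "\<bar>P (Suc m) x\<bar> \<le> M0 * g \<and> \<bar>P m x\<bar> \<le> M0 * g"
    if W: "hyp_system d m P G g" and x: "x \<in> {0..4}" for P G g x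
  proof -
    have "\<bar>G m 0\<bar> \<le> g" using W by (simp add: hyp_system_def)
    then have g: "g \<ge> 0" by linarith
    have "g * (1/2) \<le> g * coefK m" using k[of m] g by (intro mult_left_mono) auto
    then have gk: "g / coefK m \<le> 2 * g" using k[of m] by (simp add: field_simps)
    have ge: "M1 * g \<le> M0 * g" "M2 * g \<le> M0 * g" "(2 + 3 * M2) * g \<le> M0 * g" "2 * g \<le> M0 * g"
      using g M1(1) M2(1) by (auto simp: M0_def intro!: mult_right_mono)
    show ?thesis
    proof (cases "x \<le> 1")
      case True
      then show ?thesis using M1(2)[OF W] x ge gk by (meson atLeastAtMost_iff order_trans)
    next
      case False
      then have x': "x \<in> {1..4}" using x by auto
      have "norm (P m x - P m 1) \<le> (M2 * g) * norm (x - 1)"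
      proof (rule field_differentiable_bound[of "{1..4}" _ "P (Suc m)"])
        show "(P m has_real_derivative P (Suc m) z) (at z within {1..4})" if "z \<in> {1..4}" for z
          by (rule has_field_derivative_subset[of _ _ _ "{0..4}"]) (use W that in \<open>auto simp: hyp_system_def\<close>)
      qed (use M2(2)[OF W] x' in auto)
      also have "\<dots> \<le> (M2 * g) * 3" using x' M2(1) g by (intro mult_left_mono) auto
      finally have *: "\<bar>P m x - P m 1\<bar> \<le> 3 * (M2 * g)" by simp
      have "\<bar>P m 1\<bar> \<le> 2 * g" using bspec[OF M1(2)[OF W], of 1] gk by auto
      with * have "\<bar>P m x\<bar> \<le> 2 * g + 3 * M2 * g" by (simp add: abs_le_iff algebra_simps)
      then show ?thesis using M2(2)[OF W] x' ge by (force simp: algebra_simps)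
    qed
  qed
  have "\<exists>M\<ge>0. \<forall>P G g. hyp_system d m P G g \<longrightarrow> (\<forall>j. m - i \<le> j \<and> j \<le> Suc m \<longrightarrow> (\<forall>x\<in>{0..4}. \<bar>P j x\<bar> \<le> M * g))"
    if "i \<le> m" for i
    using that
  proof (induction i)
    case 0
    have "\<forall>x\<in>{0..4}. \<bar>P j x\<bar> \<le> M0 * g" if "hyp_system d m P G g" "m \<le> j" "j \<le> Suc m" for P G g j
    proof -
      have "j = m \<or> j = Suc m" using that by auto
      then show ?thesis using top[OF that(1)] by auto
    qed
    moreover have "M0 \<ge> 0" using M1(1) M2(1) by (simp add: M0_def)
    ultimately show ?case by (intro exI[of _ M0]) simp
  next
    case (Suc i)
    then obtain M where M: "M \<ge> 0" "\<And>P G g j x. hyp_system d m P G g \<Longrightarrow> m - i \<le> j \<Longrightarrow> j \<le> Suc m \<Longrightarrow>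
        x \<in> {0..4} \<Longrightarrow> \<bar>P j x\<bar> \<le> M * g" by (metis Suc_leD)
    define k where "k = m - Suc i"
    define N where "N = M + 2 * (12 * M + (coefA d k + 4 * coefB k) * M + 1)"
    have pos: "coefA d k \<ge> 0" "coefB k \<ge> 0" by (auto simp: coefA_def coefB_def)
    have "\<bar>P j x\<bar> \<le> N * g" if W: "hyp_system d m P G g" and j: "m - Suc i \<le> j" "j \<le> Suc m" and x: "x \<in> {0..4}"
      for P G g j x
    proof -
      have "\<bar>G m 0\<bar> \<le> g" using W by (simp add: hyp_system_def)
      then have g: "g \<ge> 0" by linarith
      have MN: "M * g \<le> N * g" using g M(1) pos by (intro mult_right_mono) (auto simp: N_def)
      show ?thesis
      proof (cases "m - i \<le> j")
        case True
        then show ?thesis using M(2)[OF W True j(2) x] MN by linarith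
      next
        case False
        then have jk: "j = k" "k \<le> m" "m - i = k + 1" "k + 2 \<le> Suc m" using j Suc.prems by (auto simp: k_def)
        have eq: "x * (1 - x) * P (k + 2) x + (coefA d k - coefB k * x) * P (k + 1) x - coefK k * P k x = G k x"
          using hyp_system_deriv[OF W jk(2) x] .
        have b2: "\<bar>P (k + 2) x\<bar> \<le> M * g" "\<bar>P (k + 1) x\<bar> \<le> M * g" using jk x by (auto intro!: M(2)[OF W])
        have bG: "\<bar>G k x\<bar> \<le> g" using W jk x by (simp add: hyp_system_def)
        have "\<bar>x * (1 - x)\<bar> \<le> 4 * 3" unfolding abs_mult using x by (intro mult_mono) auto
        then have 1: "\<bar>x * (1 - x) * P (k + 2) x\<bar> \<le> 12 * (M * g)"
          unfolding abs_mult[of "x * (1 - x)"] using b2 by (intro mult_mono) auto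
        have "\<bar>coefA d k - coefB k * x\<bar> \<le> coefA d k + 4 * coefB k"
        proof -
          have "0 \<le> coefB k * x" "coefB k * x \<le> coefB k * 4" using pos x by (auto intro: mult_left_mono)
          then show ?thesis using pos by linarith
        qed
        then have 2: "\<bar>(coefA d k - coefB k * x) * P (k + 1) x\<bar> \<le> (coefA d k + 4 * coefB k) * (M * g)"
          unfolding abs_mult using b2 pos by (intro mult_mono) auto
        have "coefK k * P k x = x * (1 - x) * P (k + 2) x + (coefA d k - coefB k * x) * P (k + 1) x - G k x"
          using eq by linarith
        then have "\<bar>coefK k * P k x\<bar> \<le> 12 * (M * g) + (coefA d k + 4 * coefB k) * (M * g) + g"
          using 1 2 bG by linarith
        moreover have "\<bar>P k x\<bar> / 2 \<le> \<bar>coefK k * P k x\<bar>"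
          using k[of k] mult_right_mono[of "1/2" "coefK k" "\<bar>P k x\<bar>"] by (simp add: abs_mult)
        ultimately have "\<bar>P k x\<bar> / 2 \<le> 12 * (M * g) + (coefA d k + 4 * coefB k) * (M * g) + g"
          by (meson order_trans)
        then have "\<bar>P k x\<bar> \<le> 2 * (12 * (M * g) + (coefA d k + 4 * coefB k) * (M * g) + g)" by simp
        also have "\<dots> \<le> N * g" using mult_nonneg_nonneg[OF M(1) g] by (simp add: N_def algebra_simps)
        finally show ?thesis using jk by simp
      qed
    qed
    moreover have "N \<ge> 0" using M(1) pos by (simp add: N_def)
    ultimately show ?case by (intro exI[of _ N]) blast
  qed
  from this[of m] show ?thesis by simp
qed

declare Ck_on.simps(2) [simp del] Cb.simps(2) [simp del]

section \<open>Invertibility of the operator with a gain of one derivative\<close>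

definition Teq :: "nat \<Rightarrow> (real \<Rightarrow> real) \<Rightarrow> (real \<Rightarrow> real) \<Rightarrow> bool" where
  "Teq d u g \<longleftrightarrow> (\<exists>u1 u2. \<forall>x\<in>{0..4}.
      (u has_real_derivative u1 x) (at x within {0..4}) \<and>
      (u1 has_real_derivative u2 x) (at x within {0..4}) \<and>
      hyp_op d x (u2 x) (u1 x) (u x) = g x)"

lemma TeqI:
  assumes "PROP deriv_on {0..4} u u1"
    "PROP deriv_on {0..4} u1 u2"
    "\<And>x. x \<in> {0..4} \<Longrightarrow> hyp_op d x (u2 x) (u1 x) (u x) = g x"
  shows "Teq d u g"
  using assms unfolding Teq_def by blast

lemma TeqE:
  assumes "Teq d u g"
  obtains u1 u2 where "PROP deriv_on {0..4} u u1"
    "PROP deriv_on {0..4} u1 u2"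
    "\<And>x. x \<in> {0..4} \<Longrightarrow> hyp_op d x (u2 x) (u1 x) (u x) = g x"
  using assms unfolding Teq_def by blast

lemma Teq_lincomb:
  assumes "Teq d u g" "Teq d v h" shows "Teq d (\<lambda>x. a * u x + b * v x) (\<lambda>x. a * g x + b * h x)"
proof -
  obtain u1 u2 where u: "PROP deriv_on {0..4} u u1"
    "PROP deriv_on {0..4} u1 u2"
    "\<And>x. x \<in> {0..4} \<Longrightarrow> hyp_op d x (u2 x) (u1 x) (u x) = g x"
    by (fact TeqE[OF assms(1)])
  obtain v1 v2 where v: "PROP deriv_on {0..4} v v1"
    "PROP deriv_on {0..4} v1 v2"
    "\<And>x. x \<in> {0..4} \<Longrightarrow> hyp_op d x (v2 x) (v1 x) (v x) = h x"
    by (fact TeqE[OF assms(2)])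
  show ?thesis
  proof (rule TeqI[where ?u1.0="\<lambda>x. a * u1 x + b * v1 x" and ?u2.0="\<lambda>x. a * u2 x + b * v2 x"])
    fix x :: real assume x: "x \<in> {0..4}"
    show "x * (1 - x) * (a * u2 x + b * v2 x) + (coefA d 0 - coefB 0 * x) * (a * u1 x + b * v1 x)
       - coefK 0 * (a * u x + b * v x) = a * g x + b * h x"
      unfolding u(3)[OF x, symmetric] v(3)[OF x, symmetric] by (simp add: algebra_simps)
  qed (intro DERIV_add DERIV_cmult u v; assumption)+
qed

lemma Teq_diff: "Teq d u g \<Longrightarrow> Teq d v h \<Longrightarrow> Teq d (\<lambda>x. u x - v x) (\<lambda>x. g x - h x)"
  using Teq_lincomb[of d u g v h 1 "-1"] by simp

lemma Teq_cong:
  assumes "Teq d u g" "\<And>x. x \<in> {0..4} \<Longrightarrow> u x = v x" "\<And>x. x \<in> {0..4} \<Longrightarrow> g x = h x"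
  shows "Teq d v h"
proof -
  obtain u1 u2 where u: "PROP deriv_on {0..4} u u1"
    "PROP deriv_on {0..4} u1 u2"
    "\<And>x. x \<in> {0..4} \<Longrightarrow> hyp_op d x (u2 x) (u1 x) (u x) = g x"
    by (fact TeqE[OF assms(1)])
  show ?thesis
  proof (rule TeqI[OF _ u(2)])
    show "(v has_real_derivative u1 x) (at x within {0..4})" if "x \<in> {0..4}" for x
      using has_field_derivative_transform_within[OF u(1)[OF that] zero_less_one that] assms(2) by blast
  qed (use u(3) assms(2,3) in auto)
qed

lemma Ck_chain:
  assumes "Ck_on n S g"
  shows "\<exists>G. G 0 = g \<and> (\<forall>j<n. \<forall>x\<in>S. (G j has_real_derivative G (Suc j) x) (at x within S)) \<and>
     (\<forall>j\<le>n. Ck_on (n - j) S (G j))"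
  using assms
proof (induction n arbitrary: g)
  case 0
  then show ?case by (intro exI[of _ "\<lambda>j. g"]) simp
next
  case (Suc n)
  obtain g' where g': "PROP deriv_on S g g'" "Ck_on n S g'"
    using Suc.prems by (rule Ck_onE) blast
  obtain G where G: "G 0 = g'" "\<forall>j<n. \<forall>x\<in>S. (G j has_real_derivative G (Suc j) x) (at x within S)"
     "\<forall>j\<le>n. Ck_on (n - j) S (G j)" using Suc.IH[OF g'(2)] by blast
  define H where "H = (\<lambda>j. case j of 0 \<Rightarrow> g | Suc i \<Rightarrow> G i)"
  have H: "H 0 = g" "\<And>i. H (Suc i) = G i" by (auto simp: H_def)
  have "(H j has_real_derivative H (Suc j) x) (at x within S)" if "j < Suc n" "x \<in> S" for j x
    using that G g' by (cases j) (auto simp: H)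
  moreover have "Ck_on (Suc n - j) S (H j)" if "j \<le> Suc n" for j
  proof (cases j)
    case 0
    then show ?thesis using Suc.prems H by (simp del: Ck_on.simps(2))
  next
    case (Suc i)
    then show ?thesis using G(3) that H by simp
  qed
  ultimately show ?case using H(1) by (intro exI[of _ H]) blast
qed

lemma chain_Cb_iff:
  assumes S: "no_isolated S" and "\<forall>j<n. \<forall>x\<in>S. (G j has_real_derivative G (Suc j) x) (at x within S)"
  shows "Cb S n K (G 0) \<longleftrightarrow> continuous_on S (G n) \<and> (\<forall>j\<le>n. \<forall>x\<in>S. \<bar>G j x\<bar> \<le> K)"
  using assms(2)
proof (induction n arbitrary: G)
  case 0
  then show ?case by simp
next
  case (Suc n)
  have G0: "PROP deriv_on S (G 0) (G 1)" using Suc.prems by simp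
  have "Cb S (Suc n) K (G 0) \<longleftrightarrow> (\<forall>x\<in>S. \<bar>G 0 x\<bar> \<le> K) \<and> Cb S n K (G 1)"
    using Cb_SucI[OF _ G0] Cb_deriv[OF S _ G0] Cb_bound by (metis (full_types))
  also have "Cb S n K (G 1) \<longleftrightarrow> continuous_on S (G (Suc n)) \<and> (\<forall>j\<le>n. \<forall>x\<in>S. \<bar>G (Suc j) x\<bar> \<le> K)"
    using Suc.IH[of "\<lambda>j. G (Suc j)"] Suc.prems by simp
  also have "(\<forall>x\<in>S. \<bar>G 0 x\<bar> \<le> K) \<and> (continuous_on S (G (Suc n)) \<and> (\<forall>j\<le>n. \<forall>x\<in>S. \<bar>G (Suc j) x\<bar> \<le> K))
    \<longleftrightarrow> continuous_on S (G (Suc n)) \<and> (\<forall>j\<le>Suc n. \<forall>x\<in>S. \<bar>G j x\<bar> \<le> K)"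
    using All_less_Suc2[of "Suc n" "\<lambda>j. \<forall>x\<in>S. \<bar>G j x\<bar> \<le> K"] by (auto simp: less_Suc_eq_le)
  finally show ?case .
qed

lemma S4: "no_isolated {0..4::real}" by (rule no_isolated_Icc) simp

text \<open>The hypothesis on \<open>u\<close> asks for one derivative more than the conclusion
  controls. This is affordable because the estimate serves for polynomials and for uniqueness; the
  limit of polynomial solutions then inherits it.\<close>

lemma Teq_apriori:
  assumes m: "real m > (real d - 3) / 2" and d: "d \<ge> 3"
  shows "\<exists>M\<ge>0. \<forall>u g c. Ck_on (m + 2) {0..4} u \<longrightarrow> Cb {0..4} m c g \<longrightarrow> Teq d u g \<longrightarrow> Cb {0..4} (Suc m) (M * c) u"
proof -
  let ?S = "{0..4::real}"
  obtain M where M: "M \<ge> 0" "\<And>P G c. hyp_system d m P G c \<Longrightarrow> (\<forall>j\<le>Suc m. \<forall>x\<in>?S. \<bar>P j x\<bar> \<le> M * c)"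
    using hyp_apriori[OF assms] by blast
  have "Cb ?S (Suc m) (M * c) u" if u: "Ck_on (m + 2) ?S u" and g: "Cb ?S m c g" and T: "Teq d u g" for u g c
  proof -
    obtain P where P: "P 0 = u" "\<forall>j<m+2. \<forall>x\<in>?S. (P j has_real_derivative P (Suc j) x) (at x within ?S)"
       "\<forall>j\<le>m+2. Ck_on (m + 2 - j) ?S (P j)"
      using Ck_chain[OF u] by blast
    obtain G where G: "G 0 = g" "\<forall>j<m. \<forall>x\<in>?S. (G j has_real_derivative G (Suc j) x) (at x within ?S)"
      using Ck_chain[OF Cb_imp_Ck[OF g]] by blast
    obtain u1 u2 where v: "PROP deriv_on {0..4} u u1"
      "PROP deriv_on {0..4} u1 u2"
      "\<And>x. x \<in> {0..4} \<Longrightarrow> hyp_op d x (u2 x) (u1 x) (u x) = g x"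
      by (fact TeqE[OF T])
    have 1: "u1 x = P 1 x" if "x \<in> ?S" for x
      using no_isolated_unique[OF S4 that v(1)[OF that], of "P 1 x"] P(1,2) that by auto
    have "(P 1 has_real_derivative u2 x) (at x within ?S)" if "x \<in> ?S" for x
      using has_field_derivative_transform_within[OF v(2)[OF that] zero_less_one that] 1 by blast
    then have 2: "u2 x = P 2 x" if "x \<in> ?S" for x
      using no_isolated_unique[OF S4 that, of "P 1" "u2 x" "P 2 x"] P(2) that by (auto simp: numeral_2_eq_2)
    have "hyp_system d m P G c"
      unfolding hyp_system_def
    proof (intro conjI)
      show "\<forall>j\<le>m. \<forall>x\<in>?S. \<bar>G j x\<bar> \<le> c"
        using chain_Cb_iff[OF S4 G(2)] g G(1) by simp
    qed (use P G v(3) 1 2 in auto)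
    then have "\<forall>j\<le>Suc m. \<forall>x\<in>?S. \<bar>P j x\<bar> \<le> M * c" by (rule M(2))
    moreover have "continuous_on ?S (P (Suc m))"
      using P(3)[rule_format, of "Suc m"] by (intro Ck_on_imp_continuous[of "m + 2 - Suc m"]) simp
    ultimately show ?thesis using chain_Cb_iff[OF S4, of "Suc m" P] P(1,2) by simp
  qed
  with M(1) show ?thesis by blast
qed

lemma Teq_unique:
  assumes m: "real m > (real d - 3) / 2" and d: "d \<ge> 3"
    and u: "Ck_on (m + 2) {0..4} u" and T: "Teq d u (\<lambda>x. 0)" and x: "x \<in> {0..4}"
  shows "u x = 0"
proof -
  obtain M where "Cb {0..4} (Suc m) (M * 0) u"
    using Teq_apriori[OF m d] u Cb_zero[of 0 "{0..4}" m] T by (metis order_refl)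
  then have "\<bar>u x\<bar> \<le> M * 0" using x by (rule Cb_bound)
  then show ?thesis by simp
qed

lemma Ck_on_poly: "Ck_on n S (poly p)"
proof (induction n arbitrary: p)
  case (Suc n)
  show ?case by (rule Ck_on_SucI[OF DERIV_subset[OF poly_DERIV]]) (auto intro: Suc.IH)
qed (auto intro: continuous_intros)

text \<open>The operator maps the monomial of degree \<open>k + 1\<close> to a combination of
  degrees \<open>k\<close> and \<open>k + 1\<close> with top coefficient
  \<open>- coefK (Suc k)\<close>. It is triangular with nonzero diagonal, so monomials are reached
  by induction.\<close>

lemma Teq_poly_surj: "\<exists>p. Teq d (poly p) (poly g)"
proof -
  let ?A = "coefA d 0" and ?B = "coefB 0" and ?K = "coefK 0"
  define L where "L = (\<lambda>p. [:0, 1, -1:] * pderiv (pderiv p) + [:?A, - ?B:] * pderiv p - smult ?K p)"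
  have L_add: "L (p + q) = L p + L q" for p q by (simp add: L_def pderiv_add algebra_simps smult_add_right)
  have L_smult: "L (smult c p) = smult c (L p)" for c p
    by (simp add: L_def pderiv_smult smult_add_right smult_diff_right mult.commute)
  have mono: "\<exists>p. L p = monom 1 k" for k
  proof (induction k)
    case 0
    have "L [:- 2:] = monom 1 0" by (simp add: L_def coefK_def monom_0)
    then show ?case by blast
  next
    case (Suc k)
    then obtain p where p: "L p = monom 1 k" by blast
    let ?c = "real (Suc k) * (real k + ?A)"
    have "L (monom 1 (Suc k)) = smult ?c (monom 1 k) - smult (coefK (Suc k)) (monom 1 (Suc k))"
    proof -
      have "poly (L (monom 1 (Suc k))) x = poly (smult ?c (monom 1 k) - smult (coefK (Suc k)) (monom 1 (Suc k))) x" for x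
      proof (cases k)
        case 0
        then show ?thesis by (simp add: L_def pderiv_monom poly_monom coefA_def coefB_def coefK_def algebra_simps)
      next
        case (Suc j)
        then show ?thesis
          by (simp add: L_def pderiv_monom poly_monom coefA_def coefB_def coefK_def field_simps)
      qed
      then show ?thesis by (simp add: poly_eq_poly_eq_iff[symmetric] fun_eq_iff)
    qed
    then have "smult ?c (L p) + smult (-1) (L (monom 1 (Suc k))) = smult (coefK (Suc k)) (monom 1 (Suc k))"
      by (simp add: p)
    then have "L (smult (1 / coefK (Suc k)) (smult ?c p + smult (-1) (monom 1 (Suc k)))) =
        smult (1 / coefK (Suc k)) (smult (coefK (Suc k)) (monom 1 (Suc k)))"
      by (simp only: L_add L_smult)
    then have "L (smult (1 / coefK (Suc k)) (smult ?c p + smult (-1) (monom 1 (Suc k)))) = monom 1 (Suc k)"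
      using coefK_pos[of "Suc k"] by simp
    then show ?case by blast
  qed
  then obtain q where q: "\<And>k. L (q k) = monom 1 k" by metis
  have sum: "L (\<Sum>i\<in>I. smult (c i) (q i)) = (\<Sum>i\<in>I. smult (c i) (monom 1 i))" if "finite I" for I c
    using that
  proof (induction I)
    case empty
    show ?case by (simp add: L_def)
  next
    case (insert i I)
    then show ?case by (simp add: L_add L_smult q)
  qed
  define p where "p = (\<Sum>i\<in>{..degree g}. smult (coeff g i) (q i))"
  have Lp: "L p = g"
    using poly_as_sum_of_monoms[of g] by (simp add: p_def sum smult_monom)
  have "Teq d (poly p) (poly g)"
  proof (rule TeqI[where ?u1.0="poly (pderiv p)" and ?u2.0="poly (pderiv (pderiv p))"])
    fix x :: real
    have "poly (L p) x = poly g x" by (simp add: Lp)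
    then show "x * (1 - x) * poly (pderiv (pderiv p)) x + (?A - ?B * x) * poly (pderiv p) x - ?K * poly p x = poly g x"
      by (simp add: L_def algebra_simps)
  qed (auto intro: DERIV_subset[OF poly_DERIV])
  then show ?thesis by blast
qed

text \<open>Approximate \<open>g\<close> in \<open>C^m\<close> by polynomials and solve exactly. The
  a priori estimate for differences makes the solutions Cauchy in \<open>C^(m + 1)\<close>, one
  order above the data.\<close>

lemma Teq_surj:
  assumes m: "real m > (real d - 3) / 2" and d: "d \<ge> 3" and m1: "m \<ge> 1"
  shows "\<exists>M\<ge>0. \<forall>g c. Cb {0..4} m c g \<longrightarrow> (\<exists>u. Cb {0..4} (Suc m) (M * c) u \<and> Teq d u g)"
proof -
  let ?S = "{0..4::real}"
  obtain M where M: "M \<ge> 0" "\<And>u g c. Ck_on (m + 2) ?S u \<Longrightarrow> Cb ?S m c g \<Longrightarrow> Teq d u g \<Longrightarrow> Cb ?S (Suc m) (M * c) u"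
    using Teq_apriori[OF m d] by blast
  have "\<exists>u. Cb ?S (Suc m) (M * c) u \<and> Teq d u g" if g: "Cb ?S m c g" for g c
  proof -
    have "\<exists>q. Cb ?S m (inverse (real (Suc i))) (\<lambda>x. g x - poly q x)" for i
      by (rule Weierstrass_Ck[OF _ Cb_imp_Ck[OF g]]) auto
    then obtain q where q: "\<And>i. Cb ?S m (inverse (real (Suc i))) (\<lambda>x. g x - poly (q i) x)" by metis
    have "\<forall>i. \<exists>p. Teq d (poly p) (poly (q i))" using Teq_poly_surj by blast
    then obtain p where p: "\<And>i. Teq d (poly (p i)) (poly (q i))" by metis
    have pb: "Cb ?S (Suc m) (M * (c + inverse (real (Suc i)))) (poly (p i))" for i
    proof (rule M(2)[OF Ck_on_poly _ p])
      show "Cb ?S m (c + inverse (real (Suc i))) (poly (q i))"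
        using Cb_diff[OF g q[of i]] by simp
    qed
    have pd: "Cb ?S (Suc m) (M * (inverse (real (Suc i)) + inverse (real (Suc j)))) (\<lambda>x. poly (p i) x - poly (p j) x)" for i j
    proof (rule M(2)[OF _ _ Teq_diff[OF p p]])
      show "Ck_on (m + 2) ?S (\<lambda>x. poly (p i) x - poly (p j) x)" by (intro Ck_on_diff Ck_on_poly)
      show "Cb ?S m (inverse (real (Suc i)) + inverse (real (Suc j))) (\<lambda>x. poly (q i) x - poly (q j) x)"
        using Cb_diff[OF q[of j] q[of i]] by (simp add: add.commute)
    qed
    have small: "\<exists>N. \<forall>i\<ge>N. M * inverse (real (Suc i)) \<le> et" if "et > 0" for et
    proof -
      have "(\<lambda>i. M * inverse (real (Suc i))) \<longlonglongrightarrow> M * 0" by (intro tendsto_intros LIMSEQ_inverse_real_of_nat)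
      then have "\<forall>\<^sub>F i in sequentially. M * inverse (real (Suc i)) < et"
        using that by (intro order_tendstoD(2)) auto
      then show ?thesis unfolding eventually_sequentially by (meson less_imp_le)
    qed
    have "Cb_Cauchy ?S (Suc m) (\<lambda>i. poly (p i))"
      unfolding Cb_Cauchy_def
    proof (intro allI impI)
      fix et :: real assume "et > 0"
      then obtain N where N: "\<forall>i\<ge>N. M * inverse (real (Suc i)) \<le> et / 2" using small[of "et/2"] by auto
      have "Cb ?S (Suc m) et (\<lambda>x. poly (p i) x - poly (p j) x)" if "i \<ge> N" "j \<ge> N" for i j
        by (rule Cb_mono[OF pd]) (use N[rule_format, OF that(1)] N[rule_format, OF that(2)] in \<open>simp add: distrib_left\<close>)
      then show "\<exists>N. \<forall>i\<ge>N. \<forall>j\<ge>N. Cb ?S (Suc m) et (\<lambda>x. poly (p i) x - poly (p j) x)" by blast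
    qed
    then obtain u where u: "Cb_lim ?S (Suc m) (\<lambda>i. poly (p i)) u"
      using Cb_complete[of 0 4 "Suc m"] Ck_on_poly by (metis zero_less_numeral)
    have Cku: "Ck_on (Suc m) ?S u" by (rule Cb_lim_Ck[OF u Ck_on_poly])
    have "Cb ?S (Suc m) (M * c + et) u" if "et > 0" for et
    proof -
      obtain N where N: "\<forall>i\<ge>N. M * inverse (real (Suc i)) \<le> et / 2" using small[of "et/2"] \<open>et > 0\<close> by auto
      obtain N' where N': "\<forall>i\<ge>N'. Cb ?S (Suc m) (et/2) (\<lambda>x. poly (p i) x - u x)"
        using u \<open>et > 0\<close> unfolding Cb_lim_def by (meson half_gt_zero)
      let ?i = "max N N'"
      have "Cb ?S (Suc m) (M * (c + inverse (real (Suc ?i))) + et/2) (\<lambda>x. poly (p ?i) x - (poly (p ?i) x - u x))"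
        by (rule Cb_diff[OF pb]) (use N' in auto)
      moreover have "M * (c + inverse (real (Suc ?i))) + et/2 \<le> M * c + et"
        using N[rule_format, of ?i] by (simp add: distrib_left)
      ultimately show ?thesis using Cb_mono by simp
    qed
    then have ub: "Cb ?S (Suc m) (M * c) u" by (rule Cb_closed[OF S4])
    \<comment> \<open>From \<open>m \<ge> 1\<close> the solutions converge at least in
      \<open>C^2\<close>, so the equation passes to the limit pointwise.\<close>
    obtain k where k: "m = Suc k" using m1 by (cases m) auto
    obtain u1 where u1: "PROP deriv_on ?S u u1" "Ck_on m ?S u1"
      using Cku by (rule Ck_onE) blast
    obtain u2 where u2: "PROP deriv_on ?S u1 u2" "Ck_on k ?S u2"
      using u1(2) unfolding k by (rule Ck_onE) blast
    have l1: "Cb_lim ?S m (\<lambda>i. poly (pderiv (p i))) u1"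
      by (rule Cb_lim_deriv[OF S4 u DERIV_subset[OF poly_DERIV] u1(1)]) auto
    have l2: "Cb_lim ?S k (\<lambda>i. poly (pderiv (pderiv (p i)))) u2"
      by (rule Cb_lim_deriv[OF S4 l1[unfolded k] DERIV_subset[OF poly_DERIV] u2(1)]) auto
    have lq: "Cb_lim ?S m (\<lambda>i. poly (q i)) g"
      unfolding Cb_lim_def
    proof (intro allI impI)
      fix et :: real assume "et > 0"
      then obtain N where N: "inverse (real (Suc N)) < et" using reals_Archimedean by blast
      have "Cb ?S m et (\<lambda>x. poly (q i) x - g x)" if "i \<ge> N" for i
      proof -
        have "inverse (real (Suc i)) \<le> inverse (real (Suc N))" using that by (intro le_imp_inverse_le) auto
        then have "inverse (real (Suc i)) \<le> et" using N by linarith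
        then show ?thesis by (rule Cb_mono[OF Cb_diff_commute[OF q[of i]]])
      qed
      then show "\<exists>N. \<forall>i\<ge>N. Cb ?S m et (\<lambda>x. poly (q i) x - g x)" by blast
    qed
    have "Teq d u g"
    proof (rule TeqI[OF u1(1) u2(1)])
      fix x :: real assume x: "x \<in> ?S"
      have "poly (q i) x = hyp_op d x (poly (pderiv (pderiv (p i))) x) (poly (pderiv (p i)) x) (poly (p i) x)" for i
      proof -
        obtain v1 v2 where v: "PROP deriv_on {0..4} (poly (p i)) v1"
          "PROP deriv_on {0..4} v1 v2"
          "\<And>x. x \<in> {0..4} \<Longrightarrow> hyp_op d x (v2 x) (v1 x) (poly (p i) x) = poly (q i) x"
          by (fact TeqE[OF p[of i]])
        have 1: "v1 x = poly (pderiv (p i)) x" if "x \<in> ?S" for x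
          by (rule no_isolated_unique[OF S4 that v(1)[OF that] DERIV_subset[OF poly_DERIV]]) simp
        have "(v1 has_real_derivative poly (pderiv (pderiv (p i))) x) (at x within ?S)"
          by (rule has_field_derivative_transform_within[OF DERIV_subset[OF poly_DERIV] zero_less_one x])
             (use 1 in auto)
        then have "v2 x = poly (pderiv (pderiv (p i))) x"
          using no_isolated_unique[OF S4 x v(2)[OF x]] by blast
        then show ?thesis using v(3)[OF x] 1[OF x] by simp
      qed
      then have "(\<lambda>i. poly (q i) x) \<longlonglongrightarrow> hyp_op d x (u2 x) (u1 x) (u x)"
        by (auto intro!: tendsto_intros Cb_lim_pointwise[OF l2 x] Cb_lim_pointwise[OF l1 x] Cb_lim_pointwise[OF u x])
      then show "hyp_op d x (u2 x) (u1 x) (u x) = g x"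
        using Cb_lim_pointwise[OF lq x] LIMSEQ_unique by blast
    qed
    with ub show ?thesis by blast
  qed
  with M(1) show ?thesis by blast
qed

section \<open>Injectivity of the linearized operator\<close>

text \<open>This is \<open>(d - 1) * (cos (2 * f0) - 1) / (4 * x)\<close> at
  \<open>x = r\<^sup>2\<close>, the derivative at \<open>f0\<close> of the nonlinear term that
  remains after its linear part has been moved into the operator.\<close>

definition Vpot :: "nat \<Rightarrow> real \<Rightarrow> real" where
  "Vpot d x = - (2 * (real d - 1) * (real d - 2) / (real d - 2 + x)\<^sup>2)"

text \<open>Taylor coefficients at \<open>0\<close> of \<open>(d - 2 + x) u\<close>, where \<open>u\<close> is the solution of the linearized
  equation that is regular at \<open>0\<close>.\<close>

fun kcoef :: "nat \<Rightarrow> nat \<Rightarrow> real" where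
  "kcoef d 0 = 1"
| "kcoef d (Suc 0) = - 1 / coefA d 0"
| "kcoef d (Suc (Suc j)) =
    (((real d - 2) * ((real j + 1)\<^sup>2 + real j) - (real j + 1) * real j) * kcoef d (Suc j)
       + real j * (real j - 1/2) * kcoef d j) / ((real d - 2) * (real j + 2) * (real j + 1 + coefA d 0))"

text \<open>With \<open>b = d - 2 \<ge> 1\<close> the recurrence reads
  \<open>(p * kcoef d (Suc j) + q * kcoef d j) / D\<close> where \<open>p > 0\<close>,
  \<open>q \<ge> 0\<close> and \<open>p + q \<le> D\<close>. Hence negativity propagates and the
  modulus never grows, which also gives convergence in the unit disc.\<close>

lemma kcoef_props:
  assumes d: "d \<ge> 3"
  shows "k \<ge> 1 \<Longrightarrow> kcoef d k < 0" "\<bar>kcoef d k\<bar> \<le> 1"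
proof -
  define b where "b = real d - 2"
  have b: "b \<ge> 1" using d by (simp add: b_def)
  define c where "c = coefA d 0"
  have c: "c \<ge> 1" by (simp add: c_def coefA_def)
  have "(k \<ge> 1 \<longrightarrow> kcoef d k < 0) \<and> \<bar>kcoef d k\<bar> \<le> 1"
  proof (induction k rule: less_induct)
    case (less k)
    consider "k = 0" | "k = 1" | j where "k = Suc (Suc j)"
      by (metis One_nat_def nat.exhaust)
    then show ?case
    proof cases
      case 1
      then show ?thesis by simp
    next
      case 2
      then show ?thesis using c by (simp add: c_def[symmetric])
    next
      case (3 j)
      define x where "x = real j"
      have x: "x \<ge> 0" by (simp add: x_def)
      define p where "p = b * ((x + 1)\<^sup>2 + x) - (x + 1) * x"
      define q where "q = x * (x - 1/2)"
      define D where "D = b * (x + 2) * (x + 1 + c)"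
      have D: "D > 0" using b c x by (simp add: D_def)
      have "(x + 1)\<^sup>2 + x \<le> b * ((x + 1)\<^sup>2 + x)" using b x mult_right_mono[of 1 b "(x + 1)\<^sup>2 + x"] by simp
      then have p: "p > 0" using x by (simp add: p_def power2_eq_square algebra_simps)
      have q: "q \<ge> 0"
      proof (cases "j = 0")
        case False
        then have "x \<ge> 1" by (simp add: x_def)
        then show ?thesis by (simp add: q_def)
      qed (simp add: q_def x_def)
      have pq: "p + q \<le> D"
      proof -
        have "0 \<le> b * c * (x + 2)" using b c x by simp
        moreover have "0 \<le> b" "0 \<le> x" using b x by auto
        moreover have "D - p - q = b * c * (x + 2) + b + 3/2 * x"
          by (simp add: D_def p_def q_def power2_eq_square field_simps)
        ultimately show ?thesis by linarith
      qed
      have eq: "kcoef d k = (p * kcoef d (Suc j) + q * kcoef d j) / D"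
        by (simp add: 3 p_def q_def D_def x_def b_def c_def)
      have IH1: "kcoef d (Suc j) < 0" "\<bar>kcoef d (Suc j)\<bar> \<le> 1" using less[of "Suc j"] 3 by auto
      have IH0: "\<bar>kcoef d j\<bar> \<le> 1" using less[of j] 3 by auto
      \<comment> \<open>The positive coefficient \<open>kcoef d 0\<close> could spoil the sign, but
        for \<open>j = 0\<close> its factor \<open>q\<close> vanishes.\<close>
      have "q * kcoef d j \<le> 0"
      proof (cases "j = 0")
        case False
        then show ?thesis using less[of j] 3 q by (simp add: mult_nonneg_nonpos)
      qed (simp add: q_def x_def)
      moreover have "p * kcoef d (Suc j) < 0" using p IH1 by (simp add: mult_pos_neg)
      ultimately have neg: "kcoef d k < 0" unfolding eq using D by (simp add: divide_neg_pos)
      have "\<bar>p * kcoef d (Suc j)\<bar> \<le> p * 1" unfolding abs_mult using p IH1 by (intro mult_mono) auto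
      moreover have "\<bar>q * kcoef d j\<bar> \<le> q * 1" unfolding abs_mult using q IH0 by (intro mult_mono) auto
      ultimately have "\<bar>p * kcoef d (Suc j) + q * kcoef d j\<bar> \<le> D" using pq by linarith
      then have "\<bar>kcoef d k\<bar> \<le> 1" unfolding eq using D by (simp add: abs_divide)
      with neg show ?thesis by simp
    qed
  qed
  then show "k \<ge> 1 \<Longrightarrow> kcoef d k < 0" "\<bar>kcoef d k\<bar> \<le> 1" by auto
qed

definition kser :: "nat \<Rightarrow> nat \<Rightarrow> real \<Rightarrow> real" where
  "kser d j x = (\<Sum>k. (diffs ^^ j) (kcoef d) k * x ^ k)"

lemma kser_summable:
  assumes d: "d \<ge> 3" and "\<bar>x\<bar> < 1"
  shows "summable (\<lambda>k. (diffs ^^ j) (kcoef d) k * x ^ k)"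
  using assms(2)
proof (induction j arbitrary: x)
  case 0
  show ?case
  proof (rule summable_comparison_test')
    show "summable (\<lambda>k. \<bar>x\<bar> ^ k)" using 0 by (intro summable_geometric) auto
    show "norm ((diffs ^^ 0) (kcoef d) k * x ^ k) \<le> \<bar>x\<bar> ^ k" if "k \<ge> 0" for k
      using kcoef_props(2)[OF d, of k] by (simp add: abs_mult power_abs mult_left_le_one_le)
  qed
next
  case (Suc j)
  show ?case
    using termdiff_converges[of x 1 "(diffs ^^ j) (kcoef d)"] Suc by simp
qed

lemma kser_deriv:
  assumes d: "d \<ge> 3" and x: "\<bar>x\<bar> < 1"
  shows "(kser d j has_real_derivative kser d (Suc j) x) (at x within S)"
proof -
  have "((\<lambda>x. \<Sum>k. (diffs ^^ j) (kcoef d) k * x ^ k) has_real_derivative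
      (\<Sum>k. diffs ((diffs ^^ j) (kcoef d)) k * x ^ k)) (at x)"
    by (rule termdiffs_strong'[where K=1]) (use kser_summable[OF d] x in auto)
  then show ?thesis unfolding kser_def[abs_def] by (auto intro: DERIV_subset)
qed

lemma diffs_kcoef_nonpos:
  assumes d: "d \<ge> 3" and "j \<ge> 1 \<or> k \<ge> 1"
  shows "(diffs ^^ j) (kcoef d) k < 0"
  using assms(2)
proof (induction j arbitrary: k)
  case 0
  then show ?case using kcoef_props(1)[OF d] by simp
next
  case (Suc j)
  have "(diffs ^^ j) (kcoef d) (Suc k) < 0" by (rule Suc.IH) simp
  then have "real (Suc k) * (diffs ^^ j) (kcoef d) (Suc k) < 0" by (intro mult_pos_neg) auto
  then show ?case by (simp add: diffs_def[of "(diffs ^^ j) (kcoef d)"])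
qed

text \<open>For \<open>j \<ge> 1\<close> all coefficients are negative, so omitting all terms but
  the first only increases the sum. The bound is uniform in \<open>x < 1\<close> and can be carried
  to \<open>x = 1\<close> by continuity, where convergence of the series is not at hand.\<close>

lemma kser_le:
  assumes d: "d \<ge> 3" and j: "j \<ge> 1" and x: "0 \<le> x" "x < 1"
  shows "kser d j x \<le> (diffs ^^ j) (kcoef d) 0"
proof -
  let ?f = "\<lambda>k. (diffs ^^ j) (kcoef d) k * x ^ k"
  have s: "summable ?f" by (rule kser_summable[OF d]) (use x in auto)
  have neg: "?f k \<le> 0" for k
    using diffs_kcoef_nonpos[OF d, of j k] j x by (intro mult_nonpos_nonneg) auto
  have "suminf ?f = ?f 0 + (\<Sum>k. ?f (Suc k))" using suminf_split_head[OF s] by simp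
  moreover have "(\<Sum>k. ?f (Suc k)) \<le> 0"
  proof -
    have "summable (\<lambda>k. ?f (Suc k))" using s by (subst summable_Suc_iff)
    then show ?thesis using suminf_le[OF neg _ summable_zero] by (simp del: power_Suc)
  qed
  ultimately show ?thesis by (simp add: kser_def)
qed

text \<open>The leading coefficients of the equation for \<open>(x + b) u\<close>, with
  \<open>b = d - 2\<close>. The cubic factors as \<open>x (1 - x) (x + b)\<close>; in particular it
  vanishes at the light cone.\<close>

definition q2 :: "real \<Rightarrow> real \<Rightarrow> real" where "q2 b x = b * x + (1 - b) * x\<^sup>2 - x ^ 3"
definition q1 :: "real \<Rightarrow> real \<Rightarrow> real" where "q1 b x = b * (b + 4) / 2 - 2 * b * x - x\<^sup>2 / 2"

lemma sums_shift_power: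
  assumes "(\<lambda>k. e k * x ^ k) sums (s::real)"
  shows "(\<lambda>k. (if k = 0 then 0 else e (k - 1)) * x ^ k) sums (x * s)"
proof -
  have "(\<lambda>k. x * (e k * x ^ k)) sums (x * s)" by (rule sums_mult[OF assms])
  then have "(\<lambda>k. (if Suc k = 0 then 0 else e (Suc k - 1)) * x ^ Suc k) sums (x * s)"
    by (simp add: algebra_simps)
  from sums_Suc[OF this] show ?thesis by simp
qed

lemma kser_ode:
  assumes d: "d \<ge> 3" and x: "\<bar>x\<bar> < 1" and b: "b = real d - 2"
  shows "q2 b x * kser d 2 x + q1 b x * kser d 1 x + b * kser d 0 x = 0"
proof -
  define a where "a = kcoef d"
  have S: "(\<lambda>k. (diffs ^^ j) a k * x ^ k) sums kser d j x" for j
    unfolding kser_def a_def by (rule summable_sums[OF kser_summable[OF d x]])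
  have s0: "(\<lambda>k. a k * x ^ k) sums kser d 0 x" using S[of 0] by simp
  define a1 where "a1 = (\<lambda>k. real (Suc k) * a (Suc k))"
  define a2 where "a2 = (\<lambda>k. real (Suc k) * (real (Suc (Suc k)) * a (Suc (Suc k))))"
  have s1: "(\<lambda>k. a1 k * x ^ k) sums kser d 1 x" using S[of 1] by (simp add: a1_def diffs_def)
  have s2: "(\<lambda>k. a2 k * x ^ k) sums kser d 2 x" using S[of 2] by (simp add: a2_def diffs_def numeral_2_eq_2)
  \<comment> \<open>\<open>sh\<close> is multiplication by \<open>x\<close> on coefficient
    sequences, with \<open>0\<close> entering at index \<open>0\<close>. With it the polynomial
    coefficients of the equation act on sequences, and \<open>cc\<close> is the coefficient sequence
    of the whole left side.\<close>
  define sh where "sh = (\<lambda>e k. if k = 0 then 0 else e (k - 1 :: nat) :: real)"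
  have sh: "(\<lambda>k. sh e k * x ^ k) sums (x * s)" if "(\<lambda>k. e k * x ^ k) sums s" for e s
    using sums_shift_power[OF that] by (simp add: sh_def)
  define cc where "cc = (\<lambda>k. b * sh a2 k + (1 - b) * sh (sh a2) k - sh (sh (sh a2)) k
       + b * (b + 4) / 2 * a1 k - 2 * b * sh a1 k - sh (sh a1) k / 2 + b * a k)"
  have "(\<lambda>k. b * (sh a2 k * x ^ k) + (1 - b) * (sh (sh a2) k * x ^ k) - sh (sh (sh a2)) k * x ^ k
       + b * (b + 4) / 2 * (a1 k * x ^ k) - 2 * b * (sh a1 k * x ^ k) - (sh (sh a1) k * x ^ k) / 2 + b * (a k * x ^ k))
     sums (b * (x * kser d 2 x) + (1 - b) * (x * (x * kser d 2 x)) - x * (x * (x * kser d 2 x))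
       + b * (b + 4) / 2 * kser d 1 x - 2 * b * (x * kser d 1 x) - (x * (x * kser d 1 x)) / 2 + b * kser d 0 x)"
    by (intro sums_add sums_diff sums_mult sums_divide sh s0 s1 s2)
  moreover have "b * (sh a2 k * x ^ k) + (1 - b) * (sh (sh a2) k * x ^ k) - sh (sh (sh a2)) k * x ^ k
       + b * (b + 4) / 2 * (a1 k * x ^ k) - 2 * b * (sh a1 k * x ^ k) - (sh (sh a1) k * x ^ k) / 2 + b * (a k * x ^ k)
     = cc k * x ^ k" for k
    by (simp add: cc_def algebra_simps)
  moreover have "cc k = 0" for k
  proof -
    have cA: "coefA d 0 = (b + 4) / 2" by (simp add: coefA_def b)
    have b1: "b \<ge> 1" using d b by simp
    show ?thesis
    proof (cases k)
      case 0
      then show ?thesis using b1 by (simp add: cc_def sh_def a1_def a_def cA)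
    next
      case (Suc j)
      let ?D = "(real d - 2) * (real j + 2) * (real j + 1 + coefA d 0)"
      have "b > 0" "real j + 2 > 0" using b1 by auto
      moreover have "real j + 1 + (b + 4) / 2 > 0"
        using b1 of_nat_0_le_iff[where 'a=real, of j] by (simp add: add_nonneg_pos)
      ultimately have D: "?D > 0" unfolding b[symmetric] cA by (intro mult_pos_pos)
      have "a (Suc (Suc j)) * ?D =
         ((real d - 2) * ((real j + 1)\<^sup>2 + real j) - (real j + 1) * real j) * a (Suc j)
       + real j * (real j - 1/2) * a j"
        unfolding a_def kcoef.simps(3)
        by (rule nonzero_divide_eq_eq[THEN iffD1, OF _ refl, symmetric]) (use D in linarith)
      then have rec: "b * (real j + 2) * (real j + 1 + (b + 4) / 2) * a (Suc (Suc j)) =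
         (b * ((real j + 1)\<^sup>2 + real j) - (real j + 1) * real j) * a (Suc j) + real j * (real j - 1/2) * a j"
        unfolding b[symmetric] cA by (simp add: mult.commute mult.left_commute)
      have "cc (Suc j) = b * (real j + 2) * (real j + 1 + (b + 4) / 2) * a (Suc (Suc j))
         - ((b * ((real j + 1)\<^sup>2 + real j) - (real j + 1) * real j) * a (Suc j) + real j * (real j - 1/2) * a j)"
      proof (cases j)
        case 0
        then show ?thesis by (simp add: cc_def sh_def a1_def a2_def power2_eq_square field_simps)
      next
        case (Suc i)
        then show ?thesis by (cases i) (simp_all add: cc_def sh_def a1_def a2_def power2_eq_square field_simps)
      qed
      then show ?thesis using rec Suc by simp
    qed
  qed
  ultimately have "(\<lambda>k. 0) sums (b * (x * kser d 2 x) + (1 - b) * (x * (x * kser d 2 x)) - x * (x * (x * kser d 2 x))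
       + b * (b + 4) / 2 * kser d 1 x - 2 * b * (x * kser d 1 x) - (x * (x * kser d 1 x)) / 2 + b * kser d 0 x)"
    by simp
  then have "b * (x * kser d 2 x) + (1 - b) * (x * (x * kser d 2 x)) - x * (x * (x * kser d 2 x))
       + b * (b + 4) / 2 * kser d 1 x - 2 * b * (x * kser d 1 x) - (x * (x * kser d 1 x)) / 2 + b * kser d 0 x = 0"
    using sums_unique2 sums_zero by blast
  then show ?thesis by (simp add: q2_def q1_def power2_eq_square power3_eq_cube algebra_simps)
qed

text \<open>Both \<open>g - f\<close> and \<open>g + f\<close> are nondecreasing, which is treated
  at once through the sign \<open>sg\<close>. In the applications \<open>g\<close> is mostly an
  exponential, so this replaces explicit integral estimates.\<close>

lemma exp_growth_bound:
  fixes f :: "real \<Rightarrow> real"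
  assumes f': "PROP deriv_on {al..be} f f'"
    and g': "PROP deriv_on {al..be} g g'"
    and b: "\<And>x. x \<in> {al..be} \<Longrightarrow> \<bar>f' x\<bar> \<le> g' x" and t: "t \<in> {al..be}"
  shows "\<bar>f t - f al\<bar> \<le> g t - g al"
proof -
  have "sg * f t - sg * f al \<le> g t - g al" if sg: "\<bar>sg\<bar> = 1" for sg
  proof -
    let ?h = "\<lambda>t. g t - sg * f t"
    have h': "(?h has_real_derivative g' s - sg * f' s) (at s within {al..be})" if "s \<in> {al..be}" for s
      by (intro DERIV_diff DERIV_cmult f' g' that)
    have "?h al \<le> ?h t"
    proof (rule DERIV_nonneg_imp_increasing_open[where f="?h" and a=al and b=t])
      fix s assume s: "al < s" "s < t"
      then have s': "s \<in> {al..be}" using t by auto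
      have "at s within {al..be} = at s" by (rule at_within_Icc_at) (use t s in auto)
      then have "(?h has_real_derivative g' s - sg * f' s) (at s)" using h'[OF s'] by simp
      moreover have "sg * f' s \<le> \<bar>f' s\<bar>" using sg by (metis abs_ge_self abs_mult mult_1)
      ultimately show "\<exists>y. (?h has_real_derivative y) (at s) \<and> 0 \<le> y"
        using b[OF s'] by (intro exI conjI) auto
    next
      show "continuous_on {al..t} ?h"
        by (rule continuous_on_subset[OF DERIV_continuous_on[OF h']]) (use t in auto)
    qed (use t in auto)
    then show ?thesis by simp
  qed
  from this[of 1] this[of "-1"] show ?thesis by (simp add: abs_le_iff)
qed

section \<open>Uniqueness for the linearized equation on either side of the light cone\<close>

lemma Vpot_bound:
  assumes d: "d \<ge> 3" and t: "t \<ge> 0" shows "\<bar>Vpot d t\<bar> \<le> 4"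
proof -
  have b: "real d - 2 \<ge> 1" using d by simp
  have "(real d - 2)\<^sup>2 \<le> (real d - 2 + t)\<^sup>2" using b t by (intro power_mono) auto
  moreover have "2 * (real d - 1) * (real d - 2) \<le> 4 * (real d - 2)\<^sup>2"
    using b mult_right_mono[of "real d - 1" "2 * (real d - 2)" "real d - 2"] by (simp add: power2_eq_square)
  moreover have "(real d - 2 + t)\<^sup>2 > 0" using b t by simp
  ultimately have "2 * (real d - 1) * (real d - 2) / (real d - 2 + t)\<^sup>2 \<le> 4"
    by (simp add: divide_le_eq)
  moreover have "2 * (real d - 1) * (real d - 2) / (real d - 2 + t)\<^sup>2 \<ge> 0" using b by simp
  ultimately show ?thesis by (simp add: Vpot_def)
qed

text \<open>The operator is the derivative of a first order operator, so solutions regular at \<open>0\<close> are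
  determined by their value there.\<close>

lemma regular_solution_unique_left:
  assumes d: "d \<ge> 3" and r: "0 < r" "r < 1"
    and v1: "PROP deriv_on {0..r} v v1"
    and v2: "PROP deriv_on {0..r} v1 v2"
    and eq: "\<And>x. x \<in> {0..r} \<Longrightarrow> hyp_op d x (v2 x) (v1 x) (v x) = Vpot d x * v x"
    and v0: "v 0 = 0" and x: "x \<in> {0..r}"
  shows "v x = 0"
proof -
  note VB = Vpot_bound[OF d]
  \<comment> \<open>The first order operator whose derivative is the hypergeometric operator. It
    vanishes at \<open>0\<close> when \<open>v 0 = 0\<close>, because \<open>x (1 - x)\<close>
    does.\<close>
  define W where "W = (\<lambda>x. x * (1 - x) * v1 x + (real d / 2 - x / 2) * v x)"
  have W': "(W has_real_derivative Vpot d t * v t) (at t within {0..r})" if t: "t \<in> {0..r}" for t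
  proof -
    have "(W has_real_derivative (t * (1 - t) * v2 t + (1 - t - t) * v1 t) + ((real d / 2 - t / 2) * v1 t + (- 1/2) * v t))
       (at t within {0..r})"
      unfolding W_def using t by (auto intro!: derivative_eq_intros v1 v2)
    also have "(t * (1 - t) * v2 t + (1 - t - t) * v1 t) + ((real d / 2 - t / 2) * v1 t + (- 1/2) * v t) = Vpot d t * v t"
      unfolding eq[OF t, symmetric] by (simp add: coefA_def coefB_def coefK_def field_simps)
    finally show ?thesis .
  qed
  \<comment> \<open>The rate \<open>8\<close> is twice the bound \<open>4\<close> on the potential:
    integrating \<open>Vpot d t * v t\<close> then costs only \<open>N / 2\<close> in the weighted
    norm, and the first order principle returns \<open>N \<le> N / 2\<close>.\<close>
  define Y where "Y = (\<lambda>t. exp (- 8 * t) * v t)"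
  have Y': "(Y has_real_derivative exp (- 8 * t) * (v1 t - 8 * v t)) (at t within {0..r})" if "t \<in> {0..r}" for t
    unfolding Y_def using that by (auto intro!: derivative_eq_intros v1 simp: algebra_simps)
  have "continuous_on {0..r} (\<lambda>t. \<bar>Y t\<bar>)" by (intro continuous_intros DERIV_continuous_on[OF Y'])
  then obtain z where z: "z \<in> {0..r}" "\<And>t. t \<in> {0..r} \<Longrightarrow> \<bar>Y t\<bar> \<le> \<bar>Y z\<bar>"
    using continuous_attains_sup[of "{0..r}" "\<lambda>t. \<bar>Y t\<bar>"] r by auto
  define N where "N = \<bar>Y z\<bar>"
  have N: "N \<ge> 0" by (simp add: N_def)
  have vN: "\<bar>v t\<bar> \<le> N * exp (8 * t)" if "t \<in> {0..r}" for t
  proof -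
    have "\<bar>v t\<bar> = \<bar>Y t\<bar> * exp (8 * t)" by (simp add: Y_def abs_mult exp_minus)
    also have "\<dots> \<le> N * exp (8 * t)" unfolding N_def by (intro mult_right_mono z that) auto
    finally show ?thesis .
  qed
  have WN: "\<bar>W t\<bar> \<le> N / 2 * exp (8 * t)" if t: "t \<in> {0..r}" for t
  proof -
    have "\<bar>W t - W 0\<bar> \<le> N / 2 * exp (8 * t) - N / 2 * exp (8 * 0)"
    proof (rule exp_growth_bound[OF W' _ _ t])
      show "((\<lambda>t. N / 2 * exp (8 * t)) has_real_derivative 4 * (N * exp (8 * s))) (at s within {0..r})" for s
        by (auto intro!: derivative_eq_intros)
      show "\<bar>Vpot d s * v s\<bar> \<le> 4 * (N * exp (8 * s))" if "s \<in> {0..r}" for s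
        unfolding abs_mult using VB[of s] vN[OF that] that by (intro mult_mono) auto
    qed
    then show ?thesis using v0 N by (simp add: W_def)
  qed
  have "\<bar>Y t\<bar> \<le> (N / 2) / 1" if "t \<in> {0..r}" for t
  proof (rule first_order_max[where al=0 and be=r and a="\<lambda>t. t * (1 - t)" and y=Y
        and m="\<lambda>t. real d / 2 - t / 2 + 8 * t * (1 - t)" and h="\<lambda>t. exp (- 8 * t) * W t"
        and y'="\<lambda>t. exp (- 8 * t) * (v1 t - 8 * v t)", OF _ Y'])
    fix t assume t: "t \<in> {0..r}"
    show "t * (1 - t) * (exp (- 8 * t) * (v1 t - 8 * v t)) + (real d / 2 - t / 2 + 8 * t * (1 - t)) * Y t
        = exp (- 8 * t) * W t"
      by (simp add: Y_def W_def algebra_simps)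
    have "0 \<le> 8 * t * (1 - t)" using t r by simp
    moreover have "1 \<le> real d / 2 - t / 2" using t r d by auto
    ultimately show "1 \<le> real d / 2 - t / 2 + 8 * t * (1 - t)" by linarith
    have "exp (- 8 * t) * \<bar>W t\<bar> \<le> exp (- 8 * t) * (N / 2 * exp (8 * t))" using WN[OF t] by (intro mult_left_mono) auto
    also have "\<dots> = N / 2" by (simp add: exp_minus)
    finally show "\<bar>exp (- 8 * t) * W t\<bar> \<le> N / 2" by (simp add: abs_mult)
  qed (use r that in auto)
  from this[OF z(1)] have "N = 0" using N by (simp add: N_def)
  then show ?thesis using vN[OF x] by simp
qed


text \<open>The light cone is singular, so vanishing data at \<open>1\<close> do not determine
  \<open>u\<close> in general; vanishing to high order does. After division by
  \<open>(x - 1) ^ p\<close> the first order equation acquires a zeroth order coefficient that grows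
  with \<open>p\<close> and dominates the potential.\<close>

lemma vanish_right:
  assumes d: "d \<ge> 3" and N: "N = d + 6"
    and P': "\<And>j x. j < N \<Longrightarrow> x \<in> {1..4} \<Longrightarrow> (P j has_real_derivative P (Suc j) x) (at x within {1..4})"
    and P1: "\<And>j. j < N \<Longrightarrow> P j 1 = 0" and K: "\<And>x. x \<in> {1..4} \<Longrightarrow> \<bar>P N x\<bar> \<le> K"
    and eq: "\<And>x. x \<in> {1..4} \<Longrightarrow>
      hyp_op d x (P 2 x) (P 1 x) (P 0 x) = Vpot d x * P 0 x"
    and x: "x \<in> {1..4}"
  shows "P 0 x = 0"
proof -
  have K0: "K \<ge> 0" using K[of 1] by auto
  have "\<bar>P (N - i) x\<bar> \<le> K * (x - 1) ^ i" if "i \<le> N" "x \<in> {1..4}" for i x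
    using that
  proof (induction i arbitrary: x)
    case 0
    then show ?case using K by simp
  next
    case (Suc i)
    have S: "Suc (N - Suc i) = N - i" "N - Suc i < N" using Suc.prems by auto
    have "norm (P (N - Suc i) x - P (N - Suc i) 1) \<le> (K * (x - 1) ^ i) * norm (x - 1)"
    proof (rule field_differentiable_bound[of "{1..x}" _ "P (N - i)"])
      fix z assume z: "z \<in> {1..x}"
      show "(P (N - Suc i) has_real_derivative P (N - i) z) (at z within {1..x})"
        by (rule has_field_derivative_subset[OF P'[OF S(2), unfolded S(1)]]) (use z Suc.prems in auto)
      have "\<bar>P (N - i) z\<bar> \<le> K * (z - 1) ^ i" using Suc z by auto
      also have "\<dots> \<le> K * (x - 1) ^ i" using z K0 by (intro mult_left_mono power_mono) auto
      finally show "norm (P (N - i) z) \<le> K * (x - 1) ^ i" by simp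
    qed (use Suc.prems in auto)
    then show ?case using P1[OF S(2)] Suc.prems by (simp add: algebra_simps)
  qed
  from this[of N] have uK: "\<bar>P 0 x\<bar> \<le> K * (x - 1) ^ N" if "x \<in> {1..4}" for x using that by simp
  \<comment> \<open>Two orders below \<open>N\<close>, so that \<open>u / (x - 1) ^ p\<close> still
    vanishes quadratically at \<open>1\<close> and is differentiable there with derivative
    \<open>0\<close>.\<close>
  define p where "p = d + 4"
  have Np: "N = p + 2" by (simp add: N p_def)
  define u where "u = P 0"
  define u1 where "u1 = P 1"
  have u': "(u has_real_derivative u1 x) (at x within {1..4})" if "x \<in> {1..4}" for x
    using P'[of 0 x] that N by (simp add: u_def u1_def)
  have u1': "(u1 has_real_derivative P 2 x) (at x within {1..4})" if "x \<in> {1..4}" for x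
    using P'[of 1 x] that N by (simp add: u1_def numeral_2_eq_2)
  define Z where "Z = (\<lambda>x. u x / (x - 1) ^ p)"
  \<comment> \<open>The value at \<open>1\<close> is set by hand; the quotient formula has a zero
    denominator there. \<open>Z 1 = 0\<close> holds by the convention on division and agrees with
    the limit.\<close>
  define Z' where "Z' = (\<lambda>x. if x = 1 then 0 else u1 x / (x - 1) ^ p - real p * u x / (x - 1) ^ (p + 1))"
  have Zb: "\<bar>Z x\<bar> \<le> K * (x - 1)\<^sup>2" if x: "x \<in> {1..4}" for x
  proof (cases "x = 1")
    case False
    then have pos: "(x - 1) ^ p > 0" using x by simp
    have "\<bar>u x\<bar> \<le> (K * (x - 1)\<^sup>2) * (x - 1) ^ p"
      using uK[OF x] by (simp add: u_def Np power_add algebra_simps power2_eq_square)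
    then show ?thesis using pos by (simp add: Z_def abs_divide pos_divide_le_eq)
  qed (simp add: Z_def p_def power_0_left)
  have Z1: "Z 1 = 0" using Zb[of 1] by simp
  have Zd: "(Z has_real_derivative Z' x) (at x within {1..4})" if x: "x \<in> {1..4}" for x
  proof (cases "x = 1")
    case True
    have "((\<lambda>y. (Z y - Z 1) / (y - 1)) \<longlongrightarrow> 0) (at 1 within {1..4})"
    proof (rule Lim_null_comparison)
      show "\<forall>\<^sub>F y in at 1 within {1..4}. norm ((Z y - Z 1) / (y - 1)) \<le> K * (y - 1)"
        unfolding eventually_at_filter
      proof (intro always_eventually allI impI)
        fix y :: real assume y: "y \<noteq> 1" "y \<in> {1..4}"
        have "\<bar>Z y\<bar> \<le> (K * (y - 1)) * (y - 1)" using Zb[OF y(2)] by (simp add: power2_eq_square)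
        then show "norm ((Z y - Z 1) / (y - 1)) \<le> K * (y - 1)"
          using y by (simp add: Z1 abs_divide pos_divide_le_eq)
      qed
      have "((\<lambda>y. K * (y - 1)) \<longlongrightarrow> K * (1 - 1)) (at 1 within {1..4})" by (intro tendsto_intros)
      then show "((\<lambda>y. K * (y - 1)) \<longlongrightarrow> 0) (at 1 within {1..4})" by simp
    qed
    then show ?thesis using True by (simp add: Z'_def has_field_derivative_iff)
  next
    case False
    have "p = Suc (p - 1)" by (simp add: p_def)
    then have pp: "(x - 1) ^ p = (x - 1) * (x - 1) ^ (p - 1)" by (metis power_Suc)
    have "(Z has_real_derivative (u1 x * (x - 1) ^ p - u x * (real p * (x - 1) ^ (p - 1))) / ((x - 1) ^ p * (x - 1) ^ p))
       (at x within {1..4})"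
      unfolding Z_def using False by (auto intro!: derivative_eq_intros u' x)
    moreover have "(u1 x * (x - 1) ^ p - u x * (real p * (x - 1) ^ (p - 1))) / ((x - 1) ^ p * (x - 1) ^ p) = Z' x"
    proof -
      have "(u1' * (y * w) - u' * (q * w)) / ((y * w) * (y * w)) = u1' / (y * w) - q * u' / (y * w * y)"
        if "y \<noteq> 0" "w \<noteq> 0" for u1' u' y w q :: real using that by (simp add: diff_divide_distrib ac_simps)
      from this[of "x - 1" "(x - 1) ^ (p - 1)" "u1 x" "u x" "real p"] False
      show ?thesis unfolding Z'_def power_add pp by simp
    qed
    ultimately show ?thesis by simp
  qed
  have "continuous_on {1..4} (\<lambda>t. \<bar>Z t\<bar>)" by (intro continuous_intros DERIV_continuous_on[OF Zd])
  then obtain z where z: "z \<in> {1..4}" "\<And>t. t \<in> {1..4} \<Longrightarrow> \<bar>Z t\<bar> \<le> \<bar>Z z\<bar>"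
    using continuous_attains_sup[of "{1..4}" "\<lambda>t. \<bar>Z t\<bar>"] by auto
  define M where "M = \<bar>Z z\<bar>"
  have M: "M \<ge> 0" by (simp add: M_def)
  have uM: "\<bar>u x\<bar> \<le> M * (x - 1) ^ p" if x: "x \<in> {1..4}" for x
  proof (cases "x = 1")
    case True
    then show ?thesis using uK[OF x] N by (simp add: u_def p_def power_0_left)
  next
    case False
    then have "(x - 1) ^ p > 0" using x by simp
    moreover have "\<bar>u x\<bar> / (x - 1) ^ p \<le> M" using z(2)[OF x] False x by (simp add: Z_def M_def abs_divide)
    ultimately show ?thesis by (simp add: pos_divide_le_eq)
  qed
  define W where "W = (\<lambda>x. x * (1 - x) * u1 x + (real d / 2 - x / 2) * u x)"
  have W': "(W has_real_derivative Vpot d t * u t) (at t within {1..4})" if t: "t \<in> {1..4}" for t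
  proof -
    have "(W has_real_derivative (t * (1 - t) * P 2 t + (1 - t - t) * u1 t) + ((real d / 2 - t / 2) * u1 t + (- 1/2) * u t))
       (at t within {1..4})"
      unfolding W_def using t by (auto intro!: derivative_eq_intros u' u1')
    also have "(t * (1 - t) * P 2 t + (1 - t - t) * u1 t) + ((real d / 2 - t / 2) * u1 t + (- 1/2) * u t) = Vpot d t * u t"
      unfolding u_def u1_def eq[OF t, symmetric] by (simp add: coefA_def coefB_def coefK_def field_simps)
    finally show ?thesis .
  qed
  have WM: "\<bar>W t\<bar> \<le> 4 * M / real (p + 1) * (t - 1) ^ (p + 1)" if t: "t \<in> {1..4}" for t
  proof -
    have "\<bar>W t - W 1\<bar> \<le> 4 * M / real (p + 1) * (t - 1) ^ (p + 1) - 4 * M / real (p + 1) * (1 - 1) ^ (p + 1)"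
    proof (rule exp_growth_bound[OF W' _ _ t])
      show "((\<lambda>t. 4 * M / real (p + 1) * (t - 1) ^ (p + 1)) has_real_derivative 4 * (M * (s - 1) ^ p)) (at s within {1..4})" for s
      proof -
        have "((\<lambda>t. t - 1) has_real_derivative 1) (at s within {1..4})" by (auto intro!: derivative_eq_intros)
        from DERIV_cmult[OF DERIV_power_Suc[OF this, of p], of "4 * M / real (p + 1)"]
        have "((\<lambda>t. 4 * M / real (p + 1) * (t - 1) ^ (p + 1)) has_real_derivative
           4 * M / (1 + real p) * ((1 + real p) * (s - 1) ^ p)) (at s within {1..4})" by (simp add: add.commute)
        then show ?thesis by (rule DERIV_cong) (simp add: add_nonneg_eq_0_iff)
      qed
      show "\<bar>Vpot d s * u s\<bar> \<le> 4 * (M * (s - 1) ^ p)" if "s \<in> {1..4}" for s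
        unfolding abs_mult using Vpot_bound[OF d, of s] uM[OF that] that by (intro mult_mono) auto
    qed
    moreover have "W 1 = 0" using uK[of 1] N by (simp add: W_def u_def power_0_left)
    ultimately show ?thesis by simp
  qed
  have "\<bar>Z t\<bar> \<le> (12 * M / real (p + 1)) / ((real d + 9) / 2)" if "t \<in> {1..4}" for t
  proof (rule first_order_max[where al=1 and be=4 and a="\<lambda>t. t * (t - 1)" and y=Z and y'=Z'
        and m="\<lambda>t. real p * t + t / 2 - real d / 2" and h="\<lambda>t. - (W t / (t - 1) ^ p)", OF _ Zd])
    fix t :: real assume t: "t \<in> {1..4}"
    show "t * (t - 1) * Z' t + (real p * t + t / 2 - real d / 2) * Z t = - (W t / (t - 1) ^ p)"
    proof (cases "t = 1")
      case False
      have "(t - 1) * (real p * u t / (t - 1) ^ (p + 1)) = real p * u t / (t - 1) ^ p"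
        using False by simp
      then have "(t - 1) * Z' t = ((t - 1) * u1 t - real p * u t) / (t - 1) ^ p"
        using False by (simp add: Z'_def right_diff_distrib diff_divide_distrib)
      then have "t * (t - 1) * Z' t = (t * (t - 1) * u1 t - t * real p * u t) / (t - 1) ^ p"
        by (simp add: algebra_simps)
      then have "t * (t - 1) * Z' t + (real p * t + t / 2 - real d / 2) * Z t
        = (t * (t - 1) * u1 t - t * real p * u t + (real p * t + t / 2 - real d / 2) * u t) / (t - 1) ^ p"
        by (simp add: Z_def add_divide_distrib)
      also have "t * (t - 1) * u1 t - t * real p * u t + (real p * t + t / 2 - real d / 2) * u t = - W t"
        by (simp add: W_def field_simps)
      finally show ?thesis by simp
    qed (simp add: Z1 p_def)
    have "real p * 1 \<le> real p * t" using t by (intro mult_left_mono) auto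
    moreover have "real p * 1 = real d + 4" by (simp add: p_def)
    ultimately have A: "real d + 4 \<le> real p * t" by (simp only:)
    have "(D + 9) / 2 \<le> Q + s / 2 - D / 2" if "D + 4 \<le> Q" "1 \<le> s" for D Q s :: real
      using that by (simp add: field_simps)
    from this[OF A, of t] show "(real d + 9) / 2 \<le> real p * t + t / 2 - real d / 2" using t by simp
    show "\<bar>- (W t / (t - 1) ^ p)\<bar> \<le> 12 * M / real (p + 1)"
    proof (cases "t = 1")
      case False
      then have pos: "(t - 1) ^ p > 0" using t by simp
      have "\<bar>W t\<bar> \<le> (4 * M / real (p + 1) * (t - 1)) * (t - 1) ^ p" using WM[OF t] by simp
      then have "\<bar>W t\<bar> / (t - 1) ^ p \<le> 4 * M / real (p + 1) * (t - 1)" using pos by (simp add: pos_divide_le_eq)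
      also have "\<dots> \<le> 4 * M / real (p + 1) * 3" using t M by (intro mult_left_mono) auto
      finally show ?thesis using t by (simp add: abs_divide)
    qed (use M p_def in \<open>simp add: power_0_left\<close>)
  qed (use that in auto)
  from this[OF z(1)] have "M \<le> (12 * M / real (p + 1)) / ((real d + 9) / 2)" by (simp only: M_def)
  moreover have "M * (q * e) \<le> M * 12" if "M \<le> (12 * M / q) / e" "q > 0" "e > 0" for q e :: real
    using that by (simp add: pos_le_divide_eq mult.commute mult.left_commute)
  ultimately have "M * (real (p + 1) * ((real d + 9) / 2)) \<le> M * 12"
    by (meson add_nonneg_pos half_gt_zero of_nat_0_le_iff of_nat_0_less_iff zero_less_numeral add_gr_0 zero_less_one)
  \<comment> \<open>The \<open>12\<close> is the bound \<open>4\<close> on the potential times the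
    length \<open>3\<close> of \<open>[1, 4]\<close>. Since \<open>d \<ge> 3\<close>, the gains
    \<open>p + 1\<close> from integration and \<open>(d + 9) / 2\<close> from the maximum principle
    multiply to at least \<open>48\<close>, which leaves \<open>M = 0\<close>.\<close>
  moreover have "real (p + 1) * ((real d + 9) / 2) \<ge> 8 * 6" using d by (intro mult_mono) (auto simp: p_def)
  ultimately have "M * 48 \<le> M * 12" using M mult_left_mono[of 48 "real (p + 1) * ((real d + 9) / 2)" M] by linarith
  then have "M = 0" using M by simp
  then show ?thesis using uM[OF x] by (simp add: u_def)
qed


text \<open>The factor \<open>x + b\<close> moves the exponents \<open>-1\<close> and
  \<open>2\<close> at the double pole \<open>x = - b\<close> of the potential to \<open>0\<close>
  and \<open>3\<close>. Thus the equation for \<open>(x + b) u\<close> has polynomial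
  coefficients.\<close>

lemma hyp_conjugation:
  fixes x b :: real
  assumes "b = real d - 2" "x + b \<noteq> 0"
  shows "q2 b x * ((x + b) * u2 + 2 * u1) + q1 b x * ((x + b) * u1 + u) + b * ((x + b) * u) =
    (x + b)\<^sup>2 * (hyp_op d x u2 u1 u - Vpot d x * u)"
proof -
  have V: "(x + b)\<^sup>2 * Vpot d x = - (2 * (b + 1) * b)"
    using assms by (simp add: Vpot_def add.commute)
  have "(x + b)\<^sup>2 * (hyp_op d x u2 u1 u - Vpot d x * u)
    = (x + b)\<^sup>2 * (hyp_op d x u2 u1 u) - ((x + b)\<^sup>2 * Vpot d x) * u"
    by (simp add: algebra_simps)
  also have "\<dots> = (x + b)\<^sup>2 * (x * (1 - x) * u2 + ((b + 4) / 2 - 5 / 2 * x) * u1 - u / 2) + 2 * (b + 1) * b * u"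
    unfolding V using assms(1) by (simp add: coefA_def coefB_def coefK_def)
  also have "\<dots> = q2 b x * ((x + b) * u2 + 2 * u1) + q1 b x * ((x + b) * u1 + u) + b * ((x + b) * u)"
    by (simp add: q1_def q2_def power2_eq_square power3_eq_cube field_simps)
  finally show ?thesis by simp
qed

text \<open>The multiple of \<open>kser d 0 x / (x + b)\<close> with the same value at
  \<open>0\<close> solves the same equation, so uniqueness applies to the difference. The series is
  controlled only for \<open>\<bar>x\<bar> < 1\<close>, hence the auxiliary interval
  \<open>[0, r]\<close> with \<open>x < r < 1\<close>.\<close>

lemma regular_solution_is_kser:
  assumes d: "d \<ge> 3" and b: "b = real d - 2"
    and u1: "PROP deriv_on {0..4} u u1"
    and u2: "PROP deriv_on {0..4} u1 u2"
    and eq: "\<And>x. x \<in> {0..4} \<Longrightarrow> hyp_op d x (u2 x) (u1 x) (u x) = Vpot d x * u x"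
    and x: "0 \<le> x" "x < 1"
  shows "(x + b) * u x = b * u 0 * kser d 0 x"
proof -
  define r where "r = (x + 1) / 2"
  have r: "0 < r" "r < 1" "x \<in> {0..r}" using x by (auto simp: r_def)
  have b1: "b \<ge> 1" using d b by simp
  define g where "g = (\<lambda>t. kser d 0 t / (t + b))"
  define g1 where "g1 = (\<lambda>t. (kser d 1 t - g t) / (t + b))"
  define g2 where "g2 = (\<lambda>t. (kser d 2 t - 2 * g1 t) / (t + b))"
  define C where "C = b * u 0"
  have nz: "t + b \<noteq> 0" if "t \<in> {0..r}" for t using that b1 by auto
  have k': "(kser d j has_real_derivative kser d (Suc j) t) (at t within {0..r})" if "t \<in> {0..r}" for t j
    using that r by (intro kser_deriv d) auto
  have k01: "(kser d 0 has_real_derivative kser d 1 t) (at t within {0..r})"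
       "(kser d 1 has_real_derivative kser d 2 t) (at t within {0..r})" if "t \<in> {0..r}" for t
    using k'[OF that, of 0] k'[OF that, of 1] by (auto simp: numeral_2_eq_2)
  have g': "(g has_real_derivative g1 t) (at t within {0..r})" if t: "t \<in> {0..r}" for t
    unfolding g_def using nz[OF t]
    by (auto intro!: derivative_eq_intros k01 t simp: g1_def g_def field_simps)
  have g1': "(g1 has_real_derivative g2 t) (at t within {0..r})" if t: "t \<in> {0..r}" for t
  proof -
    have "(g1 has_real_derivative ((kser d 2 t - g1 t) * (t + b) - (kser d 1 t - g t) * (1 + 0)) / ((t + b) * (t + b)))
        (at t within {0..r})"
      unfolding g1_def[abs_def]
      by (intro DERIV_divide DERIV_diff DERIV_add DERIV_ident DERIV_const k01(2) t nz g'[unfolded g1_def])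
    moreover have "kser d 1 t - g t = g1 t * (t + b)" using nz[OF t] by (simp add: g1_def)
    ultimately show ?thesis using nz[OF t] by (simp add: g2_def left_diff_distrib[symmetric])
  qed
  have "u x - C * g x = 0"
  proof (rule regular_solution_unique_left[OF d r(1,2) _ _ _ _ r(3)])
    fix t assume t: "t \<in> {0..r}"
    have t4: "t \<in> {0..4}" "\<bar>t\<bar> < 1" and sub: "{0..r} \<subseteq> {0..4}" using t r by auto
    show "((\<lambda>x. u x - C * g x) has_real_derivative u1 t - C * g1 t) (at t within {0..r})"
      by (intro DERIV_diff DERIV_cmult g' t has_field_derivative_subset[OF u1[OF t4(1)] sub])
    show "((\<lambda>x. u1 x - C * g1 x) has_real_derivative u2 t - C * g2 t) (at t within {0..r})"
      by (intro DERIV_diff DERIV_cmult g1' t has_field_derivative_subset[OF u2[OF t4(1)] sub])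
    have e: "(t + b) * g2 t + 2 * g1 t = kser d 2 t" "(t + b) * g1 t + g t = kser d 1 t" "(t + b) * g t = kser d 0 t"
      using nz[OF t] by (simp_all add: g2_def g1_def g_def)
    have "(t + b)\<^sup>2 * (hyp_op d t (g2 t) (g1 t) (g t) - Vpot d t * g t) = 0"
      unfolding hyp_conjugation[OF b nz[OF t], symmetric] e by (rule kser_ode[OF d t4(2) b])
    then have "hyp_op d t (g2 t) (g1 t) (g t) - Vpot d t * g t = 0"
      using nz[OF t] by simp
    then have ge: "Vpot d t * g t = hyp_op d t (g2 t) (g1 t) (g t)" by simp
    show "hyp_op d t (u2 t - C * g2 t) (u1 t - C * g1 t) (u t - C * g t)
      = Vpot d t * (u t - C * g t)"
      using eq[OF t4(1)] ge by (simp add: right_diff_distrib left_diff_distrib mult.left_commute[of _ C])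
         (simp add: algebra_simps)
  next
    have "kser d 0 0 = 1" by (simp add: kser_def)
    then show "u 0 - C * g 0 = 0" using b1 by (simp add: g_def C_def)
  qed
  then show ?thesis using nz[OF r(3)] by (simp add: g_def C_def field_simps)
qed

text \<open>Leibniz' rule, which breaks off because \<open>q2\<close> is cubic, \<open>q1\<close>
  quadratic and the last coefficient constant. For \<open>m = 0\<close> the index
  \<open>m - 1\<close> is truncated to \<open>0\<close>, but the coefficient in front of it is
  \<open>0\<close>.\<close>

lemma conjugated_ode_deriv:
  assumes H': "\<And>j x. j < N \<Longrightarrow> x \<in> {0..4} \<Longrightarrow> (H j has_real_derivative H (Suc j) x) (at x within {0..4})"
    and eq: "\<And>x. x \<in> {0..4} \<Longrightarrow> q2 b x * H 2 x + q1 b x * H 1 x + b * H 0 x = 0"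
    and m: "m + 2 \<le> N" and x: "x \<in> {0..4}"
  shows "q2 b x * H (m + 2) x + (real m * (b + 2 * (1 - b) * x - 3 * x\<^sup>2) + q1 b x) * H (m + 1) x
     + (real m * (real m - 1) / 2 * (2 * (1 - b) - 6 * x) + real m * (- 2 * b - x) + b) * H m x
     - (real m * (real m - 1) * (real m - 2) + real m * (real m - 1) / 2) * H (m - 1) x = 0"
  using m x
proof (induction m arbitrary: x)
  case 0
  then show ?case using eq by (simp add: numeral_2_eq_2)
next
  case (Suc m)
  let ?E = "\<lambda>x. q2 b x * H (m + 2) x + (real m * (b + 2 * (1 - b) * x - 3 * x\<^sup>2) + q1 b x) * H (m + 1) x
     + (real m * (real m - 1) / 2 * (2 * (1 - b) - 6 * x) + real m * (- 2 * b - x) + b) * H m x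
     - (real m * (real m - 1) * (real m - 2) + real m * (real m - 1) / 2) * H (m - 1) x"
  have Hd: "(H j has_real_derivative H (Suc j) x) (at x within {0..4})" if "j \<le> m + 2" for j
    using H'[of j x] that Suc.prems by simp
  \<comment> \<open>\<open>Suc (m - 1) = m\<close> fails only for \<open>m = 0\<close>, where the
    factor vanishes.\<close>
  have Hm: "(real m * (real m - 1) * (real m - 2) + real m * (real m - 1) / 2) * H (Suc (m - 1)) x =
      (real m * (real m - 1) * (real m - 2) + real m * (real m - 1) / 2) * H m x"
    by (cases m) auto
  have "(?E has_real_derivative
     (q2 b x * H (Suc (m + 2)) x + (b + 2 * (1 - b) * x - 3 * x\<^sup>2) * H (m + 2) x)
     + ((real m * (b + 2 * (1 - b) * x - 3 * x\<^sup>2) + q1 b x) * H (Suc (m + 1)) x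
         + (real m * (2 * (1 - b) - 6 * x) + (- 2 * b - x)) * H (m + 1) x)
     + ((real m * (real m - 1) / 2 * (2 * (1 - b) - 6 * x) + real m * (- 2 * b - x) + b) * H (Suc m) x
         + (real m * (real m - 1) / 2 * (- 6) + real m * (- 1)) * H m x)
     - (real m * (real m - 1) * (real m - 2) + real m * (real m - 1) / 2) * H (Suc (m - 1)) x)
     (at x within {0..4})"
    unfolding q2_def q1_def
    by (auto intro!: derivative_eq_intros Hd simp: power2_eq_square field_simps)
  moreover have "(?E has_real_derivative 0) (at x within {0..4})"
    by (rule has_field_derivative_transform_within[OF DERIV_const[of 0] zero_less_one Suc.prems(2)])
       (use Suc.IH Suc.prems(1) in simp)
  ultimately have F: "(q2 b x * H (Suc (m + 2)) x + (b + 2 * (1 - b) * x - 3 * x\<^sup>2) * H (m + 2) x)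
     + ((real m * (b + 2 * (1 - b) * x - 3 * x\<^sup>2) + q1 b x) * H (Suc (m + 1)) x
         + (real m * (2 * (1 - b) - 6 * x) + (- 2 * b - x)) * H (m + 1) x)
     + ((real m * (real m - 1) / 2 * (2 * (1 - b) - 6 * x) + real m * (- 2 * b - x) + b) * H (Suc m) x
         + (real m * (real m - 1) / 2 * (- 6) + real m * (- 1)) * H m x)
     - (real m * (real m - 1) * (real m - 2) + real m * (real m - 1) / 2) * H (Suc (m - 1)) x = 0"
    using no_isolated_unique[OF S4 Suc.prems(2)] by blast
  have "(q2 b x * H (Suc (m + 2)) x + (b + 2 * (1 - b) * x - 3 * x\<^sup>2) * H (m + 2) x)
     + ((real m * (b + 2 * (1 - b) * x - 3 * x\<^sup>2) + q1 b x) * H (Suc (m + 1)) x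
         + (real m * (2 * (1 - b) - 6 * x) + (- 2 * b - x)) * H (m + 1) x)
     + ((real m * (real m - 1) / 2 * (2 * (1 - b) - 6 * x) + real m * (- 2 * b - x) + b) * H (Suc m) x
         + (real m * (real m - 1) / 2 * (- 6) + real m * (- 1)) * H m x)
     - (real m * (real m - 1) * (real m - 2) + real m * (real m - 1) / 2) * H m x = 0"
    using F by (simp only: Hm)
  then show ?case by (simp add: numeral_2_eq_2 field_simps)
qed

text \<open>Regularity at \<open>0\<close> leaves on \<open>[0, 1)\<close> the multiples
  \<open>C\<close> of one series. The equation at \<open>x = 1\<close> forces \<open>C = 0\<close>,
  and then all derivatives of order below \<open>d + 6\<close> vanish at \<open>1\<close>, which
  forces \<open>u\<close> to vanish beyond.\<close>

lemma linearized_kernel_trivial: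
  assumes d: "d \<ge> 3" and u: "Ck_on (d + 6) {0..4} u" and T: "Teq d u (\<lambda>x. Vpot d x * u x)" and x: "x \<in> {0..4}"
  shows "u x = 0"
proof -
  define N where "N = d + 6"
  define b where "b = real d - 2"
  have b1: "b \<ge> 1" using d by (simp add: b_def)
  obtain P where P: "P 0 = u" "\<forall>j<N. \<forall>x\<in>{0..4}. (P j has_real_derivative P (Suc j) x) (at x within {0..4})"
      "\<forall>j\<le>N. Ck_on (N - j) {0..4} (P j)"
    using Ck_chain[OF u] unfolding N_def by blast
  obtain v1 v2 where v: "PROP deriv_on {0..4} u v1"
      "PROP deriv_on {0..4} v1 v2"
      "\<And>x. x \<in> {0..4} \<Longrightarrow> hyp_op d x (v2 x) (v1 x) (u x) = Vpot d x * u x"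
    by (fact TeqE[OF T])
  have "Ck_on N {0..4} (\<lambda>x. (x + b) * u x)"
    using u unfolding N_def by (intro Ck_on_mult Ck_on_add Ck_on_ident Ck_on_const)
  from Ck_chain[OF this]
  obtain H where H0: "H 0 = (\<lambda>x. (x + b) * u x)" and H': "\<And>j x. j < N \<Longrightarrow> x \<in> {0..4} \<Longrightarrow> (H j has_real_derivative H (Suc j) x) (at x within {0..4})"
      and HC: "\<And>j. j \<le> N \<Longrightarrow> Ck_on (N - j) {0..4} (H j)" by blast
  have H1: "H 1 x = (x + b) * v1 x + u x" if x: "x \<in> {0..4}" for x
  proof -
    have "((\<lambda>x. (x + b) * u x) has_real_derivative (x + b) * v1 x + u x) (at x within {0..4})"
      by (auto intro!: derivative_eq_intros v x)
    then show ?thesis using no_isolated_unique[OF S4 x] H'[of 0 x] x H0 by (auto simp: N_def)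
  qed
  have H2: "H 2 x = (x + b) * v2 x + 2 * v1 x" if x: "x \<in> {0..4}" for x
  proof -
    have "((\<lambda>x. (x + b) * v1 x + u x) has_real_derivative (x + b) * v2 x + 2 * v1 x) (at x within {0..4})"
      by (auto intro!: derivative_eq_intros v x)
    moreover have "((\<lambda>x. (x + b) * v1 x + u x) has_real_derivative H 2 x) (at x within {0..4})"
      by (rule has_field_derivative_transform_within[of "H 1", OF _ zero_less_one x])
         (use H'[of 1 x] x H1 in \<open>auto simp: N_def numeral_2_eq_2\<close>)
    ultimately show ?thesis using no_isolated_unique[OF S4 x] by blast
  qed
  have Heq: "q2 b x * H 2 x + q1 b x * H 1 x + b * H 0 x = 0" if x: "x \<in> {0..4}" for x
    unfolding H1[OF x] H2[OF x] H0
    by (subst hyp_conjugation[OF b_def]) (use v(3)[OF x] x b1 in auto)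
  define C where "C = b * u 0"
  have HK: "H j x = C * kser d j x" if "j \<le> N" "x \<in> {0<..<1}" for j x
    using that
  proof (induction j arbitrary: x)
    case 0
    then show ?case using regular_solution_is_kser[OF d b_def v(1) v(2) v(3), of x] by (simp add: H0 C_def)
  next
    case (Suc j)
    have x4: "x \<in> {0..4}" using Suc.prems by auto
    have "at x within {0..4} = at x" by (rule at_within_Icc_at) (use Suc.prems in auto)
    then have 1: "(H j has_real_derivative H (Suc j) x) (at x)" using H'[of j x] Suc.prems x4 by simp
    have "((\<lambda>x. C * kser d j x) has_real_derivative C * kser d (Suc j) x) (at x)"
      by (intro DERIV_cmult kser_deriv d) (use Suc.prems in auto)
    moreover have "((\<lambda>x. C * kser d j x) has_real_derivative H (Suc j) x) (at x)"
      by (rule has_field_derivative_transform_within_open[OF 1 open_greaterThanLessThan Suc.prems(2)])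
         (use Suc in auto)
    ultimately show ?case using DERIV_unique by blast
  qed
  have C0: "C = 0"
  proof (rule ccontr)
    assume C: "C \<noteq> 0"
    \<comment> \<open>The series represents \<open>H j\<close> only for \<open>x < 1\<close>. The
      strict negative bound survives in the limit because \<open>H j\<close> is continuous across
      the light cone.\<close>
    have neg: "H j 1 / C < 0" if j: "1 \<le> j" "j \<le> N" for j
    proof -
      have "H j 1 / C \<le> (diffs ^^ j) (kcoef d) 0"
      proof (rule continuous_le_on_closure[of "{0<..<1}" "\<lambda>x. H j x / C" 1])
        have "continuous_on {0..4} (H j)" using HC[OF j(2)] by (rule Ck_on_imp_continuous)
        then have "continuous_on {0..1} (H j)" by (rule continuous_on_subset) auto
        then show "continuous_on (closure {0<..<1}) (\<lambda>x. H j x / C)"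
          using C by (auto intro!: continuous_intros)
        show "H j x / C \<le> (diffs ^^ j) (kcoef d) 0" if "x \<in> {0<..<1}" for x
          using HK[OF j(2) that] C kser_le[OF d j(1), of x] that by simp
      qed simp
      also have "\<dots> < 0" using diffs_kcoef_nonpos[OF d] j by simp
      finally show ?thesis .
    qed
    \<comment> \<open>At \<open>x = 1\<close> the top coefficient \<open>q2\<close> vanishes and a
      relation between three consecutive derivatives remains. Here
      \<open>e1 = - (d - 1) (d - (d - 3) / 2)\<close>, negative by the same threshold as in the
      maximum principle; \<open>e2\<close> is negative and \<open>e3\<close> nonnegative. Three
      negative derivatives then make the sum positive.\<close>
    define e1 where "e1 = real d * (b + 2 * (1 - b) * 1 - 3 * 1\<^sup>2) + q1 b 1"
    define e2 where "e2 = real d * (real d - 1) / 2 * (2 * (1 - b) - 6 * 1) + real d * (- 2 * b - 1) + b"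
    define e3 where "e3 = real d * (real d - 1) * (real d - 2) + real d * (real d - 1) / 2"
    have "q2 b 1 * H (d + 2) 1 + e1 * H (d + 1) 1 + e2 * H d 1 - e3 * H (d - 1) 1 = 0"
      unfolding e1_def e2_def e3_def by (rule conjugated_ode_deriv[OF H' Heq]) (auto simp: N_def)
    moreover have "q2 b 1 = 0" by (simp add: q2_def)
    ultimately have s0: "e1 * (H (d + 1) 1 / C) + e2 * (H d 1 / C) - e3 * (H (d - 1) 1 / C) = 0"
      using C by (simp add: field_simps)
    have dr: "real d = b + 2" by (simp add: b_def)
    have "e1 = - ((b + 1) * (b + 2 - b / 2 + 1/2))"
      unfolding e1_def dr q1_def by (simp add: power2_eq_square field_simps)
    then have "e1 < 0" using b1 by (simp add: mult_pos_pos)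
    moreover have "e2 < 0"
    proof -
      have "e2 = - ((b + 2) * (b + 1) * (2 + b) + (b + 2) * (2 * b + 1) - b)"
        unfolding e2_def dr by (simp add: field_simps)
      moreover have "(b + 2) * (b + 1) * (2 + b) > 0" "(b + 2) * (2 * b + 1) > b"
        using b1 by (auto simp: algebra_simps intro!: add_pos_nonneg)
      ultimately show ?thesis by linarith
    qed
    moreover have "e3 \<ge> 0" using d by (simp add: e3_def)
    moreover have "H (d + 1) 1 / C < 0" "H d 1 / C < 0" "H (d - 1) 1 / C < 0"
      using d by (auto intro!: neg simp: N_def)
    ultimately have "e1 * (H (d + 1) 1 / C) > 0" "e2 * (H d 1 / C) > 0" "e3 * (H (d - 1) 1 / C) \<le> 0"
      by (blast intro: mult_neg_neg mult_nonneg_nonpos less_imp_le)+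
    then show False using s0 by linarith
  qed
  have u01: "u x = 0" if "x \<in> {0..1}" for x
  proof -
    have z: "u x = 0" if "x \<in> {0<..<1}" for x
      using HK[of 0 x] that C0 b1 by (auto simp: H0)
    have cu: "continuous_on {0..1} u"
      using Ck_on_imp_continuous[OF u] by (rule continuous_on_subset) auto
    have "u x = 0"
      by (rule continuous_constant_on_closure[of "{0<..<1}"]) (use cu z that in auto)
    then show ?thesis .
  qed
  \<comment> \<open>At \<open>x = 1\<close> the derivatives can be computed from the left.
    Regularity across the cone thus passes the vanishing on to the other side.\<close>
  have P0: "P j x = 0" if "j \<le> N" "x \<in> {0..1}" for j x
    using that
  proof (induction j arbitrary: x)
    case 0
    then show ?case using u01 P(1) by simp
  next
    case (Suc j)
    have "(P j has_real_derivative P (Suc j) x) (at x within {0..4})" using P(2) Suc.prems by auto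
    then have 1: "(P j has_real_derivative P (Suc j) x) (at x within {0..1})"
      by (rule has_field_derivative_subset) auto
    have "(P j has_real_derivative 0) (at x within {0..1})"
      by (rule has_field_derivative_transform_within[OF DERIV_const[of 0] zero_less_one Suc.prems(2)])
         (use Suc in auto)
    then show ?case using no_isolated_unique[OF no_isolated_Icc[of 0 1] Suc.prems(2) 1] by simp
  qed
  have "continuous_on {0..4} (P N)" using P(3) by (auto intro: Ck_on_imp_continuous)
  then have "continuous_on {1..4} (P N)" by (rule continuous_on_subset) auto
  then have "bounded (P N ` {1..4})" by (intro compact_imp_bounded compact_continuous_image) auto
  then obtain K where "\<forall>x\<in>{1..4}. \<bar>P N x\<bar> \<le> K" unfolding bounded_iff by auto
  then have K: "\<And>x. x \<in> {1..4} \<Longrightarrow> \<bar>P N x\<bar> \<le> K" by blast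
  show ?thesis
  proof (cases "x \<le> 1")
    case False
    have "P 0 x = 0"
    proof (rule vanish_right[OF d N_def, of P K])
      show "(P j has_real_derivative P (Suc j) x) (at x within {1..4})" if "j < N" "x \<in> {1..4}" for j x
        by (rule has_field_derivative_subset[of _ _ _ "{0..4}"]) (use P(2) that in auto)
      show "P j 1 = 0" if "j < N" for j using P0 that by simp
      fix x :: real assume "x \<in> {1..4}"
      then have x: "x \<in> {0..4}" by auto
      have 1: "v1 x = P 1 x" if "x \<in> {0..4}" for x
        using no_isolated_unique[OF S4 that v(1)[OF that], of "P 1 x"] P(1,2) that by (auto simp: N_def)
      have "(P 1 has_real_derivative v2 x) (at x within {0..4})"
        using has_field_derivative_transform_within[OF v(2)[OF x] zero_less_one x] 1 by blast
      then have 2: "v2 x = P 2 x"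
        using no_isolated_unique[OF S4 x, of "P 1" "v2 x" "P 2 x"] P(2) x by (auto simp: numeral_2_eq_2 N_def)
      show "hyp_op d x (P 2 x) (P 1 x) (P 0 x) = Vpot d x * P 0 x"
        using v(3)[OF x] 1[OF x] 2 P(1) by simp
    qed (use K False x in auto)
    then show ?thesis using P(1) by simp
  qed (use u01 x in auto)
qed

section \<open>The Fredholm alternative in \<open>C\<^sup>n\<close>\<close>

text \<open>The infimum of all bounds is itself a bound because \<open>Cb\<close> is closed. It
  plays the role of the norm of \<open>u\<close>, which is needed to normalize sequences.\<close>

lemma Cb_least_bound:
  assumes S: "no_isolated S" "compact S" "S \<noteq> {}" and u: "Ck_on n S u"
  obtains N where "N \<ge> 0" "Cb S n N u" "\<And>L. L < N \<Longrightarrow> \<not> Cb S n L u"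
proof -
  define B where "B = {L. Cb S n L u}"
  have ne: "B \<noteq> {}" using Ck_on_imp_Cb[OF u S(2)] by (auto simp: B_def)
  have nonneg: "0 \<le> L" if "L \<in> B" for L using that Cb_nonneg S(3) by (auto simp: B_def)
  then have bdd: "bdd_below B" by (rule bdd_belowI)
  have "Cb S n (Inf B + et) u" if "et > 0" for et
  proof -
    have "\<exists>L\<in>B. L < Inf B + et" using that ne bdd by (simp add: cInf_less_iff[symmetric])
    then show ?thesis using Cb_mono less_imp_le unfolding B_def by blast
  qed
  then have "Cb S n (Inf B) u" by (rule Cb_closed[OF S(1)])
  moreover have "\<not> Cb S n L u" if "L < Inf B" for L
    using cInf_lower[OF _ bdd, of L] that by (auto simp: B_def)
  moreover have "Inf B \<ge> 0" using ne nonneg by (rule cInf_greatest)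
  ultimately show ?thesis using that by blast
qed

lemma Cb_scale:
  assumes "Cb S n K u" "c > 0" shows "Cb S n (K / c) (\<lambda>x. u x / c)"
  using Cb_cmult[OF assms(1), of "1 / c"] assms(2) by simp

lemma Cb_unscale:
  assumes "Cb S n K (\<lambda>x. u x / c)" "c > 0" shows "Cb S n (c * K) u"
  using Cb_cmult[OF assms(1), of c] assms(2) by (simp add: field_simps)

text \<open>The setting of the Riesz theory for \<open>1 - K\<close> on \<open>C^n\<close>, with
  norms expressed through \<open>Cb\<close>. Elements of \<open>X\<close> vanish outside the
  interval, so they are determined by their values on it, and linearity and injectivity can be
  stated as equalities of functions.\<close>

locale compact_operator =
  fixes a b :: real and n :: nat and K :: "(real \<Rightarrow> real) \<Rightarrow> real \<Rightarrow> real" and X :: "(real \<Rightarrow> real) set" and M :: real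
  assumes ab: "a < b"
    and X: "X = {u. Ck_on n {a..b} u \<and> (\<forall>x. x \<notin> {a..b} \<longrightarrow> u x = 0)}"
    and KX: "u \<in> X \<Longrightarrow> K u \<in> X"
    and K_lin: "u \<in> X \<Longrightarrow> v \<in> X \<Longrightarrow> K (\<lambda>x. al * u x + be * v x) = (\<lambda>x. al * K u x + be * K v x)"
    and K_bdd: "u \<in> X \<Longrightarrow> Cb {a..b} n kp u \<Longrightarrow> Cb {a..b} n (M * kp) (K u)" and M: "M \<ge> 0"
    and K_compact: "\<And>u. (\<And>i. u i \<in> X) \<Longrightarrow> (\<And>i. Cb {a..b} n 1 (u i)) \<Longrightarrow>
        \<exists>r::nat\<Rightarrow>nat. strict_mono r \<and> Cb_Cauchy {a..b} n (\<lambda>i. K (u (r i)))"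
    and inj: "u \<in> X \<Longrightarrow> K u = u \<Longrightarrow> u = (\<lambda>x. 0)"
begin

abbreviation "I \<equiv> {a..b}"

definition A :: "(real \<Rightarrow> real) \<Rightarrow> real \<Rightarrow> real" where "A u = (\<lambda>x. u x - K u x)"

lemma ni: "no_isolated I" by (rule no_isolated_Icc[OF ab])

lemma X_lin: "u \<in> X \<Longrightarrow> v \<in> X \<Longrightarrow> (\<lambda>x. al * u x + be * v x) \<in> X"
  unfolding X by (auto intro!: Ck_on_add Ck_on_cmult)

lemma X_diff: "u \<in> X \<Longrightarrow> v \<in> X \<Longrightarrow> (\<lambda>x. u x - v x) \<in> X"
  using X_lin[of u v 1 "-1"] by simp

lemma X_Ck: "u \<in> X \<Longrightarrow> Ck_on n I u" by (simp add: X)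

lemma X_eqI: "u \<in> X \<Longrightarrow> v \<in> X \<Longrightarrow> (\<And>x. x \<in> I \<Longrightarrow> u x = v x) \<Longrightarrow> u = v"
  unfolding X by (rule ext) (metis (mono_tags, lifting) mem_Collect_eq)

lemma AX: "u \<in> X \<Longrightarrow> A u \<in> X"
  unfolding A_def by (rule X_diff[OF _ KX])

lemma A_lin: "u \<in> X \<Longrightarrow> v \<in> X \<Longrightarrow> A (\<lambda>x. al * u x + be * v x) = (\<lambda>x. al * A u x + be * A v x)"
  by (simp add: A_def K_lin algebra_simps)

lemma A_diff: "u \<in> X \<Longrightarrow> v \<in> X \<Longrightarrow> A (\<lambda>x. u x - v x) = (\<lambda>x. A u x - A v x)"
  using A_lin[of u v 1 "-1"] by simp

lemma K_diff: "u \<in> X \<Longrightarrow> v \<in> X \<Longrightarrow> K (\<lambda>x. u x - v x) = (\<lambda>x. K u x - K v x)"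
  using K_lin[of u v 1 "-1"] by simp

lemma zero_X: "(\<lambda>x. 0) \<in> X"
  by (simp add: X Ck_on_const)

lemma X_scale: "u \<in> X \<Longrightarrow> (\<lambda>x. u x / c) \<in> X"
  using X_lin[OF _ zero_X, of u "1/c" 0] by simp

lemma A_scale: "u \<in> X \<Longrightarrow> A (\<lambda>x. u x / c) = (\<lambda>x. A u x / c)"
  using A_lin[OF _ zero_X, of u "1/c" 0] by simp

lemma Cauchy_limit_X:
  assumes "\<And>i. u i \<in> X" "Cb_Cauchy I n u"
  obtains w where "w \<in> X" "Cb_lim I n u w"
proof -
  obtain v where v: "Cb_lim I n u v" using Cb_complete[OF ab assms(2)] X_Ck[OF assms(1)] by blast
  define w where "w = (\<lambda>x. if x \<in> I then v x else 0)"
  have w: "Cb_lim I n u w"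
    unfolding Cb_lim_def
  proof (intro allI impI)
    fix et :: real assume "et > 0"
    then obtain N where "\<forall>i\<ge>N. Cb I n et (\<lambda>x. u i x - v x)" using v unfolding Cb_lim_def by blast
    moreover have "Cb I n et (\<lambda>x. u i x - w x)" if "Cb I n et (\<lambda>x. u i x - v x)" for i
      by (rule Cb_cong[OF _ that]) (simp add: w_def)
    ultimately show "\<exists>N. \<forall>i\<ge>N. Cb I n et (\<lambda>x. u i x - w x)" by blast
  qed
  have "w \<in> X" using Cb_lim_Ck[OF w X_Ck[OF assms(1)]] by (auto simp: X w_def)
  with w show ?thesis using that by blast
qed

lemma K_lim:
  assumes "\<And>i. u i \<in> X" "w \<in> X" "Cb_lim I n u w"
  shows "Cb_lim I n (\<lambda>i. K (u i)) (K w)"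
  unfolding Cb_lim_def
proof (intro allI impI)
  fix et :: real assume et: "et > 0"
  have pos: "et / (M + 1) > 0" using et M by simp
  then obtain N where N: "\<forall>i\<ge>N. Cb I n (et / (M + 1)) (\<lambda>x. u i x - w x)"
    using assms(3) unfolding Cb_lim_def by blast
  have le: "M * (et / (M + 1)) \<le> et" using M et by (simp add: field_simps)
  have "Cb I n et (\<lambda>x. K (u i) x - K w x)" if "i \<ge> N" for i
    using Cb_mono[OF K_bdd[OF X_diff[OF assms(1,2)] N[rule_format, OF that]] le]
    by (simp add: K_diff[OF assms(1,2)])
  then show "\<exists>N. \<forall>i\<ge>N. Cb I n et (\<lambda>x. K (u i) x - K w x)" by blast
qed

text \<open>Otherwise there are \<open>w i\<close> of norm between \<open>1/2\<close> and
  \<open>1\<close> with \<open>A (w i)\<close> tending to \<open>0\<close>. Along a subsequence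
  \<open>K (w i)\<close> converges, hence so does \<open>w i = A (w i) + K (w i)\<close>; the limit
  is fixed by \<open>K\<close>, so it is \<open>0\<close>, against the lower bound on the
  norm.\<close>

lemma bounded_below: "\<exists>c>0. \<forall>u\<in>X. \<forall>kp. Cb I n kp (A u) \<longrightarrow> Cb I n (c * kp) u"
proof (rule ccontr)
  assume neg: "\<not> ?thesis"
  \<comment> \<open>A counterexample \<open>u\<close> to the constant \<open>Suc i\<close> is
    divided by its least bound \<open>N\<close>. The quotient has bound \<open>1\<close> but not
    \<open>1/2\<close>, and \<open>A\<close> of it is bounded by \<open>1 / Suc i\<close>.\<close>
  have "\<exists>w. w \<in> X \<and> Cb I n 1 w \<and> Cb I n (inverse (real (Suc i))) (A w) \<and> \<not> Cb I n (1/2) w" for i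
  proof -
    obtain u kp where u: "u \<in> X" "Cb I n kp (A u)" "\<not> Cb I n (real (Suc i) * kp) u"
      using neg of_nat_0_less_iff zero_less_Suc by blast
    obtain N where N: "N \<ge> 0" "Cb I n N u" "\<And>L. L < N \<Longrightarrow> \<not> Cb I n L u"
      using Cb_least_bound[OF ni _ _ X_Ck[OF u(1)]] ab by auto
    have kp: "kp \<ge> 0" using Cb_nonneg[OF u(2)] ab by simp
    have lt: "real (Suc i) * kp < N" using u(3) Cb_mono[OF N(2)] by (meson not_le)
    then have N0: "N > 0" using kp by (meson le_less_trans mult_nonneg_nonneg of_nat_0_le_iff)
    let ?w = "\<lambda>x. u x / N"
    have "Cb I n 1 ?w" using Cb_scale[OF N(2) N0] N0 by simp
    moreover have "Cb I n (inverse (real (Suc i))) (A ?w)"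
      unfolding A_scale[OF u(1)] using lt N0
      by (intro Cb_mono[OF Cb_scale[OF u(2) N0]]) (simp add: field_simps)
    moreover have "\<not> Cb I n (1/2) ?w" using Cb_unscale[OF _ N0, of I n "1/2" u] N(3)[of "N * (1/2)"] N0 by auto
    ultimately show ?thesis using X_scale[OF u(1)] by blast
  qed
  then obtain w where w: "\<And>i. w i \<in> X" "\<And>i. Cb I n 1 (w i)"
    "\<And>i. Cb I n (inverse (real (Suc i))) (A (w i))" "\<And>i. \<not> Cb I n (1/2) (w i)"
    by metis
  obtain r where r: "strict_mono (r :: nat \<Rightarrow> nat)" "Cb_Cauchy I n (\<lambda>i. K (w (r i)))"
    using K_compact[of w] w(1,2) by blast
  have Asmall: "\<exists>N. \<forall>i\<ge>N. Cb I n et (A (w (r i)))" if et: "et > 0" for et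
  proof -
    obtain N where N: "inverse (real (Suc N)) < et" using reals_Archimedean[OF et] by blast
    have "Cb I n et (A (w (r i)))" if "i \<ge> N" for i
    proof (rule Cb_mono[OF w(3)])
      have "N \<le> r i" using that seq_suble[OF r(1), of i] by simp
      then have "inverse (real (Suc (r i))) \<le> inverse (real (Suc N))" by (intro le_imp_inverse_le) auto
      then show "inverse (real (Suc (r i))) \<le> et" using N by linarith
    qed
    then show ?thesis by blast
  qed
  have "Cb_Cauchy I n (\<lambda>i. w (r i))"
    unfolding Cb_Cauchy_def
  proof (intro allI impI)
    fix et :: real assume "et > 0"
    then obtain N where N: "\<forall>i\<ge>N. Cb I n (et/4) (A (w (r i)))" using Asmall[of "et/4"] by auto
    obtain N' where N': "\<forall>i\<ge>N'. \<forall>j\<ge>N'. Cb I n (et/2) (\<lambda>x. K (w (r i)) x - K (w (r j)) x)"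
      using r(2) \<open>et > 0\<close> unfolding Cb_Cauchy_def by (meson half_gt_zero)
    have "Cb I n et (\<lambda>x. w (r i) x - w (r j) x)" if "i \<ge> max N N'" "j \<ge> max N N'" for i j
    proof -
      have "Cb I n ((et/4 + et/4) + et/2) (\<lambda>x. (A (w (r i)) x - A (w (r j)) x) + (K (w (r i)) x - K (w (r j)) x))"
        using N N' that by (intro Cb_add Cb_diff) auto
      then show ?thesis by (simp add: A_def)
    qed
    then show "\<exists>N. \<forall>i\<ge>N. \<forall>j\<ge>N. Cb I n et (\<lambda>x. w (r i) x - w (r j) x)" by blast
  qed
  then obtain v where v: "v \<in> X" "Cb_lim I n (\<lambda>i. w (r i)) v" using Cauchy_limit_X w(1) by metis
  have Kv: "Cb_lim I n (\<lambda>i. K (w (r i))) (K v)" by (rule K_lim[OF w(1) v])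
  have "K v = v"
  proof (rule X_eqI[OF KX[OF v(1)] v(1)])
    fix x assume x: "x \<in> I"
    have "(\<lambda>i. A (w (r i)) x) \<longlonglongrightarrow> v x - K v x"
      unfolding A_def by (intro tendsto_diff Cb_lim_pointwise[OF v(2) x] Cb_lim_pointwise[OF Kv x])
    moreover have "(\<lambda>i. A (w (r i)) x) \<longlonglongrightarrow> 0"
    proof (rule LIMSEQ_I)
      fix e :: real assume "e > 0"
      then obtain N where "\<forall>i\<ge>N. Cb I n (e/2) (A (w (r i)))" using Asmall[of "e/2"] by auto
      then have "\<forall>i\<ge>N. \<bar>A (w (r i)) x\<bar> \<le> e/2" using Cb_bound x by blast
      then show "\<exists>N. \<forall>i\<ge>N. norm (A (w (r i)) x - 0) < e" using \<open>e > 0\<close> by (intro exI[of _ N]) force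
    qed
    ultimately have "v x - K v x = 0" by (rule LIMSEQ_unique)
    then show "K v x = v x" by simp
  qed
  then have "v = (\<lambda>x. 0)" by (rule inj[OF v(1)])
  then have "\<exists>N. \<forall>i\<ge>N. Cb I n (1/2) (\<lambda>x. w (r i) x - 0)"
    using v(2)[unfolded Cb_lim_def, rule_format, of "1/2"] by simp
  then obtain N where "\<forall>i\<ge>N. Cb I n (1/2) (\<lambda>x. w (r i) x - 0)" by blast
  then show False using w(4)[of "r N"] by simp
qed

definition R :: "nat \<Rightarrow> (real \<Rightarrow> real) set" where "R k = (A ^^ k) ` X"

lemma Ak_X: "u \<in> X \<Longrightarrow> (A ^^ k) u \<in> X"
  by (induction k) (auto intro: AX)

lemma Ak_lin: "u \<in> X \<Longrightarrow> v \<in> X \<Longrightarrow>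
    (A ^^ k) (\<lambda>x. al * u x + be * v x) = (\<lambda>x. al * (A ^^ k) u x + be * (A ^^ k) v x)"
  by (induction k) (auto simp: A_lin Ak_X)

lemma R_lin: "u \<in> R k \<Longrightarrow> v \<in> R k \<Longrightarrow> (\<lambda>x. al * u x + be * v x) \<in> R k"
  unfolding R_def by (auto simp flip: Ak_lin intro!: imageI X_lin)

lemma R_sub_X: "R k \<subseteq> X" unfolding R_def using Ak_X by auto

lemma R_A: "u \<in> R k \<Longrightarrow> A u \<in> R (Suc k)" unfolding R_def by auto

lemma R_Suc: "R (Suc k) \<subseteq> R k"
  unfolding R_def by (auto simp: funpow_Suc_right AX simp del: funpow.simps)

lemma R_antimono: "j \<le> k \<Longrightarrow> R k \<subseteq> R j"
  by (induction rule: inc_induct) (use R_Suc in blast)+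

text \<open>If \<open>f\<close> is not attained, the iterates \<open>(A ^^ k) f\<close> stay at
  positive distance from the next range \<open>R (Suc k)\<close>. Riesz' lemma then provides
  elements \<open>y k\<close> of \<open>R k\<close> with bound \<open>1\<close> and farther than
  \<open>2/3\<close> from \<open>R (Suc k)\<close>; their images under \<open>K\<close> stay apart,
  against compactness.\<close>

lemma A_surj:
  assumes f: "f \<in> X" shows "\<exists>u\<in>X. A u = f"
proof (rule ccontr)
  assume nosol: "\<not> ?thesis"
  obtain c where c: "c > 0" "\<And>u kp. u \<in> X \<Longrightarrow> Cb I n kp (A u) \<Longrightarrow> Cb I n (c * kp) u"
    using bounded_below by blast
  have ck: "Cb I n (c ^ k * kp) u" if "u \<in> X" "Cb I n kp ((A ^^ k) u)" for u k kp
    using that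
  proof (induction k arbitrary: kp)
    case (Suc k)
    have "Cb I n (c * kp) ((A ^^ k) u)" using c(2)[OF Ak_X[OF Suc.prems(1)], of kp k] Suc.prems(2) by simp
    then have "Cb I n (c ^ k * (c * kp)) u" by (rule Suc.IH[OF Suc.prems(1)])
    then show ?case by (simp add: mult.assoc mult.left_commute)
  qed simp
  \<comment> \<open>Otherwise some \<open>A (u i)\<close> approximate \<open>f\<close>, because the
    lower bound for \<open>A\<close>, used \<open>k\<close> times, cancels \<open>A ^^ k\<close>. By
    the same bound the \<open>u i\<close> are Cauchy, and their limit solves the equation.\<close>
  have dist: "\<exists>de>0. \<forall>w\<in>R (Suc k). \<not> Cb I n de (\<lambda>x. (A ^^ k) f x - w x)" for k
  proof (rule ccontr)
    assume *: "\<not> ?thesis"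
    have "\<exists>u. u \<in> X \<and> Cb I n (inverse (real (Suc i))) (\<lambda>x. f x - A u x)" for i
    proof -
      define de where "de = inverse (real (Suc i)) / c ^ k"
      have "de > 0" using c(1) by (simp add: de_def)
      then obtain w where w: "w \<in> R (Suc k)" "Cb I n de (\<lambda>x. (A ^^ k) f x - w x)" using * by blast
      then obtain u where u: "u \<in> X" "w = (A ^^ k) (A u)"
        unfolding R_def by (auto simp: funpow_Suc_right simp del: funpow.simps)
      have "(A ^^ k) (\<lambda>x. f x - A u x) = (\<lambda>x. (A ^^ k) f x - w x)"
        using Ak_lin[OF f AX[OF u(1)], of k 1 "-1"] u(2) by simp
      then have "Cb I n (c ^ k * de) (\<lambda>x. f x - A u x)" using w(2) by (intro ck X_diff f AX u) simp
      then show ?thesis using u(1) c(1) by (auto simp: de_def)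
    qed
    then obtain u where u: "\<And>i. u i \<in> X" "\<And>i. Cb I n (inverse (real (Suc i))) (\<lambda>x. f x - A (u i) x)" by metis
    have small: "\<exists>N. \<forall>i\<ge>N. inverse (real (Suc i)) \<le> et" if "et > 0" for et :: real
    proof -
      obtain N where N: "inverse (real (Suc N)) < et" using reals_Archimedean[OF \<open>et > 0\<close>] by blast
      have "inverse (real (Suc i)) \<le> et" if "i \<ge> N" for i
      proof -
        have "inverse (real (Suc i)) \<le> inverse (real (Suc N))" using that by (intro le_imp_inverse_le) auto
        then show ?thesis using N by linarith
      qed
      then show ?thesis by blast
    qed
    have "Cb_Cauchy I n u"
      unfolding Cb_Cauchy_def
    proof (intro allI impI)
      fix et :: real assume et: "et > 0"
      then obtain N where N: "\<forall>i\<ge>N. inverse (real (Suc i)) \<le> et / (2 * c)" using small[of "et / (2 * c)"] c(1) by auto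
      have "Cb I n et (\<lambda>x. u i x - u j x)" if "i \<ge> N" "j \<ge> N" for i j
      proof -
        have "Cb I n (et / (2 * c) + et / (2 * c)) (\<lambda>x. (f x - A (u j) x) - (f x - A (u i) x))"
          using N that by (intro Cb_diff Cb_mono[OF u(2)]) auto
        then have "Cb I n (et / c) (A (\<lambda>x. u i x - u j x))" by (simp add: A_diff[OF u(1) u(1)])
        then have "Cb I n (c * (et / c)) (\<lambda>x. u i x - u j x)" by (intro c(2) X_diff u)
        then show ?thesis using c(1) by simp
      qed
      then show "\<exists>N. \<forall>i\<ge>N. \<forall>j\<ge>N. Cb I n et (\<lambda>x. u i x - u j x)" by blast
    qed
    then obtain v where v: "v \<in> X" "Cb_lim I n u v" using Cauchy_limit_X u(1) by metis
    have Kv: "Cb_lim I n (\<lambda>i. K (u i)) (K v)" by (rule K_lim[OF u(1) v])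
    have "A v = f"
    proof (rule X_eqI[OF AX[OF v(1)] f])
      fix x assume x: "x \<in> I"
      have "(\<lambda>i. A (u i) x) \<longlonglongrightarrow> A v x"
        unfolding A_def by (intro tendsto_diff Cb_lim_pointwise[OF v(2) x] Cb_lim_pointwise[OF Kv x])
      moreover have "(\<lambda>i. A (u i) x) \<longlonglongrightarrow> f x"
      proof (rule LIMSEQ_I)
        fix e :: real assume "e > 0"
        then obtain N where N: "\<forall>i\<ge>N. inverse (real (Suc i)) \<le> e/2" using small[of "e/2"] by auto
        have "norm (A (u i) x - f x) < e" if "i \<ge> N" for i
          using Cb_bound[OF u(2)[of i] x] N[rule_format, OF that] \<open>e > 0\<close> by (simp add: abs_minus_commute)
        then show "\<exists>N. \<forall>i\<ge>N. norm (A (u i) x - f x) < e" by blast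
      qed
      ultimately show "A v x = f x" using LIMSEQ_unique by blast
    qed
    then show False using nosol v(1) by blast
  qed
  have "\<exists>y. y \<in> R k \<and> Cb I n 1 y \<and> (\<forall>w\<in>R (Suc k). \<not> Cb I n (2/3) (\<lambda>x. y x - w x))" for k
  proof -
    let ?v = "(A ^^ k) f"
    have vR: "?v \<in> R k" using f by (auto simp: R_def)
    obtain de where de: "de > 0" "\<And>w. w \<in> R (Suc k) \<Longrightarrow> \<not> Cb I n de (\<lambda>x. ?v x - w x)" using dist by blast
    define B where "B = {L. \<exists>w\<in>R (Suc k). Cb I n L (\<lambda>x. ?v x - w x)}"
    have BI: "L \<in> B" if "w \<in> R (Suc k)" "Cb I n L (\<lambda>x. ?v x - w x)" for L w
      using that unfolding B_def by blast
    have ge: "de \<le> L" if L: "L \<in> B" for L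
    proof -
      obtain w where w: "w \<in> R (Suc k)" "Cb I n L (\<lambda>x. ?v x - w x)" using L unfolding B_def by blast
      show ?thesis using de(2)[OF w(1)] Cb_mono[OF w(2)] by (meson linear)
    qed
    have z: "(\<lambda>x. 0) \<in> R (Suc k)"
      using R_lin[OF R_A[OF vR] R_A[OF vR], of 0 0] by simp
    obtain L0 where "Cb I n L0 (\<lambda>x. ?v x - 0)" using Ck_on_imp_Cb[OF X_Ck[OF Ak_X[OF f]], of k] by auto
    then have "L0 \<in> B" by (rule BI[OF z])
    then have ne: "B \<noteq> {}" by blast
    have bdd: "bdd_below B" using ge by (rule bdd_belowI)
    have D: "Inf B \<ge> de" using ne ge by (rule cInf_greatest)
    then have "Inf B < 3/2 * Inf B" using de(1) by simp
    then obtain L where L: "L \<in> B" "L < 3/2 * Inf B" using cInf_less_iff[OF ne bdd] by blast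
    have L0: "L > 0" using ge[OF L(1)] de(1) by linarith
    obtain w where w: "w \<in> R (Suc k)" "Cb I n L (\<lambda>x. ?v x - w x)" using L(1) unfolding B_def by blast
    let ?y = "\<lambda>x. (?v x - w x) / L"
    have "?y \<in> R k"
      using R_lin[OF vR subsetD[OF R_Suc w(1)], of "1/L" "- 1/L"] by (simp add: diff_divide_distrib)
    moreover have "Cb I n 1 ?y" using Cb_scale[OF w(2) L0] L0 by simp
    moreover have "\<not> Cb I n (2/3) (\<lambda>x. ?y x - w' x)" if w': "w' \<in> R (Suc k)" for w'
    proof
      assume "Cb I n (2/3) (\<lambda>x. ?y x - w' x)"
      moreover have "?y x - w' x = (?v x - (1 * w x + L * w' x)) / L" for x using L0 by (simp add: field_simps)
      ultimately have "Cb I n (2/3) (\<lambda>x. (?v x - (1 * w x + L * w' x)) / L)" by simp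
      then have "Cb I n (L * (2/3)) (\<lambda>x. ?v x - (1 * w x + L * w' x))" using L0 by (rule Cb_unscale)
      then have "L * (2/3) \<in> B" by (rule BI[OF R_lin[OF w(1) w', of 1 L]])
      then have "Inf B \<le> L * (2/3)" using bdd by (rule cInf_lower)
      then show False using L(2) by simp
    qed
    ultimately show ?thesis by blast
  qed
  then obtain y where y: "\<And>k. y k \<in> R k" "\<And>k. Cb I n 1 (y k)"
    "\<And>k w. w \<in> R (Suc k) \<Longrightarrow> \<not> Cb I n (2/3) (\<lambda>x. y k x - w x)" by metis
  have yX: "y k \<in> X" for k using y(1) R_sub_X by blast
  obtain r where r: "strict_mono (r :: nat \<Rightarrow> nat)" "Cb_Cauchy I n (\<lambda>i. K (y (r i)))"
    using K_compact[of y] y(2) yX by blast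
  obtain N where N: "\<forall>i\<ge>N. \<forall>j\<ge>N. Cb I n (2/3) (\<lambda>x. K (y (r i)) x - K (y (r j)) x)"
    using r(2) unfolding Cb_Cauchy_def by (meson zero_less_divide_iff zero_less_numeral)
  let ?i = "r N" and ?j = "r (Suc N)"
  have ij: "Suc ?i \<le> ?j" using strict_monoD[OF r(1), of N "Suc N"] by simp
  have yj: "y ?j \<in> R (Suc ?i)" using R_antimono[OF ij] y(1) by blast
  have Ayj: "A (y ?j) \<in> R (Suc ?i)" using R_antimono[of "Suc ?i" "Suc ?j"] R_A[OF y(1)] ij by auto
  \<comment> \<open>\<open>K y_i - K y_j\<close> equals \<open>y_i - (A y_i + y_j - A y_j)\<close>,
    and for \<open>j > i\<close> the bracket belongs to \<open>R (Suc i)\<close>.\<close>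
  have "(\<lambda>x. 1 * (1 * A (y ?i) x + 1 * y ?j x) + (-1) * A (y ?j) x) \<in> R (Suc ?i)"
    by (rule R_lin[OF R_lin[OF R_A[OF y(1)] yj] Ayj])
  then have "\<not> Cb I n (2/3) (\<lambda>x. y ?i x - (1 * (1 * A (y ?i) x + 1 * y ?j x) + (-1) * A (y ?j) x))" by (rule y(3))
  moreover have "(\<lambda>x. y ?i x - (1 * (1 * A (y ?i) x + 1 * y ?j x) + (-1) * A (y ?j) x)) = (\<lambda>x. K (y ?i) x - K (y ?j) x)"
    by (simp add: A_def)
  ultimately show False using N[rule_format, of N "Suc N"] by simp
qed

end

section \<open>Solvability of the linearized equation\<close>

lemma Vpot_smooth:
  assumes "d \<ge> 3" shows "Ck_on n {0..4} (Vpot d)"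
proof -
  have "Ck_on n {0..4} (\<lambda>x. - (2 * (real d - 1) * (real d - 2) / (real d - 2 + x)\<^sup>2))"
    by (intro Ck_on_minus Ck_on_divide Ck_on_const Ck_on_power Ck_on_add Ck_on_ident) (use assms in auto)
  then show ?thesis by (simp add: Vpot_def[abs_def])
qed

text \<open>The equation \<open>T u = g + V u\<close> means \<open>u - K u = Tinv g\<close> with
  \<open>K u = Tinv (V u)\<close>. The gained derivative makes \<open>K\<close> compact on
  \<open>C^n\<close>, and a fixed point of \<open>K\<close> solves the homogeneous linearized
  equation, so injectivity is the trivial kernel.\<close>

lemma linearized_solvable:
  assumes d: "d \<ge> 3"
  shows "\<exists>M>0. \<forall>g gm. Cb {0..4} (d + 5) gm g \<longrightarrow>
    (\<exists>u. Cb {0..4} (d + 5) (M * gm) u \<and> Ck_on (d + 6) {0..4} u \<and> Teq d u (\<lambda>x. g x + Vpot d x * u x))"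
proof -
  let ?S = "{0..4::real}"
  define n where "n = d + 5"
  \<comment> \<open>Uniqueness is used with \<open>m = d + 4\<close>: it asks for
    \<open>C^(m + 2)\<close>, and solutions with data in \<open>C^n\<close> lie in
    \<open>C^(n + 1) = C^(d + 6)\<close>.\<close>
  have n: "real n > (real d - 3) / 2" "real (d + 4) > (real d - 3) / 2" "n \<ge> 1"
    using d by (auto simp: n_def field_simps)
  obtain MT where MT: "MT \<ge> 0" "\<And>g gm. Cb ?S n gm g \<Longrightarrow> \<exists>u. Cb ?S (Suc n) (MT * gm) u \<and> Teq d u g"
    using Teq_surj[OF n(1) d n(3)] by blast
  obtain KV where KV: "KV \<ge> 0" "Cb ?S n KV (Vpot d)" using Ck_on_imp_Cb[OF Vpot_smooth[OF d]] by blast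
  have uniq: "u x = 0" if "Ck_on (Suc n) ?S u" "Teq d u (\<lambda>x. 0)" "x \<in> ?S" for u x
    by (rule Teq_unique[OF n(2) d _ that(2,3)]) (use that(1) in \<open>simp add: n_def\<close>)
  define sol where "sol = (\<lambda>g w. Ck_on (Suc n) ?S w \<and> Teq d w g \<and> (\<forall>x. x \<notin> ?S \<longrightarrow> w x = 0))"
  \<comment> \<open>Functions solving the equation and vanishing outside \<open>[0, 4]\<close> are
    unique, so the choice determines a linear operator; linearity is proved by uniqueness.\<close>
  define Tinv where "Tinv = (\<lambda>g. SOME w. sol g w)"
  have sol_unique: "w = w'" if "sol g w" "sol g w'" for g w w'
  proof
    fix x
    have "Teq d (\<lambda>x. w x - w' x) (\<lambda>x. g x - g x)" using that unfolding sol_def by (intro Teq_diff) auto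
    then have "Teq d (\<lambda>x. w x - w' x) (\<lambda>x. 0)" by simp
    moreover have "Ck_on (Suc n) ?S (\<lambda>x. w x - w' x)" using that unfolding sol_def by (intro Ck_on_diff) auto
    ultimately have "x \<in> ?S \<Longrightarrow> w x - w' x = 0" using uniq by blast
    then show "w x = w' x" using that unfolding sol_def by (cases "x \<in> ?S") auto
  qed
  have Tinv: "sol g (Tinv g) \<and> Cb ?S (Suc n) (MT * gm) (Tinv g)" if g: "Cb ?S n gm g" for g gm
  proof -
    obtain u where u: "Cb ?S (Suc n) (MT * gm) u" "Teq d u g" using MT(2)[OF g] by blast
    define w where "w = (\<lambda>x. if x \<in> ?S then u x else 0)"
    have w: "Cb ?S (Suc n) (MT * gm) w" by (rule Cb_cong[OF _ u(1)]) (simp add: w_def)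
    have "sol g w"
      unfolding sol_def using Cb_imp_Ck[OF w] Teq_cong[OF u(2), of w g] by (auto simp: w_def)
    moreover from this have "sol g (Tinv g)" unfolding Tinv_def by (rule someI[of "sol g"])
    ultimately show ?thesis using sol_unique w by metis
  qed
  define X where "X = {u. Ck_on n ?S u \<and> (\<forall>x. x \<notin> ?S \<longrightarrow> u x = 0)}"
  define K where "K = (\<lambda>u. Tinv (\<lambda>x. Vpot d x * u x))"
  have KC: "sol (\<lambda>x. Vpot d x * u x) (K u) \<and> Cb ?S (Suc n) (MT * (2 ^ n * (KV * k))) (K u)"
    if "Cb ?S n k u" for u k
    unfolding K_def by (rule Tinv[OF Cb_mult[OF KV(2) that]])
  have XC: "\<exists>k\<ge>0. Cb ?S n k u" if "u \<in> X" for u using that Ck_on_imp_Cb[of n ?S u] by (auto simp: X_def)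
  have Ksol: "sol (\<lambda>x. Vpot d x * u x) (K u)" if "u \<in> X" for u using KC XC[OF that] by blast
  interpret compact_operator 0 4 n K X "MT * (2 ^ n * KV)"
  proof
    show "(0::real) < 4" "X = {u. Ck_on n ?S u \<and> (\<forall>x. x \<notin> ?S \<longrightarrow> u x = 0)}" by (auto simp: X_def)
    show "K u \<in> X" if "u \<in> X" for u using Ksol[OF that] by (auto simp: X_def sol_def dest: Ck_on_pred)
    show "0 \<le> MT * (2 ^ n * KV)" using MT(1) KV(1) by simp
    show "Cb ?S n (MT * (2 ^ n * KV) * k) (K u)" if "u \<in> X" "Cb ?S n k u" for u k
      using Cb_pred[OF conjunct2[OF KC[OF that(2)]]] by (simp add: algebra_simps)
    show "K (\<lambda>x. al * u x + be * v x) = (\<lambda>x. al * K u x + be * K v x)" if uv: "u \<in> X" "v \<in> X" for u v al be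
    proof (rule sol_unique)
      have "(\<lambda>x. al * u x + be * v x) \<in> X" using uv by (auto simp: X_def intro!: Ck_on_add Ck_on_cmult)
      then show "sol (\<lambda>x. Vpot d x * (al * u x + be * v x)) (K (\<lambda>x. al * u x + be * v x))" by (rule Ksol)
      have "Teq d (\<lambda>x. al * K u x + be * K v x) (\<lambda>x. al * (Vpot d x * u x) + be * (Vpot d x * v x))"
        using Ksol[OF uv(1)] Ksol[OF uv(2)] unfolding sol_def by (intro Teq_lincomb) auto
      then have "Teq d (\<lambda>x. al * K u x + be * K v x) (\<lambda>x. Vpot d x * (al * u x + be * v x))"
        by (rule Teq_cong) (auto simp: algebra_simps)
      then show "sol (\<lambda>x. Vpot d x * (al * u x + be * v x)) (\<lambda>x. al * K u x + be * K v x)"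
        using Ksol[OF uv(1)] Ksol[OF uv(2)] unfolding sol_def by (auto intro!: Ck_on_add Ck_on_cmult)
    qed
    show "\<exists>r::nat\<Rightarrow>nat. strict_mono r \<and> Cb_Cauchy ?S n (\<lambda>i. K (u (r i)))"
      if "\<And>i. u i \<in> X" "\<And>i. Cb ?S n 1 (u i)" for u
      by (rule Cb_compact[OF _ conjunct2[OF KC[OF that(2)]]]) simp
    show "u = (\<lambda>x. 0)" if u: "u \<in> X" "K u = u" for u
    proof
      fix x
      have s: "sol (\<lambda>x. Vpot d x * u x) u" using Ksol[OF u(1)] u(2) by simp
      show "u x = 0"
      proof (cases "x \<in> ?S")
        case True
        show ?thesis by (rule linearized_kernel_trivial[OF d _ _ True]) (use s in \<open>auto simp: sol_def n_def add.commute\<close>)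
      qed (use s in \<open>auto simp: sol_def\<close>)
    qed
  qed
  obtain c where c: "c > 0" "\<And>u k. u \<in> X \<Longrightarrow> Cb ?S n k (A u) \<Longrightarrow> Cb ?S n (c * k) u"
    using bounded_below by blast
  have "\<exists>u. Cb ?S n (c * MT * gm) u \<and> Ck_on (Suc n) ?S u \<and> Teq d u (\<lambda>x. g x + Vpot d x * u x)"
    if g: "Cb ?S n gm g" for g gm
  proof -
    have w: "sol g (Tinv g)" "Cb ?S n (MT * gm) (Tinv g)" using Tinv[OF g] Cb_pred by auto
    then have "Tinv g \<in> X" by (auto simp: X_def sol_def dest: Ck_on_pred)
    then obtain u where u: "u \<in> X" "A u = Tinv g" using A_surj by blast
    have ub: "Cb ?S n (c * MT * gm) u" using c(2)[OF u(1)] w(2) u(2) by (simp add: mult.assoc)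
    have eq: "u = (\<lambda>x. 1 * Tinv g x + 1 * K u x)" using u(2) by (auto simp: A_def fun_eq_iff algebra_simps)
    have "Ck_on (Suc n) ?S (\<lambda>x. 1 * Tinv g x + 1 * K u x)"
      using w(1) Ksol[OF u(1)] unfolding sol_def by (intro Ck_on_add Ck_on_cmult) auto
    moreover have "Teq d (\<lambda>x. 1 * Tinv g x + 1 * K u x) (\<lambda>x. 1 * g x + 1 * (Vpot d x * u x))"
      using w(1) Ksol[OF u(1)] unfolding sol_def by (intro Teq_lincomb) auto
    ultimately show ?thesis using ub eq by (intro exI[of _ u]) (simp flip: eq)
  qed
  \<comment> \<open>The summand \<open>1\<close> makes the constant strictly positive even if
    \<open>MT = 0\<close>, so that later it may be divided by.\<close>
  moreover have "Cb ?S n ((c * MT + 1) * gm) u" if "Cb ?S n (c * MT * gm) u" "Cb ?S n gm g" for u g gm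
  proof (rule Cb_mono[OF that(1)])
    have "0 \<le> gm" using Cb_nonneg[OF that(2)] by simp
    then show "c * MT * gm \<le> (c * MT + 1) * gm" by (simp add: algebra_simps)
  qed
  moreover have "c * MT + 1 > 0" using c(1) MT(1) by (intro add_nonneg_pos) auto
  moreover have "Suc n = d + 6" by (simp add: n_def)
  ultimately show ?thesis
    unfolding n_def[symmetric] by (intro exI[of _ "c * MT + 1"]) metis
qed

section \<open>Smooth even and odd functions\<close>

lemma no_isolated_UNIV: "no_isolated UNIV"
  by (simp add: no_isolated_def)

lemma no_isolated_atLeast: "no_isolated {a..}"
  using at_within_atLeast_ne_bot by (auto simp: no_isolated_def)

lemma smooth_on_chainE:
  fixes f :: "real \<Rightarrow> real"
  assumes "smooth_on S f" "no_isolated S"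
  obtains D where "D 0 = f" "\<And>j. PROP deriv_on S (D j) (D (Suc j))"
proof -
  define nxt where "nxt = (\<lambda>g. SOME h. (\<forall>x\<in>S. (g has_real_derivative h x) (at x within S)) \<and> smooth_on S h)"
  have nxt: "(\<forall>x\<in>S. (g has_real_derivative nxt g x) (at x within S)) \<and> smooth_on S (nxt g)"
    if g: "smooth_on S g" for g
  proof -
    obtain h where "PROP deriv_on S g h" "smooth_on S h"
      using smooth_on_derivE[OF g] assms(2) unfolding no_isolated_def by blast
    then have "\<exists>h. (\<forall>x\<in>S. (g has_real_derivative h x) (at x within S)) \<and> smooth_on S h" by blast
    then show ?thesis unfolding nxt_def by (rule someI_ex)
  qed
  have sm: "smooth_on S ((nxt ^^ n) f)" for n
    by (induction n) (use assms(1) nxt in auto)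
  show ?thesis
    by (rule that[of "\<lambda>n. (nxt ^^ n) f"]) (use nxt[OF sm] in auto)
qed

lemma chain_smooth_on:
  fixes D :: "nat \<Rightarrow> real \<Rightarrow> real"
  assumes "\<And>j. PROP deriv_on S (D j) (D (Suc j))"
  shows "smooth_on S (D j)"
proof -
  have "Ck_on k S (D j)" for k
  proof (induction k arbitrary: j)
    case 0
    show ?case using DERIV_continuous_on[OF assms] by simp
  next
    case (Suc k)
    show ?case by (rule Ck_on_SucI[OF assms Suc.IH])
  qed
  then show ?thesis by (simp add: smooth_on_def)
qed

text \<open>Hadamard's lemma: \<open>k u - k 0\<close> is \<open>u\<close> times the integral of
  \<open>k' (t * u)\<close> over \<open>t\<close> in \<open>[0, 1]\<close>. Both admissible sets are
  star-shaped about \<open>0\<close>, so the integrand stays where \<open>k\<close> is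
  smooth.\<close>

lemma Hadamard_smooth:
  fixes k :: "real \<Rightarrow> real"
  assumes k: "smooth_on S k" and S: "S = UNIV \<or> S = {0..}"
  obtains h where "smooth_on S h" "\<And>u. u \<in> S \<Longrightarrow> k u = k 0 + u * h u"
proof -
  have ni: "no_isolated S" using S no_isolated_UNIV no_isolated_atLeast by auto
  have conv: "convex S" using S by auto
  have 0: "0 \<in> S" using S by auto
  have mul: "t * u \<in> S" if "u \<in> S" "t \<in> cbox 0 1" for t u :: real using that S by auto
  obtain D where D: "D 0 = k" "\<And>j. PROP deriv_on S (D j) (D (Suc j))"
    by (fact smooth_on_chainE[OF k ni])
  have cont: "continuous_on S (D j)" for j using DERIV_continuous_on[OF D(2)] .
  \<comment> \<open>The candidate for the \<open>j\<close>-th derivative of the quotient, obtained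
    by differentiating under the integral sign.\<close>
  define K where "K = (\<lambda>j u. integral (cbox 0 1) (\<lambda>t. t ^ j * D (Suc j) (t * u)))"
  have K': "(K j has_real_derivative K (Suc j) u) (at u within S)" if u: "u \<in> S" for j u
    unfolding K_def
  proof (rule leibniz_rule_field_derivative[OF _ _ _ u conv])
    show "((\<lambda>u. t ^ j * D (Suc j) (t * u)) has_real_derivative t ^ Suc j * D (Suc (Suc j)) (t * x)) (at x within S)"
      if "x \<in> S" "t \<in> cbox 0 1" for x t
    proof -
      have "((\<lambda>u. D (Suc j) (t * u)) has_real_derivative D (Suc (Suc j)) (t * x) * t) (at x within S)"
        by (rule DERIV_compose_within[OF D(2)]) (use that mul in \<open>auto intro!: derivative_eq_intros\<close>)
      from DERIV_cmult[OF this, of "t ^ j"] show ?thesis by (simp add: algebra_simps)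
    qed
    show "(\<lambda>t. t ^ j * D (Suc j) (t * x)) integrable_on cbox 0 1" if "x \<in> S" for x
      by (intro integrable_continuous continuous_intros continuous_on_compose2[OF cont]) (use that mul in auto)
    have "continuous_on (S \<times> cbox 0 1) (\<lambda>z. snd z ^ Suc j * D (Suc (Suc j)) (snd z * fst z))"
      by (intro continuous_intros continuous_on_compose2[OF cont]) (use mul in auto)
    then show "continuous_on (S \<times> cbox 0 1) (\<lambda>(x, t). t ^ Suc j * D (Suc (Suc j)) (t * x))"
      by (simp add: case_prod_beta)
  qed
  have "k u = k 0 + u * K 0 u" if u: "u \<in> S" for u
  proof -
    have "((\<lambda>t. D 1 (t * u) * u) has_integral k (1 * u) - k (0 * u)) {0..1}"
    proof (rule fundamental_theorem_of_calculus)
      fix t :: real assume t: "t \<in> {0..1}"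
      have "((\<lambda>t. k (t * u)) has_real_derivative D 1 (t * u) * u) (at t within {0..1})"
        by (rule DERIV_compose_within[where T=S]) (use D(2)[of "t * u" 0] D(1) t u mul in \<open>auto intro!: derivative_eq_intros\<close>)
      then show "((\<lambda>t. k (t * u)) has_vector_derivative D 1 (t * u) * u) (at t within {0..1})"
        by (simp add: has_real_derivative_iff_has_vector_derivative)
    qed simp
    from integral_unique[OF this] have "integral {0..1} (\<lambda>t. D 1 (t * u)) * u = k u - k 0" by simp
    then show ?thesis by (simp add: K_def algebra_simps)
  qed
  moreover have "smooth_on S (K 0)" by (rule chain_smooth_on[where D=K and j=0]) (rule K')
  ultimately show ?thesis using that by blast
qed

lemma smooth_on_mult: "smooth_on S f \<Longrightarrow> smooth_on S g \<Longrightarrow> smooth_on S (\<lambda>x::real. f x * g x)"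
  by (auto simp: smooth_on_def intro: Ck_on_mult)

lemma smooth_on_add: "smooth_on S f \<Longrightarrow> smooth_on S g \<Longrightarrow> smooth_on S (\<lambda>x::real. f x + g x)"
  by (auto simp: smooth_on_def intro: Ck_on_add)

lemma smooth_on_diff: "smooth_on S f \<Longrightarrow> smooth_on S g \<Longrightarrow> smooth_on S (\<lambda>x::real. f x - g x)"
  by (auto simp: smooth_on_def intro: Ck_on_diff)

lemma smooth_on_const: "smooth_on S (\<lambda>x::real. c)"
  by (auto simp: smooth_on_def intro: Ck_on_const)

lemma smooth_on_ident: "smooth_on S (\<lambda>x::real. x)"
  by (auto simp: smooth_on_def intro: Ck_on_ident)

lemma smooth_on_power: "smooth_on S f \<Longrightarrow> smooth_on S (\<lambda>x::real. f x ^ n)"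
  by (auto simp: smooth_on_def intro: Ck_on_power)

lemma smooth_on_compose:
  fixes f g :: "real \<Rightarrow> real"
  shows "smooth_on T f \<Longrightarrow> smooth_on S g \<Longrightarrow> g ` S \<subseteq> T \<Longrightarrow> smooth_on S (\<lambda>x. f (g x))"
  unfolding smooth_on_def using Ck_on_compose by blast

lemma smooth_on_divide:
  fixes f g :: "real \<Rightarrow> real"
  shows "smooth_on S f \<Longrightarrow> smooth_on S g \<Longrightarrow> (\<And>x. x \<in> S \<Longrightarrow> g x \<noteq> 0) \<Longrightarrow> smooth_on S (\<lambda>x. f x / g x)"
  by (auto simp: smooth_on_def intro!: Ck_on_divide)

lemma smooth_on_subset: "smooth_on S f \<Longrightarrow> T \<subseteq> S \<Longrightarrow> smooth_on T (f :: real \<Rightarrow> real)"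
  by (auto simp: smooth_on_def intro: Ck_on_subset)

lemma smooth_on_imp_continuous: "smooth_on S f \<Longrightarrow> continuous_on S (f :: real \<Rightarrow> real)"
  using Ck_on_imp_continuous smooth_on_def by blast

lemma smooth_on_sin: "smooth_on S (sin :: real \<Rightarrow> real)" and smooth_on_cos: "smooth_on S (cos :: real \<Rightarrow> real)"
  and smooth_on_arctan: "smooth_on S arctan"
  using Ck_on_sin_cos Ck_on_arctan by (auto simp: smooth_on_def)

lemma even_smooth_expansion:
  fixes k :: "real \<Rightarrow> real"
  assumes k: "smooth_on UNIV k" and even: "\<And>u. k (- u) = k u"
  obtains e where "smooth_on UNIV e" "\<And>u. e (- u) = e u" "\<And>u. k u = k 0 + u\<^sup>2 * e u"
proof -
  obtain m where m: "smooth_on UNIV m" "\<And>u. k u = k 0 + u * m u"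
    using Hadamard_smooth[OF k] by auto
  have odd: "m (- u) = - m u" if "u \<noteq> 0" for u
  proof -
    have "u * (m u + m (- u)) = 0" using m(2)[of u] m(2)[of "-u"] even[of u] by (simp add: distrib_left)
    then show ?thesis using that by (simp add: eq_neg_iff_add_eq_0 add.commute)
  qed
  have m0: "m 0 = 0"
  proof -
    have c: "isCont m 0" using smooth_on_imp_continuous[OF m(1)] by (simp add: continuous_on_eq_continuous_at)
    have l1: "(m \<longlongrightarrow> m 0) (at 0)" using c by (simp add: isCont_def)
    have "isCont (\<lambda>u. m (- u)) 0" by (intro continuous_intros isCont_o2[of _ uminus]) (use c in auto)
    then have l2: "((\<lambda>u. m (- u)) \<longlongrightarrow> m 0) (at 0)" by (simp add: isCont_def)
    have "((\<lambda>u. m (- u)) \<longlongrightarrow> - m 0) (at 0)"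
      by (rule Lim_transform_eventually[OF tendsto_minus[OF l1]])
         (auto simp: eventually_at_filter odd)
    from tendsto_unique[OF _ this l2] have "- m 0 = m 0" by simp
    then show ?thesis by simp
  qed
  obtain e where e: "smooth_on UNIV e" "\<And>u. m u = u * e u"
    using Hadamard_smooth[OF m(1)] m0 by auto
  have "e (- u) = e u" for u
    using odd[of u] e(2)[of u] e(2)[of "-u"] by (cases "u = 0") auto
  moreover have "k u = k 0 + u\<^sup>2 * e u" for u using m(2)[of u] e(2)[of u] by (simp add: power2_eq_square)
  ultimately show ?thesis using that e(1) by blast
qed

text \<open>Whitney's theorem on even functions. From \<open>k u = k 0 + u\<^sup>2 * e u\<close> the
  derivative of \<open>k (sqrt q)\<close> is again of the form \<open>E (sqrt q)\<close> with
  \<open>E\<close> smooth and even, so the induction closes up to the boundary point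
  \<open>q = 0\<close>.\<close>

lemma even_smooth_sqrt:
  fixes k :: "real \<Rightarrow> real"
  assumes "smooth_on UNIV k" "\<And>u. k (- u) = k u"
  shows "smooth_on {0..} (\<lambda>q. k (sqrt q))"
proof -
  have "Ck_on n {0..} (\<lambda>q. k (sqrt q))" if "smooth_on UNIV k" "\<And>u. k (- u) = k u" for n and k :: "real \<Rightarrow> real"
    using that
  proof (induction n arbitrary: k)
    case 0
    have "continuous_on UNIV k" using 0(1) by (rule smooth_on_imp_continuous)
    then have "continuous_on {0..} (\<lambda>q. k (sqrt q))"
      by (rule continuous_on_compose2) (auto intro!: continuous_intros)
    then show ?case by simp
  next
    case (Suc n)
    obtain e where e: "smooth_on UNIV e" "\<And>u. e (- u) = e u" "\<And>u. k u = k 0 + u\<^sup>2 * e u"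
      by (fact even_smooth_expansion[OF Suc.prems])
    obtain e' where e': "\<And>x. (e has_real_derivative e' x) (at x)" "smooth_on UNIV e'"
      using smooth_on_derivE[OF e(1)] by auto
    have odd: "e' (- u) = - e' u" for u
    proof -
      have "((\<lambda>u. e (- u)) has_real_derivative - e' (- u)) (at u)"
        using DERIV_chain2[where f=e and g=uminus and x=u, OF e'(1)[of "- u"] DERIV_minus[OF DERIV_ident]] by simp
      then have "(e has_real_derivative - e' (- u)) (at u)" by (simp add: e(2))
      then show ?thesis using DERIV_unique[OF e'(1)[of u]] by simp
    qed
    \<comment> \<open>The product rule for \<open>q * e (sqrt q)\<close> at
      \<open>u = sqrt q\<close>; since \<open>e'\<close> is odd, \<open>u * e' u\<close> is even
      again.\<close>
    define E where "E = (\<lambda>u. e u + u * e' u / 2)"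
    have E: "smooth_on UNIV E" unfolding E_def
      by (intro smooth_on_add e smooth_on_divide smooth_on_mult smooth_on_ident e' smooth_on_const) simp
    have Eeven: "E (- u) = E u" for u by (simp add: E_def e(2) odd)
    have "((\<lambda>q. k (sqrt q)) has_real_derivative E (sqrt q)) (at q within {0..})" if q: "q \<in> {0..}" for q
    proof (cases "q = 0")
      case True
      have ce: "continuous_on {0..} (\<lambda>q. e (sqrt q))"
        by (rule continuous_on_compose2[OF smooth_on_imp_continuous[OF e(1)]]) (auto intro!: continuous_intros)
      have "((\<lambda>q. e (sqrt q)) \<longlongrightarrow> e (sqrt 0)) (at 0 within {0..})"
        using ce[unfolded continuous_on_def] by (rule bspec) simp
      then have "((\<lambda>y. (k (sqrt y) - k (sqrt 0)) / (y - 0)) \<longlongrightarrow> e (sqrt 0)) (at 0 within {0..})"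
      proof (rule Lim_transform_eventually)
        show "\<forall>\<^sub>F y in at 0 within {0..}. e (sqrt y) = (k (sqrt y) - k (sqrt 0)) / (y - 0)"
          unfolding eventually_at_filter using e(3)[of "sqrt _"] by (intro always_eventually) auto
      qed
      then show ?thesis using True by (simp add: has_field_derivative_iff E_def)
    next
      case False
      then have q0: "q > 0" using q by simp
      have s: "(sqrt has_real_derivative inverse (sqrt q) / 2) (at q)" using q0 by (rule DERIV_real_sqrt)
      have "((\<lambda>q. e (sqrt q)) has_real_derivative e' (sqrt q) * (inverse (sqrt q) / 2)) (at q)"
        by (rule DERIV_chain2[OF e'(1) s])
      from DERIV_add[OF DERIV_const[of "k 0"] DERIV_mult[OF DERIV_ident this]]
      have "((\<lambda>q. k 0 + q * e (sqrt q)) has_real_derivative E (sqrt q)) (at q)"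
      proof (rule DERIV_cong)
        have "inverse (sqrt q) * q = sqrt q" using q0 by (simp add: field_simps)
        then show "0 + (1 * e (sqrt q) + e' (sqrt q) * (inverse (sqrt q) / 2) * q) = E (sqrt q)"
          by (simp add: E_def algebra_simps)
      qed
      then have "((\<lambda>q. k (sqrt q)) has_real_derivative E (sqrt q)) (at q)"
        by (rule has_field_derivative_transform_within_open[of _ _ _ "{0<..}"]) (use q0 e(3)[of "sqrt _"] in auto)
      then show ?thesis by (rule has_field_derivative_at_within)
    qed
    then show ?case by (rule Ck_on_SucI[OF _ Suc.IH[OF E Eeven]])
  qed
  then show ?thesis using assms by (simp add: smooth_on_def)
qed

lemma odd_smooth_factor:
  fixes g :: "real \<Rightarrow> real"
  assumes g: "smooth_on UNIV g" and odd: "\<And>u. g (- u) = - g u"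
  obtains h where "smooth_on {0..} h" "\<And>u. g u = u * h (u\<^sup>2)"
proof -
  have g0: "g 0 = 0" using odd[of 0] by simp
  obtain e where e: "smooth_on UNIV e" "\<And>u. g u = u * e u" using Hadamard_smooth[OF g] g0 by auto
  have even: "e (- u) = e u" for u
    using odd[of u] e(2)[of u] e(2)[of "-u"] by (cases "u = 0") auto
  have "g u = u * e (sqrt (u\<^sup>2))" for u
    using e(2)[of u] even[of u] by (simp add: abs_if)
  then show ?thesis using that[OF even_smooth_sqrt[OF e(1) even]] by blast
qed

text \<open>Inserting \<open>f = r * u\<close> with \<open>x = r\<^sup>2\<close> into the cubic
  remainder gives \<open>r ^ 3 * u ^ 3 * H (x * u\<^sup>2)\<close>. This is how the singular
  nonlinearity of the profile equation becomes smooth in \<open>x\<close> down to the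
  centre.\<close>

lemma odd_smooth_expansion:
  fixes g :: "real \<Rightarrow> real"
  assumes g: "smooth_on UNIV g" and odd: "\<And>u. g (- u) = - g u" and c: "(g has_real_derivative c) (at 0)"
  obtains H where "smooth_on {0..} H" "\<And>u. g u = c * u + u ^ 3 * H (u\<^sup>2)"
proof -
  obtain h where h: "smooth_on {0..} h" "\<And>u. g u = u * h (u\<^sup>2)" by (fact odd_smooth_factor[OF g odd])
  obtain H where H: "smooth_on {0..} H" "\<And>q. q \<ge> 0 \<Longrightarrow> h q = h 0 + q * H q"
    using Hadamard_smooth[OF h(1)] by auto
  have exp: "g u = h 0 * u + u ^ 3 * H (u\<^sup>2)" for u
    using h(2)[of u] H(2)[of "u\<^sup>2"] by (simp add: algebra_simps power2_eq_square power3_eq_cube)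
  have "h 0 = c"
  proof -
    have "((\<lambda>u. (g u - g 0) / (u - 0)) \<longlongrightarrow> c) (at 0)" using c by (simp add: has_field_derivative_iff)
    then have "((\<lambda>u. h (u\<^sup>2)) \<longlongrightarrow> c) (at 0)"
      by (rule Lim_transform_eventually) (auto simp: eventually_at_filter h(2))
    moreover have "continuous_on UNIV (\<lambda>u::real. h (u\<^sup>2))"
      by (rule continuous_on_compose2[OF smooth_on_imp_continuous[OF h(1)]]) (auto intro!: continuous_intros)
    then have "((\<lambda>u. h (u\<^sup>2)) \<longlongrightarrow> h (0\<^sup>2)) (at (0::real))" 
      unfolding continuous_on_def by blast
    ultimately show ?thesis using tendsto_unique[of "at (0::real)" "\<lambda>u. h (u\<^sup>2)" c "h (0\<^sup>2)"] by simp
  qed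
  with exp H(1) show ?thesis using that by blast
qed

section \<open>The perturbed nonlinear equation near the origin and the light cone\<close>

text \<open>Iterating \<open>rr / 2 + c\<close> from any initial bound drives the bound to its fixed
  point \<open>2 * c\<close>. This is how half of an unknown norm is absorbed when only bounds are
  at hand.\<close>

lemma Cb_iterate:
  assumes S: "no_isolated S" and c: "c \<ge> 0" and r: "r \<ge> 0" and u: "Cb S n r u"
    and step: "\<And>rr. 0 \<le> rr \<Longrightarrow> Cb S n rr u \<Longrightarrow> Cb S n (rr / 2 + c) u"
  shows "Cb S n (2 * c) u"
proof (rule Cb_closed[OF S])
  fix et :: real assume et: "et > 0"
  have it: "Cb S n (r * (1/2) ^ k + 2 * c) u" for k
  proof (induction k)
    case 0
    show ?case by (rule Cb_mono[OF u]) (use c in simp)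
  next
    case (Suc k)
    show ?case by (rule Cb_mono[OF step[OF _ Suc]]) (use c r in auto)
  qed
  have "(\<lambda>k. r * (1/2) ^ k) \<longlonglongrightarrow> r * 0" by (intro tendsto_intros LIMSEQ_power_zero) auto
  then have "\<forall>\<^sub>F k in sequentially. r * (1/2) ^ k < et" using et by (intro order_tendstoD(2)) auto
  then obtain k where "r * (1/2) ^ k < et" unfolding eventually_sequentially by blast
  then show "Cb S n (2 * c + et) u" by (intro Cb_mono[OF it[of k]]) simp
qed

lemma Cb_lim_bound:
  assumes S: "no_isolated S" and l: "Cb_lim S n u v" and u: "\<And>i. Cb S n K (u i)"
  shows "Cb S n K v"
proof (rule Cb_closed[OF S])
  fix et :: real assume "et > 0"
  then obtain N where "Cb S n et (\<lambda>x. u N x - v x)" using l unfolding Cb_lim_def by blast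
  from Cb_diff[OF u[of N] this] show "Cb S n (K + et) v" by simp
qed

text \<open>Banach's fixed point theorem on a ball of \<open>C^n\<close>, expressed by bounds. The
  iteration starts at \<open>0\<close>; successive differences decay like powers of
  \<open>1/2\<close>.\<close>

lemma Cb_contraction:
  assumes ab: "a < b" and r: "r \<ge> 0"
    and self: "\<And>f. Cb {a..b} n r f \<Longrightarrow> Cb {a..b} n r (Ph f)"
    and contr: "\<And>f1 f2 rr. 0 \<le> rr \<Longrightarrow> Cb {a..b} n r f1 \<Longrightarrow> Cb {a..b} n r f2 \<Longrightarrow> Cb {a..b} n rr (\<lambda>x. f1 x - f2 x)
       \<Longrightarrow> Cb {a..b} n (rr / 2) (\<lambda>x. Ph f1 x - Ph f2 x)"
  obtains f where "Cb {a..b} n r f" "\<And>x. x \<in> {a..b} \<Longrightarrow> Ph f x = f x"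
proof -
  let ?S = "{a..b}"
  have S: "no_isolated ?S" by (rule no_isolated_Icc[OF ab])
  define u where "u = (\<lambda>k. (Ph ^^ k) (\<lambda>x. 0))"
  have u: "u (Suc k) = Ph (u k)" for k by (simp add: u_def)
  have ur: "Cb ?S n r (u k)" for k
    by (induction k) (use r self in \<open>auto simp: u Cb_zero\<close>, simp add: u_def Cb_zero)
  have d: "Cb ?S n (r * (1/2) ^ k) (\<lambda>x. u (Suc k) x - u k x)" for k
  proof (induction k)
    case 0
    show ?case using ur[of 1] by (simp add: u_def)
  next
    case (Suc k)
    show ?case using contr[OF _ ur ur Suc] r by (simp add: u)
  qed
  have d': "Cb ?S n (2 * r * (1/2) ^ i) (\<lambda>x. u (i + j) x - u i x)" for i j
  proof -
    have "Cb ?S n (2 * r * (1/2) ^ i * (1 - (1/2) ^ j)) (\<lambda>x. u (i + j) x - u i x)"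
    proof (induction j)
      case 0
      show ?case by (simp add: Cb_zero)
    next
      case (Suc j)
      have "Cb ?S n (r * (1/2) ^ (i + j) + 2 * r * (1/2) ^ i * (1 - (1/2) ^ j))
         (\<lambda>x. (u (Suc (i + j)) x - u (i + j) x) + (u (i + j) x - u i x))"
        by (rule Cb_add[OF d Suc])
      moreover have "r * (1/2) ^ (i + j) + 2 * r * (1/2) ^ i * (1 - (1/2) ^ j) = 2 * r * (1/2) ^ i * (1 - (1/2) ^ Suc j)"
        by (simp add: power_add algebra_simps)
      ultimately show ?case by simp
    qed
    then show ?thesis by (rule Cb_mono) (rule mult_left_le, use r in auto)
  qed
  have small: "\<exists>N. \<forall>i\<ge>N. 2 * r * (1/2) ^ i \<le> et" if "et > 0" for et :: real
  proof -
    have "(\<lambda>k. 2 * r * (1/2) ^ k) \<longlonglongrightarrow> 2 * r * 0" by (intro tendsto_intros LIMSEQ_power_zero) auto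
    then have "\<forall>\<^sub>F k in sequentially. 2 * r * (1/2) ^ k < et" using that by (intro order_tendstoD(2)) auto
    then show ?thesis unfolding eventually_sequentially by (meson less_imp_le)
  qed
  have "Cb_Cauchy ?S n u"
    unfolding Cb_Cauchy_def
  proof (intro allI impI)
    fix et :: real assume "et > 0"
    then obtain N where N: "\<forall>i\<ge>N. 2 * r * (1/2) ^ i \<le> et" using small by blast
    have 1: "Cb ?S n et (\<lambda>x. u i x - u j x)" if "j \<ge> N" "i \<ge> j" for i j
      using Cb_mono[OF d'[of j "i - j"]] N that by simp
    have "Cb ?S n et (\<lambda>x. u i x - u j x)" if "i \<ge> N" "j \<ge> N" for i j
      using 1[where i=i and j=j] Cb_diff_commute[OF 1[where i=j and j=i]] that by (cases "i \<le> j") auto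
    then show "\<exists>N. \<forall>i\<ge>N. \<forall>j\<ge>N. Cb ?S n et (\<lambda>x. u i x - u j x)" by blast
  qed
  then obtain f where f: "Cb_lim ?S n u f" using Cb_complete[OF ab] Cb_imp_Ck[OF ur] by blast
  have fr: "Cb ?S n r f" by (rule Cb_lim_bound[OF S f ur])
  have "Ph f x = f x" if x: "x \<in> ?S" for x
  proof -
    have "(\<lambda>k. u (Suc k) x) \<longlonglongrightarrow> Ph f x"
    proof (rule LIMSEQ_I)
      fix e :: real assume e: "e > 0"
      then obtain N where N: "\<forall>i\<ge>N. Cb ?S n e (\<lambda>x. u i x - f x)" using f unfolding Cb_lim_def by blast
      have "norm (u (Suc k) x - Ph f x) < e" if "k \<ge> N" for k
      proof -
        have "Cb ?S n (e/2) (\<lambda>x. u (Suc k) x - Ph f x)"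
          unfolding u using contr[OF _ ur fr N[rule_format, OF that]] e by simp
        from Cb_bound[OF this x] show ?thesis using e by simp
      qed
      then show "\<exists>N. \<forall>k\<ge>N. norm (u (Suc k) x - Ph f x) < e" by blast
    qed
    moreover have "(\<lambda>k. u (Suc k) x) \<longlonglongrightarrow> f x"
      using Cb_lim_pointwise[OF f x] by (rule LIMSEQ_Suc)
    ultimately show ?thesis by (rule LIMSEQ_unique)
  qed
  with fr show ?thesis using that by blast
qed

text \<open>With \<open>Lop\<close> the solution operator of the linearized equation,
  \<open>f ep\<close> is the fixed point of \<open>f \<mapsto> Lop (N ep f)\<close>. Subtracting the
  differential \<open>Vpot d\<close> leaves of \<open>c0\<close> a part with Lipschitz constant
  proportional to the radius \<open>r\<close>, and the other two terms are small with
  \<open>ep\<close>.\<close>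

lemma perturbed_equation_solvable:
  assumes d: "d \<ge> 3" and n: "n = d + 5"
    and c0: "strict_diff {0..4} n c0 (Vpot d)" and c1: "strict_diff {0..4} n c1 L1" and c2: "strict_diff {0..4} n c2 L2"
    and e0: "e0 > 0"
  shows "\<exists>eps>0. eps \<le> e0 \<and> (\<exists>C>0. \<exists>f. \<forall>ep. \<bar>ep\<bar> \<le> eps \<longrightarrow>
     Ck_on (Suc n) {0..4} (f ep) \<and>
     Teq d (f ep) (\<lambda>x. c0 x (f ep x) - c0 x 0 + ep * c1 x (f ep x) + ep\<^sup>2 * c2 x (f ep x)) \<and>
     Cb {0..4} n (C * \<bar>ep\<bar>) (f ep) \<and>
     (\<forall>k. \<bar>k\<bar> \<le> eps \<longrightarrow> Cb {0..4} n (C * \<bar>ep - k\<bar>) (\<lambda>x. f ep x - f k x)))"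
proof -
  let ?S = "{0..4::real}"
  let ?V = "Vpot d"
  have Suc_n: "Suc n = d + 6" by (simp add: n)
  obtain M where M': "M > 0 \<and> (\<forall>g c. Cb ?S n c g \<longrightarrow>
      (\<exists>u. Cb ?S n (M * c) u \<and> Ck_on (Suc n) ?S u \<and> Teq d u (\<lambda>x. g x + ?V x * u x)))"
    using linearized_solvable[OF d, folded Suc_n, folded n] by (elim exE)
  note M = conjunct1[OF M'] conjunct2[OF M', rule_format]
  have uniq: "u x = u' x" if "Ck_on (Suc n) ?S u" "Teq d u (\<lambda>x. g x + ?V x * u x)"
      "Ck_on (Suc n) ?S u'" "Teq d u' (\<lambda>x. g x + ?V x * u' x)" "x \<in> ?S" for u u' g x
  proof -
    have "Teq d (\<lambda>x. u x - u' x) (\<lambda>x. (g x + ?V x * u x) - (g x + ?V x * u' x))" using that by (intro Teq_diff)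
    then have "Teq d (\<lambda>x. u x - u' x) (\<lambda>x. ?V x * (u x - u' x))" by (rule Teq_cong) (auto simp: algebra_simps)
    moreover have "Ck_on (d + 6) ?S (\<lambda>x. u x - u' x)" using that unfolding Suc_n by (intro Ck_on_diff)
    ultimately have "u x - u' x = 0" using linearized_kernel_trivial[OF d] that(5) by blast
    then show ?thesis by simp
  qed
  define Lop where "Lop = (\<lambda>g. SOME u. Ck_on (Suc n) ?S u \<and> Teq d u (\<lambda>x. g x + ?V x * u x))"
  have Lop: "Ck_on (Suc n) ?S (Lop g) \<and> Teq d (Lop g) (\<lambda>x. g x + ?V x * Lop g x)" if "Cb ?S n c g" for g c
  proof -
    have "\<exists>u. Ck_on (Suc n) ?S u \<and> Teq d u (\<lambda>x. g x + ?V x * u x)" using M(2)[OF that] by blast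
    then show ?thesis unfolding Lop_def by (rule someI_ex)
  qed
  have LopB: "Cb ?S n (M * c) (Lop g)" if g: "Cb ?S n c g" for g c
  proof -
    obtain u where u: "Cb ?S n (M * c) u" "Ck_on (Suc n) ?S u" "Teq d u (\<lambda>x. g x + ?V x * u x)"
      using M(2)[OF g] by blast
    show ?thesis by (rule Cb_cong[OF _ u(1)]) (use uniq u(2,3) Lop[OF g] in blast)
  qed
  have LopD: "Cb ?S n (M * rr) (\<lambda>x. Lop g x - Lop h x)"
    if g: "Cb ?S n c g" and h: "Cb ?S n c' h" and D: "Cb ?S n rr (\<lambda>x. g x - h x)" for g h c c' rr
  proof (rule Cb_cong[OF _ LopB[OF D]])
    fix x assume x: "x \<in> ?S"
    have T0: "Teq d (\<lambda>x. Lop g x - Lop h x) (\<lambda>x. (g x + ?V x * Lop g x) - (h x + ?V x * Lop h x))"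
      using Lop[OF g] Lop[OF h] by (intro Teq_diff) auto
    have T: "Teq d (\<lambda>x. Lop g x - Lop h x) (\<lambda>x. (g x - h x) + ?V x * (Lop g x - Lop h x))"
      by (rule Teq_cong[OF T0]) (auto simp: algebra_simps)
    have C: "Ck_on (Suc n) ?S (\<lambda>x. Lop g x - Lop h x)" using Lop[OF g] Lop[OF h] by (intro Ck_on_diff) auto
    show "Lop (\<lambda>x. g x - h x) x = Lop g x - Lop h x"
      by (rule uniq[OF conjunct1[OF Lop[OF D]] conjunct2[OF Lop[OF D]] C T x])
  qed
  obtain K0 r0 where K0: "K0 \<ge> 0" "r0 > 0"
    "\<And>r rr f1 f2. r \<le> r0 \<Longrightarrow> small_pair ?S n r rr f1 f2 \<Longrightarrow>
       Cb ?S n (K0 * (r * rr)) (\<lambda>x. c0 x (f1 x) - c0 x (f2 x) - ?V x * (f1 x - f2 x))"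
    by (fact strict_diffE[OF c0])
  obtain K1 r1 where K1: "K1 \<ge> 0" "r1 > 0"
    "\<And>r rr f1 f2. r \<le> r1 \<Longrightarrow> small_pair ?S n r rr f1 f2 \<Longrightarrow> Cb ?S n (K1 * rr) (\<lambda>x. c1 x (f1 x) - c1 x (f2 x))"
    "\<And>r f. 0 \<le> r \<Longrightarrow> r \<le> r1 \<Longrightarrow> Cb ?S n r f \<Longrightarrow> Cb ?S n (K1 * r) (\<lambda>x. c1 x (f x) - c1 x 0)"
    "\<And>r f. 0 \<le> r \<Longrightarrow> r \<le> r1 \<Longrightarrow> Cb ?S n r f \<Longrightarrow> Cb ?S n K1 (\<lambda>x. c1 x (f x))"
    by (fact strict_diff_lipE[OF c1])
  obtain K2 r2 where K2: "K2 \<ge> 0" "r2 > 0"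
    "\<And>r rr f1 f2. r \<le> r2 \<Longrightarrow> small_pair ?S n r rr f1 f2 \<Longrightarrow> Cb ?S n (K2 * rr) (\<lambda>x. c2 x (f1 x) - c2 x (f2 x))"
    "\<And>r f. 0 \<le> r \<Longrightarrow> r \<le> r2 \<Longrightarrow> Cb ?S n r f \<Longrightarrow> Cb ?S n (K2 * r) (\<lambda>x. c2 x (f x) - c2 x 0)"
    "\<And>r f. 0 \<le> r \<Longrightarrow> r \<le> r2 \<Longrightarrow> Cb ?S n r f \<Longrightarrow> Cb ?S n K2 (\<lambda>x. c2 x (f x))"
    by (fact strict_diff_lipE[OF c2])
  define K where "K = K0 + K1 + K2 + 1"
  have K: "K > 0" "K0 \<le> K" "K1 \<le> K" "K2 \<le> K" using K0 K1 K2 by (auto simp: K_def)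
  \<comment> \<open>The last entry makes \<open>M * K * r \<le> 1/4\<close>, half of the contraction
    factor \<open>1/2\<close>; the others keep the strict differentiability estimates
    applicable.\<close>
  define r where "r = min (min r0 (min r1 r2)) (1 / (4 * M * K))"
  have r: "r > 0" "r \<le> r0" "r \<le> r1" "r \<le> r2" "r \<le> 1 / (4 * M * K)" using K0 K1 K2 M(1) K(1) by (auto simp: r_def)
  have MKr: "M * (K * r) \<le> 1/4"
  proof -
    have "M * K * r \<le> M * K * (1 / (4 * M * K))" using r(5) M(1) K(1) by (intro mult_left_mono) auto
    also have "\<dots> = 1/4" using M(1) K(1) by simp
    finally show ?thesis by (simp add: mult.assoc)
  qed
  \<comment> \<open>The parameter dependent terms may use the other quarter of the contraction
    factor, and at \<open>f = 0\<close> they may move the ball by at most \<open>r / 4\<close>. The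
    bound \<open>eps \<le> 1\<close> allows squares of parameters to be estimated by the
    parameters.\<close>
  define eps where "eps = min (min e0 1) (min (1 / (8 * M * K)) (r / (8 * M * K)))"
  have eps: "eps > 0" "eps \<le> e0" "eps \<le> 1" "eps \<le> 1 / (8 * M * K)" "eps \<le> r / (8 * M * K)"
    using e0 r(1) M(1) K(1) by (auto simp: eps_def)
  have MKe: "M * (2 * K * eps) \<le> 1/4" "M * (2 * K * eps) \<le> r/4"
  proof -
    have "2 * M * K * eps \<le> 2 * M * K * (1 / (8 * M * K))" using eps(4) M(1) K(1) by (intro mult_left_mono) auto
    also have "\<dots> = 1/4" using M(1) K(1) by simp
    finally show "M * (2 * K * eps) \<le> 1/4" by (simp add: algebra_simps)
    have "2 * M * K * eps \<le> 2 * M * K * (r / (8 * M * K))" using eps(5) M(1) K(1) by (intro mult_left_mono) auto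
    also have "\<dots> = r/4" using M(1) K(1) by simp
    finally show "M * (2 * K * eps) \<le> r/4" by (simp add: algebra_simps)
  qed
  define N where "N = (\<lambda>ep f x. (c0 x (f x) - c0 x 0 - ?V x * f x) + ep * c1 x (f x) + ep\<^sup>2 * c2 x (f x))"
  have sq: "ep\<^sup>2 \<le> eps" if "\<bar>ep\<bar> \<le> eps" for ep :: real
  proof -
    have "\<bar>ep\<bar> * \<bar>ep\<bar> \<le> eps * 1" using that eps by (intro mult_mono) auto
    then show ?thesis by (simp add: power2_eq_square)
  qed
  have ND: "Cb ?S n (K * r * rr + 2 * K * eps * rr) (\<lambda>x. N ep f1 x - N ep f2 x)"
    if ep: "\<bar>ep\<bar> \<le> eps" and p: "small_pair ?S n r rr f1 f2" for ep rr f1 f2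
  proof -
    have rr: "rr \<ge> 0" using p by (simp add: small_pair_def)
    have "Cb ?S n (K0 * (r * rr) + \<bar>ep\<bar> * (K1 * rr) + \<bar>ep\<^sup>2\<bar> * (K2 * rr))
       (\<lambda>x. (c0 x (f1 x) - c0 x (f2 x) - ?V x * (f1 x - f2 x)) + ep * (c1 x (f1 x) - c1 x (f2 x))
          + ep\<^sup>2 * (c2 x (f1 x) - c2 x (f2 x)))"
      by (intro Cb_add Cb_cmult K0(3)[OF r(2) p] K1(3)[OF r(3) p] K2(3)[OF r(4) p])
    moreover have "K0 * (r * rr) + \<bar>ep\<bar> * (K1 * rr) + \<bar>ep\<^sup>2\<bar> * (K2 * rr) \<le> K * r * rr + 2 * K * eps * rr"
    proof -
      have "K0 * (r * rr) \<le> K * (r * rr)" using K r(1) rr by (intro mult_right_mono) auto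
      moreover have "\<bar>ep\<bar> * (K1 * rr) \<le> eps * (K * rr)" using ep K K1(1) rr eps(1) by (intro mult_mono) auto
      moreover have "\<bar>ep\<^sup>2\<bar> * (K2 * rr) \<le> eps * (K * rr)" using sq[OF ep] K K2(1) rr eps(1) by (intro mult_mono) auto
      moreover have "K * r * rr + 2 * K * eps * rr = K * (r * rr) + eps * (K * rr) + eps * (K * rr)"
        by (simp add: algebra_simps)
      ultimately show ?thesis by linarith
    qed
    ultimately have "Cb ?S n (K * r * rr + 2 * K * eps * rr)
       (\<lambda>x. (c0 x (f1 x) - c0 x (f2 x) - ?V x * (f1 x - f2 x)) + ep * (c1 x (f1 x) - c1 x (f2 x))
          + ep\<^sup>2 * (c2 x (f1 x) - c2 x (f2 x)))" by (rule Cb_mono)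
    then show ?thesis by (rule Cb_cong[rotated]) (simp add: N_def algebra_simps)
  qed
  have z: "Cb ?S n r (\<lambda>x. 0)" using r(1) by (simp add: Cb_zero)
  \<comment> \<open>The factor \<open>3\<close> is \<open>1\<close> from the linear term and
    \<open>2\<close> from the quadratic one, where
    \<open>\<bar>ep + k\<bar> \<le> 2\<close>.\<close>
  have Neps: "Cb ?S n (3 * K * \<bar>ep - k\<bar>) (\<lambda>x. N ep f x - N k f x)"
    if e: "\<bar>ep\<bar> \<le> eps" "\<bar>k\<bar> \<le> eps" and f: "Cb ?S n r f" for ep k f
  proof -
    have "Cb ?S n (\<bar>ep - k\<bar> * K1 + \<bar>ep\<^sup>2 - k\<^sup>2\<bar> * K2)
       (\<lambda>x. (ep - k) * c1 x (f x) + (ep\<^sup>2 - k\<^sup>2) * c2 x (f x))"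
      using r f by (intro Cb_add Cb_cmult K1(5)[of r] K2(5)[of r]) auto
    moreover have "\<bar>ep - k\<bar> * K1 + \<bar>ep\<^sup>2 - k\<^sup>2\<bar> * K2 \<le> 3 * K * \<bar>ep - k\<bar>"
    proof -
      have "\<bar>ep\<^sup>2 - k\<^sup>2\<bar> = \<bar>ep - k\<bar> * \<bar>ep + k\<bar>" by (simp add: power2_eq_square abs_mult[symmetric] algebra_simps)
      also have "\<dots> \<le> \<bar>ep - k\<bar> * 2" using e eps(3) by (intro mult_left_mono) auto
      finally have "\<bar>ep\<^sup>2 - k\<^sup>2\<bar> * K2 \<le> \<bar>ep - k\<bar> * 2 * K" using K K2(1) by (intro mult_mono) auto
      moreover have "\<bar>ep - k\<bar> * K1 \<le> \<bar>ep - k\<bar> * K" using K by (intro mult_left_mono) auto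
      ultimately show ?thesis by (simp add: algebra_simps)
    qed
    ultimately have "Cb ?S n (3 * K * \<bar>ep - k\<bar>)
       (\<lambda>x. (ep - k) * c1 x (f x) + (ep\<^sup>2 - k\<^sup>2) * c2 x (f x))" by (rule Cb_mono)
    then show ?thesis by (rule Cb_cong[rotated]) (simp add: N_def algebra_simps)
  qed
  have N0: "N 0 (\<lambda>x. 0) = (\<lambda>x. 0)" by (simp add: N_def)
  have NB: "Cb ?S n (K * r * r + 2 * K * eps) (N ep f)" if ep: "\<bar>ep\<bar> \<le> eps" and f: "Cb ?S n r f" for ep f
  proof -
    have "Cb ?S n (K0 * (r * r)) (\<lambda>x. c0 x (f x) - c0 x 0 - ?V x * (f x - 0))"
      by (rule K0(3)[OF r(2), of r f "\<lambda>x. 0"]) (use f z r(1) in \<open>simp add: small_pair_def\<close>)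
    then have "Cb ?S n (K0 * (r * r) + \<bar>ep\<bar> * K1 + \<bar>ep\<^sup>2\<bar> * K2) (\<lambda>x. (c0 x (f x) - c0 x 0 - ?V x * (f x - 0))
        + ep * c1 x (f x) + ep\<^sup>2 * c2 x (f x))"
      using r f by (intro Cb_add Cb_cmult K1(5)[of r] K2(5)[of r]) auto
    moreover have "K0 * (r * r) + \<bar>ep\<bar> * K1 + \<bar>ep\<^sup>2\<bar> * K2 \<le> K * r * r + 2 * K * eps"
    proof -
      have "K0 * (r * r) \<le> K * (r * r)" using K r(1) by (intro mult_right_mono) auto
      moreover have "\<bar>ep\<bar> * K1 \<le> eps * K" using ep K K1(1) eps(1) by (intro mult_mono) auto
      moreover have "\<bar>ep\<^sup>2\<bar> * K2 \<le> eps * K" using sq[OF ep] K K2(1) eps(1) by (intro mult_mono) auto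
      ultimately show ?thesis by (simp add: algebra_simps)
    qed
    ultimately show ?thesis unfolding N_def by (simp add: Cb_mono)
  qed
  have half: "M * (K * r * rr + 2 * K * eps * rr) \<le> rr / 2" if "rr \<ge> 0" for rr
  proof -
    have "M * (K * r * rr + 2 * K * eps * rr) = (M * (K * r) + M * (2 * K * eps)) * rr" by (simp add: algebra_simps)
    also have "\<dots> \<le> (1/4 + 1/4) * rr" using MKr MKe(1) that by (intro mult_right_mono add_mono) auto
    finally show ?thesis by simp
  qed
  have contr: "Cb ?S n (rr / 2) (\<lambda>x. Lop (N ep f1) x - Lop (N ep f2) x)"
    if "\<bar>ep\<bar> \<le> eps" "0 \<le> rr" "Cb ?S n r f1" "Cb ?S n r f2" "Cb ?S n rr (\<lambda>x. f1 x - f2 x)" for ep rr f1 f2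
    by (rule Cb_mono[OF LopD[OF NB[OF that(1,3)] NB[OF that(1,4)] ND[OF that(1)]] half[OF that(2)]])
       (use that r(1) in \<open>simp add: small_pair_def\<close>)
  have ex: "\<exists>f. Cb ?S n r f \<and> (\<forall>x\<in>?S. Lop (N ep f) x = f x)" if ep: "\<bar>ep\<bar> \<le> eps" for ep
  proof (rule Cb_contraction[where a=0 and b=4 and r=r and n=n and Ph="\<lambda>f. Lop (N ep f)"])
    show "Cb ?S n r (Lop (N ep f))" if "Cb ?S n r f" for f
    proof (rule Cb_mono[OF LopB[OF NB[OF ep that]]])
      have "M * (K * r * r + 2 * K * eps) = M * (K * r) * r + M * (2 * K * eps)" by (simp add: algebra_simps)
      also have "\<dots> \<le> 1/4 * r + r/4" using MKr MKe(2) r(1) by (intro add_mono mult_right_mono) auto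
      finally show "M * (K * r * r + 2 * K * eps) \<le> r" using r(1) by simp
    qed
  qed (use contr[OF ep] r(1) in \<open>auto simp del: Cb.simps\<close>)
  define f where "f = (\<lambda>ep. SOME f. Cb ?S n r f \<and> (\<forall>x\<in>?S. Lop (N ep f) x = f x))"
  have f: "Cb ?S n r (f ep)" "\<And>x. x \<in> ?S \<Longrightarrow> Lop (N ep (f ep)) x = f ep x" if "\<bar>ep\<bar> \<le> eps" for ep
    using someI_ex[OF ex[OF that]] unfolding f_def by blast+
  \<comment> \<open>Twice \<open>M * (3 * K)\<close>: the factor \<open>2\<close> is the price of
    absorbing the contraction term with \<open>Cb_iterate\<close>.\<close>
  define C where "C = 6 * M * K"
  have C: "C > 0" using M(1) K(1) by (simp add: C_def)
  have lip: "Cb ?S n (C * \<bar>ep - k\<bar>) (\<lambda>x. f ep x - f k x)" if e: "\<bar>ep\<bar> \<le> eps" "\<bar>k\<bar> \<le> eps" for ep k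
  proof -
    have "Cb ?S n (2 * (M * (3 * K * \<bar>ep - k\<bar>))) (\<lambda>x. f ep x - f k x)"
    proof (rule Cb_iterate[OF S4, where r="r + r"])
      show "Cb ?S n (r + r) (\<lambda>x. f ep x - f k x)" by (rule Cb_diff[OF f(1)[OF e(1)] f(1)[OF e(2)]])
      fix rr :: real assume rr: "0 \<le> rr" "Cb ?S n rr (\<lambda>x. f ep x - f k x)"
      have 1: "Cb ?S n (rr / 2) (\<lambda>x. Lop (N ep (f ep)) x - Lop (N ep (f k)) x)"
        by (rule contr[OF e(1) rr(1) f(1)[OF e(1)] f(1)[OF e(2)] rr(2)])
      have 2: "Cb ?S n (M * (3 * K * \<bar>ep - k\<bar>)) (\<lambda>x. Lop (N ep (f k)) x - Lop (N k (f k)) x)"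
        by (rule LopD[OF NB[OF e(1) f(1)[OF e(2)]] NB[OF e(2) f(1)[OF e(2)]] Neps[OF e f(1)[OF e(2)]]])
      show "Cb ?S n (rr / 2 + M * (3 * K * \<bar>ep - k\<bar>)) (\<lambda>x. f ep x - f k x)"
        by (rule Cb_cong[OF _ Cb_add[OF 1 2]]) (simp add: f(2)[OF e(1)] f(2)[OF e(2)])
    qed (use r(1) M(1) K(1) in auto)
    then show ?thesis by (simp add: C_def algebra_simps)
  qed
  have e00: "\<bar>0::real\<bar> \<le> eps" using eps(1) by simp
  \<comment> \<open>The zero function is a fixed point for parameter \<open>0\<close>, and
    contraction makes it the only one. The Lipschitz estimate then also bounds \<open>f ep\<close>
    by \<open>C * \<bar>ep\<bar>\<close>.\<close>
  have zero: "f 0 x = 0" if x: "x \<in> ?S" for x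
  proof -
    have L0: "Lop (\<lambda>x. 0) x = 0" if "x \<in> ?S" for x
      using Cb_bound[OF LopB[OF Cb_zero[of 0 ?S n]] that] by simp
    have "Cb ?S n (2 * 0) (f 0)"
    proof (rule Cb_iterate[OF S4, where r=r])
      fix rr :: real assume rr: "0 \<le> rr" "Cb ?S n rr (f 0)"
      have "Cb ?S n (rr / 2) (\<lambda>x. Lop (N 0 (f 0)) x - Lop (N 0 (\<lambda>x. 0)) x)"
        by (rule contr[OF e00 rr(1) f(1)[OF e00] z]) (use rr in simp)
      then show "Cb ?S n (rr / 2 + 0) (f 0)"
        unfolding add_0_right by (rule Cb_cong[rotated]) (simp add: f(2)[OF e00] N0 L0)
    qed (use r(1) f(1)[OF e00] in auto)
    from Cb_bound[OF this x] show ?thesis by simp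
  qed
  have main: "Ck_on (Suc n) ?S (f ep) \<and>
     Teq d (f ep) (\<lambda>x. c0 x (f ep x) - c0 x 0 + ep * c1 x (f ep x) + ep\<^sup>2 * c2 x (f ep x)) \<and>
     Cb ?S n (C * \<bar>ep\<bar>) (f ep)" if e: "\<bar>ep\<bar> \<le> eps" for ep
  proof (intro conjI)
    note L = Lop[OF NB[OF e f(1)[OF e]]]
    show "Ck_on (Suc n) ?S (f ep)" by (rule Ck_on_cong[OF f(2)[OF e] conjunct1[OF L]])
    show "Teq d (f ep) (\<lambda>x. c0 x (f ep x) - c0 x 0 + ep * c1 x (f ep x) + ep\<^sup>2 * c2 x (f ep x))"
    proof (rule Teq_cong[OF conjunct2[OF L] f(2)[OF e]])
      fix x :: real assume x: "x \<in> ?S"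
      show "N ep (f ep) x + ?V x * Lop (N ep (f ep)) x =
          c0 x (f ep x) - c0 x 0 + ep * c1 x (f ep x) + ep\<^sup>2 * c2 x (f ep x)"
        unfolding f(2)[OF e x] by (simp add: N_def)
    qed
    show "Cb ?S n (C * \<bar>ep\<bar>) (f ep)"
      by (rule Cb_cong[OF _ lip[OF e e00, simplified diff_0_right]]) (simp add: zero)
  qed
  show ?thesis
    using eps(1,2) C main lip by (intro exI[of _ eps] conjI exI[of _ C] exI[of _ f]) blast+
qed

section \<open>The equation outside the light cone\<close>

text \<open>A Gronwall estimate through the maximum \<open>N\<close> of
  \<open>exp (- l * t) * (\<bar>f t\<bar> + \<bar>f1 t\<bar>)\<close>. With
  \<open>l = 2 * (K + 1)\<close> integrating \<open>f1\<close> and \<open>f2\<close> costs at most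
  \<open>N / 2\<close>, which is absorbed.\<close>

lemma second_order_growth:
  fixes f :: "real \<Rightarrow> real"
  assumes L: "0 \<le> L" and K: "0 \<le> K" and et: "0 \<le> et"
    and f1: "PROP deriv_on {0..L} f f1"
    and f2: "PROP deriv_on {0..L} f1 f2"
    and b: "\<And>t. t \<in> {0..L} \<Longrightarrow> \<bar>f2 t\<bar> \<le> K * (\<bar>f t\<bar> + \<bar>f1 t\<bar>) + et"
    and t: "t \<in> {0..L}"
  shows "\<bar>f t\<bar> + \<bar>f1 t\<bar> \<le> 2 * exp (2 * (K + 1) * L) * (\<bar>f 0\<bar> + \<bar>f1 0\<bar> + et * L)"
proof -
  define l where "l = 2 * (K + 1)"
  have l: "l > 0" using K by (simp add: l_def)
  define E where "E = (\<lambda>t. exp (- l * t) * (\<bar>f t\<bar> + \<bar>f1 t\<bar>))"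
  have "continuous_on {0..L} E"
    unfolding E_def by (intro continuous_intros DERIV_continuous_on[OF f1] DERIV_continuous_on[OF f2])
  then obtain z where z: "z \<in> {0..L}" "\<And>t. t \<in> {0..L} \<Longrightarrow> E t \<le> E z"
    using continuous_attains_sup[of "{0..L}" E] L by auto
  define N where "N = E z"
  have N0: "N \<ge> 0" by (simp add: N_def E_def)
  have fN: "\<bar>f t\<bar> + \<bar>f1 t\<bar> \<le> N * exp (l * t)" if "t \<in> {0..L}" for t
  proof -
    have "\<bar>f t\<bar> + \<bar>f1 t\<bar> = E t * exp (l * t)" by (simp add: E_def exp_minus)
    also have "\<dots> \<le> N * exp (l * t)" unfolding N_def by (intro mult_right_mono z that) auto
    finally show ?thesis .
  qed
  have e': "((\<lambda>t. c / l * exp (l * t)) has_real_derivative c * exp (l * s)) (at s within {0..L})" for c s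
    using l by (auto intro!: derivative_eq_intros)
  have 1: "\<bar>f z\<bar> \<le> \<bar>f 0\<bar> + N / l * exp (l * z)"
  proof -
    have "\<bar>f z - f 0\<bar> \<le> N / l * exp (l * z) - N / l * exp (l * 0)"
    proof (rule exp_growth_bound[OF f1 e' _ z(1)])
      show "\<bar>f1 s\<bar> \<le> N * exp (l * s)" if "s \<in> {0..L}" for s
        using fN[OF that] abs_ge_zero[of "f s"] by linarith
    qed
    moreover have "N / l \<ge> 0" using N0 l by simp
    ultimately show ?thesis by simp
  qed
  have 2: "\<bar>f1 z\<bar> \<le> \<bar>f1 0\<bar> + et * L + K * N / l * exp (l * z)"
  proof -
    have "\<bar>f1 z - f1 0\<bar> \<le> (K * N / l * exp (l * z) + et * z) - (K * N / l * exp (l * 0) + et * 0)"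
    proof (rule exp_growth_bound[OF f2 _ _ z(1)])
      show "((\<lambda>t. K * N / l * exp (l * t) + et * t) has_real_derivative K * N * exp (l * s) + et) (at s within {0..L})" for s
        by (intro DERIV_add e') (auto intro!: derivative_eq_intros)
      show "\<bar>f2 s\<bar> \<le> K * N * exp (l * s) + et" if "s \<in> {0..L}" for s
        using b[OF that] mult_left_mono[OF fN[OF that] K] by (simp add: mult.assoc)
    qed
    moreover have "K * N / l \<ge> 0" using N0 l K by simp
    moreover have "et * z \<le> et * L" using z(1) et by (intro mult_left_mono) auto
    ultimately show ?thesis by simp
  qed
  have "N \<le> \<bar>f 0\<bar> + \<bar>f1 0\<bar> + et * L + N / 2"
  proof -
    have "(K + 1) / l = 1/2" using K by (simp add: l_def)
    then have k: "N / l + K * N / l = N / 2" by (metis add.commute add_divide_distrib distrib_right mult_1 times_divide_eq_left times_divide_eq_right mult.commute)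
    have le: "exp (- l * z) \<le> 1" using l z(1) by simp
    have "N = exp (- l * z) * (\<bar>f z\<bar> + \<bar>f1 z\<bar>)" by (simp add: N_def E_def)
    also have "\<dots> \<le> exp (- l * z) * ((\<bar>f 0\<bar> + \<bar>f1 0\<bar> + et * L) + (N / l + K * N / l) * exp (l * z))"
      using 1 2 by (intro mult_left_mono) (auto simp: algebra_simps)
    also have "\<dots> = exp (- l * z) * (\<bar>f 0\<bar> + \<bar>f1 0\<bar> + et * L) + N / 2"
      unfolding k by (simp add: distrib_left exp_minus)
    also have "\<dots> \<le> 1 * (\<bar>f 0\<bar> + \<bar>f1 0\<bar> + et * L) + N / 2"
      using le et L by (intro add_right_mono mult_right_mono) auto
    finally show ?thesis by simp
  qed
  then have N2: "N \<le> 2 * (\<bar>f 0\<bar> + \<bar>f1 0\<bar> + et * L)" by simp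
  have "\<bar>f t\<bar> + \<bar>f1 t\<bar> \<le> N * exp (l * t)" by (rule fN[OF t])
  also have "\<dots> \<le> (2 * (\<bar>f 0\<bar> + \<bar>f1 0\<bar> + et * L)) * exp (l * L)"
    using N2 N0 t l et L by (intro mult_mono) auto
  also have "\<dots> = 2 * exp (2 * (K + 1) * L) * (\<bar>f 0\<bar> + \<bar>f1 0\<bar> + et * L)" unfolding l_def by (simp only: mult_ac)
  finally show ?thesis .
qed

lemma has_real_derivative_integral:
  fixes f :: "real \<Rightarrow> real"
  assumes "continuous_on {0..L} f" "t \<in> {0..L}"
  shows "((\<lambda>t. integral {0..t} f) has_real_derivative f t) (at t within {0..L})"
  using integral_has_vector_derivative[OF assms] by (simp add: has_real_derivative_iff_has_vector_derivative)

text \<open>Picard iteration for the unknown \<open>exp (- l * t) * v t\<close>. Since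
  \<open>p\<close> is globally Lipschitz, the weight makes the map a contraction on the whole
  interval, so no continuation argument is required.\<close>

lemma second_order_ivp:
  fixes p a c :: "real \<Rightarrow> real"
  assumes L: "0 < L" and a: "continuous_on {0..L} a" and c: "continuous_on {0..L} c"
    and lip: "\<And>u v. \<bar>p u - p v\<bar> \<le> La * \<bar>u - v\<bar>"
  obtains y v where "PROP deriv_on {0..L} y v"
    "\<And>t. t \<in> {0..L} \<Longrightarrow> (v has_real_derivative a t * v t + c t * p (y t)) (at t within {0..L})"
    "y 0 = y0" "v 0 = v0"
proof -
  let ?S = "{0..L}"
  have La: "La \<ge> 0" using lip[of 1 0] by (simp add: order_trans[OF abs_ge_zero])
  have contp: "continuous_on UNIV p"
  proof (rule continuous_on_iff[THEN iffD2], intro ballI allI impI)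
    fix x e :: real assume "e > 0"
    then show "\<exists>d>0. \<forall>x'\<in>UNIV. dist x' x < d \<longrightarrow> dist (p x') (p x) < e"
    proof (intro exI[of _ "e / (La + 1)"] conjI ballI impI)
      fix x' assume "dist x' x < e / (La + 1)"
      then have "(La + 1) * \<bar>x' - x\<bar> < e" using La by (simp add: dist_real_def pos_less_divide_eq mult.commute)
      moreover have "\<bar>p x' - p x\<bar> \<le> (La + 1) * \<bar>x' - x\<bar>"
        using lip[of x' x] mult_right_mono[of La "La + 1" "\<bar>x' - x\<bar>"] by simp
      ultimately show "dist (p x') (p x) < e" by (simp add: dist_real_def)
    qed (use La in auto)
  qed
  obtain A where A: "A \<ge> 0" "Cb ?S 0 A a" using Ck_on_imp_Cb[of 0 ?S a] a by auto
  obtain C where C: "C \<ge> 0" "Cb ?S 0 C c" using Ck_on_imp_Cb[of 0 ?S c] c by auto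
  \<comment> \<open>Both integrations gain \<open>1 / l\<close>. The first summand yields the
    contraction factor \<open>1/2\<close> for \<open>w\<close>; the summand \<open>1\<close> ensures
    \<open>l \<ge> 1\<close>, so that passing from \<open>f\<close> to \<open>y\<close> loses
    nothing.\<close>
  define l where "l = 2 * (A + C * La) + 1"
  have l: "l \<ge> 1" using A(1) C(1) La by (simp add: l_def)
  define y where "y = (\<lambda>f t. y0 + integral {0..t} (\<lambda>s. exp (l * s) * f s))"
  define R where "R = (\<lambda>f t. a t * (exp (l * t) * f t) + c t * p (y f t))"
  define w where "w = (\<lambda>f t. v0 + integral {0..t} (R f))"
  define Ph where "Ph = (\<lambda>f t. exp (- l * t) * w f t)"
  have y': "(y f has_real_derivative exp (l * t) * f t) (at t within ?S)" if "continuous_on ?S f" "t \<in> ?S" for f t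
  proof -
    have "((\<lambda>t. integral {0..t} (\<lambda>s. exp (l * s) * f s)) has_real_derivative exp (l * t) * f t) (at t within ?S)"
      by (rule has_real_derivative_integral[OF _ that(2)]) (intro continuous_intros that)
    then show ?thesis unfolding y_def by (auto intro!: derivative_eq_intros)
  qed
  have Rc: "continuous_on ?S (R f)" if "continuous_on ?S f" for f
    unfolding R_def by (intro continuous_intros a c that continuous_on_compose2[OF contp] DERIV_continuous_on[OF y'[OF that]]) auto
  have w': "(w f has_real_derivative R f t) (at t within ?S)" if "continuous_on ?S f" "t \<in> ?S" for f t
    using has_real_derivative_integral[OF Rc[OF that(1)] that(2)] unfolding w_def by (auto intro!: derivative_eq_intros)
  have Phc: "continuous_on ?S (Ph f)" if "continuous_on ?S f" for f
    unfolding Ph_def by (intro continuous_intros DERIV_continuous_on[OF w'[OF that]])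
  have e': "((\<lambda>t. k / l * exp (l * t)) has_real_derivative k * exp (l * s)) (at s within ?S)" for k s
    using l by (auto intro!: derivative_eq_intros)
  have contr: "Cb ?S 0 (r / 2) (\<lambda>x. Ph f1 x - Ph f2 x)"
    if r: "0 \<le> r" and c1: "continuous_on ?S f1" and c2: "continuous_on ?S f2" and D0: "Cb ?S 0 r (\<lambda>x. f1 x - f2 x)" for r f1 f2
  proof -
    have D: "\<bar>f1 s - f2 s\<bar> \<le> r" if "s \<in> ?S" for s using D0 that by (rule Cb_bound)
    have Dy: "\<bar>y f1 t - y f2 t\<bar> \<le> r * exp (l * t)" if t: "t \<in> ?S" for t
    proof -
      have "\<bar>(y f1 t - y f2 t) - (y f1 0 - y f2 0)\<bar> \<le> r / l * exp (l * t) - r / l * exp (l * 0)"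
      proof (rule exp_growth_bound[OF DERIV_diff[OF y'[OF c1] y'[OF c2]] e' _ t])
        fix s assume s: "s \<in> ?S"
        have "\<bar>exp (l * s) * f1 s - exp (l * s) * f2 s\<bar> = exp (l * s) * \<bar>f1 s - f2 s\<bar>"
          by (simp add: right_diff_distrib[symmetric] abs_mult)
        also have "\<dots> \<le> exp (l * s) * r" using D[OF s] by (intro mult_left_mono) auto
        finally show "\<bar>exp (l * s) * f1 s - exp (l * s) * f2 s\<bar> \<le> r * exp (l * s)" by (simp add: mult.commute)
      qed
      moreover have "y f1 0 - y f2 0 = 0" by (simp add: y_def)
      moreover have "r / l * exp (l * t) \<le> r * exp (l * t)"
        using l r by (intro mult_right_mono) (auto simp: divide_le_eq mult_le_cancel_left1)
      moreover have "r / l \<ge> 0" using l r by simp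
      ultimately show ?thesis by simp
    qed
    have Dw: "\<bar>w f1 t - w f2 t\<bar> \<le> r / 2 * exp (l * t)" if t: "t \<in> ?S" for t
    proof -
      let ?k = "(A + C * La) * r"
      have "\<bar>(w f1 t - w f2 t) - (w f1 0 - w f2 0)\<bar> \<le> ?k / l * exp (l * t) - ?k / l * exp (l * 0)"
      proof (rule exp_growth_bound[OF DERIV_diff[OF w'[OF c1] w'[OF c2]] e' _ t])
        fix s assume s: "s \<in> ?S"
        have "\<bar>a s * (exp (l * s) * (f1 s - f2 s))\<bar> \<le> A * (exp (l * s) * r)"
          unfolding abs_mult using Cb_bound[OF A(2) s] D[OF s] A(1) by (intro mult_mono) auto
        moreover have "\<bar>c s * (p (y f1 s) - p (y f2 s))\<bar> \<le> C * (La * (r * exp (l * s)))"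
          unfolding abs_mult using Cb_bound[OF C(2) s] C(1)
            order_trans[OF lip mult_left_mono[OF Dy[OF s] La]] by (intro mult_mono) auto
        moreover have "R f1 s - R f2 s = a s * (exp (l * s) * (f1 s - f2 s)) + c s * (p (y f1 s) - p (y f2 s))"
          by (simp add: R_def algebra_simps)
        ultimately have "\<bar>R f1 s - R f2 s\<bar> \<le> A * (exp (l * s) * r) + C * (La * (r * exp (l * s)))"
          by linarith
        then show "\<bar>R f1 s - R f2 s\<bar> \<le> ?k * exp (l * s)" by (simp add: algebra_simps)
      qed
      moreover have "w f1 0 - w f2 0 = 0" by (simp add: w_def)
      moreover have kl: "?k / l \<le> r / 2"
      proof -
        have "2 * (A + C * La) * r \<le> l * r"
          using r by (intro mult_right_mono) (auto simp: l_def)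
        then have "2 * ((A + C * La) * r) \<le> l * r" by (simp only: mult.assoc)
        then show ?thesis using l by (simp add: divide_le_eq field_simps)
      qed
      moreover have "?k / l * exp (l * t) \<le> r / 2 * exp (l * t)" using kl by (intro mult_right_mono) auto
      moreover have "?k / l \<ge> 0" using l r A(1) C(1) La by simp
      moreover have "exp (l * 0) = 1" by simp
      ultimately show ?thesis by (simp only: diff_zero mult_1_right)
    qed
    have "\<bar>Ph f1 t - Ph f2 t\<bar> \<le> r / 2" if t: "t \<in> ?S" for t
    proof -
      have "\<bar>Ph f1 t - Ph f2 t\<bar> = exp (- l * t) * \<bar>w f1 t - w f2 t\<bar>"
        by (simp add: Ph_def right_diff_distrib[symmetric] abs_mult)
      also have "\<dots> \<le> exp (- l * t) * (r / 2 * exp (l * t))" using Dw[OF t] by (intro mult_left_mono) auto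
      also have "\<dots> = r / 2" by (simp add: exp_minus)
      finally show ?thesis .
    qed
    then show ?thesis using Phc[OF c1] Phc[OF c2] by (auto intro!: continuous_intros)
  qed
  obtain r0 where r0: "r0 \<ge> 0" "Cb ?S 0 r0 (Ph (\<lambda>x. 0))"
    using Ck_on_imp_Cb[of 0 ?S "Ph (\<lambda>x. 0)"] Phc[of "\<lambda>x. 0"] by auto
  obtain f where f: "Cb ?S 0 (2 * r0) f" "\<And>x. x \<in> ?S \<Longrightarrow> Ph f x = f x"
  proof (rule Cb_contraction[OF L, of "2 * r0" 0 Ph])
    show "Cb ?S 0 (2 * r0) (Ph f)" if "Cb ?S 0 (2 * r0) f" for f
    proof -
      have "Cb ?S 0 (2 * r0 / 2) (\<lambda>x. Ph f x - Ph (\<lambda>x. 0) x)"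
        by (rule contr) (use that r0 in auto)
      from Cb_add[OF this r0(2)] show ?thesis by simp
    qed
  qed (use contr r0(1) in auto)
  have fc: "continuous_on ?S f" using f(1) by simp
  have v: "w f t = exp (l * t) * f t" if "t \<in> ?S" for t
    using f(2)[OF that] by (simp add: Ph_def exp_minus field_simps)
  show ?thesis
  proof (rule that[of "y f" "w f"])
    fix t assume t: "t \<in> ?S"
    show "(y f has_real_derivative w f t) (at t within ?S)" using y'[OF fc t] v[OF t] by simp
    show "(w f has_real_derivative a t * w f t + c t * p (y f t)) (at t within ?S)"
      using w'[OF fc t] v[OF t] by (simp add: R_def)
  next
    show "y f 0 = y0" "w f 0 = v0" by (auto simp: y_def w_def)
  qed
qed

lemma has_derivative_reflect:
  fixes f :: "real \<Rightarrow> real"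
  assumes "PROP deriv_on {0..L} f f'" "s \<in> {0..L}"
  shows "((\<lambda>s. f (L - s)) has_real_derivative - f' (L - s)) (at s within {0..L})"
proof -
  have "((\<lambda>s. f (L - s)) has_real_derivative f' (L - s) * (- 1)) (at s within {0..L})"
    by (rule DERIV_compose_within[OF assms(1)]) (use assms(2) in \<open>auto intro!: derivative_eq_intros\<close>)
  then show ?thesis by simp
qed

text \<open>\<open>F s = f (1/s)\<close> turns the profile equation into one that is regular at \<open>s = 0\<close>.\<close>

definition outer_solution :: "nat \<Rightarrow> (real \<Rightarrow> real) \<Rightarrow> real \<Rightarrow> (real \<Rightarrow> real) \<Rightarrow> (real \<Rightarrow> real) \<Rightarrow> (real \<Rightarrow> real) \<Rightarrow> bool" where
  "outer_solution d p b F F1 F2 \<longleftrightarrow> (\<forall>s\<in>{b..3/4}.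
     (F has_real_derivative F1 s) (at s within {b..3/4}) \<and> (F1 has_real_derivative F2 s) (at s within {b..3/4}) \<and>
     (s\<^sup>2 - 1) * F2 s - (real d - 3) * s * F1 s = (real d - 1) * p (F s))"

lemma outer_bound:
  fixes s :: real assumes "s \<in> {0..3/4}" shows "7/16 \<le> 1 - s\<^sup>2"
proof -
  have "s\<^sup>2 \<le> (3/4)\<^sup>2" using assms by (intro power_mono) auto
  then show ?thesis by (simp add: power2_eq_square)
qed

text \<open>In \<open>t = 3/4 - s\<close> this is an initial value problem at \<open>t = 0\<close>.
  The light cone \<open>s = 1\<close> lies off the interval, so the coefficients are smooth, and
  smoothness of \<open>F\<close> follows by feeding its regularity back into the equation.\<close>

lemma outer_solution_exists:
  assumes lip: "\<And>u v. \<bar>p u - p v\<bar> \<le> L * \<bar>u - v\<bar>" and p: "smooth_on UNIV p"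
  obtains F F1 F2 where "outer_solution d p 0 F F1 F2" "F (3/4) = F0" "F1 (3/4) = G0" "smooth_on {0..3/4} F"
proof -
  let ?S = "{0..3/4::real}"
  define a where "a = (\<lambda>s. (real d - 3) * s / (1 - s\<^sup>2))"
  define c where "c = (\<lambda>s. - (real d - 1) / (1 - s\<^sup>2))"
  have nz: "1 - s\<^sup>2 \<noteq> 0" if "s \<in> ?S" for s using outer_bound[OF that] by auto
  have sma: "smooth_on ?S a" "smooth_on ?S c" unfolding a_def c_def
    by (intro smooth_on_divide smooth_on_mult smooth_on_diff smooth_on_const smooth_on_ident smooth_on_power nz; assumption)+
  have refl: "continuous_on ?S (\<lambda>t. a (3/4 - t))" "continuous_on ?S (\<lambda>t. c (3/4 - t))"
    by (rule continuous_on_compose2[OF smooth_on_imp_continuous[OF sma(1)]], auto intro!: continuous_intros)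
       (rule continuous_on_compose2[OF smooth_on_imp_continuous[OF sma(2)]], auto intro!: continuous_intros)
  obtain y v where y: "PROP deriv_on ?S y v"
    "\<And>t. t \<in> ?S \<Longrightarrow> (v has_real_derivative a (3/4 - t) * v t + c (3/4 - t) * p (y t)) (at t within ?S)"
    "y 0 = F0" "v 0 = - G0"
    using second_order_ivp[OF _ refl lip, of F0 "- G0"] by auto
  define F where "F = (\<lambda>s. y (3/4 - s))"
  define F1 where "F1 = (\<lambda>s. - v (3/4 - s))"
  define F2 where "F2 = (\<lambda>s. - (a s * F1 s) + c s * p (F s))"
  have d1: "(F has_real_derivative F1 s) (at s within ?S)" if "s \<in> ?S" for s
    unfolding F_def F1_def by (rule has_derivative_reflect[OF y(1) that])
  have d2: "(F1 has_real_derivative F2 s) (at s within ?S)" if "s \<in> ?S" for s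
    using DERIV_minus[OF has_derivative_reflect[OF y(2) that]] unfolding F1_def F2_def F_def
    by (simp add: add.commute)
  have "Ck_on k ?S F \<and> Ck_on k ?S F1" for k
  proof (induction k)
    case 0
    show ?case using DERIV_continuous_on[OF d1] DERIV_continuous_on[OF d2] by simp
  next
    case (Suc k)
    have "Ck_on k ?S F2"
      unfolding F2_def using Suc sma p Ck_on_compose[of k UNIV p ?S F]
      by (intro Ck_on_add Ck_on_minus Ck_on_mult) (auto simp: smooth_on_def)
    then show ?case using Ck_on_SucI[OF d1] Ck_on_SucI[OF d2] Suc by blast
  qed
  then have sm: "smooth_on ?S F" by (simp add: smooth_on_def)
  have "outer_solution d p 0 F F1 F2"
    unfolding outer_solution_def
  proof (intro ballI conjI)
    fix s assume s: "s \<in> ?S"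
    have "(s\<^sup>2 - 1) * a s = - ((real d - 3) * s)" "(s\<^sup>2 - 1) * c s = real d - 1"
      using nz[OF s] by (simp_all add: a_def c_def field_simps)
    then have "(s\<^sup>2 - 1) * F2 s = (real d - 3) * s * F1 s + (real d - 1) * p (F s)"
    proof -
      assume *: "(s\<^sup>2 - 1) * a s = - ((real d - 3) * s)" "(s\<^sup>2 - 1) * c s = real d - 1"
      have "(s\<^sup>2 - 1) * F2 s = - (((s\<^sup>2 - 1) * a s) * F1 s) + ((s\<^sup>2 - 1) * c s) * p (F s)"
        unfolding F2_def by (simp only: distrib_left mult.assoc mult_minus_right)
      then show ?thesis unfolding * by simp
    qed
    then show "(s\<^sup>2 - 1) * F2 s - (real d - 3) * s * F1 s = (real d - 1) * p (F s)" by simp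
  qed (use d1 d2 in auto)
  then show ?thesis by (rule that[OF _ _ _ sm]) (auto simp: F_def F1_def y)
qed

text \<open>\<open>z\<close> bounds the difference of the data at \<open>s = 3/4\<close> and
  \<open>et\<close> that of the nonlinearities. The constant \<open>M\<close> stands outside the
  quantifiers: it serves every left end \<open>b\<close>, every pair of nonlinearities and all
  solutions.\<close>

abbreviation (input) outer_stable :: "nat \<Rightarrow> real \<Rightarrow> real \<Rightarrow> prop" where
  "outer_stable d L M \<equiv> (\<And>p q F F1 F2 G G1 G2 et z b s. 0 \<le> b \<Longrightarrow> (\<And>u v. \<bar>p u - p v\<bar> \<le> L * \<bar>u - v\<bar>) \<Longrightarrow> (\<And>u. \<bar>p u - q u\<bar> \<le> et) \<Longrightarrow>
      outer_solution d p b F F1 F2 \<Longrightarrow> outer_solution d q b G G1 G2 \<Longrightarrow>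
      \<bar>F (3/4) - G (3/4)\<bar> \<le> z \<Longrightarrow> \<bar>F1 (3/4) - G1 (3/4)\<bar> \<le> z \<Longrightarrow> s \<in> {b..3/4} \<Longrightarrow>
      \<bar>F s - G s\<bar> \<le> M * (z + et) \<and> \<bar>F1 s - G1 s\<bar> \<le> M * (z + et) \<and> \<bar>F2 s - G2 s\<bar> \<le> M * (z + et))"

text \<open>Gronwall for the difference, run from \<open>s = 3/4\<close> downwards where
  \<open>1 - s\<^sup>2 \<ge> 7/16\<close>. With \<open>z = et = 0\<close> it gives uniqueness, used
  for matching; otherwise it gives the Lipschitz dependence on the parameter.\<close>

lemma outer_solution_stability:
  assumes d: "d \<ge> 3" and L: "La \<ge> 0"
  obtains M where "M > 0"
    "PROP outer_stable d La M"
proof -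
  \<comment> \<open>The \<open>3\<close> is an upper bound for \<open>16/7\<close>, the inverse of
    the lower bound on the leading coefficient.\<close>
  define K where "K = 3 * real d * (La + 1)"
  have K: "K \<ge> 0" using L by (simp add: K_def)
  define B where "B = 2 * exp (2 * (K + 1) * (3/4))"
  have B: "B > 0" by (simp add: B_def)
  define M0 where "M0 = B * (2 + 3 * real d)"
  have M0: "M0 > 0" using B d by (simp add: M0_def)
  define M where "M = M0 + K * M0 + 3 * real d"
  have M: "M > 0" "M0 \<le> M" using M0 K mult_nonneg_nonneg[of K M0] by (auto simp: M_def intro!: add_pos_nonneg)
  show ?thesis
  proof (rule that[OF M(1)])
    fix p q F F1 F2 G G1 G2 and et z b s :: real
    let ?S = "{b..3/4}"
    assume b: "0 \<le> b" and lip: "\<And>u v. \<bar>p u - p v\<bar> \<le> La * \<bar>u - v\<bar>" and pq: "\<And>u. \<bar>p u - q u\<bar> \<le> et"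
      and F: "outer_solution d p b F F1 F2" and G: "outer_solution d q b G G1 G2"
      and z: "\<bar>F (3/4) - G (3/4)\<bar> \<le> z" "\<bar>F1 (3/4) - G1 (3/4)\<bar> \<le> z" and s: "s \<in> ?S"
    have nn: "et \<ge> 0" "z \<ge> 0" using pq[of 0] z by linarith+
    define f where "f = (\<lambda>s. F s - G s)"
    define f1 where "f1 = (\<lambda>s. F1 s - G1 s)"
    define f2 where "f2 = (\<lambda>s. F2 s - G2 s)"
    have f': "(f has_real_derivative f1 t) (at t within ?S)" "(f1 has_real_derivative f2 t) (at t within ?S)"
      if "t \<in> ?S" for t
      using F G that unfolding f_def f1_def f2_def outer_solution_def by (auto intro!: DERIV_diff)
    have bd: "\<bar>f2 t\<bar> \<le> K * (\<bar>f t\<bar> + \<bar>f1 t\<bar>) + 3 * real d * et" if t: "t \<in> ?S" for t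
    proof -
      have e: "(t\<^sup>2 - 1) * f2 t = (real d - 3) * t * f1 t + (real d - 1) * (p (F t) - q (G t))"
      proof -
        have "(t\<^sup>2 - 1) * F2 t - (real d - 3) * t * F1 t = (real d - 1) * p (F t)"
          "(t\<^sup>2 - 1) * G2 t - (real d - 3) * t * G1 t = (real d - 1) * q (G t)"
          using F G t unfolding outer_solution_def by blast+
        then show ?thesis unfolding f1_def f2_def by (simp only: right_diff_distrib)
      qed
      have "\<bar>p (F t) - q (G t)\<bar> \<le> La * \<bar>f t\<bar> + et"
        using lip[of "F t" "G t"] pq[of "G t"] unfolding f_def by linarith
      then have 1: "\<bar>(real d - 1) * (p (F t) - q (G t))\<bar> \<le> real d * (La * \<bar>f t\<bar> + et)"
        unfolding abs_mult using d by (intro mult_mono) auto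
      have "\<bar>(real d - 3) * t\<bar> \<le> real d * 1" unfolding abs_mult using d t b by (intro mult_mono) auto
      then have 2: "\<bar>(real d - 3) * t * f1 t\<bar> \<le> real d * \<bar>f1 t\<bar>"
        unfolding abs_mult[of "(real d - 3) * t"] by (intro mult_right_mono) auto
      have "7/16 * \<bar>f2 t\<bar> \<le> \<bar>t\<^sup>2 - 1\<bar> * \<bar>f2 t\<bar>" using outer_bound[of t] t b by (intro mult_right_mono) auto
      also have "\<dots> = \<bar>(real d - 3) * t * f1 t + (real d - 1) * (p (F t) - q (G t))\<bar>" unfolding e[symmetric] abs_mult ..
      also have "\<dots> \<le> real d * \<bar>f1 t\<bar> + real d * (La * \<bar>f t\<bar> + et)" using 1 2 by linarith
      finally have 3: "\<bar>f2 t\<bar> \<le> 16/7 * (real d * \<bar>f1 t\<bar> + real d * (La * \<bar>f t\<bar> + et))" by simp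
      have "0 \<le> real d * \<bar>f1 t\<bar> + real d * (La * \<bar>f t\<bar> + et)" using nn L by simp
      then have "\<bar>f2 t\<bar> \<le> 3 * (real d * \<bar>f1 t\<bar> + real d * (La * \<bar>f t\<bar> + et))" using 3 by linarith
      also have "\<dots> \<le> K * (\<bar>f t\<bar> + \<bar>f1 t\<bar>) + 3 * real d * et"
      proof -
        have "0 \<le> real d * (La * \<bar>f1 t\<bar>)" "0 \<le> real d * \<bar>f t\<bar>" using L by simp_all
        then show ?thesis unfolding K_def by (simp add: algebra_simps)
      qed
      finally show ?thesis .
    qed
    have b': "b \<le> 3/4" using s by simp
    let ?T = "{0..3/4 - b}"
    define h where "h = (\<lambda>t. f (3/4 - t))"
    define h1 where "h1 = (\<lambda>t. - f1 (3/4 - t))"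
    have refl: "((\<lambda>t. u (3/4 - t)) has_real_derivative - u' (3/4 - t)) (at t within ?T)"
      if "t \<in> ?T" "PROP deriv_on ?S u u'" for t u u'
    proof -
      have "((\<lambda>t. u (3/4 - t)) has_real_derivative u' (3/4 - t) * (0 - 1)) (at t within ?T)"
        by (rule DERIV_compose_within[OF that(2)]) (use that(1) in \<open>auto intro!: derivative_eq_intros\<close>)
      then show ?thesis by simp
    qed
    have h': "(h has_real_derivative h1 t) (at t within ?T)" "(h1 has_real_derivative f2 (3/4 - t)) (at t within ?T)"
      if "t \<in> ?T" for t
      unfolding h_def h1_def using refl[OF that f'(1)] DERIV_minus[OF refl[OF that f'(2)]] by auto
    have T: "3/4 - t \<in> ?S" if "t \<in> ?T" for t using that by auto
    have "\<bar>h t\<bar> + \<bar>h1 t\<bar> \<le> 2 * exp (2 * (K + 1) * (3/4 - b)) * (\<bar>h 0\<bar> + \<bar>h1 0\<bar> + 3 * real d * et * (3/4 - b))" if "t \<in> ?T" for t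
      by (rule second_order_growth[OF _ K _ h' _ that]) (use bd[OF T] nn b' in \<open>auto simp: h_def h1_def\<close>)
    from this[of "3/4 - s"] s have "\<bar>f s\<bar> + \<bar>f1 s\<bar> \<le> 2 * exp (2 * (K + 1) * (3/4 - b)) * (\<bar>f (3/4)\<bar> + \<bar>f1 (3/4)\<bar> + 3 * real d * et * (3/4 - b))"
      by (simp add: h_def h1_def)
    also have "\<dots> \<le> B * (\<bar>f (3/4)\<bar> + \<bar>f1 (3/4)\<bar> + 3 * real d * et * (3/4))"
    proof (rule mult_mono)
      have "2 * (K + 1) * (3/4 - b) \<le> 2 * (K + 1) * (3/4)" using K b by (intro mult_left_mono) auto
      then show "2 * exp (2 * (K + 1) * (3/4 - b)) \<le> B" unfolding B_def by simp
      have "3 * real d * et * (3/4 - b) \<le> 3 * real d * et * (3/4)" using nn b by (intro mult_left_mono) auto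
      then show "\<bar>f (3/4)\<bar> + \<bar>f1 (3/4)\<bar> + 3 * real d * et * (3/4 - b) \<le> \<bar>f (3/4)\<bar> + \<bar>f1 (3/4)\<bar> + 3 * real d * et * (3/4)" by simp
    qed (use B nn b' in auto)
    also have "\<dots> \<le> B * (2 * z + 3 * real d * et)"
    proof (rule mult_left_mono)
      have "0 \<le> real d * et" "0 \<le> et * real d" using nn by simp_all
      then have "3 * real d * et * (3/4) \<le> 3 * real d * et" by simp
      then show "\<bar>f (3/4)\<bar> + \<bar>f1 (3/4)\<bar> + 3 * real d * et * (3/4) \<le> 2 * z + 3 * real d * et"
        using z unfolding f_def f1_def by linarith
    qed (use B in simp)
    also have "\<dots> \<le> B * ((2 + 3 * real d) * (z + et))"
      using B nn by (intro mult_left_mono) (auto simp: algebra_simps)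
    finally have s01: "\<bar>f s\<bar> + \<bar>f1 s\<bar> \<le> M0 * (z + et)" by (simp add: M0_def mult.assoc)
    have "\<bar>f2 s\<bar> \<le> K * (M0 * (z + et)) + 3 * real d * et"
      using bd[OF s] mult_left_mono[OF s01 K] by linarith
    also have "\<dots> \<le> M * (z + et)"
      using nn M0 mult_nonneg_nonneg[of "real d" z] mult_nonneg_nonneg[of M0 "z + et"] by (simp add: M_def algebra_simps)
    finally have "\<bar>f2 s\<bar> \<le> M * (z + et)" .
    moreover have "M0 * (z + et) \<le> M * (z + et)" using M(2) nn by (intro mult_right_mono) auto
    ultimately show "\<bar>F s - G s\<bar> \<le> M * (z + et) \<and> \<bar>F1 s - G1 s\<bar> \<le> M * (z + et) \<and> \<bar>F2 s - G2 s\<bar> \<le> M * (z + et)"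
      using s01 unfolding f_def f1_def f2_def by linarith
  qed
qed

section \<open>Profiles up to and beyond the light cone\<close>

text \<open>Bootstrapping: if \<open>u\<close> is in \<open>C^m\<close>, so is \<open>g\<close>, and
  the equation with right side \<open>g\<close> has a solution in \<open>C^(m + 1)\<close>, which
  equals \<open>u\<close> by uniqueness. The start \<open>C^(d + 2)\<close> is where uniqueness is
  available.\<close>

lemma Teq_smooth:
  assumes d: "d \<ge> 3" and u: "Ck_on (d + 2) {0..4} u" and T: "Teq d u g"
    and g: "\<And>m. Ck_on m {0..4} u \<Longrightarrow> Ck_on m {0..4} g"
  shows "smooth_on {0..4} u"
proof -
  have "Ck_on (d + 2 + k) {0..4} u" for k
  proof (induction k)
    case (Suc k)
    let ?m = "d + 2 + k"
    obtain c where c: "Cb {0..4} ?m c g"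
      using Ck_on_imp_Cb[OF g[OF Suc.IH] compact_Icc] by (elim exE conjE)
    have "real ?m > (real d - 3) / 2" "?m \<ge> 1" using d by auto
    from Teq_surj[OF this(1) d this(2)] c obtain K v where v: "Cb {0..4} (Suc ?m) K v" "Teq d v g"
      by (elim exE conjE) (elim allE, drule (1) mp, elim exE conjE, rule that)
    have "u x = v x" if x: "x \<in> {0..4}" for x
    proof -
      have "Ck_on ?m {0..4} (\<lambda>x. u x - v x)"
        by (rule Ck_on_diff[OF Suc.IH Cb_imp_Ck[OF Cb_pred[OF v(1)]]])
      moreover have "?m = (d + k) + 2" by simp
      ultimately have 1: "Ck_on (d + k + 2) {0..4} (\<lambda>x. u x - v x)" by simp
      have 2: "Teq d (\<lambda>x. u x - v x) (\<lambda>x. 0)" using Teq_diff[OF T v(2)] by simp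
      have "real (d + k) > (real d - 3) / 2" by simp
      from Teq_unique[OF this d 1 2 x] show ?thesis by simp
    qed
    then have "Ck_on (Suc ?m) {0..4} u"
      by (intro Ck_on_cong[OF _ Cb_imp_Ck[OF v(1)]]) simp
    then show ?case by simp
  qed (use u in simp)
  then have "Ck_on k {0..4} u" for k by (rule Ck_on_le[of "d + 2 + k"]) simp
  then show ?thesis by (simp add: smooth_on_def)
qed

text \<open>\<open>a\<close> is the function around which the equation is linearized and
  \<open>v\<close> the correction. The map is built from shifts, products and one composition, each
  strictly differentiable by the rules above.\<close>

lemma strict_diff_nonlinearity:
  assumes S: "no_isolated S" "compact S" "S \<subseteq> {0..}" and a: "Ck_on n S a"
    and H: "smooth_on {0..} H" "\<And>x. x \<ge> 0 \<Longrightarrow> (H has_real_derivative H' x) (at x within {0..})"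
  shows "strict_diff S n (\<lambda>x v. c * ((a x + v) ^ 3 * H (x * (a x + v)\<^sup>2)))
    (\<lambda>x. c * (3 * (a x)\<^sup>2 * H (x * (a x)\<^sup>2) + 2 * x * a x ^ 4 * H' (x * (a x)\<^sup>2)))"
proof -
  obtain Ka where Ka: "Ka \<ge> 0" "Cb S n Ka a" using Ck_on_imp_Cb[OF a S(2)] by (elim exE conjE)
  obtain Kx where Kx: "Kx \<ge> 0" "Cb S n Kx (\<lambda>x. x)" using Ck_on_imp_Cb[OF Ck_on_ident S(2), of n] by (elim exE conjE)
  obtain Kc where Kc: "Kc \<ge> 0" "Cb S n Kc (\<lambda>x. c)" using Ck_on_imp_Cb[OF Ck_on_const S(2), of n c] by (elim exE conjE)
  note sh = strict_diff_shift[OF Ka(2,1)]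
  note sq = strict_diff_mult[OF sh sh]
  note xsq = strict_diff_mult[OF strict_diff_const[OF Kx(2,1)] sq]
  have "strict_diff S n (\<lambda>x v. H (x * ((a x + v) * (a x + v))))
     (\<lambda>x. H' (x * ((a x + 0) * (a x + 0))) * (0 * ((a x + 0) * (a x + 0)) + x * (1 * (a x + 0) + (a x + 0) * 1)))"
    by (rule strict_diff_compose[OF S(1) xsq H]) (use S(3) in \<open>auto intro: mult_nonneg_nonneg[OF _ zero_le_square]\<close>)
  note all = strict_diff_mult[OF strict_diff_const[OF Kc(2,1)] strict_diff_mult[OF strict_diff_mult[OF sh sq] this]]
  show ?thesis
    by (rule strict_diff_cong[OF all]) (simp_all add: power2_eq_square power3_eq_cube power4_eq_xxxx algebra_simps)
qed

text \<open>Identities for the explicit profile are derived after cancelling \<open>x\<close> or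
  passing to \<open>sqrt x\<close>, hence only for \<open>x > 0\<close>; continuity restores the
  centre.\<close>

lemma continuous_eq_at_left_end:
  fixes f g :: "real \<Rightarrow> real"
  assumes "continuous_on {0..b} f" "continuous_on {0..b} g" "b > 0"
    and "\<And>x. x \<in> {0<..b} \<Longrightarrow> f x = g x" and x: "x \<in> {0..b}"
  shows "f x = g x"
proof (cases "x = 0")
  case True
  have "(f \<longlongrightarrow> f 0) (at 0 within {0..b})" "(g \<longlongrightarrow> g 0) (at 0 within {0..b})"
    using assms(1-3) unfolding continuous_on_def by auto
  moreover have "eventually (\<lambda>x. f x = g x) (at 0 within {0..b})"
    unfolding eventually_at_filter using assms(4) by (intro always_eventually) auto
  ultimately have "(g \<longlongrightarrow> f 0) (at 0 within {0..b})" "(g \<longlongrightarrow> g 0) (at 0 within {0..b})"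
    using tendsto_cong by blast+
  then have "f 0 = g 0" by (rule tendsto_unique[OF at_within_Icc_ne_bot[OF assms(3)], rotated]) (use assms(3) in auto)
  then show ?thesis using True by simp
qed (use assms in auto)

section \<open>The explicit profile at parameter zero and its linearization\<close>

lemma sin_cos_f0:
  assumes d: "d \<ge> 3"
  shows "sin (f0 d rr) = 2 * sqrt (real d - 2) * rr / (real d - 2 + rr\<^sup>2)"
    and "cos (f0 d rr) = (real d - 2 - rr\<^sup>2) / (real d - 2 + rr\<^sup>2)"
proof -
  define a where "a = sqrt (real d - 2)"
  have a: "a > 0" "a\<^sup>2 = real d - 2" using d by (auto simp: a_def)
  have pos: "a\<^sup>2 + rr\<^sup>2 > 0" using a(1) by (intro add_pos_nonneg) auto
  have r: "sqrt (1 + (rr / a)\<^sup>2) ^ 2 = (a\<^sup>2 + rr\<^sup>2) / a\<^sup>2" "sqrt (1 + (rr / a)\<^sup>2) \<noteq> 0"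
    using a(1) by (auto simp: power_divide field_simps add_nonneg_eq_0_iff)
  have c2: "(cos (arctan (rr / a)))\<^sup>2 = a\<^sup>2 / (a\<^sup>2 + rr\<^sup>2)"
    using r a(1) pos by (simp add: cos_arctan power_divide field_simps)
  have "f0 d rr = 2 * arctan (rr / a)" by (simp add: f0_def a_def)
  note f = this
  have s: "sin (arctan (rr / a)) = rr / a * cos (arctan (rr / a))"
    by (simp add: sin_arctan cos_arctan)
  have "sin (f0 d rr) = 2 * (rr / a) * (cos (arctan (rr / a)))\<^sup>2"
    unfolding f sin_double s by (simp add: power2_eq_square)
  also have "\<dots> = 2 * a * rr / (a\<^sup>2 + rr\<^sup>2)" unfolding c2 using a(1) pos by (simp add: power2_eq_square)
  finally show "sin (f0 d rr) = 2 * sqrt (real d - 2) * rr / (real d - 2 + rr\<^sup>2)"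
    unfolding a(2) by (simp add: a_def)
  have "cos (f0 d rr) = 2 * (cos (arctan (rr / a)))\<^sup>2 - 1"
    unfolding f by (rule cos_double_cos)
  also have "\<dots> = (a\<^sup>2 - rr\<^sup>2) / (a\<^sup>2 + rr\<^sup>2)" 
  proof -
    define q where "q = a\<^sup>2 + rr\<^sup>2"
    have q: "q \<noteq> 0" "rr\<^sup>2 = q - a\<^sup>2" using pos by (auto simp: q_def)
    show ?thesis unfolding c2 q_def[symmetric] using q by (simp add: field_simps)
  qed
  finally show "cos (f0 d rr) = (real d - 2 - rr\<^sup>2) / (real d - 2 + rr\<^sup>2)" unfolding a(2) .
qed

lemma f0_factor:
  assumes d: "d \<ge> 3"
  obtains p where "smooth_on {0..} p" "\<And>r. f0 d r = r * p (r\<^sup>2)"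
proof -
  define a where "a = sqrt (real d - 2)"
  have a: "a > 0" using d by (auto simp: a_def)
  obtain h where h: "smooth_on {0..} h" "\<And>u. arctan u = u * h (u\<^sup>2)"
    by (rule odd_smooth_factor[OF smooth_on_arctan arctan_minus]) (rule that)
  show ?thesis
  proof (rule that)
    show "smooth_on {0..} (\<lambda>x. 2 / a * h (x / a\<^sup>2))"
      by (intro smooth_on_mult smooth_on_const smooth_on_compose[OF h(1)] smooth_on_divide smooth_on_ident) (use a in auto)
    show "f0 d r = r * (2 / a * h (r\<^sup>2 / a\<^sup>2))" for r
      using h(2)[of "r / a"] unfolding f0_def a_def[symmetric] by (simp add: power_divide)
  qed
qed

lemma f0_deriv:
  assumes d: "d \<ge> 3"
  shows "(f0 d has_real_derivative 2 * sqrt (real d - 2) / (real d - 2 + r\<^sup>2)) (at r)"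
proof -
  define a where "a = sqrt (real d - 2)"
  have a: "a > 0" "a\<^sup>2 = real d - 2" using d by (auto simp: a_def)
  have "((\<lambda>r. 2 * arctan (r / a)) has_real_derivative 2 * (inverse (1 + (r / a)\<^sup>2) * (1 / a))) (at r)"
    using a(1) by (auto intro!: derivative_eq_intros)
  moreover have "2 * (inverse (1 + (r / a)\<^sup>2) * (1 / a)) = 2 * a / (a\<^sup>2 + r\<^sup>2)"
  proof -
    have "1 + (r / a)\<^sup>2 = (a\<^sup>2 + r\<^sup>2) / a\<^sup>2" using a(1) by (simp add: power_divide field_simps)
    then show ?thesis using a(1) by (simp add: power2_eq_square)
  qed
  ultimately show ?thesis unfolding f0_def[abs_def] a_def[symmetric] unfolding a(2)[symmetric] by simp
qed

context
  fixes d :: nat and p H :: "real \<Rightarrow> real"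
  assumes d: "d \<ge> 3"
    and p: "smooth_on {0..} p" "\<And>r. f0 d r = r * p (r\<^sup>2)"
    and H: "smooth_on {0..} H" "\<And>u. sin u * cos u = u + u ^ 3 * H (u\<^sup>2)"
begin

text \<open>The function \<open>p\<close> is not elementary, but the derivative of \<open>f0\<close>
  is rational. It yields two identities, for \<open>p + 2 x p'\<close> and for its derivative, from
  which the hypergeometric operator applied to \<open>p\<close> is assembled.\<close>

lemma f0_Teq: "Teq d p (\<lambda>x. (real d - 1) / 4 * (p x ^ 3 * H (x * (p x)\<^sup>2)))"
proof -
  define a where "a = sqrt (real d - 2)"
  have a: "a > 0" "a\<^sup>2 = real d - 2" using d by (auto simp: a_def)
  obtain D where D: "D 0 = p" "\<And>j. PROP deriv_on {0..} (D j) (D (Suc j))"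
    using smooth_on_chainE[OF p(1) no_isolated_atLeast] by metis
  have D': "(D j has_real_derivative D (Suc j) x) (at x within {0..4})" if "x \<in> {0..4}" for j x
    by (rule DERIV_subset[OF D(2)]) (use that in auto)
  have smD: "smooth_on {0..} (D j)" for j by (rule chain_smooth_on[of "{0..}" D, OF D(2)])
  have cD: "continuous_on {0..4} (D j)" for j
    by (rule continuous_on_subset[OF smooth_on_imp_continuous[OF smD]]) auto
  have cH: "continuous_on {0..4} (\<lambda>x. H (x * (p x)\<^sup>2))"
    by (rule continuous_on_compose2[OF smooth_on_imp_continuous[OF H(1)]])
       (auto intro!: continuous_intros cD[of 0, unfolded D(1)])
  have pos: "a\<^sup>2 + x > 0" if "x \<in> {0..4}" for x using a(1) that by (auto intro!: add_pos_nonneg)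
  \<comment> \<open>The derivative of \<open>f0 d r = r * p (r\<^sup>2)\<close> at
    \<open>r = sqrt x\<close>, computed in two ways.\<close>
  have e1: "p x + 2 * x * D 1 x = 2 * a / (a\<^sup>2 + x)" if x: "x > 0" for x
  proof -
    have "((\<lambda>r. r * p (r\<^sup>2)) has_real_derivative 1 * p x + D 1 x * (2 * sqrt x) * sqrt x) (at (sqrt x))"
    proof (rule DERIV_mult[OF DERIV_ident DERIV_chain2[where g = "\<lambda>r. r\<^sup>2" and x = "sqrt x", THEN DERIV_cong], of _ "D 1 x" "2 * sqrt x", THEN DERIV_cong])
      have "at x within {0..} = at x" by (rule at_within_interior) (use x in simp)
      then show "(p has_real_derivative D 1 x) (at ((sqrt x)\<^sup>2))" using D(2)[of x 0] x D(1) by simp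
      show "((\<lambda>r. r\<^sup>2) has_real_derivative 2 * sqrt x) (at (sqrt x))" by (auto intro!: derivative_eq_intros)
    qed (use x in auto)
    then have "(f0 d has_real_derivative 1 * p x + D 1 x * (2 * sqrt x) * sqrt x) (at (sqrt x))"
      by (simp add: p(2)[abs_def])
    moreover have "(f0 d has_real_derivative 2 * a / (a\<^sup>2 + x)) (at (sqrt x))"
      using f0_deriv[OF d, of "sqrt x"] x unfolding a_def[symmetric] unfolding a(2)[symmetric] by simp
    ultimately have "1 * p x + D 1 x * (2 * sqrt x) * sqrt x = 2 * a / (a\<^sup>2 + x)" by (rule DERIV_unique)
    moreover have "D 1 x * (2 * sqrt x) * sqrt x = 2 * (sqrt x * sqrt x) * D 1 x" by (simp only: mult_ac)
    moreover have "sqrt x * sqrt x = x" using x by simp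
    ultimately show ?thesis by (simp only: mult_1_left)
  qed
  have e1': "p x + 2 * x * D 1 x = 2 * a / (a\<^sup>2 + x)" if x: "x \<in> {0..4}" for x
    by (rule continuous_eq_at_left_end[OF _ _ _ _ x])
       (use cD[of 0] pos in \<open>force intro!: continuous_intros cD e1 simp: D(1)\<close>)+
  have e2: "3 * D 1 x + 2 * x * D 2 x = - (2 * a / (a\<^sup>2 + x)\<^sup>2)" if x: "x \<in> {0..4}" for x
  proof -
    have "((\<lambda>x. p x + 2 * x * D 1 x) has_real_derivative D 1 x + (2 * D 1 x + D 2 x * (2 * x))) (at x within {0..4})"
      using D'[OF x, of 0] D'[OF x, of 1] D(1) by (auto intro!: derivative_eq_intros simp: numeral_2_eq_2)
    moreover have "((\<lambda>x. p x + 2 * x * D 1 x) has_real_derivative - (2 * a / (a\<^sup>2 + x)\<^sup>2)) (at x within {0..4})"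
    proof (rule has_field_derivative_transform_within[OF _ zero_less_one x])
      show "((\<lambda>x. 2 * a / (a\<^sup>2 + x)) has_real_derivative - (2 * a / (a\<^sup>2 + x)\<^sup>2)) (at x within {0..4})"
        using pos[OF x] by (auto intro!: derivative_eq_intros simp: power2_eq_square)
    qed (rule e1'[symmetric])
    ultimately show ?thesis using no_isolated_unique[OF S4 x] by fastforce
  qed
  have main: "hyp_op d x (D 2 x) (D 1 x) (p x)
      = (real d - 1) / 4 * (p x ^ 3 * H (x * (p x)\<^sup>2))" if x: "x \<in> {0<..4}" for x
  proof -
    have x': "x > 0" "x \<in> {0..4}" using x by auto
    define q where "q = a\<^sup>2 + x"
    have q: "q > 0" using pos[OF x'(2)] by (simp add: q_def)
    have d1: "real d - 1 = 1 + a\<^sup>2" by (simp add: a(2))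
    have sx: "(sqrt x)\<^sup>2 = x" "sqrt x > 0" using x' by auto
    have "sin (f0 d (sqrt x)) * cos (f0 d (sqrt x)) = sqrt x * p x + (sqrt x * p x) ^ 3 * H ((sqrt x * p x)\<^sup>2)"
      using H(2)[of "f0 d (sqrt x)"] p(2)[of "sqrt x"] sx(1) by simp
    also have "\<dots> = sqrt x * (p x + x * (p x ^ 3 * H (x * (p x)\<^sup>2)))"
    proof -
      have "(sqrt x * p x) ^ 3 = sqrt x * (sqrt x)\<^sup>2 * p x ^ 3" by (simp only: power3_eq_cube power2_eq_square mult_ac)
      then show ?thesis by (simp only: power_mult_distrib sx(1) distrib_left mult.assoc)
    qed
    finally have "sqrt x * (p x + x * (p x ^ 3 * H (x * (p x)\<^sup>2))) = sqrt x * (2 * a * (a\<^sup>2 - x) / q\<^sup>2)"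
      unfolding sin_cos_f0[OF d] sx(1) a_def[symmetric] unfolding a(2)[symmetric] q_def by (simp add: power2_eq_square mult.left_commute mult.commute)
    with sx(2) have "p x + x * (p x ^ 3 * H (x * (p x)\<^sup>2)) = 2 * a * (a\<^sup>2 - x) / q\<^sup>2"
      using mult_left_cancel[of "sqrt x"] less_irrefl by metis
    then have nl: "x * (p x ^ 3 * H (x * (p x)\<^sup>2)) = 2 * a * (a\<^sup>2 - x) / q\<^sup>2 - p x" by linarith
    have E1: "p x + 2 * x * D 1 x = 2 * a / q" using e1'[OF x'(2)] by (simp add: q_def)
    have E2: "3 * D 1 x + 2 * x * D 2 x = - (2 * a / q\<^sup>2)" using e2[OF x'(2)] by (simp add: q_def)
    \<comment> \<open>Multiplied by \<open>4 * x\<close>, the operator is a combination of the two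
      known quantities and of \<open>p\<close> alone.\<close>
    have "4 * x * (hyp_op d x (D 2 x) (D 1 x) (p x))
      = 2 * x * (1 - x) * (3 * D 1 x + 2 * x * D 2 x) - 2 * x * (p x + 2 * x * D 1 x) + (real d - 1) * (p x + 2 * x * D 1 x) - (real d - 1) * p x"
      by (simp add: coefA_def coefB_def coefK_def algebra_simps power2_eq_square)
    also have "\<dots> = - (4 * a * x * (1 - x) / q\<^sup>2) - 4 * a * x / q + (real d - 1) * (2 * a / q) - (real d - 1) * p x"
      unfolding E1 E2 by (simp add: mult.left_commute mult.commute)
    also have "- (4 * a * x * (1 - x) / q\<^sup>2) - 4 * a * x / q = - (4 * a * x * (1 - x + q) / q\<^sup>2)"
      using q by (simp add: field_simps power2_eq_square)
    also have "1 - x + q = real d - 1" by (simp add: q_def d1)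
    also have "- (4 * a * x * (real d - 1) / q\<^sup>2) + (real d - 1) * (2 * a / q) = (real d - 1) * (2 * a * (a\<^sup>2 - x) / q\<^sup>2)"
    proof -
      have "(real d - 1) * (2 * a / q) = (real d - 1) * (2 * a * (a\<^sup>2 + x)) / q\<^sup>2"
        using q unfolding q_def[symmetric] by (simp add: power2_eq_square)
      then show ?thesis by (simp add: diff_divide_distrib[symmetric] algebra_simps)
    qed
    also have "(real d - 1) * (2 * a * (a\<^sup>2 - x) / q\<^sup>2) - (real d - 1) * p x = 4 * x * ((real d - 1) / 4 * (p x ^ 3 * H (x * (p x)\<^sup>2)))"
    proof -
      have "4 * x * ((real d - 1) / 4 * (p x ^ 3 * H (x * (p x)\<^sup>2))) = (real d - 1) * (x * (p x ^ 3 * H (x * (p x)\<^sup>2)))" by simp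
      then show ?thesis unfolding nl by (simp add: right_diff_distrib)
    qed
    finally show ?thesis using x'(1) by simp
  qed
  show ?thesis
  proof (rule TeqI)
    show "(p has_real_derivative D 1 x) (at x within {0..4})" if "x \<in> {0..4}" for x using D'[OF that, of 0] D(1) by simp
    show "(D 1 has_real_derivative D 2 x) (at x within {0..4})" if "x \<in> {0..4}" for x
      using D'[OF that, of 1] by (simp add: numeral_2_eq_2)
    show "hyp_op d x (D 2 x) (D 1 x) (p x)
      = (real d - 1) / 4 * (p x ^ 3 * H (x * (p x)\<^sup>2))" if x: "x \<in> {0..4}" for x
      by (rule continuous_eq_at_left_end[OF _ _ _ main x]) (auto intro!: continuous_intros cD cD[of 0, unfolded D(1)] cH)
  qed
qed

text \<open>Differentiating \<open>sin u * cos u = u + u ^ 3 * H (u\<^sup>2)\<close> gives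
  \<open>3 * u\<^sup>2 * H + 2 * u ^ 4 * H' = - 2 * (sin u)\<^sup>2\<close>, and at
  \<open>u = f0\<close> the square of the sine is rational in \<open>x\<close>.\<close>

lemma f0_linearization:
  fixes H' :: "real \<Rightarrow> real"
  assumes H': "\<And>x. x \<ge> 0 \<Longrightarrow> (H has_real_derivative H' x) (at x within {0..})" "continuous_on {0..} H'"
    and x: "x \<in> {0..4}"
  shows "(real d - 1) / 4 * (3 * (p x)\<^sup>2 * H (x * (p x)\<^sup>2) + 2 * x * p x ^ 4 * H' (x * (p x)\<^sup>2)) = Vpot d x"
proof -
  have cp: "continuous_on {0..4} p"
    by (rule continuous_on_subset[OF smooth_on_imp_continuous[OF p(1)]]) auto
  have cH: "continuous_on {0..4} (\<lambda>x. H (x * (p x)\<^sup>2))" "continuous_on {0..4} (\<lambda>x. H' (x * (p x)\<^sup>2))"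
    by (rule continuous_on_compose2[OF smooth_on_imp_continuous[OF H(1)]] continuous_on_compose2[OF H'(2)];
       auto intro!: continuous_intros cp)+
  show ?thesis
  proof (rule continuous_eq_at_left_end[OF _ _ _ _ x])
    show "continuous_on {0..4} (\<lambda>x. (real d - 1) / 4 * (3 * (p x)\<^sup>2 * H (x * (p x)\<^sup>2) + 2 * x * p x ^ 4 * H' (x * (p x)\<^sup>2)))"
      by (intro continuous_intros cp cH)
    show "continuous_on {0..4} (Vpot d)" by (rule Ck_on_imp_continuous[OF Vpot_smooth[OF d]])
    fix x :: real assume x: "x \<in> {0<..4}"
    define u where "u = f0 d (sqrt x)"
    have u: "u = sqrt x * p x" "u\<^sup>2 = x * (p x)\<^sup>2" using p(2)[of "sqrt x"] x by (auto simp: u_def power_mult_distrib)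
    have f0p: "sqrt x > 0" "sqrt (real d - 2) > 0" using x d by auto
    have "u > 0" unfolding u_def f0_def using f0p by (simp add: zero_less_arctan_iff)
    have sq: "((\<lambda>u. u\<^sup>2) has_real_derivative 2 * u) (at u)" by (auto intro!: derivative_eq_intros)
    from \<open>u > 0\<close> have "at (u\<^sup>2) within {0..} = at (u\<^sup>2)" by (intro at_within_interior) simp
    then have "((\<lambda>u. H (u\<^sup>2)) has_real_derivative H' (u\<^sup>2) * (2 * u)) (at u)"
      using H'(1)[of "u\<^sup>2"] sq
      by (intro DERIV_chain2[where f = H and g = "\<lambda>u. u\<^sup>2"]) simp_all
    then have "((\<lambda>u. u + u ^ 3 * H (u\<^sup>2)) has_real_derivative 1 + (3 * u\<^sup>2 * H (u\<^sup>2) + H' (u\<^sup>2) * (2 * u) * u ^ 3)) (at u)"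
      by (auto intro!: derivative_eq_intros)
    then have "((\<lambda>u. sin u * cos u) has_real_derivative 1 + (3 * u\<^sup>2 * H (u\<^sup>2) + H' (u\<^sup>2) * (2 * u) * u ^ 3)) (at u)"
      by (simp add: H(2)[symmetric])
    moreover have "((\<lambda>u. sin u * cos u) has_real_derivative cos u * cos u - sin u * sin u) (at u)"
      by (auto intro!: derivative_eq_intros)
    ultimately have "1 + (3 * u\<^sup>2 * H (u\<^sup>2) + H' (u\<^sup>2) * (2 * u) * u ^ 3) = cos u * cos u - sin u * sin u"
      by (rule DERIV_unique)
    also have "\<dots> = 1 - 2 * (sin u)\<^sup>2"
      using sin_cos_squared_add[of u] by (simp add: power2_eq_square algebra_simps)
    also have "(sin u)\<^sup>2 = 4 * (real d - 2) * x / (real d - 2 + x)\<^sup>2"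
      unfolding u_def sin_cos_f0[OF d] using x d by (simp add: power_divide power_mult_distrib)
    finally have "3 * u\<^sup>2 * H (u\<^sup>2) + H' (u\<^sup>2) * (2 * u) * u ^ 3 = - 2 * (4 * (real d - 2) * x / (real d - 2 + x)\<^sup>2)"
      by linarith
    moreover have "- 2 * (4 * (real d - 2) * x / (real d - 2 + x)\<^sup>2) = - 8 * (real d - 2) * x / (real d - 2 + x)\<^sup>2"
    proof -
      have "- 2 * (4 * b * x / q) = - 8 * b * x / q" for b q :: real by simp
      then show ?thesis .
    qed
    ultimately have "3 * u\<^sup>2 * H (u\<^sup>2) + H' (u\<^sup>2) * (2 * u) * u ^ 3 = - 8 * (real d - 2) * x / (real d - 2 + x)\<^sup>2"
      by (rule trans)
    moreover have "3 * u\<^sup>2 * H (u\<^sup>2) + H' (u\<^sup>2) * (2 * u) * u ^ 3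
      = x * (3 * (p x)\<^sup>2 * H (x * (p x)\<^sup>2) + 2 * x * p x ^ 4 * H' (x * (p x)\<^sup>2))"
    proof -
      have "u * u ^ 3 = (u\<^sup>2)\<^sup>2" by (simp add: power2_eq_square power3_eq_cube)
      then have "H' (u\<^sup>2) * (2 * u) * u ^ 3 = 2 * (u\<^sup>2)\<^sup>2 * H' (u\<^sup>2)" by (simp add: mult.assoc mult.left_commute)
      then show ?thesis unfolding u(2) by (simp add: power2_eq_square power4_eq_xxxx algebra_simps)
    qed
    ultimately have "x * (3 * (p x)\<^sup>2 * H (x * (p x)\<^sup>2) + 2 * x * p x ^ 4 * H' (x * (p x)\<^sup>2))
      = x * (- 8 * (real d - 2) / (real d - 2 + x)\<^sup>2)" by simp
    from mult_left_cancel[THEN iffD1, OF _ this] x have "3 * (p x)\<^sup>2 * H (x * (p x)\<^sup>2) + 2 * x * p x ^ 4 * H' (x * (p x)\<^sup>2)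
      = - 8 * (real d - 2) / (real d - 2 + x)\<^sup>2" by simp
    then have "(real d - 1) / 4 * (3 * (p x)\<^sup>2 * H (x * (p x)\<^sup>2) + 2 * x * p x ^ 4 * H' (x * (p x)\<^sup>2))
      = (real d - 1) / 4 * (- 8 * (real d - 2) / (real d - 2 + x)\<^sup>2)" by (rule arg_cong)
    also have "\<dots> = Vpot d x"
    proof -
      have "a / 4 * (- 8 * b / q) = - (2 * a * b / q)" for a b q :: real by simp
      then show ?thesis unfolding Vpot_def .
    qed
    finally show "(real d - 1) / 4 * (3 * (p x)\<^sup>2 * H (x * (p x)\<^sup>2) + 2 * x * p x ^ 4 * H' (x * (p x)\<^sup>2)) = Vpot d x" .
  qed simp
qed

text \<open>The perturbation result is applied to the correction \<open>y ep = Y ep - p\<close>.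
  Adding the equation of \<open>p\<close> cancels the term \<open>gm H x 0\<close> and restores the
  full nonlinearity.\<close>

lemma inner_profiles:
  assumes H1: "smooth_on {0..} H1" and H2: "smooth_on {0..} H2" and e0: "e0 > 0"
  obtains eps C Y where "0 < eps" "eps \<le> e0" "0 < C"
    "\<And>ep. \<bar>ep\<bar> \<le> eps \<Longrightarrow> smooth_on {0..4} (Y ep)"
    "\<And>ep. \<bar>ep\<bar> \<le> eps \<Longrightarrow> Teq d (Y ep) (\<lambda>x. (real d - 1) / 4 * (Y ep x ^ 3 *
       (H (x * (Y ep x)\<^sup>2) + ep * H1 (x * (Y ep x)\<^sup>2) + ep\<^sup>2 * H2 (x * (Y ep x)\<^sup>2))))"
    "\<And>ep. \<bar>ep\<bar> \<le> eps \<Longrightarrow> Y ep 0 \<noteq> 0"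
    "\<And>ep k. \<bar>ep\<bar> \<le> eps \<Longrightarrow> \<bar>k\<bar> \<le> eps \<Longrightarrow> Cb {0..4} 2 (C * \<bar>ep - k\<bar>) (\<lambda>x. Y ep x - Y k x)"
    "\<And>x. x \<in> {0..4} \<Longrightarrow> Y 0 x = p x"
proof -
  define n where "n = d + 5"
  have sub: "{0..4::real} \<subseteq> {0..}" by auto
  have sm: "Ck_on m {0..4} p" for m by (rule smooth_onD[OF smooth_on_subset[OF p(1) sub]])
  let ?c = "(real d - 1) / 4"
  define gm where "gm = (\<lambda>H x v. ?c * ((p x + v) ^ 3 * H (x * (p x + v)\<^sup>2)))"
  have sd: "\<exists>L. strict_diff {0..4} n (gm h) L" if h: "smooth_on {0..} h" for h
  proof -
    obtain h' where h': "PROP deriv_on {0..} h h'"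
      using smooth_on_derivE[OF h at_within_atLeast_ne_bot] by metis
    show ?thesis unfolding gm_def
      by (rule exI, rule strict_diff_nonlinearity[OF S4 compact_Icc sub sm h h']) simp
  qed
  obtain H' where H': "PROP deriv_on {0..} H H'" "smooth_on {0..} H'"
    using smooth_on_derivE[OF H(1) at_within_atLeast_ne_bot] by metis
  have H'0: "(H has_real_derivative H' x) (at x within {0..})" if "x \<ge> 0" for x using H'(1) that by simp
  have sd0: "strict_diff {0..4} n (gm H) (Vpot d)"
  proof (rule strict_diff_cong[OF strict_diff_nonlinearity[OF S4 compact_Icc sub sm H(1) H'0]])
    show "?c * ((p x + v) ^ 3 * H (x * (p x + v)\<^sup>2)) = gm H x v" for x v by (simp add: gm_def)
    show "?c * (3 * (p x)\<^sup>2 * H (x * (p x)\<^sup>2) + 2 * x * p x ^ 4 * H' (x * (p x)\<^sup>2)) = Vpot d x" if "x \<in> {0..4}" for x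
      by (rule f0_linearization[OF H'0 smooth_on_imp_continuous[OF H'(2)] that])
  qed
  obtain L1 where sd1: "strict_diff {0..4} n (gm H1) L1" using sd[OF H1] by (elim exE)
  obtain L2 where sd2: "strict_diff {0..4} n (gm H2) L2" using sd[OF H2] by (elim exE)
  from perturbed_equation_solvable[OF d n_def sd0 sd1 sd2 e0] obtain ep1 C y where ep1: "ep1 > 0" "ep1 \<le> e0" "C > 0" and
    y': "\<forall>ep. \<bar>ep\<bar> \<le> ep1 \<longrightarrow> Ck_on (Suc n) {0..4} (y ep) \<and>
      Teq d (y ep) (\<lambda>x. gm H x (y ep x) - gm H x 0 + ep * gm H1 x (y ep x) + ep\<^sup>2 * gm H2 x (y ep x)) \<and>
      Cb {0..4} n (C * \<bar>ep\<bar>) (y ep) \<and>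
      (\<forall>k. \<bar>k\<bar> \<le> ep1 \<longrightarrow> Cb {0..4} n (C * \<bar>ep - k\<bar>) (\<lambda>x. y ep x - y k x))"
    by (elim exE conjE)
  have p0: "p 0 > 0"
  proof -
    have "((\<lambda>r. f0 d r) has_real_derivative 2 * sqrt (real d - 2) / (real d - 2 + 0\<^sup>2)) (at 0)" by (rule f0_deriv[OF d])
    then have "(\<lambda>r. (f0 d r - f0 d 0) / (r - 0)) \<midarrow>0\<rightarrow> 2 * sqrt (real d - 2) / (real d - 2)"
      unfolding has_field_derivative_iff by simp
    then have "((\<lambda>r. (f0 d r - f0 d 0) / (r - 0)) \<longlongrightarrow> 2 * sqrt (real d - 2) / (real d - 2)) (at_right 0)"
      by (rule tendsto_within_subset) auto
    moreover have l2: "((\<lambda>r. p (r\<^sup>2)) \<longlongrightarrow> p 0) (at_right 0)"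
    proof -
      have "continuous_on {0..} (\<lambda>r. p (r\<^sup>2))"
        by (rule continuous_on_compose2[OF smooth_on_imp_continuous[OF p(1)]]) (auto intro!: continuous_intros)
      then have "((\<lambda>r. p (r\<^sup>2)) \<longlongrightarrow> p (0\<^sup>2)) (at 0 within {0..})" unfolding continuous_on_def by (rule bspec) simp
      then show ?thesis by (rule tendsto_within_subset[THEN tendsto_eq_rhs]) auto
    qed
    moreover have "(f0 d r - f0 d 0) / (r - 0) = p (r\<^sup>2)" if "r \<noteq> 0" for r
      using that by (simp only: p(2)[of r] p(2)[of 0]) simp
    then have "eventually (\<lambda>r. (f0 d r - f0 d 0) / (r - 0) = p (r\<^sup>2)) (at_right 0)"
      by (intro eventually_at_rightI[of 0 1]) simp_all
    ultimately have "((\<lambda>r. p (r\<^sup>2)) \<longlongrightarrow> 2 * sqrt (real d - 2) / (real d - 2)) (at_right 0)"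
      by (metis (no_types) Lim_transform_eventually)
    from this l2 have "p 0 = 2 * sqrt (real d - 2) / (real d - 2)"
      by (rule tendsto_unique[OF trivial_limit_at_right_real, rotated])
    then show ?thesis using d by simp
  qed
  \<comment> \<open>The second entry keeps the correction below \<open>p 0 / 2\<close>, so
    \<open>Y ep 0\<close> stays nonzero. That value is the slope of the profile at the centre and
    causes the gradient blow-up.\<close>
  define eps where "eps = min ep1 (p 0 / (2 * C))"
  have eps: "0 < eps" "eps \<le> ep1" "eps \<le> p 0 / (2 * C)" using ep1 p0 by (auto simp: eps_def)
  have y: "Ck_on (Suc n) {0..4} (y ep)"
      "Teq d (y ep) (\<lambda>x. gm H x (y ep x) - gm H x 0 + ep * gm H1 x (y ep x) + ep\<^sup>2 * gm H2 x (y ep x))"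
      "Cb {0..4} n (C * \<bar>ep\<bar>) (y ep)"
      "\<And>k. \<bar>k\<bar> \<le> eps \<Longrightarrow> Cb {0..4} n (C * \<bar>ep - k\<bar>) (\<lambda>x. y ep x - y k x)" if "\<bar>ep\<bar> \<le> eps" for ep
    using y'[rule_format, of ep] that eps(2) by simp_all
  have bd: "\<bar>y ep x\<bar> \<le> C * \<bar>ep\<bar>" if "\<bar>ep\<bar> \<le> eps" "x \<in> {0..4}" for ep x by (rule Cb_bound[OF y(3)[OF that(1)] that(2)])
  define Y where "Y = (\<lambda>ep x. p x + y ep x)"
  show ?thesis
  proof (rule that[OF eps(1) _ ep1(3)])
    show "eps \<le> e0" using eps ep1 by simp
    fix ep assume ep: "\<bar>ep\<bar> \<le> eps"
    show T: "Teq d (Y ep) (\<lambda>x. ?c * (Y ep x ^ 3 *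
       (H (x * (Y ep x)\<^sup>2) + ep * H1 (x * (Y ep x)\<^sup>2) + ep\<^sup>2 * H2 (x * (Y ep x)\<^sup>2))))"
      by (rule Teq_cong[OF Teq_lincomb[OF f0_Teq y(2)[OF ep], of 1 1]]) (auto simp: Y_def gm_def algebra_simps)
    show "smooth_on {0..4} (Y ep)"
    proof (rule Teq_smooth[OF d _ T])
      have "Ck_on (d + 2) {0..4} (y ep)" by (rule Ck_on_le[OF y(1)[OF ep]]) (simp add: n_def)
      then show "Ck_on (d + 2) {0..4} (Y ep)" unfolding Y_def by (rule Ck_on_add[OF sm])
      fix m assume m: "Ck_on m {0..4} (Y ep)"
      have q: "Ck_on m {0..4} (\<lambda>x. x * (Y ep x)\<^sup>2)" by (intro Ck_on_mult Ck_on_ident Ck_on_power m)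
      have c: "Ck_on m {0..4} (\<lambda>x. h (x * (Y ep x)\<^sup>2))" if "smooth_on {0..} h" for h
        by (rule Ck_on_compose[OF smooth_onD[OF that] q]) auto
      show "Ck_on m {0..4} (\<lambda>x. ?c * (Y ep x ^ 3 *
       (H (x * (Y ep x)\<^sup>2) + ep * H1 (x * (Y ep x)\<^sup>2) + ep\<^sup>2 * H2 (x * (Y ep x)\<^sup>2))))"
        by (intro Ck_on_cmult Ck_on_mult Ck_on_power m Ck_on_add Ck_on_const c H(1) H1 H2)
    qed
    show "Y ep 0 \<noteq> 0"
    proof -
      have "C * \<bar>ep\<bar> \<le> C * (p 0 / (2 * C))" using ep eps(3) ep1(3) by (intro mult_left_mono) auto
      also have "\<dots> = p 0 / 2" using ep1(3) by simp
      finally show ?thesis using bd[OF ep, of 0] p0 by (auto simp: Y_def)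
    qed
    fix k assume k: "\<bar>k\<bar> \<le> eps"
    have "Cb {0..4} 2 (C * \<bar>ep - k\<bar>) (\<lambda>x. y ep x - y k x)"
      by (rule Cb_le[OF y(4)[OF ep k]]) (simp add: n_def)
    then show "Cb {0..4} 2 (C * \<bar>ep - k\<bar>) (\<lambda>x. Y ep x - Y k x)" by (simp add: Y_def)
  next
    fix x :: real assume "x \<in> {0..4}"
    then show "Y 0 x = p x" using bd[of 0 x] eps by (simp add: Y_def)
  qed
qed

end

section \<open>Global profiles\<close>

text \<open>The two pieces overlap in an interval of positive length. There the two one-sided
  families of derivatives coincide at every order; a common point alone would not identify
  them.\<close>

lemma Ck_on_glue:
  fixes f :: "real \<Rightarrow> real"
  assumes abc: "a \<le> b" "b < c" and "Ck_on k {a..c} f" "Ck_on k {b..} f"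
  shows "Ck_on k {a..} f"
  using assms(3,4)
proof (induction k arbitrary: f)
  case 0
  have "{a..} = {a..c} \<union> {b..}" using abc by auto
  then show ?case using continuous_on_closed_Un[of "{a..c}" "{b..}" f] 0 by simp
next
  case (Suc k)
  obtain f1 where f1: "PROP deriv_on {a..c} f f1" "Ck_on k {a..c} f1"
    using Ck_onE[OF Suc.prems(1)] by metis
  obtain f2 where f2: "PROP deriv_on {b..} f f2" "Ck_on k {b..} f2"
    using Ck_onE[OF Suc.prems(2)] by metis
  have eq: "f1 x = f2 x" if "x \<in> {b..c}" for x
  proof (rule no_isolated_unique[OF no_isolated_Icc[OF abc(2)] that])
    show "(f has_real_derivative f1 x) (at x within {b..c})" by (rule DERIV_subset[OF f1(1)]) (use that abc in auto)
    show "(f has_real_derivative f2 x) (at x within {b..c})" by (rule DERIV_subset[OF f2(1)]) (use that abc in auto)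
  qed
  define g where "g = (\<lambda>x. if x \<le> c then f1 x else f2 x)"
  show ?case
  proof (rule Ck_on_SucI)
    show "(f has_real_derivative g x) (at x within {a..})" if x: "x \<in> {a..}" for x
    proof (cases "x < c")
      case True
      have "at x within {a..} = at x within {a..c}"
        by (rule at_within_nhd[of x "{..<c}"]) (use True in auto)
      then show ?thesis using f1(1)[of x] True x by (simp add: g_def)
    next
      case False
      have "at x within {a..} = at x within {b..}"
        by (rule at_within_nhd[of x "{b<..}"]) (use False abc in auto)
      moreover have "g x = f2 x" using False eq[of x] abc by (cases "x = c") (auto simp: g_def)
      ultimately show ?thesis using f2(1)[of x] False abc by simp
    qed
    show "Ck_on k {a..} g"
    proof (rule Suc.IH)
      show "Ck_on k {a..c} g" by (rule Ck_on_cong[OF _ f1(2)]) (simp add: g_def)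
      show "Ck_on k {b..} g" by (rule Ck_on_cong[OF _ f2(2)]) (auto simp: g_def eq)
    qed
  qed
qed

lemma second_derivs_unique:
  fixes f g :: "real \<Rightarrow> real"
  assumes S: "no_isolated S" and fg: "\<And>x. x \<in> S \<Longrightarrow> f x = g x"
    and f: "PROP deriv_on S f f1"
      "PROP deriv_on S f1 f2"
    and g: "PROP deriv_on S g g1"
      "PROP deriv_on S g1 g2"
    and x: "x \<in> S"
  shows "f1 x = g1 x" "f2 x = g2 x"
proof -
  have *: "u1 x = v1 x" if "\<And>x. x \<in> S \<Longrightarrow> u x = v x" "PROP deriv_on S u u1"
      "PROP deriv_on S v v1" "x \<in> S" for u v u1 v1 :: "real \<Rightarrow> real" and x
    by (rule no_isolated_unique[OF S that(4) _ that(3)[OF that(4)]],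
        rule has_field_derivative_transform_within[OF that(2)[OF that(4)] zero_less_one that(4) that(1)])
  have 1: "f1 x = g1 x" if "x \<in> S" for x by (rule *[OF fg f(1) g(1) that])
  show "f1 x = g1 x" by (rule 1[OF x])
  show "f2 x = g2 x" by (rule *[OF 1 f(2) g(2) x])
qed

lemma inversion_derivs:
  fixes g :: "real \<Rightarrow> real"
  assumes g: "PROP deriv_on T g g1"
      "PROP deriv_on T g1 g2"
    and S: "\<And>x. x \<in> S \<Longrightarrow> x \<noteq> 0 \<and> 1 / x \<in> T" and x: "x \<in> S"
  shows "((\<lambda>x. g (1 / x)) has_real_derivative - (g1 (1 / x) / x\<^sup>2)) (at x within S)"
    "((\<lambda>x. - (g1 (1 / x) / x\<^sup>2)) has_real_derivative g2 (1 / x) / x ^ 4 + 2 * g1 (1 / x) / x ^ 3) (at x within S)"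
proof -
  have nz: "x \<noteq> 0" using S x by auto
  have i: "((\<lambda>x. 1 / x) has_real_derivative - (1 / x\<^sup>2)) (at x within S)"
    using nz by (auto intro!: derivative_eq_intros simp: power2_eq_square)
  have im: "(\<lambda>x. 1 / x) ` S \<subseteq> T" using S by auto
  have 1: "((\<lambda>x. u (1 / x)) has_real_derivative u1 (1 / x) * - (1 / x\<^sup>2)) (at x within S)"
    if "PROP deriv_on T u u1" for u u1 :: "real \<Rightarrow> real"
    by (rule DERIV_compose_within[OF that i im]) (use S x in auto)
  show "((\<lambda>x. g (1 / x)) has_real_derivative - (g1 (1 / x) / x\<^sup>2)) (at x within S)"
    using 1[OF g(1)] by simp
  have "((\<lambda>x. - (g1 (1 / x) / x\<^sup>2)) has_real_derivative - ((g2 (1 / x) * - (1 / x\<^sup>2) * x\<^sup>2 - g1 (1 / x) * (2 * x)) / (x\<^sup>2 * x\<^sup>2))) (at x within S)"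
    by (rule DERIV_minus, rule DERIV_divide[OF 1[OF g(2)]]) (use nz in \<open>auto intro!: derivative_eq_intros\<close>)
  moreover have "- ((g2 (1 / x) * - (1 / x\<^sup>2) * x\<^sup>2 - g1 (1 / x) * (2 * x)) / (x\<^sup>2 * x\<^sup>2)) = g2 (1 / x) / x ^ 4 + 2 * g1 (1 / x) / x ^ 3"
    using nz by (simp add: field_simps power2_eq_square power3_eq_cube power4_eq_xxxx)
  ultimately show "((\<lambda>x. - (g1 (1 / x) / x\<^sup>2)) has_real_derivative g2 (1 / x) / x ^ 4 + 2 * g1 (1 / x) / x ^ 3) (at x within S)"
    by simp
qed

text \<open>The equation \<open>(1 - r\<^sup>2) f'' + ((d - 1) / r - 2 r) f' = (d - 1) p(f) / r\<^sup>2\<close> for the profile of a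
  self-similar solution, multiplied by \<open>r\<^sup>2\<close>; here \<open>p = w w'\<close>.\<close>

definition profile_eq :: "nat \<Rightarrow> (real \<Rightarrow> real) \<Rightarrow> real \<Rightarrow> real \<Rightarrow> real \<Rightarrow> real \<Rightarrow> bool" where
  "profile_eq d p r u u1 u2 \<longleftrightarrow>
     r\<^sup>2 * (1 - r\<^sup>2) * u2 + (real d - 1 - 2 * r\<^sup>2) * r * u1 = (real d - 1) * p u"

lemma profile_eq_inversion:
  assumes "r \<noteq> 0"
  shows "profile_eq d p r u (- (v1 / r\<^sup>2)) (v2 / r ^ 4 + 2 * v1 / r ^ 3) \<longleftrightarrow>
    ((1 / r)\<^sup>2 - 1) * v2 - (real d - 3) * (1 / r) * v1 = (real d - 1) * p u"
proof -
  have "r\<^sup>2 * (1 - r\<^sup>2) * (v2 / r ^ 4 + 2 * v1 / r ^ 3) + (real d - 1 - 2 * r\<^sup>2) * r * (- (v1 / r\<^sup>2))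
    = ((1 / r)\<^sup>2 - 1) * v2 - (real d - 3) * (1 / r) * v1"
    using assms by (simp add: field_simps power2_eq_square power3_eq_cube power4_eq_xxxx)
  then show ?thesis by (simp add: profile_eq_def)
qed

lemma inner_profile_eq:
  assumes T: "Teq d w (\<lambda>x. (real d - 1) / 4 * (w x ^ 3 * h (x * (w x)\<^sup>2)))"
    and p: "\<And>u. p u = u + u ^ 3 * h (u\<^sup>2)"
  obtains f1 f2 where
    "PROP deriv_on {0..2} (\<lambda>r. r * w (r\<^sup>2)) f1"
    "PROP deriv_on {0..2} f1 f2"
    "\<And>r. r \<in> {0..2} \<Longrightarrow> profile_eq d p r (r * w (r\<^sup>2)) (f1 r) (f2 r)"
    "f1 0 = w 0"
proof -
  obtain w1 w2 where w: "PROP deriv_on {0..4} w w1"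
    "PROP deriv_on {0..4} w1 w2"
    and eq: "\<And>x. x \<in> {0..4} \<Longrightarrow> hyp_op d x (w2 x) (w1 x) (w x)
      = (real d - 1) / 4 * (w x ^ 3 * h (x * (w x)\<^sup>2))"
    using TeqE[OF T] by metis
  have sq: "r\<^sup>2 \<in> {0..4}" if "r \<in> {0..2}" for r :: real
    using power_mono[of r 2 2] that by auto
  have dsq: "((\<lambda>r. r\<^sup>2) has_real_derivative 2 * r) (at r within {0..2})" for r :: real
    by (auto intro!: derivative_eq_intros)
  have c: "((\<lambda>r. u (r\<^sup>2)) has_real_derivative u1 (r\<^sup>2) * (2 * r)) (at r within {0..2})"
    if "PROP deriv_on {0..4} u u1" "r \<in> {0..2}" for u u1 :: "real \<Rightarrow> real" and r
    by (rule DERIV_compose_within[OF that(1)[OF sq[OF that(2)]] dsq]) (use sq in auto)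
  define f1 where "f1 = (\<lambda>r. w (r\<^sup>2) + 2 * r\<^sup>2 * w1 (r\<^sup>2))"
  define f2 where "f2 = (\<lambda>r. 6 * r * w1 (r\<^sup>2) + 4 * r ^ 3 * w2 (r\<^sup>2))"
  show ?thesis
  proof (rule that)
    fix r :: real assume r: "r \<in> {0..2}"
    show "((\<lambda>r. r * w (r\<^sup>2)) has_real_derivative f1 r) (at r within {0..2})"
      using DERIV_mult[OF DERIV_ident c[OF w(1) r]] by (simp add: f1_def power2_eq_square algebra_simps)
    note c1 = c[of w w1, OF w(1) r, simplified] and c2 = c[of w1 w2, OF w(2) r, simplified]
    have "((\<lambda>r. 2 * r\<^sup>2) has_real_derivative 2 * (2 * r)) (at r within {0..2})" by (rule DERIV_cmult[OF dsq])
    from DERIV_add[OF c1 DERIV_mult[OF this c2]]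
    show "(f1 has_real_derivative f2 r) (at r within {0..2})"
      unfolding f1_def by (rule DERIV_cong) (unfold f2_def power2_eq_square power3_eq_cube, algebra)
    define x where "x = r\<^sup>2"
    have "r\<^sup>2 * (1 - r\<^sup>2) * f2 r + (real d - 1 - 2 * r\<^sup>2) * r * f1 r
      = r * (4 * x * (hyp_op d x (w2 x) (w1 x) (w x)) + (real d - 1) * w x)"
      unfolding f1_def f2_def x_def[symmetric] coefA_def coefB_def coefK_def
      by (simp add: power3_eq_cube x_def[unfolded power2_eq_square] power2_eq_square algebra_simps)
    also have "\<dots> = r * (4 * x * ((real d - 1) / 4 * (w x ^ 3 * h (x * (w x)\<^sup>2))) + (real d - 1) * w x)"
      using eq[OF sq[OF r]] by (simp only: x_def)
    also have "\<dots> = (real d - 1) * (r * w x + (r * x) * w x ^ 3 * h (x * (w x)\<^sup>2))"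
    proof -
      have "r * (4 * x * (D / 4 * (N * k)) + D * u) = D * (r * u + (r * x) * N * k)" for D N k u :: real
        by (simp add: distrib_left mult.commute mult.left_commute)
      then show ?thesis .
    qed
    also have "r * x = r ^ 3" by (simp add: x_def power2_eq_square power3_eq_cube)
    also have "x * (w x)\<^sup>2 = (r * w x)\<^sup>2" by (simp add: x_def power_mult_distrib)
    also have "(real d - 1) * (r * w x + r ^ 3 * w x ^ 3 * h ((r * w x)\<^sup>2)) = (real d - 1) * p (r * w x)"
      by (simp add: p power_mult_distrib)
    finally show "profile_eq d p r (r * w (r\<^sup>2)) (f1 r) (f2 r)"
      unfolding profile_eq_def x_def .
  qed (simp add: f1_def)
qed

text \<open>The properties from which everything about the self-similar solution follows: the
  nonzero slope gives blow-up, and the smooth function \<open>F\<close> of \<open>1 / r\<close>, up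
  to \<open>0\<close>, encodes the behaviour at infinity. The radius \<open>4/3\<close> is a point
  past the light cone and inside the inner interval \<open>[0, 2]\<close>.\<close>

definition profile :: "nat \<Rightarrow> (real \<Rightarrow> real) \<Rightarrow> (real \<Rightarrow> real) \<Rightarrow> bool" where
  "profile d p f \<longleftrightarrow> smooth_on {0..} f \<and> f 0 = 0 \<and>
     (\<exists>c. c \<noteq> 0 \<and> (f has_real_derivative c) (at 0 within {0..})) \<and>
     (\<exists>F. smooth_on {0..3/4} F \<and> (\<forall>r\<ge>4/3. f r = F (1 / r))) \<and>
     (\<exists>f1 f2. \<forall>r>0. (f has_real_derivative f1 r) (at r) \<and> (f1 has_real_derivative f2 r) (at r) \<and>
        profile_eq d p r (f r) (f1 r) (f2 r))"

text \<open>The outer problem is solved with the data of the inner solution at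
  \<open>r = 4/3\<close>. In \<open>s = 1 / r\<close> both solve the same regular equation on
  \<open>[1/2, 3/4]\<close>, so they agree for \<open>4/3 \<le> r \<le> 2\<close> and can be glued.
  The slope at \<open>4/3\<close> is recorded so that different parameters can be compared
  there.\<close>

lemma profile_extension:
  assumes d: "d \<ge> 3" and w: "smooth_on {0..4} w" "w 0 \<noteq> 0"
    and T: "Teq d w (\<lambda>x. (real d - 1) / 4 * (w x ^ 3 * h (x * (w x)\<^sup>2)))"
    and p: "\<And>u. p u = u + u ^ 3 * h (u\<^sup>2)" "smooth_on UNIV p" "\<And>u v. \<bar>p u - p v\<bar> \<le> L * \<bar>u - v\<bar>"
  obtains f F F1 F2 where "profile d p f" "outer_solution d p 0 F F1 F2"
    "\<And>r. r \<in> {0..2} \<Longrightarrow> f r = r * w (r\<^sup>2)" "\<And>r. r \<ge> 4/3 \<Longrightarrow> f r = F (1 / r)"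
    "(f has_real_derivative - (9/16 * F1 (3/4))) (at (4/3))"
proof -
  obtain f1 f2 where f1: "PROP deriv_on {0..2} (\<lambda>r. r * w (r\<^sup>2)) f1"
    and f2: "PROP deriv_on {0..2} f1 f2"
    and feq: "\<And>r. r \<in> {0..2} \<Longrightarrow> profile_eq d p r (r * w (r\<^sup>2)) (f1 r) (f2 r)"
    and f10: "f1 0 = w 0"
    by (fact inner_profile_eq[OF T p(1)])
  let ?g = "\<lambda>r. r * w (r\<^sup>2)"
  obtain F F1 F2 where F: "outer_solution d p 0 F F1 F2" "F (3/4) = ?g (4/3)" "F1 (3/4) = - (f1 (4/3) / (3/4)\<^sup>2)"
      "smooth_on {0..3/4} F"
    using outer_solution_exists[OF p(3,2)] .
  have Fd: "(F has_real_derivative F1 s) (at s within {0..3/4})" "(F1 has_real_derivative F2 s) (at s within {0..3/4})"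
      "(s\<^sup>2 - 1) * F2 s - (real d - 3) * s * F1 s = (real d - 1) * p (F s)" if "s \<in> {0..3/4}" for s
    using F(1) that unfolding outer_solution_def by auto
  have inv: "s \<noteq> 0 \<and> 1 / s \<in> {0..2}" if "s \<in> {1/2..3/4}" for s :: real
    using that by (auto simp: field_simps)
  note G = inversion_derivs[OF f1 f2 inv]
  have outG: "outer_solution d p (1/2) (\<lambda>s. ?g (1 / s)) (\<lambda>s. - (f1 (1 / s) / s\<^sup>2)) (\<lambda>s. f2 (1 / s) / s ^ 4 + 2 * f1 (1 / s) / s ^ 3)"
    unfolding outer_solution_def
  proof (intro ballI conjI G)
    fix s :: real assume s: "s \<in> {1/2..3/4}"
    then have nz: "1 / s \<noteq> 0" by auto
    have "f1 (1 / s) = - ((- (f1 (1 / s) / s\<^sup>2)) / (1 / s)\<^sup>2)"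
      "f2 (1 / s) = (f2 (1 / s) / s ^ 4 + 2 * f1 (1 / s) / s ^ 3) / (1 / s) ^ 4 + 2 * (- (f1 (1 / s) / s\<^sup>2)) / (1 / s) ^ 3"
      using nz by (auto simp: field_simps power2_eq_square power3_eq_cube power4_eq_xxxx)
    then show "(s\<^sup>2 - 1) * (f2 (1 / s) / s ^ 4 + 2 * f1 (1 / s) / s ^ 3) - (real d - 3) * s * - (f1 (1 / s) / s\<^sup>2) = (real d - 1) * p (?g (1 / s))"
      using feq[of "1 / s"] inv[OF s] profile_eq_inversion[OF nz, of d p "?g (1 / s)" "- (f1 (1 / s) / s\<^sup>2)" "f2 (1 / s) / s ^ 4 + 2 * f1 (1 / s) / s ^ 3"]
      by simp
  qed
  \<comment> \<open>Uniqueness is the stability estimate with equal data and equal nonlinearities,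
    which bounds the difference by \<open>0\<close>.\<close>
  have agree: "F (1 / r) = ?g r" if r: "r \<in> {4/3..2}" for r
  proof -
    have L: "L \<ge> 0" using p(3)[of 1 0] by simp
    obtain M where "M > 0" and M: "PROP outer_stable d L M"
      by (fact outer_solution_stability[OF d L])
    have outF: "outer_solution d p (1/2) F F1 F2"
      unfolding outer_solution_def using Fd by (auto intro!: DERIV_subset[OF Fd(1)] DERIV_subset[OF Fd(2)])
    have "\<bar>F (1 / r) - ?g (1 / (1 / r))\<bar> \<le> M * (0 + 0)"
      by (rule conjunct1[OF M[OF _ p(3) _ outF outG]]) (use F(2,3) r in \<open>auto simp: field_simps\<close>)
    then show ?thesis by simp
  qed
  define f where "f = (\<lambda>r. if r \<le> 4/3 then ?g r else F (1 / r))"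
  have fi: "f r = ?g r" if "r \<in> {0..2}" for r using that agree[of r] by (auto simp: f_def)
  have fo: "f r = F (1 / r)" if "r \<in> {4/3..}" for r using that agree[of r] by (auto simp: f_def)
  have sm: "smooth_on {0..} f"
    unfolding smooth_on_def
  proof
    fix k
    have 1: "smooth_on {0..2} ?g"
      by (intro smooth_on_mult smooth_on_ident smooth_on_compose[OF w(1)] smooth_on_power)
         (use power_mono[of _ "2::real" 2] in auto)
    have 2: "smooth_on {4/3..} (\<lambda>r. F (1 / r))"
      by (rule smooth_on_compose[OF F(4)]) (auto intro!: smooth_on_divide smooth_on_const smooth_on_ident simp: field_simps)
    show "Ck_on k {0..} f"
      by (rule Ck_on_glue[of 0 "4/3" 2, OF _ _ Ck_on_cong[OF _ smooth_onD[OF 1]] Ck_on_cong[OF _ smooth_onD[OF 2]]])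
         (auto simp: fi fo)
  qed
  obtain D where D: "D 0 = f" "\<And>j. PROP deriv_on {0..} (D j) (D (Suc j))"
    using smooth_on_chainE[OF sm no_isolated_atLeast] by metis
  have D': "(f has_real_derivative D 1 x) (at x within S)" "(D 1 has_real_derivative D 2 x) (at x within S)"
    if "x \<in> S" "S \<subseteq> {0..}" for x S
    using DERIV_subset[OF D(2)[of x 0] that(2)] DERIV_subset[OF D(2)[of x 1] that(2)] that D(1) by (auto simp: numeral_2_eq_2)
  have i02: "no_isolated {0..2::real}" by (rule no_isolated_Icc) simp
  have s02: "{0..2} \<subseteq> {0..}" "{4/3..} \<subseteq> {0::real..}" by auto
  have inn: "D 1 x = f1 x" "D 2 x = f2 x" if "x \<in> {0..2}" for x
    by (rule second_derivs_unique[OF i02 fi D'(1)[OF _ s02(1)] D'(2)[OF _ s02(1)] f1 f2 that]; assumption)+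
  have inv': "s \<noteq> 0 \<and> 1 / s \<in> {0..3/4}" if "s \<in> {4/3..}" for s :: real
    using that by (auto simp: field_simps)
  note F' = inversion_derivs[OF Fd(1) Fd(2) inv']
  have out: "D 1 x = - (F1 (1 / x) / x\<^sup>2)" "D 2 x = F2 (1 / x) / x ^ 4 + 2 * F1 (1 / x) / x ^ 3" if "x \<in> {4/3..}" for x
    by (rule second_derivs_unique[OF no_isolated_atLeast fo D'(1)[OF _ s02(2)] D'(2)[OF _ s02(2)] F' that]; assumption)+
  have at: "at x within {0..} = at x" if "x > 0" for x :: real by (rule at_within_interior) (use that in simp)
  have eq: "profile_eq d p r (f r) (D 1 r) (D 2 r)" if "r > 0" for r
  proof (cases "r \<le> 2")
    case True
    then show ?thesis using feq[of r] inn[of r] fi[of r] that by simp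
  next
    case False
    then have r: "r \<in> {4/3..}" "r \<noteq> 0" by auto
    show ?thesis unfolding out[OF r(1)] fo[OF r(1)] profile_eq_inversion[OF r(2)]
      using Fd(3)[of "1 / r"] inv'[OF r(1)] by simp
  qed
  show ?thesis
  proof (rule that[OF _ F(1) fi])
    show "profile d p f"
      unfolding profile_def
    proof (intro conjI)
      show "smooth_on {0..} f" by (rule sm)
      show "f 0 = 0" by (simp add: f_def)
      show "\<exists>c. c \<noteq> 0 \<and> (f has_real_derivative c) (at 0 within {0..})"
        using D'(1)[of 0 "{0..}"] inn(1)[of 0] f10 w(2) by auto
      show "\<exists>F. smooth_on {0..3/4} F \<and> (\<forall>r\<ge>4/3. f r = F (1 / r))" using F(4) fo by auto
      show "\<exists>f1 f2. \<forall>r>0. (f has_real_derivative f1 r) (at r) \<and> (f1 has_real_derivative f2 r) (at r) \<and>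
        profile_eq d p r (f r) (f1 r) (f2 r)"
      proof (rule exI[of _ "D 1"], rule exI[of _ "D 2"], intro allI impI conjI)
        fix r :: real assume r: "r > 0"
        then have "r \<in> {0..}" by simp
        note * = D'[OF this subset_refl, unfolded at[OF r]]
        show "(f has_real_derivative D 1 r) (at r)" by (rule *)
        show "(D 1 has_real_derivative D 2 r) (at r)" by (rule *)
        show "profile_eq d p r (f r) (D 1 r) (D 2 r)" by (rule eq[OF r])
      qed
    qed
    show "f r = F (1 / r)" if "r \<ge> 4/3" for r using fo that by simp
    have "D 1 (4/3) = - (9/16 * F1 (3/4))" using out(1)[of "4/3"] by (simp add: power2_eq_square)
    then show "(f has_real_derivative - (9/16 * F1 (3/4))) (at (4/3))"
      using D'(1)[of "4/3" "{0..}"] at[of "4/3"] by simp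
  qed
qed

lemma no_isolated_open: "open S \<Longrightarrow> no_isolated S"
  unfolding no_isolated_def by (metis at_within_open at_neq_bot)

text \<open>The inversion formula of the arctangent. It serves to identify the constructed profile
  for parameter \<open>0\<close> with \<open>f0\<close> beyond the inner region, by uniqueness of
  the outer problem.\<close>

lemma f0_outer:
  assumes d: "d \<ge> 3"
  defines "a \<equiv> sqrt (real d - 2)"
  shows "outer_solution d (\<lambda>u. sin u * cos u) 0 (\<lambda>s. pi - 2 * arctan (a * s))
      (\<lambda>s. - (2 * a / (1 + (a * s)\<^sup>2))) (\<lambda>s. 4 * a ^ 3 * s / (1 + (a * s)\<^sup>2)\<^sup>2)"
    and "r > 0 \<Longrightarrow> f0 d r = pi - 2 * arctan (a * (1 / r))"
proof -
  have a: "a > 0" "a\<^sup>2 = real d - 2" using d by (auto simp: a_def)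
  show f0: "f0 d r = pi - 2 * arctan (a * (1 / r))" if "r > 0" for r
  proof -
    have "a / r > 0" using a that by simp
    from arctan_inverse[OF this] have "arctan (r / a) = pi / 2 - arctan (a / r)" by simp
    then show ?thesis by (simp add: f0_def a_def[symmetric])
  qed
  show "outer_solution d (\<lambda>u. sin u * cos u) 0 (\<lambda>s. pi - 2 * arctan (a * s))
      (\<lambda>s. - (2 * a / (1 + (a * s)\<^sup>2))) (\<lambda>s. 4 * a ^ 3 * s / (1 + (a * s)\<^sup>2)\<^sup>2)"
    unfolding outer_solution_def
  proof (intro ballI conjI)
    fix s :: real assume s: "s \<in> {0..3/4}"
    have q: "1 + (a * s)\<^sup>2 > 0" by (intro add_pos_nonneg) auto
    then have q0: "1 + (a * s)\<^sup>2 \<noteq> 0" by simp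
    have "((\<lambda>s. pi - 2 * arctan (a * s)) has_real_derivative 0 - 2 * (inverse (1 + (a * s)\<^sup>2) * (a * 1))) (at s)"
      by (intro DERIV_diff DERIV_const DERIV_cmult DERIV_chain2[OF DERIV_arctan] DERIV_ident)
    moreover have "0 - 2 * (inverse q * (a * 1)) = - (2 * a / q)" for q by (simp add: divide_inverse)
    ultimately have "((\<lambda>s. pi - 2 * arctan (a * s)) has_real_derivative - (2 * a / (1 + (a * s)\<^sup>2))) (at s)" by metis
    then show "((\<lambda>s. pi - 2 * arctan (a * s)) has_real_derivative - (2 * a / (1 + (a * s)\<^sup>2))) (at s within {0..3/4})"
      by (rule has_field_derivative_at_within)
    have "((\<lambda>s. 1 + (a * s)\<^sup>2) has_real_derivative 2 * a\<^sup>2 * s) (at s)"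
      by (auto intro!: derivative_eq_intros simp: power2_eq_square)
    from DERIV_minus[OF DERIV_divide[OF DERIV_const[of "2 * a"] this q0]]
    have "((\<lambda>s. - (2 * a / (1 + (a * s)\<^sup>2))) has_real_derivative - ((0 * (1 + (a * s)\<^sup>2) - 2 * a * (2 * a\<^sup>2 * s)) / ((1 + (a * s)\<^sup>2) * (1 + (a * s)\<^sup>2)))) (at s)" .
    then have "((\<lambda>s. - (2 * a / (1 + (a * s)\<^sup>2))) has_real_derivative 4 * a ^ 3 * s / (1 + (a * s)\<^sup>2)\<^sup>2) (at s)"
      by (rule DERIV_cong) (simp add: power2_eq_square power3_eq_cube mult.assoc)
    then show "((\<lambda>s. - (2 * a / (1 + (a * s)\<^sup>2))) has_real_derivative 4 * a ^ 3 * s / (1 + (a * s)\<^sup>2)\<^sup>2) (at s within {0..3/4})"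
      by (rule has_field_derivative_at_within)
    have sc: "sin (pi - 2 * arctan (a * s)) * cos (pi - 2 * arctan (a * s)) = 2 * a * s * ((a * s)\<^sup>2 - 1) / (1 + (a * s)\<^sup>2)\<^sup>2"
    proof (cases "s = 0")
      case False
      then have s': "s > 0" using s by simp
      have e: "a\<^sup>2 + (1 / s)\<^sup>2 = (1 + (a * s)\<^sup>2) / s\<^sup>2" "a\<^sup>2 - (1 / s)\<^sup>2 = ((a * s)\<^sup>2 - 1) / s\<^sup>2"
        using s' by (auto simp: field_simps power2_eq_square)
      have "sin (f0 d (1 / s)) * cos (f0 d (1 / s)) = 2 * a * (1 / s) / (a\<^sup>2 + (1 / s)\<^sup>2) * ((a\<^sup>2 - (1 / s)\<^sup>2) / (a\<^sup>2 + (1 / s)\<^sup>2))"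
        unfolding sin_cos_f0[OF d] a(2) a_def[symmetric] ..
      also have "\<dots> = 2 * a * s * ((a * s)\<^sup>2 - 1) / (1 + (a * s)\<^sup>2)\<^sup>2"
        unfolding e using s' by (simp add: power2_eq_square)
      finally show ?thesis using f0[of "1 / s"] s' by simp
    qed simp
    have "((s\<^sup>2 - 1) * (4 * a ^ 3 * s) + (real d - 3) * s * (2 * a) * (1 + (a * s)\<^sup>2)) = (real d - 1) * (2 * a * s * ((a * s)\<^sup>2 - 1))"
    proof -
      have "real d - 3 = a\<^sup>2 - 1" "real d - 1 = a\<^sup>2 + 1" using a(2) by auto
      then show ?thesis by (simp add: power2_eq_square power3_eq_cube algebra_simps)
    qed
    then have "((s\<^sup>2 - 1) * (4 * a ^ 3 * s) + (real d - 3) * s * (2 * a) * (1 + (a * s)\<^sup>2)) / (1 + (a * s)\<^sup>2)\<^sup>2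
      = (real d - 1) * (2 * a * s * ((a * s)\<^sup>2 - 1)) / (1 + (a * s)\<^sup>2)\<^sup>2" by simp
    moreover have "(s\<^sup>2 - 1) * (4 * a ^ 3 * s / (1 + (a * s)\<^sup>2)\<^sup>2) - (real d - 3) * s * - (2 * a / (1 + (a * s)\<^sup>2))
      = ((s\<^sup>2 - 1) * (4 * a ^ 3 * s) + (real d - 3) * s * (2 * a) * (1 + (a * s)\<^sup>2)) / (1 + (a * s)\<^sup>2)\<^sup>2"
    proof -
      have "A * (B / q\<^sup>2) - E * - (J / q) = (A * B + E * J * q) / q\<^sup>2" if "q \<noteq> 0" for A B E J q :: real
        using that by (simp add: add_divide_distrib power2_eq_square)
      then show ?thesis using q0 by blast
    qed
    ultimately show "(s\<^sup>2 - 1) * (4 * a ^ 3 * s / (1 + (a * s)\<^sup>2)\<^sup>2) - (real d - 3) * s * - (2 * a / (1 + (a * s)\<^sup>2))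
      = (real d - 1) * (sin (pi - 2 * arctan (a * s)) * cos (pi - 2 * arctan (a * s)))"
      unfolding sc by simp
  qed
qed

lemma sin_cos_lipschitz: "\<bar>sin u * cos u - sin v * cos v\<bar> \<le> \<bar>u - v\<bar>" for u v :: real
proof -
  have "sin u * cos u - sin v * cos v = (sin (2 * u) - sin (2 * v)) / 2" by (simp add: sin_double)
  also have "\<dots> = sin (u - v) * cos (u + v)"
  proof -
    have "(2 * u - 2 * v) / 2 = u - v" "(2 * u + 2 * v) / 2 = u + v" by simp_all
    then show ?thesis by (simp only: sin_diff_sin)
  qed
  finally have "\<bar>sin u * cos u - sin v * cos v\<bar> = \<bar>sin (u - v)\<bar> * \<bar>cos (u + v)\<bar>" by (simp add: abs_mult)
  also have "\<dots> \<le> \<bar>u - v\<bar> * 1" by (intro mult_mono abs_sin_x_le_abs_x) auto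
  finally show ?thesis by simp
qed

text \<open>The second derivative of \<open>z (r\<^sup>2)\<close> is
  \<open>4 r\<^sup>2 z2 + 2 z1\<close>, hence at most \<open>16 * e + 2 * e\<close> for
  \<open>r < 2\<close>.\<close>

lemma inner_difference_bounds:
  fixes z :: "real \<Rightarrow> real"
  assumes "Cb {0..4} 2 e z"
  obtains E1 E2 where
    "PROP deriv_on {0<..<2} (\<lambda>r. z (r\<^sup>2)) E1"
    "PROP deriv_on {0<..<2} E1 E2"
    "\<And>r. r \<in> {0<..<2} \<Longrightarrow> \<bar>z (r\<^sup>2)\<bar> \<le> 18 * e \<and> \<bar>E1 r\<bar> \<le> 18 * e \<and> \<bar>E2 r\<bar> \<le> 18 * e"
proof -
  obtain z1 where z1: "PROP deriv_on {0..4} z z1" "Cb {0..4} (Suc 0) e z1"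
    using Cb_SucE[of "{0..4}" "Suc 0" e z] assms by (metis numeral_2_eq_2)
  obtain z2 where z2: "PROP deriv_on {0..4} z1 z2" "Cb {0..4} 0 e z2"
    using Cb_SucE[OF z1(2)] by metis
  have e: "e \<ge> 0" using Cb_nonneg[OF assms] by simp
  have sq: "r\<^sup>2 \<in> {0..4}" if "r \<in> {0<..<2}" for r :: real
    using power_mono[of r 2 2] that by auto
  have dsq: "((\<lambda>r. r\<^sup>2) has_real_derivative 2 * r) (at r within {0<..<2})" for r :: real
    by (auto intro!: derivative_eq_intros)
  have im: "(\<lambda>r. r\<^sup>2) ` {0<..<2} \<subseteq> {0..4::real}" using sq by auto
  show ?thesis
  proof (rule that)
    fix r :: real assume r: "r \<in> {0<..<2}"
    show "((\<lambda>r. z (r\<^sup>2)) has_real_derivative z1 (r\<^sup>2) * (2 * r)) (at r within {0<..<2})"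
      by (rule DERIV_compose_within[OF z1(1)[OF sq[OF r]] dsq im])
    have "((\<lambda>r. 2 * r) has_real_derivative 2 * 1) (at r within {0<..<2})" by (rule DERIV_cmult[OF DERIV_ident])
    from DERIV_mult[OF DERIV_compose_within[OF z2(1)[OF sq[OF r]] dsq im] this]
    show "((\<lambda>r. z1 (r\<^sup>2) * (2 * r)) has_real_derivative z2 (r\<^sup>2) * (2 * r) * (2 * r) + 2 * 1 * z1 (r\<^sup>2)) (at r within {0<..<2})" .
    have b: "\<bar>z (r\<^sup>2)\<bar> \<le> e" "\<bar>z1 (r\<^sup>2)\<bar> \<le> e" "\<bar>z2 (r\<^sup>2)\<bar> \<le> e"
      using Cb_bound[OF assms sq[OF r]] Cb_bound[OF z1(2) sq[OF r]] Cb_bound[OF z2(2) sq[OF r]] .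
    have 1: "\<bar>z1 (r\<^sup>2) * (2 * r)\<bar> \<le> e * 4" unfolding abs_mult using b r by (intro mult_mono) auto
    have 2: "\<bar>z2 (r\<^sup>2) * (2 * r) * (2 * r)\<bar> \<le> e * 4 * 4"
      unfolding abs_mult using b r e by (intro mult_mono) auto
    have 3: "\<bar>x + 2 * 1 * y\<bar> \<le> 18 * e" if "\<bar>x\<bar> \<le> e * 4 * 4" "\<bar>y\<bar> \<le> e" for x y using that by linarith
    show "\<bar>z (r\<^sup>2)\<bar> \<le> 18 * e \<and> \<bar>z1 (r\<^sup>2) * (2 * r)\<bar> \<le> 18 * e \<and>
        \<bar>z2 (r\<^sup>2) * (2 * r) * (2 * r) + 2 * 1 * z1 (r\<^sup>2)\<bar> \<le> 18 * e"
    proof (intro conjI)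
      show "\<bar>z (r\<^sup>2)\<bar> \<le> 18 * e" using b(1) e by linarith
      show "\<bar>z1 (r\<^sup>2) * (2 * r)\<bar> \<le> 18 * e" using 1 e by linarith
    qed (rule 3[OF 2 b(2)])
  qed
qed

text \<open>\<open>G (1 / r) / r\<close> is \<open>K (1 / r)\<close> with
  \<open>K s = s * G s\<close>. As \<open>r > 1\<close>, its second derivative
  \<open>K2 / r ^ 4 + 2 K1 / r ^ 3\<close> is at most \<open>3 * m + 4 * m\<close>.\<close>

lemma outer_difference_bounds:
  fixes G :: "real \<Rightarrow> real"
  assumes G: "PROP deriv_on {0..3/4} G G1"
      "PROP deriv_on {0..3/4} G1 G2"
    and b: "\<And>s. s \<in> {0..3/4} \<Longrightarrow> \<bar>G s\<bar> \<le> m \<and> \<bar>G1 s\<bar> \<le> m \<and> \<bar>G2 s\<bar> \<le> m"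
  obtains E1 E2 where
    "PROP deriv_on {4/3<..} (\<lambda>r. G (1 / r) / r) E1"
    "PROP deriv_on {4/3<..} E1 E2"
    "\<And>r. r \<in> {4/3<..} \<Longrightarrow> \<bar>G (1 / r) / r\<bar> \<le> 7 * m \<and> \<bar>E1 r\<bar> \<le> 7 * m \<and> \<bar>E2 r\<bar> \<le> 7 * m"
proof -
  have m: "m \<ge> 0" using b[of 0] by auto
  define K where "K = (\<lambda>s. s * G s)"
  define K1 where "K1 = (\<lambda>s. G s + s * G1 s)"
  define K2 where "K2 = (\<lambda>s. 2 * G1 s + s * G2 s)"
  have K: "(K has_real_derivative K1 s) (at s within {0..3/4})" "(K1 has_real_derivative K2 s) (at s within {0..3/4})"
    if "s \<in> {0..3/4}" for s
    unfolding K_def K1_def K2_def using DERIV_mult[OF DERIV_ident G(1)[OF that]] DERIV_add[OF G(1)[OF that] DERIV_mult[OF DERIV_ident G(2)[OF that]]]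
    by (simp_all add: algebra_simps)
  have inv: "r \<noteq> 0 \<and> 1 / r \<in> {0..3/4}" if "r \<in> {4/3<..}" for r :: real using that by (auto simp: field_simps)
  show ?thesis
  proof (rule that)
    fix r :: real assume r: "r \<in> {4/3<..}"
    note I = inversion_derivs[OF K inv r]
    show "((\<lambda>r. G (1 / r) / r) has_real_derivative - (K1 (1 / r) / r\<^sup>2)) (at r within {4/3<..})"
      using I(1) by (simp add: K_def)
    show "((\<lambda>r. - (K1 (1 / r) / r\<^sup>2)) has_real_derivative K2 (1 / r) / r ^ 4 + 2 * K1 (1 / r) / r ^ 3) (at r within {4/3<..})"
      using I(2) by simp
    define s where "s = 1 / r"
    have s: "s \<in> {0..3/4}" using inv[OF r] by (simp add: s_def)
    have sm: "\<bar>s * y\<bar> \<le> m" if "\<bar>y\<bar> \<le> m" for y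
    proof -
      have "\<bar>s * y\<bar> \<le> 1 * m" unfolding abs_mult using s that by (intro mult_mono) auto
      then show ?thesis by simp
    qed
    have KK: "\<bar>K s\<bar> \<le> m" "\<bar>K1 s\<bar> \<le> 2 * m" "\<bar>K2 s\<bar> \<le> 3 * m"
    proof -
      note bs = conjunct1[OF b[OF s]] conjunct1[OF conjunct2[OF b[OF s]]] conjunct2[OF conjunct2[OF b[OF s]]]
      show "\<bar>K s\<bar> \<le> m" unfolding K_def by (rule sm[OF bs(1)])
      show "\<bar>K1 s\<bar> \<le> 2 * m" unfolding K1_def using sm[OF bs(2)] bs(1) by linarith
      show "\<bar>K2 s\<bar> \<le> 3 * m" unfolding K2_def using sm[OF bs(3)] bs(2) by linarith
    qed
    have dv: "\<bar>y / r ^ j\<bar> \<le> \<bar>y\<bar>" for y j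
    proof -
      have "1 \<le> r ^ j" using r by (intro one_le_power) auto
      then show ?thesis using r by (simp add: divide_le_eq mult_le_cancel_left1)
    qed
    have Gs: "\<bar>G s / r\<bar> = \<bar>K s\<bar>" by (simp add: K_def s_def)
    show "\<bar>G (1 / r) / r\<bar> \<le> 7 * m \<and> \<bar>- (K1 (1 / r) / r\<^sup>2)\<bar> \<le> 7 * m \<and> \<bar>K2 (1 / r) / r ^ 4 + 2 * K1 (1 / r) / r ^ 3\<bar> \<le> 7 * m"
      unfolding s_def[symmetric]
    proof (intro conjI)
      show "\<bar>G s / r\<bar> \<le> 7 * m" using Gs KK(1) m by linarith
      show "\<bar>- (K1 s / r\<^sup>2)\<bar> \<le> 7 * m" using KK(2) dv[of "K1 s" 2] m by linarith
      have "\<bar>2 * K1 s / r ^ 3\<bar> \<le> 4 * m" using KK(2) dv[of "2 * K1 s" 3] by linarith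
      moreover have "\<bar>K2 s / r ^ 4\<bar> \<le> 3 * m" using KK(3) dv[of "K2 s" 4] by linarith
      ultimately show "\<bar>K2 s / r ^ 4 + 2 * K1 s / r ^ 3\<bar> \<le> 7 * m" by linarith
    qed
  qed
qed

text \<open>The profiles are extended one parameter at a time, so the comparison beyond the cone
  must be uniform in the parameter. For \<open>\<bar>ep\<bar> \<le> 1\<close> the common bound
  \<open>P\<close> gives all nonlinearities the Lipschitz constant \<open>1 + 2 * P\<close>.\<close>

lemma profile_family:
  fixes g1 g2 :: "real \<Rightarrow> real"
  assumes d: "d \<ge> 3" and e0: "e0 > 0"
    and g1: "smooth_on UNIV g1" "\<And>u. g1 (- u) = - g1 u" "(g1 has_real_derivative 0) (at 0)"
      "\<And>u. \<bar>g1 u\<bar> \<le> P" "\<And>u v. \<bar>g1 u - g1 v\<bar> \<le> P * \<bar>u - v\<bar>"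
    and g2: "smooth_on UNIV g2" "\<And>u. g2 (- u) = - g2 u" "(g2 has_real_derivative 0) (at 0)"
      "\<And>u. \<bar>g2 u\<bar> \<le> P" "\<And>u v. \<bar>g2 u - g2 v\<bar> \<le> P * \<bar>u - v\<bar>"
  obtains eps C f where "0 < eps" "eps \<le> e0" "0 < C"
    "\<And>ep. \<bar>ep\<bar> \<le> eps \<Longrightarrow> profile d (\<lambda>u. sin u * cos u + ep * g1 u + ep\<^sup>2 * g2 u) (f ep)"
    "\<And>r. r \<ge> 0 \<Longrightarrow> f 0 r = f0 d r"
    "\<And>ep k. \<bar>ep\<bar> \<le> eps \<Longrightarrow> \<bar>k\<bar> \<le> eps \<Longrightarrow> \<exists>E1 E2. \<forall>r>0.
       ((\<lambda>r. (f ep r - f k r) / r) has_real_derivative E1 r) (at r) \<and> (E1 has_real_derivative E2 r) (at r) \<and>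
       \<bar>(f ep r - f k r) / r\<bar> \<le> C * \<bar>ep - k\<bar> \<and> \<bar>E1 r\<bar> \<le> C * \<bar>ep - k\<bar> \<and> \<bar>E2 r\<bar> \<le> C * \<bar>ep - k\<bar>"
proof -
  obtain w where w: "smooth_on {0..} w" "\<And>r. f0 d r = r * w (r\<^sup>2)" by (fact f0_factor[OF d])
  let ?sc = "\<lambda>u::real. sin u * cos u"
  have sc: "smooth_on UNIV ?sc" by (intro smooth_on_mult smooth_on_sin smooth_on_cos)
  have dsc: "(?sc has_real_derivative 1) (at 0)" by (auto intro!: derivative_eq_intros)
  obtain H where H: "smooth_on {0..} H" "\<And>u. sin u * cos u = 1 * u + u ^ 3 * H (u\<^sup>2)"
    by (rule odd_smooth_expansion[OF sc _ dsc]) (simp, rule that)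
  have H': "sin u * cos u = u + u ^ 3 * H (u\<^sup>2)" for u using H(2) by simp
  obtain H1 where H1: "smooth_on {0..} H1" "\<And>u. g1 u = 0 * u + u ^ 3 * H1 (u\<^sup>2)" by (fact odd_smooth_expansion[OF g1(1-3)])
  obtain H2 where H2: "smooth_on {0..} H2" "\<And>u. g2 u = 0 * u + u ^ 3 * H2 (u\<^sup>2)" by (fact odd_smooth_expansion[OF g2(1-3)])
  have P: "P \<ge> 0" using g1(4)[of 0] by simp
  have "min e0 1 > 0" using e0 by simp
  obtain eps C Ps where eps: "0 < eps" "eps \<le> min e0 1" "0 < C"
    and Ps: "\<And>ep. \<bar>ep\<bar> \<le> eps \<Longrightarrow> smooth_on {0..4} (Ps ep)"
    "\<And>ep. \<bar>ep\<bar> \<le> eps \<Longrightarrow> Teq d (Ps ep) (\<lambda>x. (real d - 1) / 4 * (Ps ep x ^ 3 *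
       (H (x * (Ps ep x)\<^sup>2) + ep * H1 (x * (Ps ep x)\<^sup>2) + ep\<^sup>2 * H2 (x * (Ps ep x)\<^sup>2))))"
    "\<And>ep. \<bar>ep\<bar> \<le> eps \<Longrightarrow> Ps ep 0 \<noteq> 0"
    "\<And>ep k. \<bar>ep\<bar> \<le> eps \<Longrightarrow> \<bar>k\<bar> \<le> eps \<Longrightarrow> Cb {0..4} 2 (C * \<bar>ep - k\<bar>) (\<lambda>x. Ps ep x - Ps k x)"
    "\<And>x. x \<in> {0..4} \<Longrightarrow> Ps 0 x = w x"
    by (fact inner_profiles[OF d w H(1) H' H1(1) H2(1) \<open>min e0 1 > 0\<close>])
  define p where "p = (\<lambda>ep u. sin u * cos u + ep * g1 u + ep\<^sup>2 * g2 u)"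
  define h where "h = (\<lambda>ep q. H q + ep * H1 q + ep\<^sup>2 * H2 q)"
  define L where "L = 1 + 2 * P"
  have L: "L \<ge> 0" using P by (simp add: L_def)
  have ph: "p ep u = u + u ^ 3 * h ep (u\<^sup>2)" for ep u
    unfolding p_def h_def H' H1(2) H2(2) by (simp add: algebra_simps)
  have psm: "smooth_on UNIV (p ep)" for ep
    unfolding p_def by (intro smooth_on_add smooth_on_mult smooth_on_const sc g1(1) g2(1) smooth_on_sin smooth_on_cos)
  have le1: "\<bar>ep\<bar> \<le> 1" if "\<bar>ep\<bar> \<le> eps" for ep using that eps by simp
  have plip: "\<bar>p ep u - p ep v\<bar> \<le> L * \<bar>u - v\<bar>" if "\<bar>ep\<bar> \<le> eps" for ep u v
  proof -
    have "\<bar>ep * (g1 u - g1 v)\<bar> \<le> 1 * (P * \<bar>u - v\<bar>)" unfolding abs_mult using le1[OF that] g1(5) by (intro mult_mono) auto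
    moreover have "\<bar>ep\<^sup>2 * (g2 u - g2 v)\<bar> \<le> 1 * (P * \<bar>u - v\<bar>)" unfolding abs_mult
      using le1[OF that] g2(5) by (intro mult_mono) (auto simp: abs_square_le_1)
    moreover have "p ep u - p ep v = (sin u * cos u - sin v * cos v) + ep * (g1 u - g1 v) + ep\<^sup>2 * (g2 u - g2 v)"
      by (simp add: p_def algebra_simps)
    moreover have "L * \<bar>u - v\<bar> = \<bar>u - v\<bar> + 2 * (P * \<bar>u - v\<bar>)" by (simp add: L_def algebra_simps)
    moreover have "\<bar>x + y + z\<bar> \<le> a + 2 * b" if "\<bar>x\<bar> \<le> a" "\<bar>y\<bar> \<le> 1 * b" "\<bar>z\<bar> \<le> 1 * b" for x y z a b :: real
      using that by linarith
    ultimately show ?thesis using sin_cos_lipschitz[of u v] by presburger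
  qed
  have pdiff: "\<bar>p ep u - p k u\<bar> \<le> 3 * P * \<bar>ep - k\<bar>" if "\<bar>ep\<bar> \<le> eps" "\<bar>k\<bar> \<le> eps" for ep k u
  proof -
    have "\<bar>(ep - k) * g1 u\<bar> \<le> \<bar>ep - k\<bar> * P" unfolding abs_mult using g1(4) by (intro mult_mono) auto
    moreover have "\<bar>(ep + k) * ((ep - k) * g2 u)\<bar> \<le> 2 * (\<bar>ep - k\<bar> * P)" unfolding abs_mult
      using g2(4) le1[OF that(1)] le1[OF that(2)] by (intro mult_mono) auto
    moreover have "p ep u - p k u = (ep - k) * g1 u + (ep + k) * ((ep - k) * g2 u)"
      by (simp add: p_def algebra_simps power2_eq_square)
    moreover have "3 * P * \<bar>ep - k\<bar> = \<bar>ep - k\<bar> * P + 2 * (\<bar>ep - k\<bar> * P)" by simp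
    moreover have "\<bar>x + y\<bar> \<le> a + b" if "\<bar>x\<bar> \<le> a" "\<bar>y\<bar> \<le> b" for x y a b :: real
      using that by linarith
    ultimately show ?thesis by presburger
  qed
  have "\<forall>ep. \<exists>f F F1 F2. \<bar>ep\<bar> \<le> eps \<longrightarrow> profile d (p ep) f \<and> outer_solution d (p ep) 0 F F1 F2 \<and>
    (\<forall>r\<in>{0..2}. f r = r * Ps ep (r\<^sup>2)) \<and> (\<forall>r\<ge>4/3. f r = F (1 / r)) \<and>
    (f has_real_derivative - (9/16 * F1 (3/4))) (at (4/3))"
  proof
    fix ep
    show "\<exists>f F F1 F2. \<bar>ep\<bar> \<le> eps \<longrightarrow> profile d (p ep) f \<and> outer_solution d (p ep) 0 F F1 F2 \<and>
    (\<forall>r\<in>{0..2}. f r = r * Ps ep (r\<^sup>2)) \<and> (\<forall>r\<ge>4/3. f r = F (1 / r)) \<and>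
    (f has_real_derivative - (9/16 * F1 (3/4))) (at (4/3))"
    proof (cases "\<bar>ep\<bar> \<le> eps")
      case True
      have T': "Teq d (Ps ep) (\<lambda>x. (real d - 1) / 4 * (Ps ep x ^ 3 * h ep (x * (Ps ep x)\<^sup>2)))"
        using Ps(2)[OF True] by (simp only: h_def)
      obtain f F F1 F2 where *: "profile d (p ep) f" "outer_solution d (p ep) 0 F F1 F2"
        "\<And>r. r \<in> {0..2} \<Longrightarrow> f r = r * Ps ep (r\<^sup>2)" "\<And>r. r \<ge> 4/3 \<Longrightarrow> f r = F (1 / r)"
        "(f has_real_derivative - (9/16 * F1 (3/4))) (at (4/3))"
        by (fact profile_extension[OF d Ps(1)[OF True] Ps(3)[OF True] T' ph psm plip[OF True]])
      then show ?thesis by (intro exI[of _ f] exI[of _ F] exI[of _ F1] exI[of _ F2] impI conjI ballI allI *)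
    qed auto
  qed
  then obtain f F F1 F2 where fF: "\<forall>ep. \<bar>ep\<bar> \<le> eps \<longrightarrow> profile d (p ep) (f ep) \<and> outer_solution d (p ep) 0 (F ep) (F1 ep) (F2 ep) \<and>
    (\<forall>r\<in>{0..2}. f ep r = r * Ps ep (r\<^sup>2)) \<and> (\<forall>r\<ge>4/3. f ep r = F ep (1 / r)) \<and>
    (f ep has_real_derivative - (9/16 * F1 ep (3/4))) (at (4/3))"
    unfolding choice_iff by (elim exE)
  have prof: "profile d (p ep) (f ep)" and out: "outer_solution d (p ep) 0 (F ep) (F1 ep) (F2 ep)"
    and fi: "\<And>r. r \<in> {0..2} \<Longrightarrow> f ep r = r * Ps ep (r\<^sup>2)" and fo: "\<And>r. r \<ge> 4/3 \<Longrightarrow> f ep r = F ep (1 / r)"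
    and fd: "(f ep has_real_derivative - (9/16 * F1 ep (3/4))) (at (4/3))" if "\<bar>ep\<bar> \<le> eps" for ep
    using fF that by blast+
  obtain M where M0: "M > 0" and M: "PROP outer_stable d L M"
    by (fact outer_solution_stability[OF d L])
  have z: "\<bar>0\<bar> \<le> eps" using eps by simp
  have in0: "f 0 r = f0 d r" if "r \<in> {0..2}" for r
    using fi[OF z that] w(2)[of r] Ps(5)[of "r\<^sup>2"] power_mono[of r 2 2] that by simp
  \<comment> \<open>The factors \<open>18\<close> and \<open>7\<close> come from the inner and outer
    difference bounds, \<open>9 * C\<close> from the data at \<open>r = 4/3\<close>, and
    \<open>3 * P\<close> from the nonlinearities, linear part \<open>P\<close> plus quadratic part
    \<open>2 * P\<close>.\<close>
  define C' where "C' = 18 * C + 7 * (M * (9 * C + 3 * P))"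
  show ?thesis
  proof (rule that[OF eps(1)])
    show "eps \<le> e0" using eps by simp
    show "C' > 0" unfolding C'_def using eps M0 P by (intro add_pos_nonneg) auto
    show "profile d (\<lambda>u. sin u * cos u + ep * g1 u + ep\<^sup>2 * g2 u) (f ep)" if "\<bar>ep\<bar> \<le> eps" for ep
      using prof[OF that] by (simp add: p_def)
    \<comment> \<open>On the inner interval this is the normalization of the inner profiles. Beyond
      it, both functions have the same value and slope at \<open>r = 4/3\<close> and solve the same
      outer problem.\<close>
    show "f 0 r = f0 d r" if r: "r \<ge> 0" for r
    proof (cases "r \<le> 2")
      case True
      then show ?thesis using in0 r by simp
    next
      case False
      let ?a = "sqrt (real d - 2)"
      have a: "?a > 0" "?a\<^sup>2 = real d - 2" using d by auto
      have p0: "p 0 = ?sc" by (simp add: p_def)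
      have F0: "F 0 (3/4) = pi - 2 * arctan (?a * (3/4))"
        using in0[of "4/3"] fo[OF z, of "4/3"] f0_outer(2)[OF d, of "4/3"] by simp
      have "((f 0) has_real_derivative 2 * ?a / (real d - 2 + (4/3)\<^sup>2)) (at (4/3))"
        by (rule has_field_derivative_transform_within_open[OF f0_deriv[OF d] open_greaterThanLessThan[of 0 2]]) (use in0 in auto)
      from DERIV_unique[OF this fd[OF z]] have "9/16 * F1 0 (3/4) = - (2 * ?a / (real d - 2 + (4/3)\<^sup>2))" by simp
      also have "real d - 2 + (4/3)\<^sup>2 = 16/9 * (1 + (?a * (3/4))\<^sup>2)" 
      proof -
        have "(?a * (3/4))\<^sup>2 = (real d - 2) * (9/16)" unfolding power_mult_distrib a(2) by (simp add: power2_eq_square)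
        moreover have "(4/3)\<^sup>2 = (16/9 :: real)" by (simp add: power2_eq_square)
        moreover have "D + Y = 16/9 * (1 + X)" if "X = D * (9/16)" "Y = 16/9" for D X Y :: real using that by simp
        ultimately show ?thesis by metis
      qed
      finally have "9/16 * F1 0 (3/4) = - (2 * ?a / (16/9 * (1 + (?a * (3/4))\<^sup>2)))" .
      moreover have "u = - (2 * v / q)" if "9/16 * u = - (2 * v / (16/9 * q))" for u v q :: real
      proof -
        have "- (2 * v / (16/9 * q)) = 9/16 * (- (2 * v / q))" by simp
        with that have "9/16 * u = 9/16 * (- (2 * v / q))" by (rule trans)
        then show ?thesis using mult_left_cancel[of "9/16 :: real" u] by (metis divide_eq_0_iff zero_neq_numeral)
      qed
      ultimately have F10: "F1 0 (3/4) = - (2 * ?a / (1 + (?a * (3/4))\<^sup>2))" by metis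
      have "\<bar>F 0 (1 / r) - (pi - 2 * arctan (?a * (1 / r)))\<bar> \<le> M * (0 + 0)"
        by (rule conjunct1[OF M[OF _ plip[OF z] _ out[OF z] f0_outer(1)[OF d]]])
           (use F0 F10 False in \<open>auto simp: p0 field_simps\<close>)
      then show ?thesis using fo[OF z, of r] f0_outer(2)[OF d, of r] False by simp
    qed
    fix ep k assume epk: "\<bar>ep\<bar> \<le> eps" "\<bar>k\<bar> \<le> eps"
    define e where "e = C * \<bar>ep - k\<bar>"
    have e0: "e \<ge> 0" using eps by (simp add: e_def)
    define m where "m = M * (9 * e + 3 * P * \<bar>ep - k\<bar>)"
    have m0: "m \<ge> 0" using M0 e0 P by (simp add: m_def)
    have C': "C' * \<bar>ep - k\<bar> = 18 * e + 7 * m" by (simp add: C'_def e_def m_def algebra_simps)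
    define E where "E = (\<lambda>r. (f ep r - f k r) / r)"
    have "smooth_on {0<..} (f ep)" if "\<bar>ep\<bar> \<le> eps" for ep
      by (rule smooth_on_subset[of "{0..}"]) (use prof[OF that] in \<open>auto simp: profile_def\<close>)
    then have "smooth_on {0<..} E" unfolding E_def using epk
      by (intro smooth_on_divide smooth_on_diff smooth_on_ident) auto
    then obtain D where D: "D 0 = E" "\<And>j. PROP deriv_on {0<..} (D j) (D (Suc j))"
      using smooth_on_chainE[OF _ no_isolated_open] by (metis open_greaterThan)
    have D': "(E has_real_derivative D 1 x) (at x within S)" "(D 1 has_real_derivative D 2 x) (at x within S)"
      if "x \<in> S" "S \<subseteq> {0<..}" for x S
      using DERIV_subset[OF D(2)[of x 0] that(2)] DERIV_subset[OF D(2)[of x 1] that(2)] that D(1) by (auto simp: numeral_2_eq_2)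
    obtain A1 A2 where
      A: "PROP deriv_on {0<..<2} (\<lambda>r. Ps ep (r\<^sup>2) - Ps k (r\<^sup>2)) A1"
      "PROP deriv_on {0<..<2} A1 A2"
      "\<And>r. r \<in> {0<..<2} \<Longrightarrow> \<bar>Ps ep (r\<^sup>2) - Ps k (r\<^sup>2)\<bar> \<le> 18 * e \<and> \<bar>A1 r\<bar> \<le> 18 * e \<and> \<bar>A2 r\<bar> \<le> 18 * e"
      by (fact inner_difference_bounds[OF Ps(4)[OF epk, folded e_def]])
    have EA: "E r = Ps ep (r\<^sup>2) - Ps k (r\<^sup>2)" if "r \<in> {0<..<2}" for r
      using that by (simp add: E_def fi[OF epk(1)] fi[OF epk(2)] diff_divide_distrib)
    have sub: "{0<..<2} \<subseteq> {0::real<..}" "{4/3<..} \<subseteq> {0::real<..}" by auto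
    have DA: "D 1 r = A1 r" "D 2 r = A2 r" if "r \<in> {0<..<2}" for r
      by (rule second_derivs_unique[OF no_isolated_open[OF open_greaterThanLessThan] EA D'(1)[OF _ sub(1)] D'(2)[OF _ sub(1)] A(1,2) that]; assumption)+
    have bnd1: "\<bar>F ep (3/4) - F k (3/4)\<bar> \<le> 9 * e"
    proof -
      have "F ep (3/4) - F k (3/4) = 4/3 * (Ps ep ((4/3)\<^sup>2) - Ps k ((4/3)\<^sup>2))"
        using fo[OF epk(1), of "4/3"] fo[OF epk(2), of "4/3"] fi[OF epk(1), of "4/3"] fi[OF epk(2), of "4/3"] by simp
      moreover have "\<bar>Ps ep ((4/3)\<^sup>2) - Ps k ((4/3)\<^sup>2)\<bar> \<le> e"
        by (rule Cb_bound[OF Ps(4)[OF epk, folded e_def]]) (simp add: power2_eq_square)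
      ultimately show ?thesis using e0 by simp
    qed
    \<comment> \<open>The slope of the difference at \<open>4/3\<close> is
      \<open>\<delta> + 32/9 \<delta>'\<close> in terms of the inner difference, and passing to
      \<open>s = 1 / r\<close> multiplies it by \<open>16/9\<close> up to sign. The resulting factor
      \<open>16/9 * (1 + 32/9)\<close> is below \<open>9\<close>.\<close>
    have bnd2: "\<bar>F1 ep (3/4) - F1 k (3/4)\<bar> \<le> 9 * e"
    proof -
      obtain de1 where de1: "PROP deriv_on {0..4} (\<lambda>x. Ps ep x - Ps k x) de1"
          "Cb {0..4} (Suc 0) e de1"
        using Cb_SucE[of "{0..4}" "Suc 0" e "\<lambda>x. Ps ep x - Ps k x"] Ps(4)[OF epk, folded e_def] by (metis numeral_2_eq_2)
      have x: "(4/3)\<^sup>2 \<in> {0..4::real}" "at ((4/3)\<^sup>2) within {0..4} = at ((4/3)\<^sup>2 :: real)"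
        by (simp add: power2_eq_square, rule at_within_interior, simp add: power2_eq_square)
      let ?de = "\<lambda>x. Ps ep x - Ps k x"
      have sqd: "((\<lambda>r. r\<^sup>2) has_real_derivative 2 * (4/3)) (at (4/3::real))" by (auto intro!: derivative_eq_intros)
      have "((\<lambda>r. r * ?de (r\<^sup>2)) has_real_derivative 1 * ?de ((4/3)\<^sup>2) + de1 ((4/3)\<^sup>2) * (2 * (4/3)) * (4/3)) (at (4/3))"
        by (rule DERIV_mult[OF DERIV_ident DERIV_chain2[of ?de, OF de1(1)[OF x(1), unfolded x(2)] sqd]])
      then have "((\<lambda>r. f ep r - f k r) has_real_derivative 1 * ?de ((4/3)\<^sup>2) + de1 ((4/3)\<^sup>2) * (2 * (4/3)) * (4/3)) (at (4/3))"
        by (rule has_field_derivative_transform_within_open[OF _ open_greaterThanLessThan[of 0 2]])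
           (auto simp: fi[OF epk(1)] fi[OF epk(2)] right_diff_distrib)
      from DERIV_unique[OF this DERIV_diff[OF fd[OF epk(1)] fd[OF epk(2)]]]
      have "?de ((4/3)\<^sup>2) + 32/9 * de1 ((4/3)\<^sup>2) = - 9/16 * (F1 ep (3/4) - F1 k (3/4))" by (simp add: algebra_simps diff_divide_distrib)
      moreover have "\<bar>?de ((4/3)\<^sup>2)\<bar> \<le> e" by (rule Cb_bound[OF Ps(4)[OF epk, folded e_def] x(1)])
      moreover have "\<bar>de1 ((4/3)\<^sup>2)\<bar> \<le> e" by (rule Cb_bound[OF de1(2) x(1)])
      moreover have "\<bar>z\<bar> \<le> 9 * e" if "x + 32/9 * y = - 9/16 * z" "\<bar>x\<bar> \<le> e" "\<bar>y\<bar> \<le> e" for x y z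
        using that by linarith
      ultimately show ?thesis by presburger
    qed
    have Gb: "\<bar>F ep s - F k s\<bar> \<le> m \<and> \<bar>F1 ep s - F1 k s\<bar> \<le> m \<and> \<bar>F2 ep s - F2 k s\<bar> \<le> m" if "s \<in> {0..3/4}" for s
      unfolding m_def by (rule M[OF _ plip[OF epk(1)] pdiff[OF epk] out[OF epk(1)] out[OF epk(2)] bnd1 bnd2 that]) simp
    have Gd: "((\<lambda>s. F ep s - F k s) has_real_derivative F1 ep s - F1 k s) (at s within {0..3/4})"
      "((\<lambda>s. F1 ep s - F1 k s) has_real_derivative F2 ep s - F2 k s) (at s within {0..3/4})" if "s \<in> {0..3/4}" for s
      using out[OF epk(1)] out[OF epk(2)] that unfolding outer_solution_def by (auto intro!: DERIV_diff)
    obtain B1 B2 where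
      B: "PROP deriv_on {4/3<..} (\<lambda>r. (F ep (1 / r) - F k (1 / r)) / r) B1"
      "PROP deriv_on {4/3<..} B1 B2"
      "\<And>r. r \<in> {4/3<..} \<Longrightarrow> \<bar>(F ep (1 / r) - F k (1 / r)) / r\<bar> \<le> 7 * m \<and> \<bar>B1 r\<bar> \<le> 7 * m \<and> \<bar>B2 r\<bar> \<le> 7 * m"
      by (rule outer_difference_bounds[of "\<lambda>s. F ep s - F k s" "\<lambda>s. F1 ep s - F1 k s" "\<lambda>s. F2 ep s - F2 k s" m];
          (rule Gd Gb that; assumption))
    have EB: "E r = (F ep (1 / r) - F k (1 / r)) / r" if "r \<in> {4/3<..}" for r
      using that by (simp add: E_def fo[OF epk(1)] fo[OF epk(2)])
    have DB: "D 1 r = B1 r" "D 2 r = B2 r" if "r \<in> {4/3<..}" for r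
      by (rule second_derivs_unique[OF no_isolated_open[OF open_greaterThan] EB D'(1)[OF _ sub(2)] D'(2)[OF _ sub(2)] B(1,2) that]; assumption)+
    have fin: "(E has_real_derivative D 1 r) (at r) \<and> (D 1 has_real_derivative D 2 r) (at r) \<and>
       \<bar>E r\<bar> \<le> C' * \<bar>ep - k\<bar> \<and> \<bar>D 1 r\<bar> \<le> C' * \<bar>ep - k\<bar> \<and> \<bar>D 2 r\<bar> \<le> C' * \<bar>ep - k\<bar>" if r: "r > 0" for r
    proof (intro conjI)
      have at: "at r within {0<..} = at r" by (rule at_within_open) (use r in auto)
      have "r \<in> {0<..}" using r by simp
      note * = D'[OF this subset_refl, unfolded at]
      show "(E has_real_derivative D 1 r) (at r)" by (rule *(1))
      show "(D 1 has_real_derivative D 2 r) (at r)" by (rule *(2))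
      have "(\<bar>E r\<bar> \<le> 18 * e \<and> \<bar>D 1 r\<bar> \<le> 18 * e \<and> \<bar>D 2 r\<bar> \<le> 18 * e) \<or> (\<bar>E r\<bar> \<le> 7 * m \<and> \<bar>D 1 r\<bar> \<le> 7 * m \<and> \<bar>D 2 r\<bar> \<le> 7 * m)"
      proof (cases "r < 2")
        case True
        then have in2: "r \<in> {0<..<2}" using r by simp
        show ?thesis using A(3)[OF in2] unfolding EA[OF in2] DA[OF in2] by blast
      next
        case False
        then have out2: "r \<in> {4/3<..}" by simp
        show ?thesis using B(3)[OF out2] unfolding EB[OF out2] DB[OF out2] by blast
      qed
      then show "\<bar>E r\<bar> \<le> C' * \<bar>ep - k\<bar>" "\<bar>D 1 r\<bar> \<le> C' * \<bar>ep - k\<bar>" "\<bar>D 2 r\<bar> \<le> C' * \<bar>ep - k\<bar>"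
        unfolding C' using e0 m0 by linarith+
    qed
    show "\<exists>E1 E2. \<forall>r>0.
       ((\<lambda>r. (f ep r - f k r) / r) has_real_derivative E1 r) (at r) \<and> (E1 has_real_derivative E2 r) (at r) \<and>
       \<bar>(f ep r - f k r) / r\<bar> \<le> C' * \<bar>ep - k\<bar> \<and> \<bar>E1 r\<bar> \<le> C' * \<bar>ep - k\<bar> \<and> \<bar>E2 r\<bar> \<le> C' * \<bar>ep - k\<bar>"
      by (rule exI[of _ "D 1"], rule exI[of _ "D 2"], intro allI impI, rule fin[unfolded E_def])
  qed
qed

section \<open>Symbol bounds and self-similar solutions\<close>

lemma deriv_within_eq:
  assumes "(f has_real_derivative y) (at x within S)" "at x within S \<noteq> bot"
  shows "deriv_within S f x = y"
  unfolding deriv_within_def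
  using assms by (intro vector_derivative_within) (auto simp: has_real_derivative_iff_has_vector_derivative)

lemma nderiv_within_chain:
  assumes S: "no_isolated S"
    and D: "\<And>j. PROP deriv_on S (D j) (D (Suc j))"
    and g: "\<And>x. x \<in> S \<Longrightarrow> g x = D 0 x" and x: "x \<in> S"
  shows "nderiv_within S k g x = D k x"
  using x
proof (induction k arbitrary: x)
  case 0
  then show ?case by (simp add: nderiv_within_def g)
next
  case (Suc k)
  have "(nderiv_within S k g has_real_derivative D (Suc k) x) (at x within S)"
    by (rule has_field_derivative_transform_within[OF D[OF Suc.prems] zero_less_one Suc.prems]) (simp add: Suc.IH)
  moreover have "at x within S \<noteq> bot" using S Suc.prems by (simp add: no_isolated_def)
  ultimately show ?case unfolding nderiv_within_def by (simp add: deriv_within_eq)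
qed

text \<open>The functions \<open>F (1 / r) / r ^ i\<close> with \<open>F\<close> smooth up to
  \<open>0\<close> form a symbol class: differentiation replaces \<open>F\<close> by
  \<open>- i F - s F'\<close> and raises the power by one.\<close>

lemma inversion_power_deriv:
  fixes F :: "real \<Rightarrow> real"
  assumes F: "smooth_on {0..3/4} F"
  obtains G where "smooth_on {0..3/4} G"
    "\<And>r. r \<in> {4/3..} \<Longrightarrow> ((\<lambda>r. F (1 / r) / r ^ i) has_real_derivative G (1 / r) / r ^ Suc i) (at r within {4/3..})"
proof -
  have no: "no_isolated {0..3/4::real}" by (rule no_isolated_Icc) simp
  obtain F' where F': "PROP deriv_on {0..3/4} F F'" "smooth_on {0..3/4} F'"
    by (rule smooth_on_derivE[OF F]) (use no in \<open>auto simp: no_isolated_def\<close>)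
  have inv: "1 / r \<in> {0..3/4}" if "r \<in> {4/3..}" for r :: real using that by (auto simp: field_simps)
  show ?thesis
  proof (rule that)
    show "smooth_on {0..3/4} (\<lambda>s. - real i * F s - s * F' s)"
      by (intro smooth_on_diff smooth_on_mult smooth_on_const smooth_on_ident F F'(2))
    fix r :: real assume r: "r \<in> {4/3..}"
    have nz: "r \<noteq> 0" using r by auto
    have i: "((\<lambda>x. 1 / x) has_real_derivative - (1 / r\<^sup>2)) (at r within {4/3..})"
      using nz by (auto intro!: derivative_eq_intros simp: power2_eq_square)
    have c: "((\<lambda>x. F (1 / x)) has_real_derivative F' (1 / r) * - (1 / r\<^sup>2)) (at r within {4/3..})"
      by (rule DERIV_compose_within[OF F'(1)[OF inv[OF r]] i]) (use inv in auto)
    have p: "((\<lambda>x. (1 / x) ^ i) has_real_derivative real i * (- (1 / r\<^sup>2) * (1 / r) ^ (i - Suc 0))) (at r within {4/3..})"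
      by (rule DERIV_power[OF i])
    have e: "real i * (- (1 / r\<^sup>2) * (1 / r) ^ (i - Suc 0)) = - real i * (1 / r) ^ Suc i"
    proof (cases i)
      case (Suc j)
      have "real (Suc j) * (- u\<^sup>2 * u ^ j) = - real (Suc j) * u ^ Suc (Suc j)" for u :: real
        by (simp only: power2_eq_square power_Suc mult_minus_left mult_minus_right mult_ac)
      from this[of "1 / r"] show ?thesis by (simp add: Suc power_one_over)
    qed simp
    have "((\<lambda>x. F (1 / x) * (1 / x) ^ i) has_real_derivative F' (1 / r) * - (1 / r\<^sup>2) * (1 / r) ^ i + - real i * (1 / r) ^ Suc i * F (1 / r)) (at r within {4/3..})"
      using DERIV_mult[OF c p] unfolding e .
    moreover have "F' (1 / r) * - (1 / r\<^sup>2) * (1 / r) ^ i + - real i * (1 / r) ^ Suc i * F (1 / r)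
      = (- real i * F (1 / r) - (1 / r) * F' (1 / r)) / r ^ Suc i"
      using nz by (simp add: power_divide field_simps power2_eq_square)
    ultimately show "((\<lambda>r. F (1 / r) / r ^ i) has_real_derivative (- real i * F (1 / r) - (1 / r) * F' (1 / r)) / r ^ Suc i) (at r within {4/3..})"
      by (simp add: power_divide)
  qed
qed

lemma japanese_bounds:
  assumes "r \<ge> 0"
  shows "japanese r \<ge> 1" "r \<le> 2 \<Longrightarrow> japanese r \<le> 3" "r \<ge> 1 \<Longrightarrow> japanese r \<le> 3 * r"
proof -
  show "japanese r \<ge> 1" unfolding japanese_def by simp
  show "japanese r \<le> 3" if "r \<le> 2"
  proof -
    have "r\<^sup>2 \<le> 2\<^sup>2" using assms that by (intro power_mono)
    then show ?thesis unfolding japanese_def by (intro real_le_lsqrt) auto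
  qed
  show "japanese r \<le> 3 * r" if "r \<ge> 1"
  proof -
    have "1\<^sup>2 \<le> r\<^sup>2" using that by (intro power_mono) auto
    then have "1 + r\<^sup>2 \<le> 9 * r\<^sup>2" by simp
    then show ?thesis unfolding japanese_def using that by (intro real_le_lsqrt) (auto simp: power_mult_distrib)
  qed
qed

text \<open>Beyond \<open>4/3\<close> each derivative has the form
  \<open>G (1 / r) / r ^ (i + k)\<close> with \<open>G\<close> bounded, which gives the decay for
  \<open>r > 2\<close>; on \<open>[0, 2]\<close> compactness suffices. The factor
  \<open>3 ^ (i + k)\<close> compares \<open>r\<close> with \<open>japanese r\<close>.\<close>

lemma symbol_decay:
  assumes D: "\<And>j. PROP deriv_on {0..} (D j) (D (Suc j))"
    and F: "smooth_on {0..3/4} F" "\<And>r. r \<in> {4/3..} \<Longrightarrow> D 0 r = F (1 / r) / r ^ i"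
  shows "\<exists>C>0. \<forall>r\<ge>0. \<bar>D k r\<bar> \<le> C * japanese r powi (- int (i + k))"
proof -
  have "\<exists>G. smooth_on {0..3/4} G \<and> (\<forall>r\<in>{4/3..}. D k r = G (1 / r) / r ^ (i + k))"
  proof (induction k)
    case 0
    then show ?case using F by auto
  next
    case (Suc k)
    then obtain G where G: "smooth_on {0..3/4} G" "\<And>r. r \<in> {4/3..} \<Longrightarrow> D k r = G (1 / r) / r ^ (i + k)" by auto
    obtain G' where G': "smooth_on {0..3/4} G'"
      "\<And>r. r \<in> {4/3..} \<Longrightarrow> ((\<lambda>r. G (1 / r) / r ^ (i + k)) has_real_derivative G' (1 / r) / r ^ Suc (i + k)) (at r within {4/3..})"
      by (fact inversion_power_deriv[OF G(1)])
    have "D (Suc k) r = G' (1 / r) / r ^ Suc (i + k)" if r: "r \<in> {4/3..}" for r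
    proof (rule no_isolated_unique[OF no_isolated_atLeast r])
      show "(D k has_real_derivative D (Suc k) r) (at r within {4/3..})"
        by (rule DERIV_subset[OF D]) (use r in auto)
      show "(D k has_real_derivative G' (1 / r) / r ^ Suc (i + k)) (at r within {4/3..})"
        by (rule has_field_derivative_transform_within[OF G'(2)[OF r] zero_less_one r]) (simp add: G(2))
    qed
    then show ?case using G'(1) by auto
  qed
  then obtain G where G: "smooth_on {0..3/4} G" "\<And>r. r \<in> {4/3..} \<Longrightarrow> D k r = G (1 / r) / r ^ (i + k)" by auto
  have bdd: "\<exists>B>0. \<forall>x\<in>{a..b}. \<bar>g x\<bar> \<le> B" if "continuous_on {a..b} g" for a b and g :: "real \<Rightarrow> real"
    using compact_imp_bounded[OF compact_continuous_image[OF that compact_Icc]] unfolding bounded_pos by auto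
  obtain B1 where B1: "B1 > 0" "\<And>s. s \<in> {0..3/4} \<Longrightarrow> \<bar>G s\<bar> \<le> B1" using bdd[OF smooth_on_imp_continuous[OF G(1)]] by auto
  have "continuous_on {0..2} (D k)"
    by (rule continuous_on_subset[of "{0..}"]) (auto intro!: DERIV_continuous_on[of "{0..}" "D k" "D (Suc k)"] D)
  from bdd[OF this] obtain B2 where B2: "B2 > 0" "\<And>x. x \<in> {0..2} \<Longrightarrow> \<bar>D k x\<bar> \<le> B2" by auto
  let ?n = "i + k"
  define C where "C = (B1 + B2) * 3 ^ ?n"
  have "\<bar>D k r\<bar> \<le> C * japanese r powi (- int ?n)" if r: "r \<ge> 0" for r
  proof -
    have j: "japanese r > 0" using japanese_bounds(1)[OF r] by simp
    have "\<bar>D k r\<bar> * japanese r ^ ?n \<le> C"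
    proof (cases "r \<le> 2")
      case True
      have "\<bar>D k r\<bar> * japanese r ^ ?n \<le> B2 * 3 ^ ?n"
        using B2 True r j japanese_bounds(2)[OF r True] by (intro mult_mono power_mono) auto
      also have "\<dots> \<le> C" using B1 by (simp add: C_def distrib_right)
      finally show ?thesis .
    next
      case False
      then have r': "r \<in> {4/3..}" "r > 0" by auto
      have "japanese r ^ ?n \<le> (3 * r) ^ ?n" using False j by (intro power_mono japanese_bounds(3)) auto
      then have "\<bar>D k r\<bar> * japanese r ^ ?n \<le> \<bar>D k r\<bar> * (3 * r) ^ ?n" by (rule mult_left_mono) simp
      also have "\<dots> = \<bar>G (1 / r)\<bar> * 3 ^ ?n" unfolding G(2)[OF r'(1)] abs_divide power_mult_distrib using r'(2) by simp
      also have "\<dots> \<le> B1 * 3 ^ ?n" using r' by (intro mult_right_mono B1) (auto simp: field_simps)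
      also have "\<dots> \<le> C" using B2 by (simp add: C_def distrib_right)
      finally show ?thesis .
    qed
    then show ?thesis using j by (simp add: power_int_minus divide_inverse[symmetric] pos_le_divide_eq del: of_nat_add)
  qed
  moreover have "C > 0" using B1 B2 by (simp add: C_def)
  ultimately show ?thesis by blast
qed

lemma profile_symbol_bounds:
  assumes "profile d p f"
  shows "\<exists>C>0. \<forall>r\<ge>0. \<bar>nderiv_within {0..} k f r\<bar> \<le> C * japanese r powi (- int k)"
    and "k \<ge> 1 \<Longrightarrow> \<exists>C>0. \<forall>r\<ge>0.
      \<bar>nderiv_within {0..} k (\<lambda>x. f x + x * deriv_within {0..} f x) r\<bar> \<le> C * japanese r powi (- 1 - int k)"
proof -
  have f: "smooth_on {0..} f" using assms by (simp add: profile_def)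
  obtain F where F: "smooth_on {0..3/4} F" "\<And>r. r \<in> {4/3..} \<Longrightarrow> f r = F (1 / r)" using assms unfolding profile_def by auto
  obtain D where D: "D 0 = f" "\<And>j. PROP deriv_on {0..} (D j) (D (Suc j))"
    using smooth_on_chainE[OF f no_isolated_atLeast] by metis
  note no = no_isolated_atLeast[of "0::real"]
  have nd: "nderiv_within {0..} k f r = D k r" if "r \<ge> 0" for k r
    by (rule nderiv_within_chain[where D = D, OF no D(2)]) (use that D(1) in auto)
  show "\<exists>C>0. \<forall>r\<ge>0. \<bar>nderiv_within {0..} k f r\<bar> \<le> C * japanese r powi (- int k)"
    using symbol_decay[where D = D and i = 0 and k = k, OF D(2) F(1)] by (simp add: nd D(1) F(2))
  assume k: "k \<ge> 1"
  \<comment> \<open>The \<open>j\<close>-th derivative of \<open>f + x f'\<close> by Leibniz'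
    rule.\<close>
  define E where "E = (\<lambda>j x. (real j + 1) * D j x + x * D (Suc j) x)"
  have E: "(E j has_real_derivative E (Suc j) x) (at x within {0..})" if "x \<in> {0..}" for j x
  proof -
    have "(E j has_real_derivative (real j + 1) * D (Suc j) x + (1 * D (Suc j) x + D (Suc (Suc j)) x * x)) (at x within {0..})"
      unfolding E_def by (intro DERIV_add DERIV_cmult DERIV_mult DERIV_ident D(2)[OF that])
    then show ?thesis by (simp add: E_def algebra_simps)
  qed
  have nE: "nderiv_within {0..} k (\<lambda>x. f x + x * deriv_within {0..} f x) r = E k r" if "r \<ge> 0" for r
  proof (rule nderiv_within_chain[where D = E, OF no E])
    show "f x + x * deriv_within {0..} f x = E 0 x" if "x \<in> {0..}" for x
      using nd[of x 1] that D(1) by (simp add: E_def nderiv_within_def)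
  qed (use that in auto)
  text \<open>In the variable \<open>s = 1 / r\<close> the function \<open>f + r f'\<close> is \<open>F - s F'\<close>, hence smooth up to
    \<open>s = 0\<close>; its first derivative is of order \<open>-2\<close>.\<close>
  obtain G where G: "smooth_on {0..3/4} G"
    "\<And>r. r \<in> {4/3..} \<Longrightarrow> ((\<lambda>r. F (1 / r) / r ^ 0) has_real_derivative G (1 / r) / r ^ Suc 0) (at r within {4/3..})"
    by (fact inversion_power_deriv[OF F(1)])
  have D1: "D 1 r = G (1 / r) / r" if r: "r \<in> {4/3..}" for r
  proof (rule no_isolated_unique[OF no_isolated_atLeast r])
    show "(f has_real_derivative D 1 r) (at r within {4/3..})"
      by (rule DERIV_subset[of _ _ _ "{0..}"]) (use D(2)[of r 0] D(1) r in auto)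
    show "(f has_real_derivative G (1 / r) / r) (at r within {4/3..})"
      using has_field_derivative_transform_within[OF G(2)[OF r] zero_less_one r] F(2) by simp
  qed
  have FG: "smooth_on {0..3/4} (\<lambda>s. F s + G s)" by (rule smooth_on_add[OF F(1) G(1)])
  obtain F' where F': "PROP deriv_on {0..3/4} (\<lambda>s. F s + G s) F'" "smooth_on {0..3/4} F'"
    by (rule smooth_on_derivE[OF FG]) (use no_isolated_Icc[of 0 "3/4"] in \<open>auto simp: no_isolated_def\<close>)
  have E1: "E 1 r = - F' (1 / r) / r ^ 2" if r: "r \<in> {4/3..}" for r
  proof (rule no_isolated_unique[OF no_isolated_atLeast r])
    show "(E 0 has_real_derivative E 1 r) (at r within {4/3..})"
      by (rule DERIV_subset[of _ _ _ "{0..}"]) (use E[of r 0] r in auto)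
    have i: "((\<lambda>x. 1 / x) has_real_derivative - (1 / r\<^sup>2)) (at r within {4/3..})"
      using r by (auto intro!: derivative_eq_intros simp: power2_eq_square)
    have inv: "1 / r \<in> {0..3/4}" if "r \<in> {4/3..}" for r :: real using that by (auto simp: field_simps)
    have "((\<lambda>r. F (1 / r) + G (1 / r)) has_real_derivative F' (1 / r) * - (1 / r\<^sup>2)) (at r within {4/3..})"
      by (rule DERIV_compose_within[OF F'(1)[OF inv[OF r]] i]) (use inv in auto)
    from has_field_derivative_transform_within[OF this zero_less_one r, of "E 0"]
    show "(E 0 has_real_derivative - F' (1 / r) / r ^ 2) (at r within {4/3..})"
      using D1 F(2) D(1) by (simp add: E_def)
  qed
  \<comment> \<open>The chain starts at the first derivative, of order \<open>-2\<close>.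
    Differentiating \<open>k - 1\<close> further times gives order
    \<open>- 2 - (k - 1) = - 1 - k\<close>.\<close>
  have "\<exists>C>0. \<forall>r\<ge>0. \<bar>E (Suc (k - 1)) r\<bar> \<le> C * japanese r powi (- int (2 + (k - 1)))"
    by (rule symbol_decay[of "\<lambda>j. E (Suc j)" "\<lambda>s. - F' s"])
       (use E E1 smooth_on_mult[OF smooth_on_const[of _ "-1"] F'(2)] in auto)
  then show "\<exists>C>0. \<forall>r\<ge>0.
      \<bar>nderiv_within {0..} k (\<lambda>x. f x + x * deriv_within {0..} f x) r\<bar> \<le> C * japanese r powi (- 1 - int k)"
    using k by (simp add: nE of_nat_diff algebra_simps)
qed

lemma profile_limit:
  assumes "profile d p f"
  shows "\<exists>L. (f \<longlongrightarrow> L) at_top"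
proof -
  obtain F where F: "smooth_on {0..3/4} F" "\<And>r. r \<ge> 4/3 \<Longrightarrow> f r = F (1 / r)" using assms unfolding profile_def by auto
  have ev: "eventually (\<lambda>r. r \<ge> 4/3) (at_top :: real filter)" by (rule eventually_ge_at_top)
  have "((\<lambda>r::real. 1 / r) \<longlongrightarrow> 0) at_top" by real_asymp
  then have "((\<lambda>r. F (1 / r)) \<longlongrightarrow> F 0) at_top"
  proof (rule continuous_on_tendsto_compose[OF smooth_on_imp_continuous[OF F(1)]])
    show "eventually (\<lambda>r. 1 / r \<in> {0..3/4}) (at_top :: real filter)"
      using ev by eventually_elim (auto simp: field_simps)
  qed simp
  then have "(f \<longlongrightarrow> F 0) at_top"
    by (rule Lim_transform_eventually) (use ev in eventually_elim, simp add: F(2))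
  then show ?thesis by blast
qed

lemma profile_bounded:
  assumes "profile d p f"
  obtains C where "C > 0" "\<And>r. r \<ge> 0 \<Longrightarrow> \<bar>f r\<bar> \<le> C"
  using profile_symbol_bounds(1)[OF assms, of 0] by (auto simp: nderiv_within_def)

section \<open>Self-similar solutions: smoothness, boundedness, wave equation, blow-up\<close>

lemma Linf_norm_le:
  assumes "f \<in> borel_measurable (lebesgue_on S)" "\<And>x. x \<in> S \<Longrightarrow> \<bar>f x\<bar> \<le> C"
  shows "Linf_norm S f \<le> ennreal C"
proof -
  have "esssup (lebesgue_on S) (\<lambda>x. ennreal \<bar>f x\<bar>) \<le> ennreal C"
  proof (rule esssup_I)
    show "(\<lambda>x. ennreal \<bar>f x\<bar>) \<in> borel_measurable (lebesgue_on S)" using assms(1) by measurable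
    show "AE x in lebesgue_on S. ennreal \<bar>f x\<bar> \<le> ennreal C"
      by (rule AE_I2) (auto simp: assms(2) ennreal_leI)
  qed
  then show ?thesis using assms(1) by (simp add: Linf_norm_def)
qed

text \<open>Functions \<open>g (r / (T - t)) / (T - t) ^ i\<close> are closed under both partial
  derivatives: each raises \<open>i\<close> by one, and \<open>g\<close> becomes
  \<open>\<rho> g' + i g\<close> for time and \<open>g'\<close> for space. The power is included to
  make the induction close.\<close>

lemma smooth_on_self_similar_family:
  assumes g: "smooth_on {0..} g"
  shows "Ck_on k ({0..<T} \<times> {0..}) (\<lambda>(t, r). g (r / (T - t)) / (T - t) ^ i)"
  using g
proof (induction k arbitrary: g i)
  case 0
  show ?case
    unfolding Ck_on.simps(1) case_prod_unfold
    by (intro continuous_intros continuous_on_compose2[OF smooth_on_imp_continuous[OF 0]]) auto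
next
  case (Suc k)
  let ?S = "{0..<T} \<times> {0::real..}"
  obtain g' where g': "PROP deriv_on {0..} g g'" "smooth_on {0..} g'"
    by (rule smooth_on_derivE[OF Suc.prems at_within_atLeast_ne_bot]; (assumption | rule that; assumption))
  define gt where "gt = (\<lambda>rr. rr * g' rr + real i * g rr)"
  have gt: "smooth_on {0..} gt" unfolding gt_def
    by (intro smooth_on_add smooth_on_mult smooth_on_ident smooth_on_const g' Suc.prems)
  define D where "D = (\<lambda>b :: real \<times> real. if b = (1, 0) then (\<lambda>(t, r). gt (r / (T - t)) / (T - t) ^ Suc i)
     else (\<lambda>(t, r). g' (r / (T - t)) / (T - t) ^ Suc i))"
  have Basis: "(Basis :: (real \<times> real) set) = {(1, 0), (0, 1)}" by (auto simp: Basis_prod_def)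
  show ?case
    unfolding Ck_on.simps(2)
  proof (intro exI[of _ D] conjI ballI)
    fix b :: "real \<times> real" assume "b \<in> Basis"
    show "Ck_on k ?S (D b)" using Suc.IH[OF gt, of "Suc i"] Suc.IH[OF g'(2), of "Suc i"] by (simp add: D_def)
  next
    fix x assume x: "x \<in> ?S"
    define t r where "t = fst x" and "r = snd x"
    have tr: "T - t > 0" "r \<ge> 0" using x by (auto simp: t_def r_def)
    have i1: "((\<lambda>t. 1 / (T - t)) has_real_derivative 1 / (T - t)\<^sup>2) (at (fst x))"
      using tr unfolding t_def by (auto intro!: derivative_eq_intros simp: power2_eq_square)
    from DERIV_compose_FDERIV[OF i1 has_derivative_fst[OF has_derivative_ident], of ?S]
    have inv: "((\<lambda>x. 1 / (T - fst x)) has_derivative (\<lambda>h. fst h * (1 / (T - t)\<^sup>2))) (at x within ?S)" .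
    have q: "((\<lambda>x. snd x / (T - fst x)) has_derivative (\<lambda>h. r * (fst h * (1 / (T - t)\<^sup>2)) + snd h * (1 / (T - t)))) (at x within ?S)"
      using has_derivative_mult[OF has_derivative_snd[OF has_derivative_ident] inv] by (simp add: r_def t_def)
    have "(g has_derivative (*) (g' (r / (T - t)))) (at (snd x / (T - fst x)) within {0..})"
      using g'(1)[of "r / (T - t)"] tr unfolding has_field_derivative_def by (simp add: t_def r_def)
    then have "(g has_derivative (*) (g' (r / (T - t)))) (at (snd x / (T - fst x)) within (\<lambda>x. snd x / (T - fst x)) ` ?S)"
      by (rule has_derivative_subset) auto
    from has_derivative_in_compose[OF q this]
    have gq: "((\<lambda>x. g (snd x / (T - fst x))) has_derivative
       (\<lambda>h. g' (r / (T - t)) * (r * (fst h * (1 / (T - t)\<^sup>2)) + snd h * (1 / (T - t))))) (at x within ?S)" .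
    have "((\<lambda>t. 1 / (T - t) ^ i) has_real_derivative real i / (T - t) ^ Suc i) (at (fst x))"
    proof -
      have "((\<lambda>t. (1 / (T - t)) ^ i) has_real_derivative real i * (1 / (T - t)\<^sup>2 * (1 / (T - t)) ^ (i - Suc 0))) (at (fst x))"
        using DERIV_power[OF i1, of i] by (simp only: t_def)
      moreover have "real i * (1 / (T - t)\<^sup>2 * (1 / (T - t)) ^ (i - Suc 0)) = real i / (T - t) ^ Suc i"
        by (cases i) (auto simp: power2_eq_square power_one_over field_simps)
      ultimately have "((\<lambda>t. (1 / (T - t)) ^ i) has_real_derivative real i / (T - t) ^ Suc i) (at (fst x))"
        by (rule DERIV_cong)
      then show ?thesis by (simp only: power_one_over)
    qed
    from DERIV_compose_FDERIV[OF this has_derivative_fst[OF has_derivative_ident], of ?S]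
    have pw: "((\<lambda>x. 1 / (T - fst x) ^ i) has_derivative (\<lambda>h. fst h * (real i / (T - t) ^ Suc i))) (at x within ?S)" .
    have "((\<lambda>x. g (snd x / (T - fst x)) * (1 / (T - fst x) ^ i)) has_derivative
       (\<lambda>h. g (r / (T - t)) * (fst h * (real i / (T - t) ^ Suc i)) +
         g' (r / (T - t)) * (r * (fst h * (1 / (T - t)\<^sup>2)) + snd h * (1 / (T - t))) * (1 / (T - t) ^ i))) (at x within ?S)"
      using has_derivative_mult[OF gq pw] by (simp add: t_def r_def)
    moreover have "g (r / (T - t)) * (fst h * (real i / (T - t) ^ Suc i)) +
         g' (r / (T - t)) * (r * (fst h * (1 / (T - t)\<^sup>2)) + snd h * (1 / (T - t))) * (1 / (T - t) ^ i)
       = (\<Sum>b\<in>Basis. (h \<bullet> b) * D b x)" for h :: "real \<times> real"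
    proof -
      obtain h1 h2 where h: "h = (h1, h2)" by fastforce
      have "(\<Sum>b\<in>Basis. (h \<bullet> b) * D b x) = h1 * (gt (r / (T - t)) / (T - t) ^ Suc i) + h2 * (g' (r / (T - t)) / (T - t) ^ Suc i)"
        unfolding Basis h by (simp add: D_def case_prod_unfold t_def r_def)
      also have "\<dots> = g (r / (T - t)) * (h1 * (real i / (T - t) ^ Suc i)) +
         g' (r / (T - t)) * (r * (h1 * (1 / (T - t)\<^sup>2)) + h2 * (1 / (T - t))) * (1 / (T - t) ^ i)"
      proof -
        have "h1 * ((r / ta * b + real i * a) / ta ^ Suc i) + h2 * (b / ta ^ Suc i)
          = a * (h1 * (real i / ta ^ Suc i)) + b * (r * (h1 * (1 / ta\<^sup>2)) + h2 * (1 / ta)) * (1 / ta ^ i)"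
          if "ta > 0" for ta a b :: real
          using that by (simp add: field_simps power2_eq_square)
        then show ?thesis unfolding gt_def using tr(1) by blast
      qed
      finally show ?thesis by (simp add: h)
    qed
    ultimately show "((\<lambda>(t, r). g (r / (T - t)) / (T - t) ^ i) has_derivative (\<lambda>h. \<Sum>b\<in>Basis. (h \<bullet> b) * D b x)) (at x within ?S)"
      by (simp add: case_prod_unfold)
  qed
qed

lemma self_similar_smooth:
  assumes "profile d p f"
  shows "smooth_on ({0..<T} \<times> {0..}) (\<lambda>(t, r). self_similar T f t r)"
  unfolding smooth_on_def
proof
  fix k
  have "smooth_on {0..} f" using assms by (simp add: profile_def)
  from smooth_on_self_similar_family[OF this, of k T 0]
  show "Ck_on k ({0..<T} \<times> {0..}) (\<lambda>(t, r). self_similar T f t r)" by (simp add: self_similar_def)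
qed

text \<open>The closed time interval contains the blow-up time, where \<open>r / (T - t)\<close> is
  \<open>0\<close> by the convention on division; the value there is \<open>f 0\<close>, so the
  bound on \<open>f\<close> still applies.\<close>

lemma self_similar_Linf:
  assumes "profile d p f"
  shows "Linf_on ({0..T} \<times> {0..}) (\<lambda>(t, r). self_similar T f t r)"
proof -
  have c: "continuous_on {0..} f" using assms by (intro smooth_on_imp_continuous) (simp add: profile_def)
  let ?S = "{0..T} \<times> {0::real..}"
  obtain C where C: "C > 0" "\<And>rr. rr \<ge> 0 \<Longrightarrow> \<bar>f rr\<bar> \<le> C" by (fact profile_bounded[OF assms])
  \<comment> \<open>Extending \<open>f\<close> constantly to the negative axis makes it continuous
    on the line. The quotient \<open>r / (T - t)\<close> is Borel measurable although discontinuous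
    at \<open>t = T\<close>, so the composition is measurable.\<close>
  define g where "g = (\<lambda>x. f (max 0 x))"
  have "continuous_on UNIV g" unfolding g_def
    by (rule continuous_on_compose2[OF c]) (auto intro!: continuous_intros)
  then have g: "g \<in> borel_measurable borel" by (rule borel_measurable_continuous_onI)
  have "(\<lambda>x :: real \<times> real. snd x / (T - fst x)) \<in> borel_measurable borel"
    by (simp add: borel_prod[symmetric])
  from measurable_compose[OF this g]
  have "(\<lambda>x :: real \<times> real. g (snd x / (T - fst x))) \<in> borel_measurable borel" .
  then have "(\<lambda>x :: real \<times> real. g (snd x / (T - fst x))) \<in> borel_measurable lebesgue"
    by (intro measurable_completion) simp
  then have mg: "(\<lambda>x. g (snd x / (T - fst x))) \<in> borel_measurable (lebesgue_on ?S)"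
    by (rule measurable_restrict_space1)
  have eq: "g (snd x / (T - fst x)) = (case x of (t, r) \<Rightarrow> self_similar T f t r)" if "x \<in> space (lebesgue_on ?S)" for x
    using that by (auto simp: g_def self_similar_def max_def intro!: arg_cong[of _ _ f])
  have m: "(\<lambda>(t, r). self_similar T f t r) \<in> borel_measurable (lebesgue_on ?S)"
    by (rule measurable_cong[THEN iffD1, OF eq mg])
  have "Linf_norm ?S (\<lambda>(t, r). self_similar T f t r) \<le> ennreal C"
    by (rule Linf_norm_le[OF m]) (auto simp: self_similar_def intro!: C(2))
  then show ?thesis unfolding Linf_on_def using le_less_trans[OF _ ennreal_less_top] by (simp add: infinity_ennreal_def)
qed

lemma Linf_on_bounded_continuous:
  fixes f :: "real \<Rightarrow> real"
  assumes "continuous_on {0..} f" "\<And>r. r \<ge> 0 \<Longrightarrow> \<bar>f r\<bar> \<le> C"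
  shows "Linf_on {0..} f"
proof -
  have "f \<in> borel_measurable (lebesgue_on {0..})" by (rule continuous_imp_measurable_on_sets_lebesgue[OF assms(1)]) simp
  then have "Linf_norm {0..} f \<le> ennreal C" by (rule Linf_norm_le) (use assms(2) in auto)
  then show ?thesis unfolding Linf_on_def using le_less_trans[OF _ ennreal_less_top] by (simp add: infinity_ennreal_def)
qed

lemma no_isolated_Ico: "no_isolated {a..<b::real}"
  unfolding no_isolated_def
proof
  fix x assume x: "x \<in> {a..<b}"
  have "at x within {x..(x + b) / 2} \<noteq> bot" by (rule at_within_Icc_ne_bot) (use x in auto)
  moreover have "at x within {x..(x + b) / 2} \<le> at x within {a..<b}" by (rule at_le) (use x in auto)
  ultimately show "at x within {a..<b} \<noteq> bot" using bot_unique by fastforce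
qed

lemma self_similar_wave_map:
  assumes f: "profile d (\<lambda>u. w u * deriv w u) f"
  shows "wave_map_solution d w T (self_similar T f)"
proof -
  obtain f1 f2 where f1: "\<And>rr. rr > 0 \<Longrightarrow> (f has_real_derivative f1 rr) (at rr)"
    and f2: "\<And>rr. rr > 0 \<Longrightarrow> (f1 has_real_derivative f2 rr) (at rr)"
    and eq: "\<And>rr. rr > 0 \<Longrightarrow> profile_eq d (\<lambda>u. w u * deriv w u) rr (f rr) (f1 rr) (f2 rr)"
    using f unfolding profile_def by auto
  define u where "u = self_similar T f"
  have u: "u t r = f (r / (T - t))" for t r by (simp add: u_def self_similar_def)
  have qt: "((\<lambda>t. r / (T - t)) has_real_derivative r / (T - t)\<^sup>2) (at t)" if "t < T" for t r
    using that by (auto intro!: derivative_eq_intros simp: power2_eq_square)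
  have pos: "r / (T - t) > 0" if "t < T" "r > 0" for t r using that by simp
  have dtu: "dt T u t r = f1 (r / (T - t)) * (r / (T - t)\<^sup>2)" if "t \<in> {0..<T}" "r > 0" for t r
    unfolding dt_def u
  proof (rule deriv_within_eq)
    show "((\<lambda>s. f (r / (T - s))) has_real_derivative f1 (r / (T - t)) * (r / (T - t)\<^sup>2)) (at t within {0..<T})"
      by (rule has_field_derivative_at_within, rule DERIV_chain2[OF f1 qt]) (use that in auto)
  qed (use no_isolated_Ico that in \<open>auto simp: no_isolated_def\<close>)
  have dttu: "dt T (dt T u) t r = f2 (r / (T - t)) * (r / (T - t)\<^sup>2) * (r / (T - t)\<^sup>2) + 2 * r / (T - t) ^ 3 * f1 (r / (T - t))"
    if t: "t \<in> {0..<T}" and r: "r > 0" for t r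
    unfolding dt_def[of _ "dt T u"]
  proof (rule deriv_within_eq)
    have q2: "((\<lambda>t. r / (T - t)\<^sup>2) has_real_derivative 2 * r / (T - t) ^ 3) (at t)"
      using t by (auto intro!: derivative_eq_intros simp: power2_eq_square power3_eq_cube divide_simps) (simp add: algebra_simps)
    have "((\<lambda>s. f1 (r / (T - s)) * (r / (T - s)\<^sup>2)) has_real_derivative
       f2 (r / (T - t)) * (r / (T - t)\<^sup>2) * (r / (T - t)\<^sup>2) + 2 * r / (T - t) ^ 3 * f1 (r / (T - t))) (at t)"
      by (rule DERIV_mult[OF DERIV_chain2[OF f2 qt] q2]) (use t r in auto)
    from has_field_derivative_transform_within[OF has_field_derivative_at_within[OF this] zero_less_one t]
    show "((\<lambda>s. dt T u s r) has_real_derivative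
       f2 (r / (T - t)) * (r / (T - t)\<^sup>2) * (r / (T - t)\<^sup>2) + 2 * r / (T - t) ^ 3 * f1 (r / (T - t))) (at t within {0..<T})"
      by (simp add: dtu r)
  qed (use no_isolated_Ico t in \<open>auto simp: no_isolated_def\<close>)
  have qr: "((\<lambda>r. r / (T - t)) has_real_derivative 1 / (T - t)) (at r)" if "t < T" for t r
    using that by (auto intro!: derivative_eq_intros)
  have dru: "dr u t r = f1 (r / (T - t)) * (1 / (T - t))" if "t < T" "r > 0" for t r
    unfolding dr_def
  proof (rule deriv_within_eq)
    show "(u t has_real_derivative f1 (r / (T - t)) * (1 / (T - t))) (at r within {0..})"
      unfolding u[abs_def] by (rule has_field_derivative_at_within, rule DERIV_chain2[OF f1[OF pos[OF that]] qr[OF that(1)]])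
  qed (use no_isolated_atLeast[of 0] that in \<open>auto simp: no_isolated_def\<close>)
  have drru: "dr (dr u) t r = f2 (r / (T - t)) * (1 / (T - t)) * (1 / (T - t))" if t: "t < T" and r: "r > 0" for t r
    unfolding dr_def[of "dr u"]
  proof (rule deriv_within_eq)
    have "((\<lambda>r. f1 (r / (T - t)) * (1 / (T - t))) has_real_derivative f2 (r / (T - t)) * (1 / (T - t)) * (1 / (T - t))) (at r)"
      by (rule DERIV_cmult_right[OF DERIV_chain2[OF f2[OF pos[OF t r]] qr[OF t]]])
    then have "(dr u t has_real_derivative f2 (r / (T - t)) * (1 / (T - t)) * (1 / (T - t))) (at r)"
      by (rule has_field_derivative_transform_within_open[OF _ open_greaterThan[of 0]]) (use t r in \<open>auto simp: dru\<close>)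
    then show "(dr u t has_real_derivative f2 (r / (T - t)) * (1 / (T - t)) * (1 / (T - t))) (at r within {0..})"
      by (rule has_field_derivative_at_within)
  qed (use no_isolated_atLeast[of 0] r in \<open>auto simp: no_isolated_def\<close>)
  show ?thesis
    unfolding wave_map_solution_def u_def[symmetric]
  proof (intro conjI ballI allI impI)
    show "u t 0 = 0" for t using f by (simp add: u profile_def)
    fix t r :: real assume t: "t \<in> {0..<T}" and r: "r > 0"
    define ta where "ta = T - t"
    define rr where "rr = r / ta"
    have ta: "ta > 0" and rr: "rr > 0" and r': "r = rr * ta" and t': "t < T" using t r by (auto simp: ta_def rr_def)
    let ?p = "w (f rr) * deriv w (f rr)"
    have E: "(real d - 1) * ?p = rr\<^sup>2 * (1 - rr\<^sup>2) * f2 rr + (real d - 1 - 2 * rr\<^sup>2) * rr * f1 rr"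
      using eq[OF rr] by (simp add: profile_eq_def)
    have "(real d - 1) / r\<^sup>2 * ?p = (rr\<^sup>2 * (1 - rr\<^sup>2) * f2 rr + (real d - 1 - 2 * rr\<^sup>2) * rr * f1 rr) / r\<^sup>2"
      unfolding E[symmetric] by simp
    \<comment> \<open>Multiplied by \<open>r\<^sup>2\<close>, the wave operator applied to
      \<open>f (r / ta)\<close> is the negative of the left side of the profile equation at
      \<open>rr\<close>.\<close>
    moreover have "B * (r / ta\<^sup>2) * (r / ta\<^sup>2) + 2 * r / ta ^ 3 * A - B * (1 / ta) * (1 / ta)
        - (z - 1) / r * (A * (1 / ta)) + (rr\<^sup>2 * (1 - rr\<^sup>2) * B + (z - 1 - 2 * rr\<^sup>2) * rr * A) / r\<^sup>2 = 0" for A B z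
      unfolding r' using ta rr by (simp add: field_simps power2_eq_square power3_eq_cube)
    ultimately have "f2 rr * (r / ta\<^sup>2) * (r / ta\<^sup>2) + 2 * r / ta ^ 3 * f1 rr - f2 rr * (1 / ta) * (1 / ta)
        - (real d - 1) / r * (f1 rr * (1 / ta)) + (real d - 1) / r\<^sup>2 * ?p = 0"
      by (simp only:)
    then show "dt T (dt T u) t r - dr (dr u) t r - (real d - 1) / r * dr u t r + (real d - 1) / r\<^sup>2 * (w (u t r) * deriv w (u t r)) = 0"
      unfolding dttu[OF t r] drru[OF t' r] dru[OF t' r] u ta_def[symmetric] rr_def[symmetric] by simp
  qed
qed

lemma self_similar_blowup:
  assumes f: "profile d p f"
  shows "filterlim (\<lambda>t. \<bar>dr (self_similar T f) t 0\<bar>) at_top (at_left T)"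
proof -
  obtain c where c: "c \<noteq> 0" "(f has_real_derivative c) (at 0 within {0..})" using f unfolding profile_def by auto
  have dr: "dr (self_similar T f) t 0 = c / (T - t)" if "t < T" for t
    unfolding dr_def
  proof (rule deriv_within_eq)
    have "((\<lambda>r. r / (T - t)) has_real_derivative 1 / (T - t)) (at 0 within {0..})"
      using that by (auto intro!: derivative_eq_intros)
    moreover have "(\<lambda>r. r / (T - t)) ` {0..} \<subseteq> {0..}" using that by (auto intro!: divide_nonneg_pos)
    ultimately have "((\<lambda>r. f (r / (T - t))) has_real_derivative c * (1 / (T - t))) (at 0 within {0..})"
      by (intro DERIV_compose_within[of f c _ _ "{0..}"]) (use c(2) in auto)
    then show "(self_similar T f t has_real_derivative c / (T - t)) (at 0 within {0..})"
      by (simp add: self_similar_def[abs_def])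
  qed (use no_isolated_atLeast[of 0] in \<open>auto simp: no_isolated_def\<close>)
  have lim: "filterlim (\<lambda>t. T - t) (at_right 0) (at_left T)"
    unfolding filterlim_at by (auto intro!: tendsto_eq_intros eventually_at_leftI[of "T - 1"])
  have "filterlim (\<lambda>t. \<bar>c\<bar> * inverse (T - t)) at_top (at_left T)"
    by (rule filterlim_tendsto_pos_mult_at_top[OF tendsto_const _ filterlim_compose[OF filterlim_inverse_at_top_right lim]])
       (use c in simp)
  then show ?thesis
  proof (rule filterlim_mono_eventually[OF _ order_refl order_refl])
    show "eventually (\<lambda>t. \<bar>c\<bar> * inverse (T - t) = \<bar>dr (self_similar T f) t 0\<bar>) (at_left T)"
      by (intro eventually_at_leftI[of "T - 1"]) (auto simp: dr abs_mult divide_inverse)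
  qed
qed

section \<open>Classical derivatives as weak derivatives on the open half-line\<close>

lemma LINT_compact_support:
  fixes h :: "real \<Rightarrow> real"
  assumes ab: "0 < a" and h: "continuous_on {a..b} h" "\<And>x. x > 0 \<Longrightarrow> x \<notin> {a..b} \<Longrightarrow> h x = 0"
  shows "(LINT x|lebesgue_on {0<..}. h x) = integral {a..b} h"
proof -
  have "(LINT x|lebesgue_on {0<..}. h x) = (LINT x|lebesgue. indicator {0<..} x *\<^sub>R h x)"
    by (rule integral_restrict_space) simp
  also have "(\<lambda>x. indicator {0<..} x *\<^sub>R h x) = (\<lambda>x. indicator {a..b} x *\<^sub>R h x)"
    using ab h(2) by (auto simp: fun_eq_iff indicator_def)
  also have "(LINT x|lebesgue. indicator {a..b} x *\<^sub>R h x) = (LINT x|lebesgue_on {a..b}. h x)"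
    by (rule integral_restrict_space[symmetric]) simp
  also have "\<dots> = integral {a..b} h"
    by (rule lebesgue_integral_eq_integral[OF continuous_imp_integrable_real[OF h(1)]]) simp
  finally show ?thesis .
qed

lemma integration_by_parts_half_line:
  fixes u v u' v' :: "real \<Rightarrow> real"
  assumes ab: "0 < a" "a < b" and u: "\<And>x. x > 0 \<Longrightarrow> (u has_real_derivative u' x) (at x)" "continuous_on {0<..} u'"
    and v: "\<And>x. x > 0 \<Longrightarrow> (v has_real_derivative v' x) (at x)" "continuous_on {0<..} v'"
    and supp: "\<And>x. x > 0 \<Longrightarrow> x \<notin> {a<..<b} \<Longrightarrow> v x = 0 \<and> v' x = 0"
  shows "(LINT x|lebesgue_on {0<..}. u x * v' x) = - (LINT x|lebesgue_on {0<..}. u' x * v x)"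
proof -
  have sub: "{a..b} \<subseteq> {0<..}" using ab by auto
  have c: "continuous_on {0<..} u" "continuous_on {0<..} v"
    using u(1) v(1) by (auto intro!: continuous_at_imp_continuous_on DERIV_isCont)
  have ci: "continuous_on {a..b} (\<lambda>x. u x * v' x)" "continuous_on {a..b} (\<lambda>x. u' x * v x)"
    by (rule continuous_on_subset[OF _ sub], intro continuous_on_mult c u(2) v(2))+
  have z: "v a = 0" "v b = 0" using supp[of a] supp[of b] ab by auto
  have "((\<lambda>x. u' x * v x + v' x * u x) has_integral (u b * v b - u a * v a)) {a..b}"
  proof (rule fundamental_theorem_of_calculus)
    fix x assume "x \<in> {a..b}"
    then have "x > 0" using ab by auto
    from DERIV_mult[OF u(1)[OF this] v(1)[OF this]]
    show "((\<lambda>x. u x * v x) has_vector_derivative u' x * v x + v' x * u x) (at x within {a..b})"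
      unfolding has_real_derivative_iff_has_vector_derivative by (rule has_vector_derivative_at_within)
  qed (use ab in simp)
  then have "integral {a..b} (\<lambda>x. u' x * v x + u x * v' x) = 0"
    using z by (simp add: integral_unique mult.commute)
  then have "integral {a..b} (\<lambda>x. u' x * v x) + integral {a..b} (\<lambda>x. u x * v' x) = 0"
    using integral_add[OF integrable_continuous_real[OF ci(2)] integrable_continuous_real[OF ci(1)]] by simp
  moreover have "(LINT x|lebesgue_on {0<..}. u x * v' x) = integral {a..b} (\<lambda>x. u x * v' x)"
    "(LINT x|lebesgue_on {0<..}. u' x * v x) = integral {a..b} (\<lambda>x. u' x * v x)"
    by (rule LINT_compact_support[OF ab(1) ci(1)], use supp in force) (rule LINT_compact_support[OF ab(1) ci(2)], use supp in force)
  ultimately show ?thesis by linarith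
qed

lemma continuous_locally_integrable:
  assumes "continuous_on {0<..} (f :: real \<Rightarrow> real)"
  shows "locally_integrable_on {0<..} f"
  unfolding locally_integrable_on_def
proof (intro allI impI)
  fix K :: "real set" assume K: "compact K \<and> K \<subseteq> {0<..}"
  show "f absolutely_integrable_on K"
  proof (cases "K = {}")
    case False
    obtain a where a: "a \<in> K" "\<And>x. x \<in> K \<Longrightarrow> a \<le> x" using compact_attains_inf[of K] K False by auto
    obtain b where b: "b \<in> K" "\<And>x. x \<in> K \<Longrightarrow> x \<le> b" using compact_attains_sup[of K] K False by auto
    have "a > 0" using a K by auto
    have "f absolutely_integrable_on {a..b}"
      by (rule absolutely_integrable_continuous_real[OF continuous_on_subset[OF assms]]) (use \<open>a > 0\<close> in auto)
    then show ?thesis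
      by (rule set_integrable_subset) (use K a b in \<open>auto intro!: lmeasurable_compact fmeasurableD\<close>)
  qed simp
qed

text \<open>Test functions have compact support in the open half-line, hence away from
  \<open>0\<close>, so integration by parts leaves no boundary terms whatever happens at the centre.
  The orders \<open>0\<close>, \<open>1\<close> and \<open>2\<close> contribute \<open>K\<close>
  each.\<close>

lemma Wk_inf_norm_classical:
  fixes E E1 E2 :: "real \<Rightarrow> real"
  assumes E: "\<And>x. x > 0 \<Longrightarrow> (E has_real_derivative E1 x) (at x)"
    and E1: "\<And>x. x > 0 \<Longrightarrow> (E1 has_real_derivative E2 x) (at x)"
    and E2: "continuous_on {0<..} E2"
    and K: "K \<ge> 0" "\<And>x. x > 0 \<Longrightarrow> \<bar>E x\<bar> \<le> K \<and> \<bar>E1 x\<bar> \<le> K \<and> \<bar>E2 x\<bar> \<le> K"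
  shows "Wk_inf_norm 2 {0<..} E \<le> ennreal (3 * K)"
proof -
  have c: "continuous_on {0<..} E" "continuous_on {0<..} E1"
    using E E1 by (auto intro!: continuous_at_imp_continuous_on DERIV_isCont)
  define D where "D = (\<lambda>i::nat. if i = 0 then E else if i = 1 then E1 else E2)"
  have cD: "continuous_on {0<..} (D i)" for i using c E2 by (simp add: D_def)
  have weak: "weak_deriv {0<..} i E (D i)" if "i \<le> 2" for i
    unfolding weak_deriv_def
  proof (intro conjI allI impI continuous_locally_integrable c(1) cD)
    fix p assume p: "test_function {0<..} p"
    let ?C = "closure {x. p x \<noteq> 0}"
    have sm: "smooth_on UNIV p" and C: "compact ?C" "?C \<subseteq> {0<..}" using p by (auto simp: test_function_def)
    obtain P where P: "P 0 = p" "\<And>j. PROP deriv_on UNIV (P j) (P (Suc j))"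
      using smooth_on_chainE[OF sm no_isolated_UNIV] by metis
    have P': "(P j has_real_derivative P (Suc j) x) (at x)" for j x using P(2)[of x j] by simp
    have d: "(deriv ^^ j) p = P j" for j
      by (induction j) (auto simp: P(1) DERIV_imp_deriv[OF P'])
    have Pz: "P j x = 0" if "x \<notin> ?C" for j x
      using that
    proof (induction j arbitrary: x)
      case 0
      then show ?case using closure_subset[of "{x. p x \<noteq> 0}"] by (auto simp: P(1))
    next
      case (Suc j)
      have "(P j has_real_derivative 0) (at x)"
        by (rule has_field_derivative_transform_within_open[OF DERIV_const[of 0], of "- ?C"]) (use Suc in auto)
      then show ?case using DERIV_unique P' by blast
    qed
    have cP: "continuous_on {0<..} (P j)" for j using P' by (auto intro!: continuous_at_imp_continuous_on DERIV_isCont)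
    obtain a b where ab: "0 < a" "a < b" "?C \<subseteq> {a<..<b}"
    proof (cases "?C = {}")
      case False
      obtain a where a: "a \<in> ?C" "\<And>x. x \<in> ?C \<Longrightarrow> a \<le> x" using compact_attains_inf[OF C(1) False] by auto
      obtain b where b: "b \<in> ?C" "\<And>x. x \<in> ?C \<Longrightarrow> x \<le> b" using compact_attains_sup[OF C(1) False] by auto
      have "a > 0" using a C by auto
      show ?thesis
        by (rule that[of "a / 2" "b + 1"]) (use \<open>a > 0\<close> a b in force)+
    qed (use that[of 1 2] in auto)
    have supp: "P j x = 0 \<and> P (Suc j) x = 0" if "x \<notin> {a<..<b}" for j x using Pz ab(3) that by blast
    note ibp = integration_by_parts_half_line[OF ab(1,2) _ _ P' cP]
    have 1: "(LINT x|lebesgue_on {0<..}. E x * P (Suc j) x) = - (LINT x|lebesgue_on {0<..}. E1 x * P j x)" for j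
      by (rule ibp[OF E c(2)]) (use supp in auto)
    have 2: "(LINT x|lebesgue_on {0<..}. E1 x * P (Suc j) x) = - (LINT x|lebesgue_on {0<..}. E2 x * P j x)" for j
      by (rule ibp[OF E1 E2]) (use supp in auto)
    consider "i = 0" | "i = 1" | "i = 2" using \<open>i \<le> 2\<close> by linarith
    then show "(LINT x|lebesgue_on {0<..}. E x * (deriv ^^ i) p x) = (- 1) ^ i * (LINT x|lebesgue_on {0<..}. D i x * p x)"
    proof cases
      case 2
      then show ?thesis using 1[of 0] d[of 1] by (simp add: D_def P(1))
    next
      case 3
      then show ?thesis using 1[of 1] \<open>\<And>j. _ = - (LINT x|lebesgue_on {0<..}. E2 x * P j x)\<close>[of 0] d[of 2]
        by (simp add: D_def P(1) numeral_2_eq_2)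
    qed (simp add: D_def)
  qed
  have n: "Linf_norm {0<..} (D i) \<le> ennreal K" for i
    by (rule Linf_norm_le[OF continuous_imp_measurable_on_sets_lebesgue[OF cD]]) (use K(2) in \<open>auto simp: D_def\<close>)
  have "Wk_inf_norm 2 {0<..} E \<le> (\<Sum>i\<le>2. Linf_norm {0<..} (D i))"
    unfolding Wk_inf_norm_def by (rule INF_lower) (use weak in auto)
  also have "\<dots> \<le> (\<Sum>i\<le>(2::nat). ennreal K)" by (rule sum_mono) (rule n)
  also have "\<dots> = ennreal (3 * K)" using K(1) by (simp add: ennreal_mult)
  finally show ?thesis .
qed

lemma Wk_inf_norm_smooth:
  fixes E E1 E2 :: "real \<Rightarrow> real"
  assumes sm: "smooth_on {0<..} E"
    and E: "\<And>x. x > 0 \<Longrightarrow> (E has_real_derivative E1 x) (at x)" "\<And>x. x > 0 \<Longrightarrow> (E1 has_real_derivative E2 x) (at x)"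
    and K: "K \<ge> 0" "\<And>x. x > 0 \<Longrightarrow> \<bar>E x\<bar> \<le> K \<and> \<bar>E1 x\<bar> \<le> K \<and> \<bar>E2 x\<bar> \<le> K"
  shows "Wk_inf_norm 2 {0<..} E \<le> ennreal (3 * K)"
proof (rule Wk_inf_norm_classical[OF E _ K])
  note no = no_isolated_open[OF open_greaterThan[of "0::real"]]
  obtain D where D: "D 0 = E" "\<And>j. PROP deriv_on {0<..} (D j) (D (Suc j))"
    using smooth_on_chainE[OF sm no] by metis
  have at: "at x within {0<..} = at x" if "x \<in> {0<..}" for x :: real by (rule at_within_open[OF that open_greaterThan])
  have "E2 x = D 2 x" if x: "x \<in> {0<..}" for x
    by (rule second_derivs_unique(2)[OF no _ _ _ _ _ x, of E "D 0" E1 E2 "D 1" "D 2"])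
       (use E D D(2)[of _ 1] in \<open>auto simp: at numeral_2_eq_2\<close>)
  moreover have "continuous_on {0<..} (D 2)" using D(2)[of _ 2] by (intro DERIV_continuous_on) auto
  ultimately show "continuous_on {0<..} E2" using continuous_on_eq by metis
qed

section \<open>The warped target\<close>

lemma periodic_reduce:
  fixes g :: "real \<Rightarrow> real"
  assumes "\<And>u. g (u + 2 * pi) = g u"
  obtains v where "v \<in> {0..2 * pi}" "g v = g u"
proof -
  have n: "g (u + 2 * pi * real n) = g u" for u n
  proof (induction n)
    case (Suc n)
    have "u + 2 * pi * real (Suc n) = (u + 2 * pi * real n) + 2 * pi" by (simp add: algebra_simps)
    then show ?case using assms[of "u + 2 * pi * real n"] Suc by (simp only:)
  qed simp
  define k where "k = \<lfloor>u / (2 * pi)\<rfloor>"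
  define v where "v = u - 2 * pi * of_int k"
  have "of_int k \<le> u / (2 * pi)" "u / (2 * pi) \<le> of_int k + 1" unfolding k_def by linarith+
  then have v: "v \<in> {0..2 * pi}" by (auto simp: v_def field_simps)
  have "g v = g u"
  proof (cases "k \<ge> 0")
    case True
    then show ?thesis using n[of v "nat k"] by (simp add: v_def)
  next
    case False
    then have "real (nat (- k)) = - of_int k" by simp
    then show ?thesis using n[of u "nat (- k)"] by (simp add: v_def)
  qed
  with v show ?thesis by (rule that)
qed

lemma deriv_periodic:
  fixes g :: "real \<Rightarrow> real"
  assumes "\<And>u. g (u + c) = g u" "\<And>u. (g has_real_derivative g' u) (at u)"
  shows "g' (u + c) = g' u"
proof -
  have "((\<lambda>x. g (x + c)) has_real_derivative g' (u + c)) (at u)"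
    using assms(2)[of "u + c"] by (simp add: DERIV_shift)
  then have "(g has_real_derivative g' (u + c)) (at u)" by (simp add: assms(1))
  then show ?thesis using assms(2) DERIV_unique by blast
qed

lemma deriv_even:
  fixes g :: "real \<Rightarrow> real"
  assumes "\<And>u. g (- u) = g u" "\<And>u. (g has_real_derivative g' u) (at u)"
  shows "g' (- u) = - g' u"
proof -
  have "((\<lambda>x. g (- x)) has_real_derivative - g' (- u)) (at u)"
    using assms(2)[of "- u"] by (simp add: DERIV_mirror)
  then have "(g has_real_derivative - g' (- u)) (at u)" by (simp add: assms(1))
  then have "- g' (- u) = g' u" using assms(2) DERIV_unique by blast
  then show ?thesis by simp
qed

lemma periodic_bounded:
  fixes g :: "real \<Rightarrow> real"
  assumes "continuous_on UNIV g" "\<And>u. g (u + 2 * pi) = g u"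
  obtains P where "\<And>u. \<bar>g u\<bar> \<le> P"
proof -
  have "bounded (g ` {0..2 * pi})"
    by (intro compact_imp_bounded compact_continuous_image continuous_on_subset[OF assms(1)]) auto
  then obtain P where "\<forall>y\<in>g ` {0..2 * pi}. \<bar>y\<bar> \<le> P" unfolding bounded_real by blast
  then have P: "\<bar>g v\<bar> \<le> P" if "v \<in> {0..2 * pi}" for v using that by blast
  show ?thesis
  proof (rule that)
    fix u
    obtain v where "v \<in> {0..2 * pi}" "g v = g u" by (fact periodic_reduce[where g = g and u = u, OF assms(2)])
    then show "\<bar>g u\<bar> \<le> P" using P[of v] by simp
  qed
qed

lemma periodic_smooth_bounds:
  fixes g :: "real \<Rightarrow> real"
  assumes g: "smooth_on UNIV g" "\<And>u. g (u + 2 * pi) = g u"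
  obtains P where "\<And>u. \<bar>g u\<bar> \<le> P" "\<And>u v. \<bar>g u - g v\<bar> \<le> P * \<bar>u - v\<bar>"
proof -
  obtain g' where g': "\<And>u. (g has_real_derivative g' u) (at u)" "smooth_on UNIV g'"
    using smooth_on_derivE[OF g(1)] by (metis UNIV_I at_neq_bot)
  obtain P where P: "\<And>u. \<bar>g u\<bar> \<le> P" by (fact periodic_bounded[OF smooth_on_imp_continuous[OF g(1)] g(2)])
  obtain Q where Q: "\<And>u. \<bar>g' u\<bar> \<le> Q"
    by (fact periodic_bounded[OF smooth_on_imp_continuous[OF g'(2)] deriv_periodic[OF g(2) g'(1)]])
  have PQ: "P \<ge> 0" "Q \<ge> 0" using P[of 0] Q[of 0] by linarith+
  have "Cb UNIV (Suc 0) (P + Q) g"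
  proof (rule Cb_SucI)
    show "\<bar>g u\<bar> \<le> P + Q" for u using P[of u] PQ by linarith
    show "(g has_real_derivative g' u) (at u)" for u by (rule g'(1))
    show "Cb UNIV 0 (P + Q) g'" using smooth_on_imp_continuous[OF g'(2)] Q PQ by (auto intro: add_increasing)
  qed
  then have "\<bar>g u - g v\<bar> \<le> \<bar>P + Q\<bar> * \<bar>u - v\<bar>" for u v by (rule Cb_lipschitz) auto
  then show ?thesis using P PQ by (intro that[of "P + Q"]) (auto intro: add_increasing2)
qed

text \<open>Periodicity moves a nonzero value of \<open>al\<close> into \<open>[0, 2 * pi]\<close>,
  and the reflection \<open>v \<mapsto> 2 * pi - v\<close>, a symmetry of even periodic functions,
  into \<open>[0, pi]\<close>. Boundedness makes the supremum at least this positive value.\<close>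

lemma eps0_pos:
  assumes "admissible al"
  shows "eps0 al > 0"
proof -
  have al: "smooth_on UNIV al" "\<And>u. al (u + 2 * pi) = al u" "\<And>u. al (- u) = al u" "\<And>u. al u \<ge> 0"
    using assms by (auto simp: admissible_def)
  obtain u where u: "al u \<noteq> 0" using assms by (auto simp: admissible_def)
  obtain v where v: "v \<in> {0..2 * pi}" "al v = al u" by (fact periodic_reduce[where g = al and u = u, OF al(2)])
  obtain P where P: "\<And>u. \<bar>al u\<bar> \<le> P" by (fact periodic_bounded[OF smooth_on_imp_continuous[OF al(1)] al(2)])
  have "\<exists>x\<in>{0..pi}. al x = al u"
  proof (cases "v \<le> pi")
    case False
    have "al (2 * pi - v) = al v" using al(2)[of "- v"] al(3)[of v] by (simp add: add.commute)
    then show ?thesis using v False by (intro bexI[of _ "2 * pi - v"]) auto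
  qed (use v in auto)
  then obtain x where x: "x \<in> {0..pi}" "al x > 0" using u al(4)[of u] by force
  have "bdd_above (al ` {0..pi})" using P by (intro bdd_aboveI[of _ P]) (auto intro: order_trans[OF abs_ge_self])
  from cSUP_upper[OF x(1) this] x(2) show ?thesis by (simp add: eps0_def)
qed

text \<open>The product of the warping function and its derivative is an exact quadratic polynomial
  in the parameter. Its coefficients are odd because \<open>al\<close> is even, and flat at
  \<open>0\<close> because \<open>al 0 = 0\<close>, so the perturbation leaves the linear part at
  the centre unchanged. Periodicity supplies the common bound \<open>P\<close>.\<close>

lemma warp_nonlinearity:
  assumes "admissible al"
  obtains g1 g2 P where
    "\<And>e u. warp al e u * deriv (warp al e) u = sin u * cos u + e * g1 u + e\<^sup>2 * g2 u"
    "smooth_on UNIV g1" "\<And>u. g1 (- u) = - g1 u" "(g1 has_real_derivative 0) (at 0)"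
    "\<And>u. \<bar>g1 u\<bar> \<le> P" "\<And>u v. \<bar>g1 u - g1 v\<bar> \<le> P * \<bar>u - v\<bar>"
    "smooth_on UNIV g2" "\<And>u. g2 (- u) = - g2 u" "(g2 has_real_derivative 0) (at 0)"
    "\<And>u. \<bar>g2 u\<bar> \<le> P" "\<And>u v. \<bar>g2 u - g2 v\<bar> \<le> P * \<bar>u - v\<bar>"
proof -
  have al: "smooth_on UNIV al" "\<And>u. al (u + 2 * pi) = al u" "\<And>u. al (- u) = al u" "al 0 = 0"
    using assms by (auto simp: admissible_def)
  obtain al' where al': "\<And>u. (al has_real_derivative al' u) (at u)" "smooth_on UNIV al'"
    using smooth_on_derivE[OF al(1)] by (metis UNIV_I at_neq_bot)
  obtain al'' where al'': "\<And>u. (al' has_real_derivative al'' u) (at u)"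
    using smooth_on_derivE[OF al'(2)] by (metis UNIV_I at_neq_bot)
  define g1 where "g1 = (\<lambda>u. 2 * (sin u * cos u) * al u + sin u * sin u * al' u)"
  define g2 where "g2 = (\<lambda>u. sin u * cos u * al u * al u + sin u * sin u * al u * al' u)"
  have sm: "smooth_on UNIV g1" "smooth_on UNIV g2" unfolding g1_def g2_def
    by (intro smooth_on_add smooth_on_mult smooth_on_const smooth_on_sin smooth_on_cos al(1) al'(2))+
  have odd: "g1 (- u) = - g1 u" "g2 (- u) = - g2 u" for u
    by (simp_all add: g1_def g2_def al(3) deriv_even[OF al(3) al'(1)])
  have per: "g1 (u + 2 * pi) = g1 u" "g2 (u + 2 * pi) = g2 u" for u
    by (simp_all add: g1_def g2_def al(2) deriv_periodic[OF al(2) al'(1)])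
  have d: "(g1 has_real_derivative 0) (at 0)" "(g2 has_real_derivative 0) (at 0)"
    unfolding g1_def g2_def by (auto intro!: derivative_eq_intros al'(1) al'' simp: al(4))
  obtain P1 where P1: "\<And>u. \<bar>g1 u\<bar> \<le> P1" "\<And>u v. \<bar>g1 u - g1 v\<bar> \<le> P1 * \<bar>u - v\<bar>" by (fact periodic_smooth_bounds[OF sm(1) per(1)])
  obtain P2 where P2: "\<And>u. \<bar>g2 u\<bar> \<le> P2" "\<And>u v. \<bar>g2 u - g2 v\<bar> \<le> P2 * \<bar>u - v\<bar>" by (fact periodic_smooth_bounds[OF sm(2) per(2)])
  have mx: "P1 * x \<le> max P1 P2 * x" "P2 * x \<le> max P1 P2 * x" if "x \<ge> 0" for x
    using that by (auto intro: mult_right_mono)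
  show ?thesis
  proof (rule that[OF _ sm(1) odd(1) d(1) _ _ sm(2) odd(2) d(2)])
    fix u v
    show "\<bar>g1 u\<bar> \<le> max P1 P2" "\<bar>g2 u\<bar> \<le> max P1 P2" using P1(1)[of u] P2(1)[of u] by auto
    show "\<bar>g1 u - g1 v\<bar> \<le> max P1 P2 * \<bar>u - v\<bar>" by (rule order_trans[OF P1(2) mx(1)]) simp
    show "\<bar>g2 u - g2 v\<bar> \<le> max P1 P2 * \<bar>u - v\<bar>" by (rule order_trans[OF P2(2) mx(2)]) simp
    fix e
    have "(warp al e has_real_derivative cos u * (1 + e * al u) + (e * al' u) * sin u) (at u)"
      unfolding warp_def[abs_def] by (auto intro!: derivative_eq_intros al'(1))
    then have "deriv (warp al e) u = cos u * (1 + e * al u) + (e * al' u) * sin u" by (rule DERIV_imp_deriv)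
    then show "warp al e u * deriv (warp al e) u = sin u * cos u + e * g1 u + e\<^sup>2 * g2 u"
      by (simp add: warp_def g1_def g2_def power2_eq_square algebra_simps)
  qed
qed

theorem theorem1p2:
  fixes \<alpha> :: "real \<Rightarrow> real" and d :: nat
  assumes "admissible \<alpha>" and "d \<ge> 3"
  shows "\<exists>\<epsilon>s. 0 < \<epsilon>s \<and> \<epsilon>s \<le> eps0 \<alpha> \<and>
    (\<exists>(f :: real \<Rightarrow> real \<Rightarrow> real) (\<phi> :: real \<Rightarrow> real \<Rightarrow> real).
      (\<forall>\<epsilon>. \<bar>\<epsilon>\<bar> \<le> \<epsilon>s \<longrightarrow>
        (\<forall>T>0.
           smooth_on ({0..<T} \<times> {0..}) (\<lambda>(t, r). self_similar T (f \<epsilon>) t r) \<and>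
           Linf_on ({0..T} \<times> {0..}) (\<lambda>(t, r). self_similar T (f \<epsilon>) t r) \<and>
           wave_map_solution d (warp \<alpha> \<epsilon>) T (self_similar T (f \<epsilon>)) \<and>
           filterlim (\<lambda>t. \<bar>dr (self_similar T (f \<epsilon>)) t 0\<bar>) at_top (at_left T)) \<and>
        (\<forall>\<rho>\<ge>0. f \<epsilon> \<rho> = f0 d \<rho> + \<phi> \<epsilon> \<rho>) \<and>
        Linf_on {0..} (\<phi> \<epsilon>) \<and> smooth_on {0..} (\<phi> \<epsilon>) \<and>
        f \<epsilon> 0 = 0 \<and> (\<exists>L. (f \<epsilon> \<longlongrightarrow> L) at_top) \<and>
        (\<forall>k::nat. \<exists>C1>0. \<exists>C2>0. \<forall>\<rho>\<ge>0.
           \<bar>nderiv_within {0..} k (f \<epsilon>) \<rho>\<bar> \<le> C1 * japanese \<rho> powi (- int k) \<and>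
           (k \<ge> 1 \<longrightarrow>
            \<bar>nderiv_within {0..} k (\<lambda>x. f \<epsilon> x + x * deriv_within {0..} (f \<epsilon>) x) \<rho>\<bar>
              \<le> C2 * japanese \<rho> powi (- 1 - int k)))) \<and>
      (\<exists>C>0. \<forall>\<epsilon> \<kappa>. \<bar>\<epsilon>\<bar> \<le> \<epsilon>s \<and> \<bar>\<kappa>\<bar> \<le> \<epsilon>s \<longrightarrow>
         Wk_inf_norm 2 {0<..} (\<lambda>\<rho>. (\<phi> \<epsilon> \<rho> - \<phi> \<kappa> \<rho>) / \<rho>) \<le> ennreal (C * \<bar>\<epsilon> - \<kappa>\<bar>)) \<and>
      (\<forall>\<rho>\<ge>0. \<phi> 0 \<rho> = 0))"
proof -
  obtain g1 g2 P where w: "\<And>\<epsilon> u. warp \<alpha> \<epsilon> u * deriv (warp \<alpha> \<epsilon>) u = sin u * cos u + \<epsilon> * g1 u + \<epsilon>\<^sup>2 * g2 u"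
    and g1: "smooth_on UNIV g1" "\<And>u. g1 (- u) = - g1 u" "(g1 has_real_derivative 0) (at 0)"
      "\<And>u. \<bar>g1 u\<bar> \<le> P" "\<And>u v. \<bar>g1 u - g1 v\<bar> \<le> P * \<bar>u - v\<bar>"
    and g2: "smooth_on UNIV g2" "\<And>u. g2 (- u) = - g2 u" "(g2 has_real_derivative 0) (at 0)"
      "\<And>u. \<bar>g2 u\<bar> \<le> P" "\<And>u v. \<bar>g2 u - g2 v\<bar> \<le> P * \<bar>u - v\<bar>"
    by (fact warp_nonlinearity[OF assms(1)])
  obtain \<epsilon>s C f where \<epsilon>s: "0 < \<epsilon>s" "\<epsilon>s \<le> eps0 \<alpha>" "0 < C"
    and prof: "\<And>\<epsilon>. \<bar>\<epsilon>\<bar> \<le> \<epsilon>s \<Longrightarrow> profile d (\<lambda>u. sin u * cos u + \<epsilon> * g1 u + \<epsilon>\<^sup>2 * g2 u) (f \<epsilon>)"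
    and f0: "\<And>\<rho>. \<rho> \<ge> 0 \<Longrightarrow> f 0 \<rho> = f0 d \<rho>"
    and lip: "\<And>\<epsilon> \<kappa>. \<bar>\<epsilon>\<bar> \<le> \<epsilon>s \<Longrightarrow> \<bar>\<kappa>\<bar> \<le> \<epsilon>s \<Longrightarrow> \<exists>E1 E2. \<forall>\<rho>>0.
       ((\<lambda>\<rho>. (f \<epsilon> \<rho> - f \<kappa> \<rho>) / \<rho>) has_real_derivative E1 \<rho>) (at \<rho>) \<and> (E1 has_real_derivative E2 \<rho>) (at \<rho>) \<and>
       \<bar>(f \<epsilon> \<rho> - f \<kappa> \<rho>) / \<rho>\<bar> \<le> C * \<bar>\<epsilon> - \<kappa>\<bar> \<and> \<bar>E1 \<rho>\<bar> \<le> C * \<bar>\<epsilon> - \<kappa>\<bar> \<and> \<bar>E2 \<rho>\<bar> \<le> C * \<bar>\<epsilon> - \<kappa>\<bar>"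
    by (fact profile_family[OF assms(2) eps0_pos[OF assms(1)] g1 g2])
  define \<phi> where "\<phi> = (\<lambda>\<epsilon> \<rho>. f \<epsilon> \<rho> - f0 d \<rho>)"
  have prof': "profile d (\<lambda>u. warp \<alpha> \<epsilon> u * deriv (warp \<alpha> \<epsilon>) u) (f \<epsilon>)" if "\<bar>\<epsilon>\<bar> \<le> \<epsilon>s" for \<epsilon>
    using prof[OF that] by (simp only: w)
  have sf: "smooth_on {0..} (f \<epsilon>)" if "\<bar>\<epsilon>\<bar> \<le> \<epsilon>s" for \<epsilon> using prof[OF that] by (simp add: profile_def)
  have sf0: "smooth_on {0..} (f0 d)"
    unfolding f0_def[abs_def]
    by (intro smooth_on_mult smooth_on_const smooth_on_compose[OF smooth_on_arctan] smooth_on_divide smooth_on_ident)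
       (use assms(2) in auto)
  have s\<phi>: "smooth_on {0..} (\<phi> \<epsilon>)" if "\<bar>\<epsilon>\<bar> \<le> \<epsilon>s" for \<epsilon>
    unfolding \<phi>_def by (rule smooth_on_diff[OF sf[OF that] sf0])
  have L\<phi>: "Linf_on {0..} (\<phi> \<epsilon>)" if \<epsilon>: "\<bar>\<epsilon>\<bar> \<le> \<epsilon>s" for \<epsilon>
  proof -
    obtain B where B: "B > 0" "\<And>\<rho>. \<rho> \<ge> 0 \<Longrightarrow> \<bar>f \<epsilon> \<rho>\<bar> \<le> B" by (fact profile_bounded[OF prof[OF \<epsilon>]])
    show ?thesis
    proof (rule Linf_on_bounded_continuous[OF smooth_on_imp_continuous[OF s\<phi>[OF \<epsilon>]], of "B + pi"])
      fix \<rho> :: real assume "\<rho> \<ge> 0"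
      moreover have "\<bar>f0 d \<rho>\<bar> \<le> pi"
        using arctan_bounded[of "\<rho> / sqrt (real d - 2)"] by (simp add: f0_def abs_le_iff)
      ultimately show "\<bar>\<phi> \<epsilon> \<rho>\<bar> \<le> B + pi" using B(2)[of \<rho>] by (simp add: \<phi>_def)
    qed
  qed
  have sym: "\<exists>C1>0. \<exists>C2>0. \<forall>\<rho>\<ge>0.
      \<bar>nderiv_within {0..} k (f \<epsilon>) \<rho>\<bar> \<le> C1 * japanese \<rho> powi (- int k) \<and>
      (k \<ge> 1 \<longrightarrow> \<bar>nderiv_within {0..} k (\<lambda>x. f \<epsilon> x + x * deriv_within {0..} (f \<epsilon>) x) \<rho>\<bar>
         \<le> C2 * japanese \<rho> powi (- 1 - int k))" if \<epsilon>: "\<bar>\<epsilon>\<bar> \<le> \<epsilon>s" for \<epsilon> and k :: nat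
  proof -
    obtain C1 where C1: "C1 > 0" "\<forall>\<rho>\<ge>0. \<bar>nderiv_within {0..} k (f \<epsilon>) \<rho>\<bar> \<le> C1 * japanese \<rho> powi (- int k)"
      using profile_symbol_bounds(1)[OF prof[OF \<epsilon>]] by blast
    obtain C2 where C2: "C2 > 0" "k \<ge> 1 \<longrightarrow> (\<forall>\<rho>\<ge>0.
        \<bar>nderiv_within {0..} k (\<lambda>x. f \<epsilon> x + x * deriv_within {0..} (f \<epsilon>) x) \<rho>\<bar> \<le> C2 * japanese \<rho> powi (- 1 - int k))"
      using profile_symbol_bounds(2)[OF prof[OF \<epsilon>], of k] zero_less_one by blast
    show ?thesis by (intro exI[of _ C1] exI[of _ C2] conjI allI impI C1(1) C2(1)) (use C1(2) C2(2) in auto)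
  qed
  \<comment> \<open>The explicit profile cancels in differences of \<open>\<phi>\<close>, so the
    classical bounds for \<open>(f \<epsilon> - f \<kappa>) / \<rho>\<close> apply. The norm sums
    three orders, whence \<open>3 * C\<close>.\<close>
  have sob: "Wk_inf_norm 2 {0<..} (\<lambda>\<rho>. (\<phi> \<epsilon> \<rho> - \<phi> \<kappa> \<rho>) / \<rho>) \<le> ennreal (3 * C * \<bar>\<epsilon> - \<kappa>\<bar>)"
    if \<epsilon>: "\<bar>\<epsilon>\<bar> \<le> \<epsilon>s" and \<kappa>: "\<bar>\<kappa>\<bar> \<le> \<epsilon>s" for \<epsilon> \<kappa>
  proof -
    obtain E1 E2 where E: "\<And>\<rho>. \<rho> > 0 \<Longrightarrow> ((\<lambda>\<rho>. (f \<epsilon> \<rho> - f \<kappa> \<rho>) / \<rho>) has_real_derivative E1 \<rho>) (at \<rho>)"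
      "\<And>\<rho>. \<rho> > 0 \<Longrightarrow> (E1 has_real_derivative E2 \<rho>) (at \<rho>)"
      "\<And>\<rho>. \<rho> > 0 \<Longrightarrow> \<bar>(f \<epsilon> \<rho> - f \<kappa> \<rho>) / \<rho>\<bar> \<le> C * \<bar>\<epsilon> - \<kappa>\<bar> \<and> \<bar>E1 \<rho>\<bar> \<le> C * \<bar>\<epsilon> - \<kappa>\<bar> \<and> \<bar>E2 \<rho>\<bar> \<le> C * \<bar>\<epsilon> - \<kappa>\<bar>"
      using lip[OF \<epsilon> \<kappa>] by (elim exE) blast
    have sub: "{0<..} \<subseteq> {0::real..}" by auto
    have sm: "smooth_on {0<..} (\<lambda>\<rho>. (f \<epsilon> \<rho> - f \<kappa> \<rho>) / \<rho>)"
      by (intro smooth_on_divide smooth_on_diff smooth_on_ident smooth_on_subset[OF sf[OF \<epsilon>] sub] smooth_on_subset[OF sf[OF \<kappa>] sub]) auto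
    have "Wk_inf_norm 2 {0<..} (\<lambda>\<rho>. (f \<epsilon> \<rho> - f \<kappa> \<rho>) / \<rho>) \<le> ennreal (3 * (C * \<bar>\<epsilon> - \<kappa>\<bar>))"
      by (rule Wk_inf_norm_smooth[OF sm E(1) E(2) _ E(3)]) (use \<epsilon>s(3) in auto)
    then show ?thesis by (simp add: \<phi>_def mult.assoc)
  qed
  show ?thesis
  proof (rule exI[of _ \<epsilon>s], intro conjI \<epsilon>s(1,2), rule exI[of _ f], rule exI[of _ \<phi>], intro conjI allI impI)
    fix \<epsilon> assume \<epsilon>: "\<bar>\<epsilon>\<bar> \<le> \<epsilon>s"
    show "smooth_on ({0..<T} \<times> {0..}) (\<lambda>(t, r). self_similar T (f \<epsilon>) t r)" for T by (rule self_similar_smooth[OF prof[OF \<epsilon>]])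
    show "Linf_on ({0..T} \<times> {0..}) (\<lambda>(t, r). self_similar T (f \<epsilon>) t r)" for T by (rule self_similar_Linf[OF prof[OF \<epsilon>]])
    show "wave_map_solution d (warp \<alpha> \<epsilon>) T (self_similar T (f \<epsilon>))" for T by (rule self_similar_wave_map[OF prof'[OF \<epsilon>]])
    show "filterlim (\<lambda>t. \<bar>dr (self_similar T (f \<epsilon>)) t 0\<bar>) at_top (at_left T)" for T by (rule self_similar_blowup[OF prof[OF \<epsilon>]])
    show "f \<epsilon> \<rho> = f0 d \<rho> + \<phi> \<epsilon> \<rho>" for \<rho> by (simp add: \<phi>_def)
    show "f \<epsilon> 0 = 0" using prof[OF \<epsilon>] by (simp add: profile_def)
    show "\<exists>L. (f \<epsilon> \<longlongrightarrow> L) at_top" by (rule profile_limit[OF prof[OF \<epsilon>]])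
  next
    show "\<exists>C>0. \<forall>\<epsilon> \<kappa>. \<bar>\<epsilon>\<bar> \<le> \<epsilon>s \<and> \<bar>\<kappa>\<bar> \<le> \<epsilon>s \<longrightarrow>
         Wk_inf_norm 2 {0<..} (\<lambda>\<rho>. (\<phi> \<epsilon> \<rho> - \<phi> \<kappa> \<rho>) / \<rho>) \<le> ennreal (C * \<bar>\<epsilon> - \<kappa>\<bar>)"
      using \<epsilon>s(3) sob by (intro exI[of _ "3 * C"]) auto
    show "\<phi> 0 \<rho> = 0" if "\<rho> \<ge> 0" for \<rho> using f0[OF that] by (simp add: \<phi>_def)
  qed (rule L\<phi> s\<phi> sym; assumption)+
qed

end
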